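(* Let $M=\Gamma\backslash N$ be a nilmanifold whose Lie algebra $\mathfrak n$ is isomorphic to one of $$\mathbb R^2\oplus\mathfrak h_5,\qquad \mathbb R\oplus\mathfrak h_3^{\mathbb C},\qquad \mathfrak h_{\mathbb H}.$$ Then $M$ admits a purely co-closed $\mathrm G_2$-structure $\varphi$ and an abelian connection $A$ (a connection with abelian gauge group) such that $(\varphi,A)$ is a solution to the heterotic $\mathrm G_2$-system.
   Context: A nilmanifold $\Gamma\backslash N$ is the quotient of a simply connected nilpotent Lie group $N$ with Lie algebra $\mathfrak n$ by a co-compact lattice $\Gamma$. The notation $(0,\dots,0,12-34,\dots)$ lists the differentials $de^1,de^2,\dots$ of a basis $(e^i)$ of the dual of the Lie algebra, with $ij$ meaning $e^i\wedge e^j$: $\mathfrak h_5=(0,0,0,0,12+34)$, $\mathfrak h_3^{\mathbb C}=(0,0,0,0,12-34,13+24)$, $\mathfrak h_{\mathbb H}=(0,0,0,0,12-34,13+24,14-23)$. A $\mathrm G_2$-structure on a $7$-manifold is given by a $3$-form $\varphi$; it determines $g_\varphi,\mathrm{vol}_\varphi$ by $6g_\varphi(X,Y)\mathrm{vol}_\varphi=(X\lrcorner\varphi)\wedge(Y\lrcorner\varphi)\wedge\varphi$, and a Hodge star $\star$. Put $\psi=\star\varphi$, $\tau_0=\frac17\star(d\varphi\wedge\varphi)$, $\tau_1=\frac1{12}\star(\varphi\wedge\star d\varphi)$, $T_\varphi=\frac16\star(d\varphi\wedge\varphi)\varphi-\star d\varphi+\star(4\tau_1\wedge\varphi)$. $\varphi$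 is purely co-closed if $d\psi=0$ and $\tau_0=0$. For a connection $A$ with curvature $F_A$ on a principal $G$-bundle, $\mathfrak g=\mathrm{Lie}(G)$, the pair $(\varphi,A)$ solves the heterotic $\mathrm G_2$-system if $d\psi=4\tau_1\wedge\psi$, $F_A\wedge\psi=0$ and $dT_\varphi=\langle F_A\wedge F_A\rangle_{\mathfrak g}$ for some $\mathrm{ad}$-invariant non-degenerate symmetric bilinear form on $\mathfrak g$. *)

theory Defs
  imports "HOL-Analysis.Analysis" "HOL-Algebra.Generated_Groups"
begin

section \<open>Smooth manifolds\<close>

text \<open>
  Manifolds are carried by a set (the \<^const>\<open>topspace\<close> of a topology), because quotients, total
  spaces of bundles and structure groups of unspecified dimension are needed.  Charts take values in
  \<^const>\<open>Euclidean_space\<close>, i.e. in the sequences supported on the first \<open>d\<close> coordinates, so that the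
  dimension is a number and not a type.
\<close>

definition partial :: "nat \<Rightarrow> ((nat \<Rightarrow> real) \<Rightarrow> real) \<Rightarrow> (nat \<Rightarrow> real) \<Rightarrow> real" where
  "partial i f x = deriv (\<lambda>t. f (x(i := t))) (x i)"

fun Ck_on :: "nat \<Rightarrow> nat \<Rightarrow> (nat \<Rightarrow> real) set \<Rightarrow> ((nat \<Rightarrow> real) \<Rightarrow> real) \<Rightarrow> bool" where
  "Ck_on 0 d V f \<longleftrightarrow> continuous_on V f"
| "Ck_on (Suc k) d V f \<longleftrightarrow> continuous_on V f \<and>
     (\<forall>i<d. (\<forall>x\<in>V. (\<lambda>t. f (x(i := t))) differentiable at (x i)) \<and> Ck_on k d V (partial i f))"

text \<open>Intended for \<open>V\<close> open in \<^term>\<open>Euclidean_space d\<close>.\<close>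

definition smooth_on :: "nat \<Rightarrow> (nat \<Rightarrow> real) set \<Rightarrow> ((nat \<Rightarrow> real) \<Rightarrow> real) \<Rightarrow> bool" where
  "smooth_on d V f \<longleftrightarrow> (\<forall>k. Ck_on k d V f)"

type_synonym 'a chart = "'a set \<times> ('a \<Rightarrow> nat \<Rightarrow> real)"

record 'a manifold =
  mdim :: nat
  mtop :: "'a topology"
  atlas :: "'a chart set"

abbreviation points :: "'a manifold \<Rightarrow> 'a set" where
  "points M \<equiv> topspace (mtop M)"

definition smooth_manifold :: "'a manifold \<Rightarrow> bool" where
  "smooth_manifold M \<longleftrightarrow>
     Hausdorff_space (mtop M) \<and> second_countable (mtop M) \<and>
     (\<Union>(U, c)\<in>atlas M. U) = points M \<and>
     (\<forall>(U, c)\<in>atlas M. openin (mtop M) U \<and> openin (Euclidean_space (mdim M)) (c ` U) \<and>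
        homeomorphic_map (subtopology (mtop M) U)
          (subtopology (Euclidean_space (mdim M)) (c ` U)) c) \<and>
     (\<forall>(U, c)\<in>atlas M. \<forall>(U', c')\<in>atlas M. \<forall>i<mdim M.
        smooth_on (mdim M) (c ` (U \<inter> U')) (\<lambda>x. c' (inv_into U c x) i))"

definition smooth_map :: "'a manifold \<Rightarrow> 'b manifold \<Rightarrow> ('a \<Rightarrow> 'b) \<Rightarrow> bool" where
  "smooth_map M M' F \<longleftrightarrow> continuous_map (mtop M) (mtop M') F \<and>
     (\<forall>(U, c)\<in>atlas M. \<forall>(U', c')\<in>atlas M'. \<forall>i<mdim M'.
        smooth_on (mdim M) (c ` {x\<in>U. F x \<in> U'}) (\<lambda>x. c' (F (inv_into U c x)) i))"

definition diffeomorphism :: "'a manifold \<Rightarrow> 'b manifold \<Rightarrow> ('a \<Rightarrow> 'b) \<Rightarrow> bool" where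
  "diffeomorphism M M' F \<longleftrightarrow> bij_betw F (points M) (points M') \<and>
     smooth_map M M' F \<and> smooth_map M' M (inv_into (points M) F)"

definition prod_manifold :: "'a manifold \<Rightarrow> 'b manifold \<Rightarrow> ('a \<times> 'b) manifold" where
  "prod_manifold M M' =
     \<lparr>mdim = mdim M + mdim M',
      mtop = prod_topology (mtop M) (mtop M'),
      atlas = {(U \<times> U', \<lambda>(x, y) i. if i < mdim M then c x i else c' y (i - mdim M)) | U c U' c'.
                 (U, c) \<in> atlas M \<and> (U', c') \<in> atlas M'}\<rparr>"

definition open_submanifold :: "'a manifold \<Rightarrow> 'a set \<Rightarrow> 'a manifold" where
  "open_submanifold M W =
     \<lparr>mdim = mdim M, mtop = subtopology (mtop M) W, atlas = {(U \<inter> W, c) | U c. (U, c) \<in> atlas M}\<rparr>"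

text \<open>Smooth functions are normalised to vanish outside the set of points, so that they are
  determined by their values on the manifold.\<close>

definition smooth_functions :: "'a manifold \<Rightarrow> ('a \<Rightarrow> real) set" where
  "smooth_functions M = {f. (\<forall>x. x \<notin> points M \<longrightarrow> f x = 0) \<and>
     (\<forall>(U, c)\<in>atlas M. smooth_on (mdim M) (c ` U) (\<lambda>x. f (inv_into U c x)))}"

definition pull_fun :: "'a manifold \<Rightarrow> ('a \<Rightarrow> 'b) \<Rightarrow> ('b \<Rightarrow> real) \<Rightarrow> 'a \<Rightarrow> real" where
  "pull_fun M F f = (\<lambda>x. if x \<in> points M then f (F x) else 0)"


section \<open>Vector fields and differential forms\<close>

text \<open>
  Vector fields are the derivations of the algebra of smooth functions, and differential \<open>k\<close>-forms
  are the alternating maps on \<open>k\<close> vector fields that are linear over smooth functions.  Derivations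
  are set to zero on functions that are not smooth, forms are only ever evaluated on lists of vector
  fields of the right length, and their equality is \<open>form_eq\<close> below.
\<close>

type_synonym 'a vfield = "('a \<Rightarrow> real) \<Rightarrow> 'a \<Rightarrow> real"
type_synonym 'a form = "'a vfield list \<Rightarrow> 'a \<Rightarrow> real"

definition vector_fields :: "'a manifold \<Rightarrow> 'a vfield set" where
  "vector_fields M = {X.
     (\<forall>f. f \<notin> smooth_functions M \<longrightarrow> X f = (\<lambda>p. 0)) \<and>
     (\<forall>f\<in>smooth_functions M. X f \<in> smooth_functions M) \<and>
     (\<forall>f\<in>smooth_functions M. \<forall>h\<in>smooth_functions M. \<forall>a b.
        X (\<lambda>p. a * f p + b * h p) = (\<lambda>p. a * X f p + b * X h p)) \<and>
     (\<forall>f\<in>smooth_functions M. \<forall>h\<in>smooth_functions M.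
        X (\<lambda>p. f p * h p) = (\<lambda>p. f p * X h p + h p * X f p))}"

definition bracket :: "'a vfield \<Rightarrow> 'a vfield \<Rightarrow> 'a vfield" where
  "bracket X Y = (\<lambda>f p. X (Y f) p - Y (X f) p)"

definition lincomb :: "(nat \<Rightarrow> real) \<Rightarrow> 'a vfield list \<Rightarrow> 'a vfield" where
  "lincomb c Xs = (\<lambda>f p. \<Sum>i<length Xs. c i * (Xs ! i) f p)"

definition is_form :: "'a manifold \<Rightarrow> nat \<Rightarrow> 'a form \<Rightarrow> bool" where
  "is_form M k \<omega> \<longleftrightarrow>
     (\<forall>Xs. length Xs = k \<and> set Xs \<subseteq> vector_fields M \<longrightarrow>
        \<omega> Xs \<in> smooth_functions M \<and>
        (\<forall>i<k. \<forall>X\<in>vector_fields M. \<forall>Y\<in>vector_fields M.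
           \<forall>f\<in>smooth_functions M. \<forall>h\<in>smooth_functions M.
             \<omega> (Xs[i := (\<lambda>u p. f p * X u p + h p * Y u p)]) =
               (\<lambda>p. f p * \<omega> (Xs[i := X]) p + h p * \<omega> (Xs[i := Y]) p)) \<and>
        (\<forall>i<k. \<forall>j<k. i \<noteq> j \<and> Xs ! i = Xs ! j \<longrightarrow> \<omega> Xs = (\<lambda>p. 0)))"

definition form_eq :: "'a manifold \<Rightarrow> nat \<Rightarrow> 'a form \<Rightarrow> 'a form \<Rightarrow> bool" where
  "form_eq M k \<alpha> \<beta> \<longleftrightarrow> (\<forall>Xs. length Xs = k \<and> set Xs \<subseteq> vector_fields M \<longrightarrow>
     (\<forall>p\<in>points M. \<alpha> Xs p = \<beta> Xs p))"

text \<open>Wedge product of a \<open>k\<close>-form with another form, as the sum over shuffles (so that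
  \<open>(\<alpha> \<and> \<beta>)(X, Y) = \<alpha>(X)\<beta>(Y) - \<alpha>(Y)\<beta>(X)\<close> for 1-forms).  The set \<open>S\<close> holds the positions of the
  arguments of \<open>\<alpha>\<close>; the sign counts the inversions.\<close>

definition wedge :: "nat \<Rightarrow> 'a form \<Rightarrow> 'a form \<Rightarrow> 'a form" where
  "wedge k \<alpha> \<beta> = (\<lambda>Xs p. \<Sum>S | S \<subseteq> {..<length Xs} \<and> card S = k.
     (-1) ^ card {(i, j). i \<in> S \<and> j \<in> {..<length Xs} - S \<and> j < i} *
     \<alpha> (nths Xs S) p * \<beta> (nths Xs ({..<length Xs} - S)) p)"

definition contract :: "'a vfield \<Rightarrow> 'a form \<Rightarrow> 'a form" where
  "contract X \<omega> = (\<lambda>Xs. \<omega> (X # Xs))"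

text \<open>The exterior derivative, by the invariant (Koszul) formula.\<close>

definition ext_deriv :: "'a form \<Rightarrow> 'a form" where
  "ext_deriv \<omega> = (\<lambda>Xs p.
     (\<Sum>i<length Xs. (-1) ^ i * (Xs ! i) (\<omega> (nths Xs (- {i}))) p) +
     (\<Sum>j<length Xs. \<Sum>i<j.
        (-1) ^ (i + j) * \<omega> (bracket (Xs ! i) (Xs ! j) # nths Xs (- {i, j})) p))"

text \<open>Pullback along \<open>F: M \<rightarrow> M'\<close>.  At a point \<open>p\<close>, the form is evaluated on vector fields
  of \<open>M'\<close> whose values at \<open>F p\<close> are the images of the given tangent vectors under the differential
  of \<open>F\<close>; forms being tensorial, the choice of these fields does not matter.\<close>

definition pullback :: "'a manifold \<Rightarrow> 'b manifold \<Rightarrow> ('a \<Rightarrow> 'b) \<Rightarrow> 'b form \<Rightarrow> 'a form" where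
  "pullback M M' F \<omega> = (\<lambda>Xs p. if p \<in> points M
     then \<omega> (SOME Ys. length Ys = length Xs \<and> set Ys \<subseteq> vector_fields M' \<and>
               (\<forall>i<length Xs. \<forall>f\<in>smooth_functions M'.
                  (Ys ! i) f (F p) = (Xs ! i) (pull_fun M F f) p)) (F p)
     else 0)"


section \<open>Riemannian metrics and the Hodge star\<close>

definition riemannian_metric :: "'a manifold \<Rightarrow> ('a vfield \<Rightarrow> 'a vfield \<Rightarrow> 'a \<Rightarrow> real) \<Rightarrow> bool" where
  "riemannian_metric M g \<longleftrightarrow>
     (\<forall>X\<in>vector_fields M. \<forall>Y\<in>vector_fields M. g X Y \<in> smooth_functions M \<and> g X Y = g Y X) \<and>
     (\<forall>X\<in>vector_fields M. \<forall>Y\<in>vector_fields M. \<forall>Z\<in>vector_fields M.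
        \<forall>f\<in>smooth_functions M. \<forall>h\<in>smooth_functions M.
          g (\<lambda>u p. f p * X u p + h p * Y u p) Z = (\<lambda>p. f p * g X Z p + h p * g Y Z p)) \<and>
     (\<forall>X\<in>vector_fields M. \<forall>p\<in>points M. (\<exists>f\<in>smooth_functions M. X f p \<noteq> 0) \<longrightarrow> g X X p > 0)"

text \<open>The values at \<open>p\<close> of the fields in \<open>Es\<close> form an orthonormal basis of the tangent space at \<open>p\<close>.\<close>

definition orthonormal_at ::
  "'a manifold \<Rightarrow> ('a vfield \<Rightarrow> 'a vfield \<Rightarrow> 'a \<Rightarrow> real) \<Rightarrow> 'a \<Rightarrow> 'a vfield list \<Rightarrow> bool" where
  "orthonormal_at M g p Es \<longleftrightarrow> length Es = mdim M \<and> set Es \<subseteq> vector_fields M \<and>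
     (\<forall>i<mdim M. \<forall>j<mdim M. g (Es ! i) (Es ! j) p = (if i = j then 1 else 0))"

text \<open>\<open>vol\<close> is the Riemannian volume form of \<open>g\<close> for one of the orientations of \<open>M\<close> (the one
  that it defines).\<close>

definition volume_form ::
  "'a manifold \<Rightarrow> ('a vfield \<Rightarrow> 'a vfield \<Rightarrow> 'a \<Rightarrow> real) \<Rightarrow> 'a form \<Rightarrow> bool" where
  "volume_form M g vol \<longleftrightarrow> is_form M (mdim M) vol \<and>
     (\<forall>p\<in>points M. \<forall>Es. orthonormal_at M g p Es \<longrightarrow> \<bar>vol Es p\<bar> = 1)"

text \<open>Hodge star on \<open>k\<close>-forms, with the convention \<open>\<alpha> \<and> \<star>\<beta> = g(\<alpha>, \<beta>) vol\<close>: at each point,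
  \<open>\<star>\<beta> = \<Sum> \<beta>(e\<^sub>I) vol(e\<^sub>I, _)\<close>, the sum being over increasing multi-indices \<open>I\<close> of length \<open>k\<close> for an
  orthonormal basis \<open>(e\<^sub>i)\<close>, whose choice does not matter.  The star of a top-degree form is a
  0-form, that is, a function of the empty list of vector fields.\<close>

definition hodge ::
  "'a manifold \<Rightarrow> ('a vfield \<Rightarrow> 'a vfield \<Rightarrow> 'a \<Rightarrow> real) \<Rightarrow> 'a form \<Rightarrow> nat \<Rightarrow> 'a form \<Rightarrow> 'a form" where
  "hodge M g vol k \<beta> = (\<lambda>Xs p. if p \<in> points M
     then let Es = (SOME Es. orthonormal_at M g p Es)
          in \<Sum>I | I \<subseteq> {..<mdim M} \<and> card I = k. \<beta> (nths Es I) p * vol (nths Es I @ Xs) p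
     else 0)"


section \<open>$G_2$-structures\<close>

text \<open>A 3-form \<open>\<phi>\<close> defining a \<open>G\<^sub>2\<close>-structure, together with the (uniquely determined) metric and
  volume form satisfying \<open>6 g(X, Y) vol = (X \<lrcorner> \<phi>) \<and> (Y \<lrcorner> \<phi>) \<and> \<phi>\<close>.  A 3-form for which such a
  positive definite \<open>g\<close> exists is exactly one that is pointwise equivalent to the model form.\<close>

definition G2_structure ::
  "'a manifold \<Rightarrow> 'a form \<Rightarrow> ('a vfield \<Rightarrow> 'a vfield \<Rightarrow> 'a \<Rightarrow> real) \<Rightarrow> 'a form \<Rightarrow> bool" where
  "G2_structure M \<phi> g vol \<longleftrightarrow> mdim M = 7 \<and> is_form M 3 \<phi> \<and>
     riemannian_metric M g \<and> volume_form M g vol \<and>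
     (\<forall>X\<in>vector_fields M. \<forall>Y\<in>vector_fields M.
        form_eq M 7 (\<lambda>Xs p. 6 * g X Y p * vol Xs p)
          (wedge 4 (wedge 2 (contract X \<phi>) (contract Y \<phi>)) \<phi>))"

definition G2_psi where
  "G2_psi M \<phi> g vol = hodge M g vol 3 \<phi>"

definition tau0 where
  "tau0 M \<phi> g vol = (\<lambda>p. 1 / 7 * hodge M g vol 7 (wedge 4 (ext_deriv \<phi>) \<phi>) [] p)"

definition tau1 where
  "tau1 M \<phi> g vol = (\<lambda>Xs p. 1 / 12 * hodge M g vol 6 (wedge 3 \<phi> (hodge M g vol 4 (ext_deriv \<phi>))) Xs p)"

definition G2_torsion where
  "G2_torsion M \<phi> g vol = (\<lambda>Xs p.
     1 / 6 * hodge M g vol 7 (wedge 4 (ext_deriv \<phi>) \<phi>) [] p * \<phi> Xs p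
     - hodge M g vol 4 (ext_deriv \<phi>) Xs p
     + hodge M g vol 4 (wedge 1 (\<lambda>Ys q. 4 * tau1 M \<phi> g vol Ys q) \<phi>) Xs p)"

definition purely_coclosed where
  "purely_coclosed M \<phi> g vol \<longleftrightarrow>
     form_eq M 5 (ext_deriv (G2_psi M \<phi> g vol)) (\<lambda>Xs p. 0) \<and>
     (\<forall>p\<in>points M. tau0 M \<phi> g vol p = 0)"


section \<open>Lie groups and nilmanifolds\<close>

record 'a smooth_group = "'a monoid" +
  gman :: "'a manifold"

definition lie_group :: "'a smooth_group \<Rightarrow> bool" where
  "lie_group G \<longleftrightarrow> group G \<and> smooth_manifold (gman G) \<and> points (gman G) = carrier G \<and>
     smooth_map (prod_manifold (gman G) (gman G)) (gman G) (\<lambda>(x, y). x \<otimes>\<^bsub>G\<^esub> y) \<and>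
     smooth_map (gman G) (gman G) (\<lambda>x. inv\<^bsub>G\<^esub> x)"

text \<open>The Lie algebra consists of the left-invariant vector fields, with their commutator.\<close>

definition lie_algebra :: "'a smooth_group \<Rightarrow> 'a vfield set" where
  "lie_algebra G = {X \<in> vector_fields (gman G).
     \<forall>a\<in>carrier G. \<forall>f\<in>smooth_functions (gman G).
       X (pull_fun (gman G) (\<lambda>x. a \<otimes>\<^bsub>G\<^esub> x) f) = pull_fun (gman G) (\<lambda>x. a \<otimes>\<^bsub>G\<^esub> x) (X f)}"

definition is_basis :: "'a vfield set \<Rightarrow> 'a vfield list \<Rightarrow> bool" where
  "is_basis V Bs \<longleftrightarrow> set Bs \<subseteq> V \<and>
     (\<forall>X\<in>V. \<exists>!c. (\<forall>i\<ge>length Bs. c i = 0) \<and> X = lincomb c Bs)"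

definition coords :: "'a vfield list \<Rightarrow> 'a vfield \<Rightarrow> nat \<Rightarrow> real" where
  "coords Bs X = (THE c. (\<forall>i\<ge>length Bs. c i = 0) \<and> X = lincomb c Bs)"

text \<open>A Lie algebra in the notation \<open>(de\<^sup>1, de\<^sup>2, \<dots>)\<close> is given by the list of differentials, and each
  differential by the list of its terms: \<open>(a, i, j)\<close> stands for \<open>a e\<^sup>i \<and> e\<^sup>j\<close>, with indices
  starting at 1.\<close>

type_synonym lie_differentials = "(real \<times> nat \<times> nat) list list"

definition h5 :: lie_differentials where
  "h5 = [[], [], [], [], [(1, 1, 2), (1, 3, 4)]]"

definition h3C :: lie_differentials where
  "h3C = [[], [], [], [], [(1, 1, 2), (-1, 3, 4)], [(1, 1, 3), (1, 2, 4)]]"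

definition hH :: lie_differentials where
  "hH = [[], [], [], [], [(1, 1, 2), (-1, 3, 4)], [(1, 1, 3), (1, 2, 4)], [(1, 1, 4), (-1, 2, 3)]]"

text \<open>\<open>\<real>\<^sup>k \<oplus> D\<close>; the abelian summand is listed last, which leaves the indices in \<open>D\<close> unchanged.\<close>

definition abelian_plus :: "nat \<Rightarrow> lie_differentials \<Rightarrow> lie_differentials" where
  "abelian_plus k D = D @ replicate k []"

text \<open>The value of \<open>de\<^sup>k\<close> on \<open>(e\<^sub>i, e\<^sub>j)\<close>, where \<open>k\<close>, \<open>i\<close>, \<open>j\<close> are now list positions (starting at 0).\<close>

definition diff_coeff :: "lie_differentials \<Rightarrow> nat \<Rightarrow> nat \<Rightarrow> nat \<Rightarrow> real" where
  "diff_coeff D k i j =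
     (\<Sum>(a, r, s)\<leftarrow>D ! k. a * (of_bool (r = Suc i \<and> s = Suc j) - of_bool (r = Suc j \<and> s = Suc i)))"

text \<open>The Lie algebra of \<open>N\<close> has a basis whose dual basis has the given differentials, by
  \<open>de\<^sup>k(X, Y) = - e\<^sup>k([X, Y])\<close>.\<close>

definition lie_algebra_iso :: "'a smooth_group \<Rightarrow> lie_differentials \<Rightarrow> bool" where
  "lie_algebra_iso N D \<longleftrightarrow> (\<exists>Es. length Es = length D \<and> is_basis (lie_algebra N) Es \<and>
     (\<forall>i<length D. \<forall>j<length D.
        bracket (Es ! i) (Es ! j) = lincomb (\<lambda>k. - diff_coeff D k i j) Es))"

fun lower_central :: "('a, 'b) monoid_scheme \<Rightarrow> nat \<Rightarrow> 'a set" where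
  "lower_central G 0 = carrier G"
| "lower_central G (Suc n) = generate G
     {x \<otimes>\<^bsub>G\<^esub> y \<otimes>\<^bsub>G\<^esub> inv\<^bsub>G\<^esub> x \<otimes>\<^bsub>G\<^esub> inv\<^bsub>G\<^esub> y | x y. x \<in> carrier G \<and> y \<in> lower_central G n}"

definition nilpotent_group :: "('a, 'b) monoid_scheme \<Rightarrow> bool" where
  "nilpotent_group G \<longleftrightarrow> (\<exists>n. lower_central G n = {\<one>\<^bsub>G\<^esub>})"

definition simply_connected_space :: "'a topology \<Rightarrow> bool" where
  "simply_connected_space X \<longleftrightarrow> path_connected_space X \<and>
     (\<forall>p. pathin X p \<and> p 0 = p 1 \<longrightarrow>
        homotopic_with (\<lambda>q. q 0 = q 1) (top_of_set {0..1}) X p (\<lambda>_. p 0))"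

definition nilpotent_lie_group :: "'a smooth_group \<Rightarrow> bool" where
  "nilpotent_lie_group N \<longleftrightarrow>
     lie_group N \<and> nilpotent_group N \<and> simply_connected_space (mtop (gman N))"

definition quotient_topology :: "'a topology \<Rightarrow> ('a \<Rightarrow> 'b) \<Rightarrow> 'b topology" where
  "quotient_topology X q =
     topology (\<lambda>W. W \<subseteq> q ` topspace X \<and> openin X {x \<in> topspace X. q x \<in> W})"

lemma openin_quotient_topology:
  "openin (quotient_topology X q) W \<longleftrightarrow>
     W \<subseteq> q ` topspace X \<and> openin X {x \<in> topspace X. q x \<in> W}"
proof -
  have "istopology (\<lambda>W. W \<subseteq> q ` topspace X \<and> openin X {x \<in> topspace X. q x \<in> W})"
    unfolding istopology_def
  proof (intro conjI allI impI)
    fix S T assume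
      "S \<subseteq> q ` topspace X \<and> openin X {x \<in> topspace X. q x \<in> S}"
      "T \<subseteq> q ` topspace X \<and> openin X {x \<in> topspace X. q x \<in> T}"
    then have "openin X ({x \<in> topspace X. q x \<in> S} \<inter> {x \<in> topspace X. q x \<in> T})"
      by blast
    moreover have "{x \<in> topspace X. q x \<in> S} \<inter> {x \<in> topspace X. q x \<in> T}
        = {x \<in> topspace X. q x \<in> S \<inter> T}" by blast
    ultimately show "openin X {x \<in> topspace X. q x \<in> S \<inter> T}" by simp
  next
    fix K assume K: "\<forall>W\<in>K. W \<subseteq> q ` topspace X \<and> openin X {x \<in> topspace X. q x \<in> W}"
    have "openin X (\<Union>W\<in>K. {x \<in> topspace X. q x \<in> W})"
      using K by blast
    moreover have "(\<Union>W\<in>K. {x \<in> topspace X. q x \<in> W}) = {x \<in> topspace X. q x \<in> \<Union>K}" by blast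
    ultimately show "openin X {x \<in> topspace X. q x \<in> \<Union>K}" by simp
  qed blast+
  then show ?thesis
    by (simp add: quotient_topology_def)
qed

text \<open>The quotient \<open>\<Gamma>\N\<close> is the space of cosets \<open>\<Gamma> x\<close>, so that left-invariant tensors on \<open>N\<close>
  descend to it.  Its charts are those of \<open>N\<close> on open sets on which the projection is injective.\<close>

definition coset_manifold :: "'a smooth_group \<Rightarrow> 'a set \<Rightarrow> 'a set manifold" where
  "coset_manifold N \<Gamma> =
     \<lparr>mdim = mdim (gman N),
      mtop = quotient_topology (mtop (gman N)) (\<lambda>x. \<Gamma> #>\<^bsub>N\<^esub> x),
      atlas = {((\<lambda>x. \<Gamma> #>\<^bsub>N\<^esub> x) ` V, \<lambda>y. c (inv_into V (\<lambda>x. \<Gamma> #>\<^bsub>N\<^esub> x) y)) | U c V.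
         (U, c) \<in> atlas (gman N) \<and> openin (mtop (gman N)) V \<and> V \<subseteq> U \<and>
         inj_on (\<lambda>x. \<Gamma> #>\<^bsub>N\<^esub> x) V}\<rparr>"

definition cocompact_lattice :: "'a smooth_group \<Rightarrow> 'a set \<Rightarrow> bool" where
  "cocompact_lattice N \<Gamma> \<longleftrightarrow> subgroup \<Gamma> N \<and>
     subtopology (mtop (gman N)) \<Gamma> = discrete_topology \<Gamma> \<and>
     compact_space (mtop (coset_manifold N \<Gamma>))"


section \<open>Principal bundles and connections\<close>

text \<open>When bundles and groups are quantified existentially, they have to live in fixed types of points;
  any type with at least continuum many elements, such as \<^typ>\<open>nat \<Rightarrow> real\<close>, has a copy of every
  second countable Lie group and of every principal bundle over a manifold with such a group.\<close>

definition principal_bundle ::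
  "'p manifold \<Rightarrow> 'a manifold \<Rightarrow> 'g smooth_group \<Rightarrow> ('p \<Rightarrow> 'g \<Rightarrow> 'p) \<Rightarrow> ('p \<Rightarrow> 'a) \<Rightarrow> bool" where
  "principal_bundle P M G act \<pi> \<longleftrightarrow>
     smooth_manifold P \<and> smooth_manifold M \<and> lie_group G \<and>
     smooth_map P M \<pi> \<and>
     smooth_map (prod_manifold P (gman G)) P (\<lambda>(u, h). act u h) \<and>
     (\<forall>u\<in>points P. act u \<one>\<^bsub>G\<^esub> = u) \<and>
     (\<forall>u\<in>points P. \<forall>h\<in>carrier G. \<forall>k\<in>carrier G. act (act u h) k = act u (h \<otimes>\<^bsub>G\<^esub> k)) \<and>
     (\<forall>u\<in>points P. \<forall>h\<in>carrier G. \<pi> (act u h) = \<pi> u) \<and>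
     (\<forall>x\<in>points M. \<exists>U \<Phi>. openin (mtop M) U \<and> x \<in> U \<and>
        diffeomorphism (open_submanifold P {u \<in> points P. \<pi> u \<in> U})
          (prod_manifold (open_submanifold M U) (gman G)) \<Phi> \<and>
        (\<forall>u\<in>points P. \<pi> u \<in> U \<longrightarrow> fst (\<Phi> u) = \<pi> u \<and>
           (\<forall>h\<in>carrier G. snd (\<Phi> (act u h)) = snd (\<Phi> u) \<otimes>\<^bsub>G\<^esub> h)))"

definition fundamental_field ::
  "'p manifold \<Rightarrow> 'g smooth_group \<Rightarrow> ('p \<Rightarrow> 'g \<Rightarrow> 'p) \<Rightarrow> 'g vfield \<Rightarrow> 'p vfield" where
  "fundamental_field P G act \<xi> = (\<lambda>f u. if f \<in> smooth_functions P \<and> u \<in> points P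
     then \<xi> (pull_fun (gman G) (\<lambda>h. act u h) f) \<one>\<^bsub>G\<^esub> else 0)"

text \<open>\<open>Ad(h)\<close> is the push-forward of left-invariant vector fields by \<open>x \<mapsto> h x h\<^sup>-\<^sup>1\<close>.\<close>

definition Ad :: "'g smooth_group \<Rightarrow> 'g \<Rightarrow> 'g vfield \<Rightarrow> 'g vfield" where
  "Ad G h \<xi> = (\<lambda>f. if f \<in> smooth_functions (gman G)
     then pull_fun (gman G) (\<lambda>x. inv\<^bsub>G\<^esub> h \<otimes>\<^bsub>G\<^esub> x \<otimes>\<^bsub>G\<^esub> h)
            (\<xi> (pull_fun (gman G) (\<lambda>x. h \<otimes>\<^bsub>G\<^esub> x \<otimes>\<^bsub>G\<^esub> inv\<^bsub>G\<^esub> h) f))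
     else (\<lambda>p. 0))"

text \<open>Lie algebra valued forms are given by their components with respect to a basis \<open>Bs\<close> of the
  Lie algebra of \<open>G\<close>.  A connection is an equivariant 1-form \<open>A\<close> that reproduces the generators of
  the fundamental vector fields.\<close>

definition connection ::
  "'p manifold \<Rightarrow> 'g smooth_group \<Rightarrow> ('p \<Rightarrow> 'g \<Rightarrow> 'p) \<Rightarrow> 'g vfield list \<Rightarrow> 'p form list \<Rightarrow> bool" where
  "connection P G act Bs A \<longleftrightarrow> is_basis (lie_algebra G) Bs \<and> length A = length Bs \<and>
     (\<forall>\<alpha>\<in>set A. is_form P 1 \<alpha>) \<and>
     (\<forall>\<xi>\<in>lie_algebra G. \<forall>u\<in>points P.
        lincomb (\<lambda>a. (A ! a) [fundamental_field P G act \<xi>] u) Bs = \<xi>) \<and>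
     (\<forall>h\<in>carrier G. \<forall>X\<in>vector_fields P. \<forall>u\<in>points P.
        lincomb (\<lambda>a. pullback P P (\<lambda>v. act v h) (A ! a) [X] u) Bs =
          Ad G (inv\<^bsub>G\<^esub> h) (lincomb (\<lambda>a. (A ! a) [X] u) Bs))"

text \<open>The component \<open>a\<close> of the curvature \<open>dA + 1/2 [A \<and> A]\<close>, a horizontal equivariant form on the
  total space.\<close>

definition curvature :: "'g vfield list \<Rightarrow> 'p form list \<Rightarrow> nat \<Rightarrow> 'p form" where
  "curvature Bs A a = (\<lambda>Xs p. ext_deriv (A ! a) Xs p +
     1 / 2 * (\<Sum>b<length Bs. \<Sum>c<length Bs.
       coords Bs (bracket (Bs ! b) (Bs ! c)) a * wedge 1 (A ! b) (A ! c) Xs p))"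

definition invariant_form :: "'g vfield set \<Rightarrow> ('g vfield \<Rightarrow> 'g vfield \<Rightarrow> real) \<Rightarrow> bool" where
  "invariant_form L \<kappa> \<longleftrightarrow>
     (\<forall>X\<in>L. \<forall>Y\<in>L. \<kappa> X Y = \<kappa> Y X) \<and>
     (\<forall>X\<in>L. \<forall>Y\<in>L. \<forall>Z\<in>L. \<forall>a b. \<kappa> (\<lambda>f p. a * X f p + b * Y f p) Z = a * \<kappa> X Z + b * \<kappa> Y Z) \<and>
     (\<forall>X\<in>L. (\<forall>Y\<in>L. \<kappa> X Y = 0) \<longrightarrow> X = (\<lambda>f p. 0)) \<and>
     (\<forall>X\<in>L. \<forall>Y\<in>L. \<forall>Z\<in>L. \<kappa> (bracket Z X) Y + \<kappa> X (bracket Z Y) = 0)"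

text \<open>The equations \<open>F\<^sub>A \<and> \<psi> = 0\<close> and \<open>dT = \<langle>F\<^sub>A \<and> F\<^sub>A\<rangle>\<close> on \<open>M\<close> are read on the total space \<open>P\<close>, where
  \<open>F\<^sub>A\<close> is the horizontal equivariant curvature form; they are equivalent because pullback along the
  submersion \<open>\<pi>\<close> is injective.\<close>

definition heterotic_G2_system where
  "heterotic_G2_system M \<phi> g vol P G \<pi> Bs A \<longleftrightarrow>
     form_eq M 5 (ext_deriv (G2_psi M \<phi> g vol))
       (wedge 1 (\<lambda>Xs p. 4 * tau1 M \<phi> g vol Xs p) (G2_psi M \<phi> g vol)) \<and>
     (\<forall>a<length Bs. form_eq P 6
        (wedge 2 (curvature Bs A a) (pullback P M \<pi> (G2_psi M \<phi> g vol))) (\<lambda>Xs p. 0)) \<and>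
     (\<exists>\<kappa>. invariant_form (lie_algebra G) \<kappa> \<and>
        form_eq P 4 (pullback P M \<pi> (ext_deriv (G2_torsion M \<phi> g vol)))
          (\<lambda>Xs p. \<Sum>a<length Bs. \<Sum>b<length Bs.
             \<kappa> (Bs ! a) (Bs ! b) * wedge 2 (curvature Bs A a) (curvature Bs A b) Xs p))"

end

theory Submission
  imports Defs
begin

text \<open>
  The left-invariant fields of \<open>N\<close> descend to a global frame of \<open>\<Gamma>\N\<close> with constant structure
  coefficients.  After changing the sign of one basis vector in the case of \<open>\<real>\<^sup>2 \<oplus> h\<^sub>5\<close>, the dual coframe
  satisfies \<open>de\<^sup>5 = a(12 - 34)\<close>, \<open>de\<^sup>6 = b(13 + 24)\<close>, \<open>de\<^sup>7 = c(14 - 23)\<close> and \<open>de\<^sup>i = 0\<close> for \<open>i \<le> 4\<close>, with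
  \<open>(a, b, c)\<close> one of \<open>(1, 0, 0)\<close>, \<open>(1, 1, 0)\<close>, \<open>(1, 1, 1)\<close>, so that one computation covers the three
  Lie algebras.  For \<open>\<phi> = 567 + (12 + 34)5 + (13 - 24)6 - (14 + 23)7\<close> one has \<open>d\<psi> = 0\<close>,
  \<open>d\<phi> \<and> \<phi> = 0\<close>, \<open>\<tau>\<^sub>1 = 0\<close> and \<open>T = \<Sum> de\<^sup>k \<and> e\<^sup>k\<close>, the sum being over \<open>k = 5, 6, 7\<close>; hence
  \<open>dT = \<Sum> de\<^sup>k \<and> de\<^sup>k\<close>.  On the trivial bundle with group \<open>\<real>\<^sup>3\<close> and fibre coordinates \<open>t\<^sub>k\<close>, the
  connection with components \<open>dt\<^sub>k + e\<^sup>k\<close> has curvature \<open>de\<^sup>k\<close>.  The forms \<open>de\<^sup>k\<close> are anti-self-dual in the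
  directions 1234, whereas \<open>\<psi>\<close> contains the self-dual ones, so \<open>F \<and> \<psi> = 0\<close>; and \<open>dT = \<langle>F \<and> F\<rangle>\<close> for
  the standard inner product of \<open>\<real>\<^sup>3\<close>.
\<close>

section \<open>Calculus in coordinates\<close>

text \<open>Vector fields are derivations of global functions and forms are evaluated on lists of
  them, so nothing is local by definition. Bump functions and Hadamard's lemma recover coordinates;
  they show that seven independent fields span every tangent space, with smooth components. Each
  form at hand is then a constant alternating form \<open>W\<close> applied to those components, its
  differential is the sum of de^k \<and> (contraction of \<open>W\<close> with e_k), and the
  geometry turns into finite algebra on R^7. The Hodge star is evaluated on an orthonormal basis
  chosen arbitrarily at each point, so independence of that basis has to be proved.

  The signs in \<phi> make 12 + 34, 13 - 24 and -(14 + 23) self-dual in the directions 1234. The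
  wedge of any of them with any de^k vanishes, hence d\<phi> = d(567). Since e^5, e^6, e^7 are
  defined on all of M, their differentials are exact, which is why a trivial bundle can carry them
  as curvature.\<close>

definition cbx :: "nat \<Rightarrow> (nat \<Rightarrow> real) \<Rightarrow> real \<Rightarrow> (nat \<Rightarrow> real) set" where
  "cbx d x r = {y. (\<forall>i\<ge>d. y i = 0) \<and> (\<forall>i<d. \<bar>y i - x i\<bar> < r)}"

lemma Euclidean_space_top_of_set: "Euclidean_space d = top_of_set {x. \<forall>i\<ge>d. x i = 0}"
  by (simp add: Euclidean_space_def euclidean_product_topology)

lemma openin_cbx: "openin (Euclidean_space d) (cbx d x r)"
proof -
  have "open (\<Inter>i\<in>{..<d}. {y. \<bar>y i - x i\<bar> < r})"
    by (intro open_INT ballI open_Collect_less continuous_intros) auto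
  moreover have "cbx d x r = {x. \<forall>i\<ge>d. x i = 0} \<inter> (\<Inter>i\<in>{..<d}. {y. \<bar>y i - x i\<bar> < r})"
    by (auto simp: cbx_def)
  ultimately show ?thesis
    unfolding Euclidean_space_top_of_set openin_open by blast
qed

lemma cbx_centre: "r > 0 \<Longrightarrow> (\<forall>i\<ge>d. x i = 0) \<Longrightarrow> x \<in> cbx d x r"
  by (auto simp: cbx_def)

lemma cbx_mono: "r \<le> s \<Longrightarrow> cbx d x r \<subseteq> cbx d x s"
  by (force simp: cbx_def)

text \<open>A basic open set of the product topology restricts each coordinate separately. Points of
  \<open>V\<close> vanish from index \<open>d\<close> on, so only \<open>d\<close> coordinates can
  move, and the smallest of their radii serves for all.\<close>

lemma openin_Euclidean_cbx:
  assumes "openin (Euclidean_space d) V" "x \<in> V"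
  obtains r where "r > 0" "cbx d x r \<subseteq> V"
proof -
  obtain T where T: "open T" "V = {x. \<forall>i\<ge>d. x i = 0} \<inter> T"
    using assms unfolding Euclidean_space_top_of_set openin_open by blast
  have "openin (product_topology (\<lambda>i. euclidean) UNIV) T"
    using T(1) by (simp add: euclidean_product_topology)
  then obtain X where X: "x \<in> (\<Pi>\<^sub>E i\<in>UNIV. X i)" "\<And>i. openin euclidean (X i)" "(\<Pi>\<^sub>E i\<in>UNIV. X i) \<subseteq> T"
    using product_topology_open_contains_basis[of "\<lambda>i. euclidean" UNIV T x] assms(2) T(2) by blast
  have "\<exists>r>0. \<forall>y. \<bar>y - x i\<bar> < r \<longrightarrow> y \<in> X i" for i
  proof -
    have "open (X i)" "x i \<in> X i" using X by auto
    then show ?thesis unfolding open_dist by (auto simp: dist_real_def)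
  qed
  then obtain R where R: "\<And>i. R i > 0" "\<And>i y. \<bar>y - x i\<bar> < R i \<Longrightarrow> y \<in> X i" by metis
  \<comment> \<open>The inserted 1 keeps the minimum defined and positive when
    \<open>d = 0\<close>.\<close>
  define r where "r = Min (insert 1 (R ` {..<d}))"
  have r: "r > 0" "\<And>i. i < d \<Longrightarrow> r \<le> R i"
    using R(1) by (auto simp: r_def)
  have "cbx d x r \<subseteq> V"
  proof
    fix y assume y: "y \<in> cbx d x r"
    have "y i \<in> X i" for i
    proof (cases "i < d")
      case True
      then show ?thesis using y r R(2)[of "y i" i] by (force simp: cbx_def)
    next
      case False
      then have "y i = x i" using y assms(2) T(2) by (auto simp: cbx_def)
      then show ?thesis using X(1) by auto
    qed
    then have "y \<in> T" using X(3) by auto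
    then show "y \<in> V" using y T(2) by (auto simp: cbx_def)
  qed
  with r show ?thesis using that by blast
qed

lemma openin_Euclidean_supp: "openin (Euclidean_space d) V \<Longrightarrow> x \<in> V \<Longrightarrow> i \<ge> d \<Longrightarrow> x i = 0"
  using openin_subset[of "Euclidean_space d" V] by (auto simp: topspace_Euclidean_space)

text \<open>The epsilon-delta criterion with cubes as neighbourhoods, because the arguments below
  move one coordinate at a time and must stay inside.\<close>

lemma continuous_on_cbx_iff:
  fixes f :: "(nat \<Rightarrow> real) \<Rightarrow> real"
  assumes "openin (Euclidean_space d) V"
  shows "continuous_on V f \<longleftrightarrow> (\<forall>x\<in>V. \<forall>e>0. \<exists>r>0. cbx d x r \<subseteq> V \<and> (\<forall>y\<in>cbx d x r. \<bar>f y - f x\<bar> < e))"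
proof
  assume f: "continuous_on V f"
  show "\<forall>x\<in>V. \<forall>e>0. \<exists>r>0. cbx d x r \<subseteq> V \<and> (\<forall>y\<in>cbx d x r. \<bar>f y - f x\<bar> < e)"
  proof (intro ballI allI impI)
    fix x and e :: real assume x: "x \<in> V" "e > 0"
    have "openin (top_of_set V) (V \<inter> f -` ball (f x) e)"
      by (rule continuous_openin_preimage_gen[OF f]) auto
    moreover have "top_of_set V = subtopology (Euclidean_space d) V"
      using openin_subset[OF assms]
      by (simp add: Euclidean_space_top_of_set subtopology_subtopology inf.absorb2)
    ultimately have "openin (Euclidean_space d) (V \<inter> f -` ball (f x) e)"
      using assms openin_open_subtopology by metis
    then obtain r where "r > 0" "cbx d x r \<subseteq> V \<inter> f -` ball (f x) e"
      using x openin_Euclidean_cbx[of d "V \<inter> f -` ball (f x) e" x] by auto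
    then show "\<exists>r>0. cbx d x r \<subseteq> V \<and> (\<forall>y\<in>cbx d x r. \<bar>f y - f x\<bar> < e)"
      by (force simp: dist_real_def abs_minus_commute)
  qed
next
  assume *: "\<forall>x\<in>V. \<forall>e>0. \<exists>r>0. cbx d x r \<subseteq> V \<and> (\<forall>y\<in>cbx d x r. \<bar>f y - f x\<bar> < e)"
  show "continuous_on V f"
    unfolding continuous_on_def
  proof (intro ballI tendstoI)
    fix x and e :: real assume x: "x \<in> V" "e > 0"
    then obtain r where r: "r > 0" "cbx d x r \<subseteq> V" "\<forall>y\<in>cbx d x r. \<bar>f y - f x\<bar> < e"
      using * by meson
    obtain T where T: "open T" "cbx d x r = {x. \<forall>i\<ge>d. x i = 0} \<inter> T"
      using openin_cbx[of d x r] unfolding Euclidean_space_top_of_set openin_open by blast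
    have "x \<in> T"
      using T cbx_centre[of r d x] r openin_Euclidean_supp[OF assms x(1)] by auto
    then show "\<forall>\<^sub>F y in at x within V. dist (f y) (f x) < e"
      unfolding eventually_at_topological
    proof (intro exI[of _ T] conjI ballI impI)
      fix y assume "y \<in> T" "y \<in> V"
      then have "y \<in> cbx d x r" using T(2) openin_Euclidean_supp[OF assms \<open>y \<in> V\<close>] by simp
      then show "dist (f y) (f x) < e" using r(3) by (simp add: dist_real_def)
    qed (auto simp: T(1))
  qed
qed

lemma continuous_on_cbxE:
  fixes f :: "(nat \<Rightarrow> real) \<Rightarrow> real"
  assumes "openin (Euclidean_space d) V" "continuous_on V f" "x \<in> V" "e > 0"
  obtains r where "r > 0" "cbx d x r \<subseteq> V" "\<And>y. y \<in> cbx d x r \<Longrightarrow> \<bar>f y - f x\<bar> < e"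
  using assms continuous_on_cbx_iff by meson

lemma eventually_upd_mem:
  assumes "openin (Euclidean_space d) V" "x \<in> V" "i < d"
  shows "\<forall>\<^sub>F t in nhds (x i). x(i := t) \<in> V"
proof -
  obtain r where r: "r > 0" "cbx d x r \<subseteq> V" using openin_Euclidean_cbx assms by metis
  have "\<forall>\<^sub>F t in nhds (x i). dist t (x i) < r" using r(1) eventually_nhds_metric by blast
  then show ?thesis
    by eventually_elim
      (use r openin_Euclidean_supp[OF assms(1,2)] assms(3) in \<open>auto simp: cbx_def dist_real_def intro!: subsetD[OF r(2)]\<close>)
qed

text \<open>Near \<open>x i\<close> the coordinate line through \<open>x\<close> stays in the open
  set \<open>V\<close>, so values off \<open>V\<close> have no influence. Inverse charts are
  arbitrary off the image of the chart, and this locality makes them usable.\<close>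

lemma partial_cong:
  assumes "openin (Euclidean_space d) V" "x \<in> V" "i < d" "\<And>y. y \<in> V \<Longrightarrow> f y = g y"
  shows "partial i f x = partial i g x"
    "(\<lambda>t. f (x(i := t))) differentiable at (x i) \<longleftrightarrow> (\<lambda>t. g (x(i := t))) differentiable at (x i)"
proof -
  have ev: "\<forall>\<^sub>F t in nhds (x i). f (x(i := t)) = g (x(i := t))"
    using eventually_upd_mem[OF assms(1-3)] by eventually_elim (rule assms(4))
  then show "partial i f x = partial i g x"
    unfolding partial_def by (intro deriv_cong_ev) auto
  show "(\<lambda>t. f (x(i := t))) differentiable at (x i) \<longleftrightarrow> (\<lambda>t. g (x(i := t))) differentiable at (x i)"
    unfolding real_differentiable_def by (simp only: DERIV_cong_ev[OF refl ev refl])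
qed

section \<open>Closure properties of the classes C^k\<close>

lemma partialI: "((\<lambda>t. f (x(i := t))) has_real_derivative D) (at (x i)) \<Longrightarrow> partial i f x = D"
  unfolding partial_def by (rule DERIV_imp_deriv)

lemma partialD:
  assumes "(\<lambda>t. f (x(i := t))) differentiable at (x i)"
  shows "((\<lambda>t. f (x(i := t))) has_real_derivative partial i f x) (at (x i))"
  unfolding partial_def using DERIV_deriv_iff_real_differentiable assms by blast

lemma Ck_on_imp_continuous: "Ck_on k d V f \<Longrightarrow> continuous_on V f"
  by (cases k) auto

lemma Ck_on_subset: "Ck_on k d V f \<Longrightarrow> W \<subseteq> V \<Longrightarrow> Ck_on k d W f"
  by (induction k arbitrary: f) (auto intro: continuous_on_subset)

lemma Ck_on_SucD: "Ck_on (Suc k) d V f \<Longrightarrow> Ck_on k d V f"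
  by (induction k arbitrary: f) auto

lemma Ck_on_cong:
  assumes "openin (Euclidean_space d) V"
  shows "(\<And>y. y \<in> V \<Longrightarrow> f y = g y) \<Longrightarrow> Ck_on k d V f \<Longrightarrow> Ck_on k d V g"
proof (induction k arbitrary: f g)
  case 0
  then show ?case by (simp cong: continuous_on_cong)
next
  case (Suc k)
  have "continuous_on V g" using Suc.prems by (simp cong: continuous_on_cong)
  moreover have "Ck_on k d V (partial i g)" if "i < d" for i
  proof (rule Suc.IH)
    show "partial i f y = partial i g y" if "y \<in> V" for y
      by (rule partial_cong(1)[where f = f and g = g, OF assms that \<open>i < d\<close> Suc.prems(1)])
    show "Ck_on k d V (partial i f)" using Suc.prems(2) that by simp
  qed
  moreover have "(\<lambda>t. g (x(i := t))) differentiable at (x i)" if "i < d" "x \<in> V" for i x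
  proof -
    have "(\<lambda>t. f (x(i := t))) differentiable at (x i)" using Suc.prems(2) that by simp
    then show ?thesis using partial_cong(2)[where f = f and g = g, OF assms that(2,1) Suc.prems(1)] by blast
  qed
  ultimately show ?case by simp
qed

text \<open>The recursion in \<open>Ck_on\<close> refers to the total function
  \<open>partial i f\<close>, which need not follow any formula off \<open>V\<close>; locality
  allows an explicit formula \<open>D i\<close> in its place.\<close>

lemma Ck_on_SucI:
  assumes "openin (Euclidean_space d) V" "continuous_on V f"
    "\<And>i x. i < d \<Longrightarrow> x \<in> V \<Longrightarrow> ((\<lambda>t. f (x(i := t))) has_real_derivative D i x) (at (x i))"
    "\<And>i. i < d \<Longrightarrow> Ck_on k d V (D i)"
  shows "Ck_on (Suc k) d V f"
proof -
  have "Ck_on k d V (partial i f)" if "i < d" for i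
    by (rule Ck_on_cong[OF assms(1) _ assms(4)[OF that]]) (use partialI assms(3) that in metis)
  then show ?thesis
    using assms(2,3) unfolding Ck_on.simps real_differentiable_def by blast
qed

lemma Ck_on_SucE:
  assumes "Ck_on (Suc k) d V f" "i < d"
  shows "\<And>x. x \<in> V \<Longrightarrow> ((\<lambda>t. f (x(i := t))) has_real_derivative partial i f x) (at (x i))"
    "Ck_on k d V (partial i f)"
  using assms partialD by auto

lemma Ck_on_const: "openin (Euclidean_space d) V \<Longrightarrow> Ck_on k d V (\<lambda>x. c)"
proof (induction k arbitrary: c)
  case (Suc k)
  then show ?case by (intro Ck_on_SucI[where D = "\<lambda>_ _. 0"]) auto
qed simp

lemma Ck_on_coord: "openin (Euclidean_space d) V \<Longrightarrow> Ck_on k d V (\<lambda>x. x j)"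
proof (cases k)
  case (Suc k)
  assume V: "openin (Euclidean_space d) V"
  show ?thesis unfolding Suc
    by (intro Ck_on_SucI[where D = "\<lambda>i _. if i = j then 1 else 0"] V Ck_on_const
        continuous_on_subset[OF continuous_on_product_coordinates]) (auto intro!: derivative_eq_intros)
qed (auto intro: continuous_on_subset[OF continuous_on_product_coordinates])

lemma Ck_on_add:
  "openin (Euclidean_space d) V \<Longrightarrow> Ck_on k d V f \<Longrightarrow> Ck_on k d V g \<Longrightarrow> Ck_on k d V (\<lambda>x. f x + g x)"
proof (induction k arbitrary: f g)
  case (Suc k)
  show ?case
  proof (rule Ck_on_SucI[where D = "\<lambda>i x. partial i f x + partial i g x"])
    fix i x assume i: "i < d" and x: "x \<in> V"
    show "((\<lambda>t. f (x(i := t)) + g (x(i := t))) has_real_derivative partial i f x + partial i g x) (at (x i))"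
      by (rule DERIV_add[OF Ck_on_SucE(1)[OF Suc.prems(2) i x] Ck_on_SucE(1)[OF Suc.prems(3) i x]])
  next
    fix i assume i: "i < d"
    show "Ck_on k d V (\<lambda>x. partial i f x + partial i g x)"
      by (intro Suc.IH Suc.prems(1) Ck_on_SucE(2)[OF _ i] Suc.prems)
  qed (use Suc in \<open>auto intro!: continuous_intros\<close>)
qed (auto intro: continuous_intros)

lemma Ck_on_mult:
  "openin (Euclidean_space d) V \<Longrightarrow> Ck_on k d V f \<Longrightarrow> Ck_on k d V g \<Longrightarrow> Ck_on k d V (\<lambda>x. f x * g x)"
proof (induction k arbitrary: f g)
  case (Suc k)
  show ?case
  proof (rule Ck_on_SucI[where D = "\<lambda>i x. partial i f x * g x + partial i g x * f x"])
    fix i x assume i: "i < d" and x: "x \<in> V"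
    show "((\<lambda>t. f (x(i := t)) * g (x(i := t))) has_real_derivative partial i f x * g x + partial i g x * f x) (at (x i))"
      using DERIV_mult[OF Ck_on_SucE(1)[OF Suc.prems(2) i x] Ck_on_SucE(1)[OF Suc.prems(3) i x]]
      by (simp only: fun_upd_triv)
  next
    fix i assume i: "i < d"
    show "Ck_on k d V (\<lambda>x. partial i f x * g x + partial i g x * f x)"
      by (intro Ck_on_add Suc.IH Suc.prems(1) Ck_on_SucE(2)[OF _ i] Suc.prems Ck_on_SucD)
  qed (use Suc in \<open>auto intro!: continuous_intros\<close>)
qed (auto intro: continuous_intros)

lemma Ck_on_sum:
  assumes "openin (Euclidean_space d) V" "\<And>j. j \<in> J \<Longrightarrow> Ck_on k d V (f j)"
  shows "Ck_on k d V (\<lambda>x. \<Sum>j\<in>J. f j x)"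
  using assms(2) by (induction J rule: infinite_finite_induct) (auto intro: Ck_on_const Ck_on_add assms(1))

lemma Ck_on_inverse:
  "openin (Euclidean_space d) V \<Longrightarrow> Ck_on k d V f \<Longrightarrow> (\<And>x. x \<in> V \<Longrightarrow> f x \<noteq> 0) \<Longrightarrow>
     Ck_on k d V (\<lambda>x. inverse (f x))"
proof (induction k arbitrary: f)
  case (Suc k)
  show ?case
  proof (rule Ck_on_SucI[where D = "\<lambda>i x. (- 1) * partial i f x * (inverse (f x) * inverse (f x))"])
    fix i x assume i: "i < d" and x: "x \<in> V"
    show "((\<lambda>t. inverse (f (x(i := t)))) has_real_derivative
        (- 1) * partial i f x * (inverse (f x) * inverse (f x))) (at (x i))"
      by (rule DERIV_cong[OF DERIV_inverse_fun[OF Ck_on_SucE(1)[OF Suc.prems(2) i x]]])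
        (use Suc.prems(3)[OF x] in simp_all)
  next
    fix i assume i: "i < d"
    show "Ck_on k d V (\<lambda>x. (- 1) * partial i f x * (inverse (f x) * inverse (f x)))"
      by (intro Ck_on_mult Suc.IH Suc.prems Ck_on_SucE(2)[OF _ i] Ck_on_const Ck_on_SucD[of _ _ _ f])
  qed (use Suc in \<open>auto intro!: continuous_intros\<close>)
qed (auto intro: continuous_intros)

text \<open>Differentiability is a condition at each point and the partial derivatives fall under
  the induction, so what really has to be glued is continuity.\<close>

lemma Ck_on_local:
  assumes V: "openin (Euclidean_space d) V"
  shows "(\<And>x. x \<in> V \<Longrightarrow> \<exists>W. openin (Euclidean_space d) W \<and> x \<in> W \<and> Ck_on k d W f) \<Longrightarrow> Ck_on k d V f"
proof (induction k arbitrary: f)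
  case 0
  have "\<exists>r>0. cbx d x r \<subseteq> V \<and> (\<forall>y\<in>cbx d x r. \<bar>f y - f x\<bar> < e)" if x: "x \<in> V" "e > 0" for x e
  proof -
    obtain W where W: "openin (Euclidean_space d) W" "x \<in> W" "continuous_on W f"
      using 0[OF x(1)] by auto
    obtain r where r: "r > 0" "\<And>y. y \<in> cbx d x r \<Longrightarrow> \<bar>f y - f x\<bar> < e"
      using continuous_on_cbxE[OF W(1,3,2) x(2)] by metis
    obtain s where s: "s > 0" "cbx d x s \<subseteq> V" using openin_Euclidean_cbx[OF V x(1)] by metis
    show ?thesis
      using r s cbx_mono[of "min r s" r d x] cbx_mono[of "min r s" s d x]
      by (intro exI[of _ "min r s"]) auto
  qed
  then show ?case by (simp add: continuous_on_cbx_iff[OF V])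
next
  case (Suc k)
  have "Ck_on k d V f"
    using Suc.prems Ck_on_SucD by (intro Suc.IH) metis
  moreover have "Ck_on k d V (partial i f)" if "i < d" for i
    using Suc.prems that by (intro Suc.IH) (metis Ck_on.simps(2))
  ultimately show ?case
    using Suc.prems Ck_on_imp_continuous by fastforce
qed

section \<open>The chain rule for continuously differentiable functions\<close>

lemma mvt_segment:
  fixes h :: "real \<Rightarrow> real"
  assumes "\<And>t. t \<in> closed_segment a b \<Longrightarrow> h differentiable at t"
  shows "\<exists>t\<in>closed_segment a b. h b - h a = (b - a) * deriv h t"
proof -
  have D: "(h has_real_derivative deriv h t) (at t)" if "t \<in> closed_segment a b" for t
    using assms[OF that] DERIV_deriv_iff_real_differentiable by blast
  consider "a < b" | "a = b" | "b < a" by linarith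
  then show ?thesis
  proof cases
    case 1
    then obtain z where "a < z" "z < b" "h b - h a = (b - a) * deriv h z"
      using MVT2[OF 1, of h "deriv h"] D by (auto simp: closed_segment_eq_real_ivl)
    then show ?thesis by (intro bexI[of _ z]) (auto simp: closed_segment_eq_real_ivl)
  next
    case 3
    then obtain z where "b < z" "z < a" "h a - h b = (a - b) * deriv h z"
      using MVT2[OF 3, of h "deriv h"] D by (auto simp: closed_segment_eq_real_ivl)
    then show ?thesis by (intro bexI[of _ z]) (auto simp: closed_segment_eq_real_ivl algebra_simps)
  qed auto
qed

text \<open>The corner \<open>z m\<close> has the first \<open>m\<close> coordinates of
  \<open>y\<close> and the others of \<open>x\<close>. The difference telescopes over the corners,
  and each edge is handled by the one-variable mean value theorem; the intermediate points stay in
  the box spanned by \<open>x\<close> and \<open>y\<close>.\<close>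

lemma mvt_coordinates:
  assumes x: "\<forall>i\<ge>d. x i = 0" and V: "cbx d x r \<subseteq> V" and y: "y \<in> cbx d x r"
    and f: "\<And>i z. i < d \<Longrightarrow> z \<in> V \<Longrightarrow> (\<lambda>t. f (z(i := t))) differentiable at (z i)"
  shows "\<exists>\<xi>. (\<forall>j<d. (\<forall>i\<ge>d. \<xi> j i = 0) \<and> (\<forall>i. \<bar>\<xi> j i - x i\<bar> \<le> \<bar>y i - x i\<bar>)) \<and>
     f y - f x = (\<Sum>j<d. (y j - x j) * partial j f (\<xi> j))"
proof -
  define z where "z = (\<lambda>m i. if i < m then y i else x i)"
  have "\<exists>\<xi>. (\<forall>i\<ge>d. \<xi> i = 0) \<and> (\<forall>i. \<bar>\<xi> i - x i\<bar> \<le> \<bar>y i - x i\<bar>) \<and>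
     f (z (Suc j)) - f (z j) = (y j - x j) * partial j f \<xi>" if j: "j < d" for j
  proof -
    define h where "h = (\<lambda>t. f ((z j)(j := t)))"
    have mem: "(z j)(j := t) \<in> V" "\<bar>t - x j\<bar> \<le> \<bar>y j - x j\<bar>" if t: "t \<in> closed_segment (x j) (y j)" for t
    proof -
      show *: "\<bar>t - x j\<bar> \<le> \<bar>y j - x j\<bar>"
        using t by (auto simp: closed_segment_eq_real_ivl split: if_splits)
      have "0 < r" "\<bar>y j - x j\<bar> < r" using y j by (auto simp: cbx_def intro: le_less_trans)
      then have "(z j)(j := t) \<in> cbx d x r"
        using y x * j unfolding z_def cbx_def by auto
      then show "(z j)(j := t) \<in> V" using V by blast
    qed
    have "\<exists>t\<in>closed_segment (x j) (y j). h (y j) - h (x j) = (y j - x j) * deriv h t"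
    proof (rule mvt_segment)
      fix t assume "t \<in> closed_segment (x j) (y j)"
      from f[OF j mem(1)[OF this]] show "h differentiable at t" by (simp add: h_def)
    qed
    then obtain t where t: "t \<in> closed_segment (x j) (y j)" "h (y j) - h (x j) = (y j - x j) * deriv h t" by blast
    have "(z j)(j := y j) = z (Suc j)" "(z j)(j := x j) = z j"
      by (auto simp: z_def less_Suc_eq)
    then have "f (z (Suc j)) - f (z j) = (y j - x j) * partial j f ((z j)(j := t))"
      using t(2) by (simp add: h_def partial_def)
    moreover have "\<forall>i\<ge>d. ((z j)(j := t)) i = 0" using x j by (auto simp: z_def)
    moreover have "\<bar>((z j)(j := t)) i - x i\<bar> \<le> \<bar>y i - x i\<bar>" for i
      using mem(2)[OF t(1)] by (auto simp: z_def)
    ultimately show ?thesis by blast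
  qed
  then obtain \<xi> where \<xi>: "\<And>j. j < d \<Longrightarrow> (\<forall>i\<ge>d. \<xi> j i = 0) \<and> (\<forall>i. \<bar>\<xi> j i - x i\<bar> \<le> \<bar>y i - x i\<bar>) \<and>
     f (z (Suc j)) - f (z j) = (y j - x j) * partial j f (\<xi> j)" by metis
  have "f (z m) - f (z 0) = (\<Sum>j<m. (y j - x j) * partial j f (\<xi> j))" if "m \<le> d" for m
    using that
  proof (induction m)
    case (Suc m)
    then show ?case using \<xi>[of m] by auto
  qed simp
  moreover have "z d = y" "z 0 = x" using x y by (auto simp: z_def cbx_def)
  ultimately show ?thesis using \<xi> by (intro exI[of _ \<xi>]) auto
qed

text \<open>The difference quotient is a sum of quotients of the components of
  \<open>\<gamma>\<close> times partial derivatives at intermediate points. These points are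
  squeezed towards \<open>\<gamma> t0\<close>, and continuity of the partial derivatives gives the
  limit.\<close>

lemma chain_rule_partial:
  fixes \<gamma> :: "real \<Rightarrow> nat \<Rightarrow> real"
  assumes V: "openin (Euclidean_space d) V"
    and f: "\<And>i z. i < d \<Longrightarrow> z \<in> V \<Longrightarrow> (\<lambda>t. f (z(i := t))) differentiable at (z i)"
    and cf: "\<And>i. i < d \<Longrightarrow> continuous_on V (partial i f)"
    and \<gamma>: "\<gamma> t0 \<in> V" "\<forall>\<^sub>F t in at t0. \<gamma> t \<in> V"
    and g: "\<And>j. j < d \<Longrightarrow> ((\<lambda>t. \<gamma> t j) has_real_derivative g j) (at t0)"
  shows "((\<lambda>t. f (\<gamma> t)) has_real_derivative (\<Sum>j<d. g j * partial j f (\<gamma> t0))) (at t0)"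
proof -
  define x where "x = \<gamma> t0"
  have x0: "\<forall>i\<ge>d. x i = 0" using openin_Euclidean_supp[OF V \<gamma>(1)] by (simp add: x_def)
  have near: "\<forall>\<^sub>F t in at t0. \<gamma> t \<in> cbx d x r" if "r > 0" for r
  proof -
    have "\<forall>\<^sub>F t in at t0. \<bar>\<gamma> t j - x j\<bar> < r" if "j < d" for j
    proof -
      have "((\<lambda>t. \<gamma> t j) \<longlongrightarrow> \<gamma> t0 j) (at t0)"
        using DERIV_isCont[OF g[OF that]] unfolding isCont_def .
      from tendstoD[OF this \<open>r > 0\<close>] show ?thesis unfolding dist_real_def x_def .
    qed
    then have "\<forall>\<^sub>F t in at t0. \<forall>j\<in>{..<d}. \<bar>\<gamma> t j - x j\<bar> < r"
      by (intro eventually_ball_finite) auto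
    with \<gamma>(2) show ?thesis
    proof eventually_elim
      case (elim t)
      then show ?case using openin_Euclidean_supp[OF V elim(1)] by (auto simp: cbx_def)
    qed
  qed
  obtain r0 where r0: "r0 > 0" "cbx d x r0 \<subseteq> V"
    unfolding x_def by (rule openin_Euclidean_cbx[OF V \<gamma>(1)])
  define good where "good = (\<lambda>t \<xi>. (\<forall>j<d. (\<forall>i\<ge>d. \<xi> j i = 0) \<and> (\<forall>i. \<bar>\<xi> j i - x i\<bar> \<le> \<bar>\<gamma> t i - x i\<bar>)) \<and>
     f (\<gamma> t) - f x = (\<Sum>j<d. (\<gamma> t j - x j) * partial j f (\<xi> j)))"
  \<comment> \<open>The intermediate points are chosen for all \<open>t\<close> at once, so that a
    limit in \<open>t\<close> can be taken; the choice is meaningful only for \<open>t\<close> near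
    \<open>t0\<close>.\<close>
  define \<Xi> where "\<Xi> = (\<lambda>t. SOME \<xi>. good t \<xi>)"
  have good: "\<forall>\<^sub>F t in at t0. good t (\<Xi> t)"
    using near[OF r0(1)]
  proof eventually_elim
    case (elim t)
    have "\<exists>\<xi>. good t \<xi>" unfolding good_def
      using mvt_coordinates[where f = f, OF x0 r0(2) elim] f by blast
    then show ?case unfolding \<Xi>_def by (rule someI_ex)
  qed
  have lim: "((\<lambda>t. partial j f (\<Xi> t j)) \<longlongrightarrow> partial j f x) (at t0)" if j: "j < d" for j
  proof (rule tendstoI)
    fix e :: real assume e: "e > 0"
    obtain r where r: "r > 0" "\<And>y. y \<in> cbx d x r \<Longrightarrow> \<bar>partial j f y - partial j f x\<bar> < e"
      unfolding x_def by (rule continuous_on_cbxE[OF V cf[OF j] \<gamma>(1) e]) blast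
    show "\<forall>\<^sub>F t in at t0. dist (partial j f (\<Xi> t j)) (partial j f x) < e"
      using near[OF r(1)] good
    proof eventually_elim
      case (elim t)
      then have "\<bar>\<Xi> t j i - x i\<bar> < r" if "i < d" for i
      proof -
        have "\<bar>\<Xi> t j i - x i\<bar> \<le> \<bar>\<gamma> t i - x i\<bar>" using elim(2) j by (simp add: good_def)
        also have "\<dots> < r" using elim(1) that by (simp add: cbx_def)
        finally show ?thesis .
      qed
      then have "\<Xi> t j \<in> cbx d x r" using j elim unfolding good_def cbx_def by auto
      then show ?case using r(2) by (simp add: dist_real_def)
    qed
  qed
  have "((\<lambda>t. \<Sum>j<d. (\<gamma> t j - x j) / (t - t0) * partial j f (\<Xi> t j)) \<longlongrightarrow> (\<Sum>j<d. g j * partial j f x)) (at t0)"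
  proof (rule tendsto_sum, rule tendsto_mult)
    fix j assume "j \<in> {..<d}"
    then have j: "j < d" by simp
    show "((\<lambda>t. (\<gamma> t j - x j) / (t - t0)) \<longlongrightarrow> g j) (at t0)"
      using g[OF j] unfolding has_field_derivative_iff x_def .
    show "((\<lambda>t. partial j f (\<Xi> t j)) \<longlongrightarrow> partial j f x) (at t0)" by (rule lim[OF j])
  qed
  then have "((\<lambda>t. (f (\<gamma> t) - f x) / (t - t0)) \<longlongrightarrow> (\<Sum>j<d. g j * partial j f x)) (at t0)"
  proof (rule Lim_transform_eventually)
    show "\<forall>\<^sub>F t in at t0. (\<Sum>j<d. (\<gamma> t j - x j) / (t - t0) * partial j f (\<Xi> t j)) = (f (\<gamma> t) - f x) / (t - t0)"
      using good by eventually_elim (simp add: good_def sum_divide_distrib)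
  qed
  then show ?thesis unfolding has_field_derivative_iff x_def .
qed

text \<open>By the chain rule the partial derivatives of the composition are sums of products of
  derivatives of \<open>G\<close> with functions \<open>partial j f\<close> composed with
  \<open>G\<close>, to which the induction hypothesis applies.\<close>

lemma Ck_on_compose:
  assumes V: "openin (Euclidean_space d) V" and V': "openin (Euclidean_space d') V'"
    and mem: "\<And>x. x \<in> V \<Longrightarrow> G x \<in> V'"
  shows "Ck_on k d' V' f \<Longrightarrow> (\<And>j. j < d' \<Longrightarrow> Ck_on k d V (\<lambda>x. G x j)) \<Longrightarrow> Ck_on k d V (\<lambda>x. f (G x))"
proof -
  \<comment> \<open>The values of \<open>G\<close> lie in \<open>V'\<close> and vanish from index
    \<open>d'\<close> on, so control of finitely many components suffices.\<close>
  have cG: "continuous_on V G" if "\<And>j. j < d' \<Longrightarrow> continuous_on V (\<lambda>x. G x j)"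
    proof (rule continuous_on_coordinatewise_then_product)
    fix j show "continuous_on V (\<lambda>x. G x j)"
    proof (cases "j < d'")
      case False
      then have "\<And>x. x \<in> V \<Longrightarrow> G x j = 0" using openin_Euclidean_supp[OF V' mem] by simp
      then show ?thesis using continuous_on_cong[of V V "\<lambda>x. G x j" "\<lambda>x. 0"] by simp
    qed (rule that)
  qed
  show "Ck_on k d' V' f \<Longrightarrow> (\<And>j. j < d' \<Longrightarrow> Ck_on k d V (\<lambda>x. G x j)) \<Longrightarrow> Ck_on k d V (\<lambda>x. f (G x))"
  proof (induction k arbitrary: f)
    case 0
    then show ?case
      unfolding Ck_on.simps by (intro continuous_on_compose2[of V' f V G] cG) (use mem in auto)
  next
    case (Suc k)
    show ?case
    proof (rule Ck_on_SucI[where D = "\<lambda>i x. \<Sum>j<d'. partial i (\<lambda>x. G x j) x * partial j f (G x)", OF V])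
      show "continuous_on V (\<lambda>x. f (G x))"
        by (rule continuous_on_compose2[of V' f V G])
          (use mem in \<open>auto intro!: cG Ck_on_imp_continuous[OF Suc.prems(1)] Ck_on_imp_continuous[OF Suc.prems(2)]\<close>)
    next
      fix i x assume i: "i < d" and x: "x \<in> V"
      have 1: "G (x(i := x i)) = G x" by simp
      have "((\<lambda>t. f (G (x(i := t)))) has_real_derivative
          (\<Sum>j<d'. partial i (\<lambda>x. G x j) x * partial j f (G (x(i := x i))))) (at (x i))"
      proof (rule chain_rule_partial[OF V'])
        show "\<forall>\<^sub>F t in at (x i). G (x(i := t)) \<in> V'"
          unfolding eventually_at_filter
          using eventually_upd_mem[OF V x i] by eventually_elim (simp add: mem)
        show "G (x(i := x i)) \<in> V'" unfolding fun_upd_triv by (rule mem[OF x])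
        show "((\<lambda>t. G (x(i := t)) j) has_real_derivative partial i (\<lambda>x. G x j) x) (at (x i))"
          if "j < d'" for j
          by (rule Ck_on_SucE(1)[OF Suc.prems(2)[OF that] i x])
        show "(\<lambda>t. f (z(j := t))) differentiable at (z j)" if "j < d'" "z \<in> V'" for j z
          using Suc.prems(1) that by simp
        show "continuous_on V' (partial j f)" if "j < d'" for j
          by (rule Ck_on_imp_continuous[OF Ck_on_SucE(2)[OF Suc.prems(1) that]])
      qed
      then show "((\<lambda>t. f (G (x(i := t)))) has_real_derivative
          (\<Sum>j<d'. partial i (\<lambda>x. G x j) x * partial j f (G x))) (at (x i))" unfolding fun_upd_triv .
    next
      fix i assume i: "i < d"
      show "Ck_on k d V (\<lambda>x. \<Sum>j<d'. partial i (\<lambda>x. G x j) x * partial j f (G x))"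
      proof (rule Ck_on_sum[OF V], rule Ck_on_mult[OF V])
        fix j assume "j \<in> {..<d'}"
        then have j: "j < d'" by simp
        show "Ck_on k d V (partial i (\<lambda>x. G x j))" by (rule Ck_on_SucE(2)[OF Suc.prems(2)[OF j] i])
        show "Ck_on k d V (\<lambda>x. partial j f (G x))"
          by (rule Suc.IH[OF Ck_on_SucE(2)[OF Suc.prems(1) j] Ck_on_SucD[OF Suc.prems(2)]])
      qed
    qed
  qed
qed

section \<open>Flat functions and bumps on cubes\<close>

definition flat :: "nat \<Rightarrow> real \<Rightarrow> real" where
  "flat m t = (if t > 0 then exp (- (1 / t)) / t ^ m else 0)"

text \<open>With s = 1/t this is the decay of s^m / exp s at infinity; to the left of 0 the function
  vanishes.\<close>

lemma flat_tendsto_0: "(flat m \<longlongrightarrow> 0) (at 0)"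
proof -
  have "((\<lambda>t. (inverse t) ^ m / exp (inverse t)) \<longlongrightarrow> (0::real)) (at_right 0)"
    by (rule filterlim_compose[OF tendsto_power_div_exp_0 filterlim_inverse_at_top_right])
  then have "(flat m \<longlongrightarrow> 0) (at_right 0)"
  proof (rule Lim_transform_eventually)
    show "\<forall>\<^sub>F t in at_right 0. inverse t ^ m / exp (inverse t) = flat m t"
      unfolding eventually_at_filter
      by (auto simp: flat_def exp_minus field_simps intro!: always_eventually)
  qed
  moreover have "(flat m \<longlongrightarrow> 0) (at_left 0)"
    by (rule tendsto_eventually) (auto simp: flat_def eventually_at_filter intro!: always_eventually)
  ultimately show ?thesis by (simp add: filterlim_split_at)
qed

text \<open>The derivatives of the family exp(-1/t)/t^m are combinations of its members; the
  exponent \<open>m\<close> is there to close the induction on the order of differentiability. At 0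
  the difference quotient of \<open>flat m\<close> is \<open>flat (Suc m)\<close>, which tends to
  0.\<close>

lemma DERIV_flat: "(flat m has_real_derivative flat (m + 2) t - m * flat (Suc m) t) (at t)"
proof -
  consider "t > 0" | "t < 0" | "t = 0" by linarith
  then show ?thesis
  proof cases
    case 1
    have "\<forall>\<^sub>F s in nhds t. flat m s = exp (- (1 / s)) / s ^ m"
      using eventually_nhds_in_open[of "{0<..}" t] 1 by (auto simp: flat_def elim: eventually_mono)
    moreover have "((\<lambda>s. exp (- (1 / s)) / s ^ m) has_real_derivative flat (m + 2) t - m * flat (Suc m) t) (at t)"
      by (rule derivative_eq_intros refl | use 1 in force)+
        (use 1 in \<open>cases m; simp add: flat_def field_simps power2_eq_square power_add\<close>)
    ultimately show ?thesis by (subst DERIV_cong_ev[OF refl _ refl]) auto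
  next
    case 2
    have "\<forall>\<^sub>F s in nhds t. flat m s = 0"
      using eventually_nhds_in_open[of "{..<0}" t] 2 by (auto simp: flat_def elim: eventually_mono)
    then show ?thesis using 2 by (subst DERIV_cong_ev[OF refl _ refl]) (auto simp: flat_def)
  next
    case 3
    have "((\<lambda>s. (flat m s - flat m 0) / (s - 0)) \<longlongrightarrow> 0) (at 0)"
    proof (rule Lim_transform_eventually[OF flat_tendsto_0[of "Suc m"]])
      show "\<forall>\<^sub>F s in at 0. flat (Suc m) s = (flat m s - flat m 0) / (s - 0)"
        by (auto simp: flat_def eventually_at_filter intro!: always_eventually)
    qed
    then show ?thesis by (simp add: 3 has_field_derivative_iff flat_def)
  qed
qed

lemma Ck_on_flat:
  assumes "openin (Euclidean_space d) V"
  shows "Ck_on k d V g \<Longrightarrow> Ck_on k d V (\<lambda>x. flat m (g x))"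
proof (induction k arbitrary: m)
  case 0
  have "continuous_on UNIV (flat m)" using DERIV_flat DERIV_isCont by (metis continuous_at_imp_continuous_on)
  then have "continuous_on V (\<lambda>x. flat m (g x))"
    using 0 by (intro continuous_on_compose2[of UNIV "flat m" V g]) auto
  then show ?case by simp
next
  case (Suc k)
  show ?case
  proof (rule Ck_on_SucI[where D = "\<lambda>i x. (flat (m + 2) (g x) + (- real m) * flat (Suc m) (g x)) * partial i g x", OF assms])
    have "continuous_on UNIV (flat m)" using DERIV_flat DERIV_isCont by (metis continuous_at_imp_continuous_on)
    then show "continuous_on V (\<lambda>x. flat m (g x))"
      using Ck_on_imp_continuous[OF Suc.prems] by (intro continuous_on_compose2[of UNIV "flat m" V g]) auto
  next
    fix i x assume i: "i < d" and x: "x \<in> V"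
    have "((\<lambda>t. flat m (g (x(i := t)))) has_real_derivative
       (flat (m + 2) (g (x(i := x i))) - m * flat (Suc m) (g (x(i := x i)))) * partial i g x) (at (x i))"
      by (rule DERIV_chain2[OF DERIV_flat Ck_on_SucE(1)[OF Suc.prems i x]])
    then show "((\<lambda>t. flat m (g (x(i := t)))) has_real_derivative
       (flat (m + 2) (g x) + (- real m) * flat (Suc m) (g x)) * partial i g x) (at (x i))"
      unfolding fun_upd_triv by (rule DERIV_cong) simp
  next
    fix i assume i: "i < d"
    show "Ck_on k d V (\<lambda>x. (flat (m + 2) (g x) + (- real m) * flat (Suc m) (g x)) * partial i g x)"
      by (intro Ck_on_mult Ck_on_add assms Suc.IH Ck_on_const Ck_on_SucD[OF Suc.prems] Ck_on_SucE(2)[OF Suc.prems i])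
  qed
qed

lemma Ck_on_prod:
  assumes "openin (Euclidean_space d) V" "\<And>j. j \<in> J \<Longrightarrow> Ck_on k d V (f j)"
  shows "Ck_on k d V (\<lambda>x. \<Prod>j\<in>J. f j x)"
  using assms(2) by (induction J rule: infinite_finite_induct) (auto intro: Ck_on_const Ck_on_mult assms(1))

lemma cbx_bump:
  assumes "r > 0" "\<forall>i\<ge>d. x i = 0"
  shows "\<exists>b. (\<forall>k. Ck_on k d (topspace (Euclidean_space d)) b) \<and> b x = 1 \<and>
    (\<forall>y. (\<exists>i<d. r \<le> \<bar>y i - x i\<bar>) \<longrightarrow> b y = 0)"
proof -
  have V: "openin (Euclidean_space d) (topspace (Euclidean_space d))" by simp
  \<comment> \<open>\<open>flat 0\<close> takes the value exp(-1/r^2) at r^2, so the factor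
    exp(1/r^2) normalises each one-dimensional bump to 1 at the centre. Its argument is no longer
    positive once y i is at distance r from x i.\<close>
  define b where "b = (\<lambda>y. \<Prod>i<d. exp (1 / r\<^sup>2) * flat 0 (r\<^sup>2 + (- 1) * ((y i + - x i) * (y i + - x i))))"
  have "Ck_on k d (topspace (Euclidean_space d)) b" for k
    unfolding b_def
    by (intro Ck_on_prod Ck_on_mult Ck_on_flat Ck_on_add Ck_on_const Ck_on_coord V)
  moreover have "b x = 1"
    using assms(1) by (simp add: b_def flat_def exp_minus)
  moreover have "b y = 0" if "i < d" "r \<le> \<bar>y i - x i\<bar>" for y i
  proof -
    have "r\<^sup>2 \<le> (y i - x i)\<^sup>2" using that(2) assms(1) by (metis abs_le_square_iff abs_of_pos)
    then have "flat 0 (r\<^sup>2 + (- 1) * ((y i + - x i) * (y i + - x i))) = 0"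
      by (simp add: flat_def power2_eq_square)
    then show ?thesis using that(1) unfolding b_def by (intro prod_zero) auto
  qed
  ultimately show ?thesis by blast
qed

section \<open>Hadamard's lemma by integration along coordinate segments\<close>

lemma cbx_segment:
  assumes "x \<in> cbx d x0 r" "t \<in> {0..1}" "i < d"
  shows "x(i := x0 i + t * (x i - x0 i)) \<in> cbx d x0 r"
proof -
  have "\<bar>x i - x0 i\<bar> < r" using assms by (auto simp: cbx_def)
  moreover have "\<bar>t * (x i - x0 i)\<bar> \<le> 1 * \<bar>x i - x0 i\<bar>"
    unfolding abs_mult using assms(2) by (intro mult_right_mono) auto
  ultimately show ?thesis using assms by (auto simp: cbx_def)
qed

lemma continuous_on_slice_integrand:
  fixes h :: "(nat \<Rightarrow> real) \<Rightarrow> real"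
  assumes h: "continuous_on (cbx d x0 r) h" and i: "i < d"
    and z: "continuous_on S (\<lambda>p. z p)" "\<And>p. p \<in> S \<Longrightarrow> z p \<in> cbx d x0 r"
    and t: "continuous_on S \<tau>" "\<And>p. p \<in> S \<Longrightarrow> \<tau> p \<in> {0..1}"
  shows "continuous_on S (\<lambda>p. \<tau> p ^ m * h ((z p)(i := x0 i + \<tau> p * (z p i - x0 i))))"
proof -
  have zi: "continuous_on S (\<lambda>p. z p j)" for j
    by (rule continuous_on_product_then_coordinatewise[OF z(1)])
  have "continuous_on S (\<lambda>p. (z p)(i := x0 i + \<tau> p * (z p i - x0 i)))"
  proof (rule continuous_on_coordinatewise_then_product)
    fix j show "continuous_on S (\<lambda>p. ((z p)(i := x0 i + \<tau> p * (z p i - x0 i))) j)"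
      by (cases "j = i") (auto intro!: continuous_intros zi t)
  qed
  then have "continuous_on S (\<lambda>p. h ((z p)(i := x0 i + \<tau> p * (z p i - x0 i))))"
    by (rule continuous_on_compose2[OF h]) (use cbx_segment[OF z(2) t(2) i] in blast)
  then show ?thesis by (intro continuous_intros t)
qed

text \<open>Differentiation under the integral sign. Differentiating in the direction
  \<open>i\<close> brings out a factor t while the other directions do not; the power
  \<open>t ^ m\<close> in the statement absorbs it, so that the induction on \<open>k\<close> goes
  through.\<close>

lemma Ck_on_slice_integral:
  assumes i: "i < d"
  shows "Ck_on k d (cbx d x0 r) h \<Longrightarrow>
    Ck_on k d (cbx d x0 r) (\<lambda>x. integral (cbox 0 1) (\<lambda>t. t ^ m * h (x(i := x0 i + t * (x i - x0 i)))))"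
proof (induction k arbitrary: h m)
  case 0
  then have h: "continuous_on (cbx d x0 r) h" by simp
  have "continuous_on (cbx d x0 r \<times> cbox 0 1) (\<lambda>(x, t). t ^ m * h (x(i := x0 i + t * (x i - x0 i))))"
    unfolding case_prod_unfold
    by (rule continuous_on_slice_integrand[OF h i continuous_on_fst[OF continuous_on_id] _
            continuous_on_snd[OF continuous_on_id]]) auto
  then show ?case unfolding Ck_on.simps by (rule integral_continuous_on_param)
next
  case (Suc k)
  let ?B = "cbx d x0 r"
  have h: "continuous_on ?B h" by (rule Ck_on_imp_continuous[OF Suc.prems])
  have Dh: "continuous_on ?B (partial j h)" if "j < d" for j
    by (rule Ck_on_imp_continuous[OF Ck_on_SucE(2)[OF Suc.prems that]])
  define M where "M = (\<lambda>j. if j = i then Suc m else m)"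
  show ?case
  proof (rule Ck_on_SucI[where D = "\<lambda>j x. integral (cbox 0 1) (\<lambda>t. t ^ M j * partial j h (x(i := x0 i + t * (x i - x0 i))))", OF openin_cbx])
    have "continuous_on (?B \<times> cbox 0 1) (\<lambda>(x, t). t ^ m * h (x(i := x0 i + t * (x i - x0 i))))"
      unfolding case_prod_unfold
      by (rule continuous_on_slice_integrand[OF h i continuous_on_fst[OF continuous_on_id] _
            continuous_on_snd[OF continuous_on_id]]) auto
    then show "continuous_on ?B (\<lambda>x. integral (cbox 0 1) (\<lambda>t. t ^ m * h (x(i := x0 i + t * (x i - x0 i)))))"
      by (rule integral_continuous_on_param)
  next
    fix j assume j: "j < d"
    show "Ck_on k d ?B (\<lambda>x. integral (cbox 0 1) (\<lambda>t. t ^ M j * partial j h (x(i := x0 i + t * (x i - x0 i)))))"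
      by (rule Suc.IH[OF Ck_on_SucE(2)[OF Suc.prems j]])
  next
    fix j x assume j: "j < d" and x: "x \<in> ?B"
    define U where "U = {x0 j - r<..<x0 j + r}"
    have xU: "x j \<in> U" using x j by (auto simp: U_def cbx_def abs_less_iff)
    have mem: "x(j := s) \<in> ?B" if "s \<in> U" for s
      using x that j by (auto simp: U_def cbx_def abs_less_iff)
    define F where "F = (\<lambda>s t. t ^ m * h ((x(j := s))(i := x0 i + t * ((x(j := s)) i - x0 i))))"
    define F' where "F' = (\<lambda>s t. t ^ M j * partial j h ((x(j := s))(i := x0 i + t * ((x(j := s)) i - x0 i))))"
    have "((\<lambda>s. integral (cbox 0 1) (F s)) has_real_derivative integral (cbox 0 1) (F' (x j))) (at (x j) within U)"
    proof (rule leibniz_rule_field_derivative)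
      fix s and t :: real assume s: "s \<in> U" and t: "t \<in> cbox 0 1"
      let ?y = "(x(j := s))(i := x0 i + t * ((x(j := s)) i - x0 i))"
      have y: "?y \<in> ?B" by (rule cbx_segment[OF mem[OF s] _ i]) (use t in auto)
      have "((\<lambda>s. t ^ m * h ((x(j := s))(i := x0 i + t * ((x(j := s)) i - x0 i)))) has_real_derivative
          t ^ M j * partial j h ?y) (at s)"
      proof (cases "j = i")
        case True
        have "((\<lambda>u. h (?y(i := u))) has_real_derivative partial i h ?y) (at (?y i))"
          using Ck_on_SucE(1)[OF Suc.prems i y] .
        then have 1: "((\<lambda>u. h (?y(i := u))) has_real_derivative partial i h ?y) (at (x0 i + t * (s - x0 i)))"
          using True by simp
        have 2: "((\<lambda>s. x0 i + t * (s - x0 i)) has_real_derivative t) (at s)"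
          by (auto intro!: derivative_eq_intros)
        have "((\<lambda>s. h (?y(i := x0 i + t * (s - x0 i)))) has_real_derivative partial i h ?y * t) (at s)"
          by (rule DERIV_chain2[OF 1 2])
        from DERIV_cmult[OF this, of "t ^ m"] show ?thesis
          using True by (simp add: M_def ac_simps)
      next
        case False
        have "((\<lambda>u. h (?y(j := u))) has_real_derivative partial j h ?y) (at (?y j))"
          using Ck_on_SucE(1)[OF Suc.prems j y] .
        moreover have "?y j = s" "\<And>u. ?y(j := u) = (x(j := u))(i := x0 i + t * ((x(j := u)) i - x0 i))"
          using False by (auto simp: fun_eq_iff)
        ultimately have "((\<lambda>u. h ((x(j := u))(i := x0 i + t * ((x(j := u)) i - x0 i)))) has_real_derivative partial j h ?y) (at s)"
          by (simp only:)
        from DERIV_cmult[OF this, of "t ^ m"] show ?thesis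
          using False by (simp only: M_def if_False)
      qed
      then show "((\<lambda>s. F s t) has_real_derivative F' s t) (at s within U)"
        unfolding F_def F'_def by (rule has_field_derivative_at_within)
    next
      fix s assume s: "s \<in> U"
      have "continuous_on (cbox 0 1) (F s)" unfolding F_def
        by (rule continuous_on_slice_integrand[OF h i]) (use mem[OF s] in \<open>auto intro!: continuous_intros\<close>)
      then show "F s integrable_on cbox 0 1" by (rule integrable_continuous)
    next
      have "continuous_on (U \<times> cbox 0 1) (\<lambda>p. snd p ^ M j * partial j h ((x(j := fst p))(i := x0 i + snd p * ((x(j := fst p)) i - x0 i))))"
      proof (rule continuous_on_slice_integrand[OF Dh[OF j] i])
        show "continuous_on (U \<times> cbox 0 1) (\<lambda>p. x(j := fst p))"
        proof (rule continuous_on_coordinatewise_then_product)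
          fix l show "continuous_on (U \<times> cbox 0 1) (\<lambda>p. (x(j := fst p)) l)"
            by (cases "l = j") (auto intro!: continuous_intros)
        qed
      qed (use mem in \<open>auto intro!: continuous_intros\<close>)
      then show "continuous_on (U \<times> cbox 0 1) (\<lambda>(s, t). F' s t)"
        unfolding F'_def case_prod_unfold .
    qed (use xU in \<open>auto simp: U_def\<close>)
    moreover have "at (x j) within U = at (x j)"
      by (rule at_within_open[OF xU]) (simp add: U_def)
    ultimately show "((\<lambda>s. integral (cbox 0 1) (\<lambda>t. t ^ m * h ((x(j := s))(i := x0 i + t * ((x(j := s)) i - x0 i)))))
        has_real_derivative integral (cbox 0 1) (\<lambda>t. t ^ M j * partial j h (x(i := x0 i + t * (x i - x0 i))))) (at (x j))"
      unfolding F_def F'_def fun_upd_triv by simp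
  qed
qed

lemma slice_integral_eq:
  assumes i: "i < d" and f: "Ck_on (Suc 0) d (cbx d x0 r) f" and x: "x \<in> cbx d x0 r"
  shows "f x - f (x(i := x0 i)) =
    (x i - x0 i) * integral (cbox 0 1) (\<lambda>t. partial i f (x(i := x0 i + t * (x i - x0 i))))"
proof -
  let ?y = "\<lambda>t. x(i := x0 i + t * (x i - x0 i))"
  have D: "((\<lambda>t. f (?y t)) has_vector_derivative (x i - x0 i) * partial i f (?y t)) (at t within {0..1})"
    if t: "t \<in> {0..1}" for t
  proof -
    have y: "?y t \<in> cbx d x0 r" by (rule cbx_segment[OF x t i])
    have "((\<lambda>u. f ((?y t)(i := u))) has_real_derivative partial i f (?y t)) (at (?y t i))"
      by (rule Ck_on_SucE(1)[OF f i y])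
    then have 1: "((\<lambda>u. f (x(i := u))) has_real_derivative partial i f (?y t)) (at (x0 i + t * (x i - x0 i)))"
      by (simp only: fun_upd_upd fun_upd_same)
    have 2: "((\<lambda>t. x0 i + t * (x i - x0 i)) has_real_derivative (x i - x0 i)) (at t)"
      by (auto intro!: derivative_eq_intros)
    have "((\<lambda>t. f (?y t)) has_real_derivative partial i f (?y t) * (x i - x0 i)) (at t)"
      by (rule DERIV_chain2[OF 1 2])
    then have "((\<lambda>t. f (?y t)) has_real_derivative (x i - x0 i) * partial i f (?y t)) (at t within {0..1})"
      by (metis has_field_derivative_at_within mult.commute)
    then show ?thesis by (simp only: has_real_derivative_iff_has_vector_derivative)
  qed
  have "((\<lambda>t. (x i - x0 i) * partial i f (?y t)) has_integral (f (?y 1) - f (?y 0))) {0..1}"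
    by (rule fundamental_theorem_of_calculus[OF _ D]) auto
  then have "integral {0..1} (\<lambda>t. (x i - x0 i) * partial i f (?y t)) = f (?y 1) - f (?y 0)"
    by (rule integral_unique)
  moreover have "?y 1 = x" "?y 0 = x(i := x0 i)" by auto
  ultimately show ?thesis by simp
qed

text \<open>Passing from \<open>x0\<close> to \<open>x\<close> one coordinate at a time, the
  fundamental theorem of calculus makes each increment a multiple of \<open>x i - x0 i\<close> with
  a smooth quotient. Combined with the Leibniz rule, such a factorisation turns a derivation at a
  point into a combination of partial derivatives.\<close>

lemma hadamard:
  assumes f: "smooth_on d (cbx d x0 r) f" and r: "r > 0" and x0: "\<forall>i\<ge>d. x0 i = 0"
  obtains g where "\<And>i. i < d \<Longrightarrow> smooth_on d (cbx d x0 r) (g i)"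
    "\<And>x. x \<in> cbx d x0 r \<Longrightarrow> f x = f x0 + (\<Sum>i<d. (x i - x0 i) * g i x)"
    "\<And>i. i < d \<Longrightarrow> g i x0 = partial i f x0"
proof -
  define z where "z = (\<lambda>m x i. if i < m then x i else x0 i)"
  define G where "G = (\<lambda>i x. integral (cbox 0 1) (\<lambda>t. t ^ 0 * partial i f (x(i := x0 i + t * (x i - x0 i)))))"
  have zmem: "z m x \<in> cbx d x0 r" if "x \<in> cbx d x0 r" for m x
    using that r x0 by (auto simp: z_def cbx_def)
  have "smooth_on d (cbx d x0 r) (\<lambda>x. G i (z (Suc i) x))" if i: "i < d" for i
    unfolding smooth_on_def
  proof
    fix k
    have "Ck_on k d (cbx d x0 r) (partial i f)"
      using f i Ck_on_SucE(2) unfolding smooth_on_def by blast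
    then have "Ck_on k d (cbx d x0 r) (G i)"
      unfolding G_def by (rule Ck_on_slice_integral[OF i])
    moreover have "Ck_on k d (cbx d x0 r) (\<lambda>x. z (Suc i) x j)" for j
      by (cases "j < Suc i") (auto simp: z_def intro: Ck_on_coord Ck_on_const openin_cbx)
    ultimately show "Ck_on k d (cbx d x0 r) (\<lambda>x. G i (z (Suc i) x))"
      using Ck_on_compose[where G = "z (Suc i)" and f = "G i", OF openin_cbx openin_cbx zmem] by blast
  qed
  moreover have "f x = f x0 + (\<Sum>i<d. (x i - x0 i) * G i (z (Suc i) x))" if x: "x \<in> cbx d x0 r" for x
  proof -
    have "f (z (Suc i) x) - f (z i x) = (x i - x0 i) * G i (z (Suc i) x)" if i: "i < d" for i
    proof -
      have "Ck_on (Suc 0) d (cbx d x0 r) f" using f unfolding smooth_on_def by blast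
      from slice_integral_eq[OF i this zmem[OF x, of "Suc i"]]
      have "f (z (Suc i) x) - f ((z (Suc i) x)(i := x0 i)) = (z (Suc i) x i - x0 i) * G i (z (Suc i) x)"
        unfolding G_def by simp
      moreover have "(z (Suc i) x)(i := x0 i) = z i x" "z (Suc i) x i = x i"
        by (auto simp: z_def less_Suc_eq)
      ultimately show ?thesis by simp
    qed
    then have "(\<Sum>i<d. (x i - x0 i) * G i (z (Suc i) x)) = (\<Sum>i<d. f (z (Suc i) x) - f (z i x))" by simp
    also have "\<dots> = f (z d x) - f (z 0 x)" by (rule sum_lessThan_telescope)
    also have "z d x = x" using x x0 by (auto simp: z_def cbx_def)
    also have "z 0 x = x0" by (auto simp: z_def)
    finally show ?thesis by simp
  qed
  moreover have "G i (z (Suc i) x0) = partial i f x0" if "i < d" for i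
  proof -
    have "z (Suc i) x0 = x0" by (auto simp: z_def)
    then show ?thesis unfolding G_def by simp
  qed
  ultimately show ?thesis using that[of "\<lambda>i x. G i (z (Suc i) x)"] by blast
qed

section \<open>Smooth functions and maps on manifolds\<close>

lemma smooth_on_const: "openin (Euclidean_space d) V \<Longrightarrow> smooth_on d V (\<lambda>x. c)"
  by (simp add: smooth_on_def Ck_on_const)

lemma smooth_on_coord: "openin (Euclidean_space d) V \<Longrightarrow> smooth_on d V (\<lambda>x. x j)"
  by (simp add: smooth_on_def Ck_on_coord)

lemma smooth_on_add:
  "openin (Euclidean_space d) V \<Longrightarrow> smooth_on d V f \<Longrightarrow> smooth_on d V g \<Longrightarrow> smooth_on d V (\<lambda>x. f x + g x)"
  by (simp add: smooth_on_def Ck_on_add)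

lemma smooth_on_mult:
  "openin (Euclidean_space d) V \<Longrightarrow> smooth_on d V f \<Longrightarrow> smooth_on d V g \<Longrightarrow> smooth_on d V (\<lambda>x. f x * g x)"
  by (simp add: smooth_on_def Ck_on_mult)

lemma smooth_on_sum:
  "openin (Euclidean_space d) V \<Longrightarrow> (\<And>j. j \<in> J \<Longrightarrow> smooth_on d V (f j)) \<Longrightarrow> smooth_on d V (\<lambda>x. \<Sum>j\<in>J. f j x)"
  unfolding smooth_on_def by (intro allI Ck_on_sum) auto

lemma smooth_on_inverse:
  "openin (Euclidean_space d) V \<Longrightarrow> smooth_on d V f \<Longrightarrow> (\<And>x. x \<in> V \<Longrightarrow> f x \<noteq> 0) \<Longrightarrow>
     smooth_on d V (\<lambda>x. inverse (f x))"
  unfolding smooth_on_def by (intro allI Ck_on_inverse) auto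

lemma smooth_on_subset: "smooth_on d V f \<Longrightarrow> W \<subseteq> V \<Longrightarrow> smooth_on d W f"
  unfolding smooth_on_def using Ck_on_subset by blast

lemma smooth_on_cong:
  assumes "openin (Euclidean_space d) V" "smooth_on d V f" "\<And>y. y \<in> V \<Longrightarrow> f y = g y"
  shows "smooth_on d V g"
  using Ck_on_cong[of d V f g] assms unfolding smooth_on_def by blast

lemma smooth_on_local:
  assumes "openin (Euclidean_space d) V"
    "\<And>x. x \<in> V \<Longrightarrow> \<exists>W. openin (Euclidean_space d) W \<and> x \<in> W \<and> smooth_on d W f"
  shows "smooth_on d V f"
  unfolding smooth_on_def
proof
  fix k show "Ck_on k d V f"
    by (rule Ck_on_local[OF assms(1)]) (use assms(2) in \<open>auto simp: smooth_on_def\<close>)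
qed

lemma smooth_on_compose:
  assumes "openin (Euclidean_space d) V" "openin (Euclidean_space d') V'"
    "\<And>x. x \<in> V \<Longrightarrow> G x \<in> V'" "smooth_on d' V' f" "\<And>j. j < d' \<Longrightarrow> smooth_on d V (\<lambda>x. G x j)"
  shows "smooth_on d V (\<lambda>x. f (G x))"
  unfolding smooth_on_def
proof
  fix k show "Ck_on k d V (\<lambda>x. f (G x))"
    using Ck_on_compose[where G = G and f = f, OF assms(1-3), of k] assms(4,5)
    unfolding smooth_on_def by blast
qed

lemma smooth_on_partial: "smooth_on d V f \<Longrightarrow> i < d \<Longrightarrow> smooth_on d V (partial i f)"
  unfolding smooth_on_def using Ck_on_SucE(2) by blast

lemma smooth_on_DERIV:
  assumes "smooth_on d V f" "i < d" "x \<in> V"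
  shows "((\<lambda>t. f (x(i := t))) has_real_derivative partial i f x) (at (x i))"
  using assms Ck_on_SucE(1) unfolding smooth_on_def by blast

text \<open>The local counterpart of \<open>smooth_functions\<close>: it makes sense for functions
  such as chart coordinates, whose values off \<open>W\<close> mean nothing.\<close>

definition sm_fun :: "'a manifold \<Rightarrow> 'a set \<Rightarrow> ('a \<Rightarrow> real) \<Rightarrow> bool" where
  "sm_fun M W f \<longleftrightarrow> (\<forall>(U, c)\<in>atlas M. smooth_on (mdim M) (c ` (U \<inter> W)) (\<lambda>x. f (inv_into U c x)))"

lemma sm_funD: "sm_fun M W f \<Longrightarrow> (U, c) \<in> atlas M \<Longrightarrow> smooth_on (mdim M) (c ` (U \<inter> W)) (\<lambda>x. f (inv_into U c x))"
  by (auto simp: sm_fun_def)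

lemma sm_funI: "(\<And>U c. (U, c) \<in> atlas M \<Longrightarrow> smooth_on (mdim M) (c ` (U \<inter> W)) (\<lambda>x. f (inv_into U c x))) \<Longrightarrow> sm_fun M W f"
  by (auto simp: sm_fun_def)

context
  fixes M :: "'a manifold"
  assumes M: "smooth_manifold M"
begin

lemma chart_homeo:
  assumes "(U, c) \<in> atlas M"
  shows "homeomorphic_map (subtopology (mtop M) U) (subtopology (Euclidean_space (mdim M)) (c ` U)) c"
    "openin (mtop M) U" "openin (Euclidean_space (mdim M)) (c ` U)"
  using M assms unfolding smooth_manifold_def by auto

lemma chart_sub: "(U, c) \<in> atlas M \<Longrightarrow> U \<subseteq> points M"
  using chart_homeo(2) openin_subset by metis

lemma chart_inj: assumes "(U, c) \<in> atlas M" shows "inj_on c U"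
  using homeomorphic_imp_injective_map[OF chart_homeo(1)[OF assms]] chart_sub[OF assms]
  by (simp add: inf.absorb2)

lemma chart_inv [simp]: "(U, c) \<in> atlas M \<Longrightarrow> x \<in> U \<Longrightarrow> inv_into U c (c x) = x"
  using chart_inj inv_into_f_f by metis

lemma chart_exists: "p \<in> points M \<Longrightarrow> \<exists>U c. (U, c) \<in> atlas M \<and> p \<in> U"
  using M unfolding smooth_manifold_def by blast

lemma chart_transition:
  assumes "(U, c) \<in> atlas M" "(U', c') \<in> atlas M" "i < mdim M"
  shows "smooth_on (mdim M) (c ` (U \<inter> U')) (\<lambda>x. c' (inv_into U c x) i)"
  using M assms unfolding smooth_manifold_def by blast

lemma chart_supp: "(U, c) \<in> atlas M \<Longrightarrow> x \<in> U \<Longrightarrow> i \<ge> mdim M \<Longrightarrow> c x i = 0"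
  using openin_Euclidean_supp[OF chart_homeo(3)] by blast

lemma chart_image_open:
  assumes "(U, c) \<in> atlas M" "openin (mtop M) W"
  shows "openin (Euclidean_space (mdim M)) (c ` (U \<inter> W))"
proof -
  have "openin (subtopology (mtop M) U) (U \<inter> W)"
    using assms(2) by (simp add: openin_subtopology_Int2)
  then have "openin (subtopology (Euclidean_space (mdim M)) (c ` U)) (c ` (U \<inter> W))"
    using homeomorphic_imp_open_map[OF chart_homeo(1)[OF assms(1)]] unfolding open_map_def by blast
  then show ?thesis using chart_homeo(3)[OF assms(1)] openin_open_subtopology by metis
qed

lemma chart_preimage_open:
  assumes "(U, c) \<in> atlas M" "openin (Euclidean_space (mdim M)) V"
  shows "openin (mtop M) {q \<in> U. c q \<in> V}"
proof -
  have cm: "continuous_map (subtopology (mtop M) U) (Euclidean_space (mdim M)) c"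
    using homeomorphic_imp_continuous_map[OF chart_homeo(1)[OF assms(1)]]
    by (simp add: continuous_map_in_subtopology)
  have "openin (subtopology (mtop M) U) {q \<in> topspace (subtopology (mtop M) U). c q \<in> V}"
    by (rule openin_continuous_map_preimage[OF cm assms(2)])
  moreover have "topspace (subtopology (mtop M) U) = U"
    using chart_sub[OF assms(1)] by (simp add: inf.absorb2)
  ultimately have "openin (subtopology (mtop M) U) {q \<in> U. c q \<in> V}" by (simp only:)
  then show ?thesis using openin_open_subtopology[OF chart_homeo(2)[OF assms(1)]] by blast
qed

lemma sm_fun_add:
  "openin (mtop M) W \<Longrightarrow> sm_fun M W f \<Longrightarrow> sm_fun M W g \<Longrightarrow> sm_fun M W (\<lambda>x. f x + g x)"
  by (rule sm_funI, rule smooth_on_add[OF chart_image_open]) (assumption | rule sm_funD[of M W f] sm_funD[of M W g])+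

lemma sm_fun_mult:
  "openin (mtop M) W \<Longrightarrow> sm_fun M W f \<Longrightarrow> sm_fun M W g \<Longrightarrow> sm_fun M W (\<lambda>x. f x * g x)"
  by (rule sm_funI, rule smooth_on_mult[OF chart_image_open]) (assumption | rule sm_funD[of M W f] sm_funD[of M W g])+

lemma sm_fun_const: "openin (mtop M) W \<Longrightarrow> sm_fun M W (\<lambda>x. a)"
  by (rule sm_funI, rule smooth_on_const[OF chart_image_open])

lemma sm_fun_sum:
  assumes "openin (mtop M) W" "\<And>j. j \<in> J \<Longrightarrow> sm_fun M W (f j)"
  shows "sm_fun M W (\<lambda>x. \<Sum>j\<in>J. f j x)"
  using assms(2) by (induction J rule: infinite_finite_induct) (auto intro: sm_fun_const sm_fun_add assms(1))

lemma sm_fun_inverse: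
  assumes "openin (mtop M) W" "sm_fun M W f" "\<And>x. x \<in> W \<Longrightarrow> f x \<noteq> 0"
  shows "sm_fun M W (\<lambda>x. inverse (f x))"
proof (rule sm_funI)
  fix U c assume Uc: "(U, c) \<in> atlas M"
  show "smooth_on (mdim M) (c ` (U \<inter> W)) (\<lambda>x. inverse (f (inv_into U c x)))"
    by (rule smooth_on_inverse[OF chart_image_open[OF Uc assms(1)] sm_funD[OF assms(2) Uc]])
      (use assms(3) Uc in auto)
qed

lemma sm_fun_cong:
  assumes "openin (mtop M) W" "sm_fun M W f" "\<And>x. x \<in> W \<Longrightarrow> f x = g x"
  shows "sm_fun M W g"
proof (rule sm_funI)
  fix U c assume Uc: "(U, c) \<in> atlas M"
  show "smooth_on (mdim M) (c ` (U \<inter> W)) (\<lambda>x. g (inv_into U c x))"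
    by (rule smooth_on_cong[OF chart_image_open[OF Uc assms(1)] sm_funD[OF assms(2) Uc]])
      (use assms(3) Uc in auto)
qed

lemma sm_fun_subset: "sm_fun M W f \<Longrightarrow> W' \<subseteq> W \<Longrightarrow> sm_fun M W' f"
  by (rule sm_funI, rule smooth_on_subset[OF sm_funD[of M W f]]) auto

lemma sm_fun_coord: "(U, c) \<in> atlas M \<Longrightarrow> i < mdim M \<Longrightarrow> sm_fun M U (\<lambda>q. c q i)"
  by (rule sm_funI, rule chart_transition)

lemma sm_fun_local:
  assumes "openin (mtop M) W" "\<And>p. p \<in> W \<Longrightarrow> \<exists>W'. openin (mtop M) W' \<and> p \<in> W' \<and> sm_fun M W' f"
  shows "sm_fun M W f"
proof (rule sm_funI)
  fix U c assume Uc: "(U, c) \<in> atlas M"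
  show "smooth_on (mdim M) (c ` (U \<inter> W)) (\<lambda>x. f (inv_into U c x))"
  proof (rule smooth_on_local[OF chart_image_open[OF Uc assms(1)]])
    fix x assume "x \<in> c ` (U \<inter> W)"
    then obtain p where p: "p \<in> U" "p \<in> W" "x = c p" by auto
    obtain W' where W': "openin (mtop M) W'" "p \<in> W'" "sm_fun M W' f" using assms(2) p by blast
    show "\<exists>W. openin (Euclidean_space (mdim M)) W \<and> x \<in> W \<and> smooth_on (mdim M) W (\<lambda>x. f (inv_into U c x))"
      using chart_image_open[OF Uc W'(1)] sm_funD[OF W'(3) Uc] p W' by blast
  qed
qed

text \<open>One chart containing \<open>W\<close> is enough: in any other chart the expression
  differs by a smooth transition map.\<close>

lemma sm_fun_chartI:
  assumes Uc: "(U, c) \<in> atlas M" and W: "openin (mtop M) W" "W \<subseteq> U"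
    and f: "smooth_on (mdim M) (c ` W) (\<lambda>x. f (inv_into U c x))"
  shows "sm_fun M W f"
proof (rule sm_funI)
  fix U1 c1 assume U1: "(U1, c1) \<in> atlas M"
  have 1: "openin (Euclidean_space (mdim M)) (c1 ` (U1 \<inter> W))" by (rule chart_image_open[OF U1 W(1)])
  have 2: "openin (Euclidean_space (mdim M)) (c ` W)"
    using chart_image_open[OF Uc W(1)] W(2) by (simp add: inf.absorb2)
  have "smooth_on (mdim M) (c1 ` (U1 \<inter> W)) (\<lambda>x. f (inv_into U c (c (inv_into U1 c1 x))))"
  proof (rule smooth_on_compose[where G = "\<lambda>x. c (inv_into U1 c1 x)" and f = "\<lambda>x. f (inv_into U c x)", OF 1 2 _ f])
    show "c (inv_into U1 c1 x) \<in> c ` W" if "x \<in> c1 ` (U1 \<inter> W)" for x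
      using that U1 by auto
    show "smooth_on (mdim M) (c1 ` (U1 \<inter> W)) (\<lambda>x. c (inv_into U1 c1 x) j)" if "j < mdim M" for j
      by (rule smooth_on_subset[OF chart_transition[OF U1 Uc that]]) (use W(2) in auto)
  qed
  then show "smooth_on (mdim M) (c1 ` (U1 \<inter> W)) (\<lambda>x. f (inv_into U1 c1 x))"
    by (rule smooth_on_cong[OF 1]) (use U1 Uc W(2) in auto)
qed

lemma mem_smooth_functions:
  "f \<in> smooth_functions M \<longleftrightarrow> (\<forall>x. x \<notin> points M \<longrightarrow> f x = 0) \<and> sm_fun M (points M) f"
proof -
  have "U \<inter> points M = U" if "(U, c) \<in> atlas M" for U c using chart_sub[OF that] by blast
  then show ?thesis unfolding smooth_functions_def sm_fun_def by fastforce
qed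

lemma smooth_functions_sm_fun: "f \<in> smooth_functions M \<Longrightarrow> W \<subseteq> points M \<Longrightarrow> sm_fun M W f"
  using mem_smooth_functions sm_fun_subset by blast

lemma smooth_functions_0: "f \<in> smooth_functions M \<Longrightarrow> x \<notin> points M \<Longrightarrow> f x = 0"
  using mem_smooth_functions by blast

lemma smooth_functions_add:
  "f \<in> smooth_functions M \<Longrightarrow> g \<in> smooth_functions M \<Longrightarrow> (\<lambda>x. f x + g x) \<in> smooth_functions M"
  unfolding mem_smooth_functions by (auto intro: sm_fun_add)

lemma smooth_functions_mult:
  "f \<in> smooth_functions M \<Longrightarrow> g \<in> smooth_functions M \<Longrightarrow> (\<lambda>x. f x * g x) \<in> smooth_functions M"
  unfolding mem_smooth_functions by (auto intro: sm_fun_mult)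

lemma smooth_functions_scale: "f \<in> smooth_functions M \<Longrightarrow> (\<lambda>x. a * f x) \<in> smooth_functions M"
  using sm_fun_mult[OF openin_topspace sm_fun_const[OF openin_topspace, of a], of f]
  unfolding mem_smooth_functions by simp

lemma smooth_functions_const: "(\<lambda>x. if x \<in> points M then a else 0) \<in> smooth_functions M"
  unfolding mem_smooth_functions by (auto intro: sm_fun_cong[OF _ sm_fun_const[of _ a]])

lemma smooth_functions_zero: "(\<lambda>x. 0) \<in> smooth_functions M"
  using smooth_functions_const[of 0] by simp

lemma smooth_functions_sum:
  assumes "\<And>j. j \<in> J \<Longrightarrow> f j \<in> smooth_functions M"
  shows "(\<lambda>x. \<Sum>j\<in>J. f j x) \<in> smooth_functions M"
  using assms by (induction J rule: infinite_finite_induct) (auto intro: smooth_functions_zero smooth_functions_add)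

end

section \<open>Smooth maps between manifolds\<close>

lemma smooth_map_iff:
  assumes "smooth_manifold M"
  shows "smooth_map M M' F \<longleftrightarrow> continuous_map (mtop M) (mtop M') F \<and>
     (\<forall>(U', c')\<in>atlas M'. \<forall>i<mdim M'. sm_fun M {x \<in> points M. F x \<in> U'} (\<lambda>x. c' (F x) i))"
proof -
  have "U \<inter> {x \<in> points M. F x \<in> U'} = {x \<in> U. F x \<in> U'}" if "(U, c) \<in> atlas M" for U c U'
    using chart_sub[OF assms that] by blast
  then show ?thesis unfolding smooth_map_def sm_fun_def by fastforce
qed

lemma smooth_mapI:
  assumes "smooth_manifold M" "continuous_map (mtop M) (mtop M') F"
    "\<And>U c i. (U, c) \<in> atlas M' \<Longrightarrow> i < mdim M' \<Longrightarrow> sm_fun M {x \<in> points M. F x \<in> U} (\<lambda>x. c (F x) i)"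
  shows "smooth_map M M' F"
  unfolding smooth_map_iff[OF assms(1)] using assms(2,3) by blast

lemma smooth_mapD:
  assumes "smooth_manifold M" "smooth_map M M' F" "(U, c) \<in> atlas M'" "i < mdim M'"
  shows "sm_fun M {x \<in> points M. F x \<in> U} (\<lambda>x. c (F x) i)"
  using assms(2-4) unfolding smooth_map_iff[OF assms(1)] by blast

lemma smooth_map_continuous: "smooth_map M M' F \<Longrightarrow> continuous_map (mtop M) (mtop M') F"
  by (simp add: smooth_map_def)

lemma smooth_map_points: "smooth_map M M' F \<Longrightarrow> x \<in> points M \<Longrightarrow> F x \<in> points M'"
  using smooth_map_continuous continuous_map_funspace by (metis PiE)

lemma smooth_map_preimage_open:
  "smooth_map M M' F \<Longrightarrow> openin (mtop M') W \<Longrightarrow> openin (mtop M) {x \<in> points M. F x \<in> W}"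
  using smooth_map_continuous openin_continuous_map_preimage by blast

text \<open>Near each point \<open>F\<close> is read in a chart around its image, where the claim
  becomes the composition of two coordinate expressions.\<close>

lemma sm_fun_compose:
  assumes M: "smooth_manifold M" and M': "smooth_manifold M'" and F: "smooth_map M M' F"
    and W: "openin (mtop M') W" and f: "sm_fun M' W f"
  shows "sm_fun M {x \<in> points M. F x \<in> W} (\<lambda>x. f (F x))"
proof (rule sm_fun_local[OF M smooth_map_preimage_open[OF F W]])
  fix p assume "p \<in> {x \<in> points M. F x \<in> W}"
  then have p: "p \<in> points M" "F p \<in> W" by auto
  then obtain U' c' where U': "(U', c') \<in> atlas M'" "F p \<in> U'"
    using chart_exists[OF M'] smooth_map_points[OF F] by blast
  let ?W = "{x \<in> points M. F x \<in> U' \<inter> W}"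
  have oW: "openin (mtop M') (U' \<inter> W)" using chart_homeo(2)[OF M' U'(1)] W by blast
  have "sm_fun M ?W (\<lambda>x. f (F x))"
  proof (rule sm_funI)
    fix U c assume Uc: "(U, c) \<in> atlas M"
    have 1: "openin (Euclidean_space (mdim M)) (c ` (U \<inter> ?W))"
      by (rule chart_image_open[OF M Uc smooth_map_preimage_open[OF F oW]])
    have 2: "openin (Euclidean_space (mdim M')) (c' ` (U' \<inter> W))"
      by (rule chart_image_open[OF M' U'(1) W])
    have "smooth_on (mdim M) (c ` (U \<inter> ?W)) (\<lambda>x. f (inv_into U' c' (c' (F (inv_into U c x)))))"
    proof (rule smooth_on_compose[where G = "\<lambda>x. c' (F (inv_into U c x))" and f = "\<lambda>y. f (inv_into U' c' y)",
          OF 1 2 _ sm_funD[OF f U'(1)]])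
      show "c' (F (inv_into U c x)) \<in> c' ` (U' \<inter> W)" if "x \<in> c ` (U \<inter> ?W)" for x
        using that chart_inv[OF M Uc] by auto
      show "smooth_on (mdim M) (c ` (U \<inter> ?W)) (\<lambda>x. c' (F (inv_into U c x)) j)" if "j < mdim M'" for j
      proof -
        have "sm_fun M {x \<in> points M. F x \<in> U'} (\<lambda>x. c' (F x) j)"
          by (rule smooth_mapD[OF M F U'(1) that])
        from sm_funD[OF this Uc] show ?thesis by (rule smooth_on_subset) (rule image_mono, blast)
      qed
    qed
    then show "smooth_on (mdim M) (c ` (U \<inter> ?W)) (\<lambda>x. f (F (inv_into U c x)))"
      by (rule smooth_on_cong[OF 1]) (use chart_inv[OF M Uc] chart_inv[OF M' U'(1)] in auto)
  qed
  then show "\<exists>W'. openin (mtop M) W' \<and> p \<in> W' \<and> sm_fun M W' (\<lambda>x. f (F x))"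
    using smooth_map_preimage_open[OF F oW] p U' by blast
qed

lemma smooth_map_compose:
  assumes M: "smooth_manifold M" and M': "smooth_manifold M'" and M'': "smooth_manifold M''"
    and F: "smooth_map M M' F" and G: "smooth_map M' M'' G"
  shows "smooth_map M M'' (\<lambda>x. G (F x))"
proof (rule smooth_mapI[OF M])
  show "continuous_map (mtop M) (mtop M'') (\<lambda>x. G (F x))"
    using continuous_map_compose[OF smooth_map_continuous[OF F] smooth_map_continuous[OF G]] by (simp add: o_def)
  fix U c i assume Uc: "(U, c) \<in> atlas M''" and i: "i < mdim M''"
  have "sm_fun M' {x \<in> points M'. G x \<in> U} (\<lambda>x. c (G x) i)"
    by (rule smooth_mapD[OF M' G Uc i])
  from sm_fun_compose[OF M M' F smooth_map_preimage_open[OF G chart_homeo(2)[OF M'' Uc]] this]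
  have "sm_fun M {x \<in> points M. F x \<in> {x \<in> points M'. G x \<in> U}} (\<lambda>x. c (G (F x)) i)" .
  moreover have "{x \<in> points M. F x \<in> {x \<in> points M'. G x \<in> U}} = {x \<in> points M. G (F x) \<in> U}"
    using smooth_map_points[OF F] by blast
  ultimately show "sm_fun M {x \<in> points M. G (F x) \<in> U} (\<lambda>x. c (G (F x)) i)" by simp
qed

lemma pull_fun_smooth:
  assumes M: "smooth_manifold M" and M': "smooth_manifold M'" and F: "smooth_map M M' F"
    and f: "f \<in> smooth_functions M'"
  shows "pull_fun M F f \<in> smooth_functions M"
proof -
  have "sm_fun M' (points M') f" using f mem_smooth_functions[OF M'] by blast
  from sm_fun_compose[OF M M' F openin_topspace this]
  have "sm_fun M {x \<in> points M. F x \<in> points M'} (\<lambda>x. f (F x))" .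
  moreover have "{x \<in> points M. F x \<in> points M'} = points M" using smooth_map_points[OF F] by blast
  ultimately have "sm_fun M (points M) (\<lambda>x. f (F x))" by (simp only:)
  then have "sm_fun M (points M) (pull_fun M F f)"
    by (rule sm_fun_cong[OF M openin_topspace]) (simp add: pull_fun_def)
  then show ?thesis unfolding mem_smooth_functions[OF M] by (simp add: pull_fun_def)
qed

lemma smooth_map_id:
  assumes M: "smooth_manifold M" shows "smooth_map M M (\<lambda>x. x)"
proof (rule smooth_mapI[OF M])
  fix U c i assume Uc: "(U, c) \<in> atlas M" and i: "i < mdim M"
  have "{x \<in> points M. x \<in> U} = U" using chart_sub[OF M Uc] by blast
  then show "sm_fun M {x \<in> points M. x \<in> U} (\<lambda>x. c x i)" using sm_fun_coord[OF M Uc i] by simp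
qed simp

lemma smooth_map_const:
  assumes M: "smooth_manifold M" and a: "a \<in> points M'"
  shows "smooth_map M M' (\<lambda>x. a)"
proof (rule smooth_mapI[OF M])
  fix U c i
  have "{x \<in> points M. a \<in> U} = (if a \<in> U then points M else {})" by auto
  then have "openin (mtop M) {x \<in> points M. a \<in> U}" by simp
  then show "sm_fun M {x \<in> points M. a \<in> U} (\<lambda>x. c a i)" by (rule sm_fun_const[OF M])
qed (use a in simp)

lemma smooth_map_cong:
  assumes M: "smooth_manifold M" and M': "smooth_manifold M'" and F: "smooth_map M M' F"
    and FG: "\<And>x. x \<in> points M \<Longrightarrow> F x = G x"
  shows "smooth_map M M' G"
proof (rule smooth_mapI[OF M])
  show "continuous_map (mtop M) (mtop M') G"
    by (rule continuous_map_eq[OF smooth_map_continuous[OF F] FG])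
  fix U c i assume Uc: "(U, c) \<in> atlas M'" and i: "i < mdim M'"
  have *: "{x \<in> points M. F x \<in> U} = {x \<in> points M. G x \<in> U}" using FG by auto
  have "sm_fun M {x \<in> points M. F x \<in> U} (\<lambda>x. c (F x) i)"
    by (rule smooth_mapD[OF M F Uc i])
  then have 1: "sm_fun M {x \<in> points M. G x \<in> U} (\<lambda>x. c (F x) i)" unfolding * .
  have 2: "openin (mtop M) {x \<in> points M. G x \<in> U}"
    using smooth_map_preimage_open[OF F chart_homeo(2)[OF M' Uc]] unfolding * .
  show "sm_fun M {x \<in> points M. G x \<in> U} (\<lambda>x. c (G x) i)"
    by (rule sm_fun_cong[OF M 2 1]) (simp add: FG)
qed

section \<open>Bump functions on manifolds and derivations at a point\<close>

lemma compactin_closed_cbx: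
  assumes x: "\<forall>i\<ge>d. x i = 0"
  shows "compactin (Euclidean_space d) {y. (\<forall>i\<ge>d. y i = 0) \<and> (\<forall>i<d. \<bar>y i - x i\<bar> \<le> s)}"
proof -
  let ?K = "{y. (\<forall>i\<ge>d. y i = 0) \<and> (\<forall>i<d. \<bar>y i - x i\<bar> \<le> s)}"
  have "y \<in> ?K \<longleftrightarrow> (\<forall>i. y i \<in> (if i < d then {x i - s..x i + s} else {0::real}))" for y
  proof -
    have "y i \<in> (if i < d then {x i - s..x i + s} else {0::real}) \<longleftrightarrow> (if i < d then \<bar>y i - x i\<bar> \<le> s else y i = 0)" for i
      by (auto simp: abs_le_iff)
    then show ?thesis by (auto simp: not_less)
  qed
  \<comment> \<open>As a product of compact intervals with the singleton of 0 in all coordinates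
    from \<open>d\<close> on, the closed cube is compact by Tychonoff.\<close>
  then have "?K = (\<Pi>\<^sub>E i\<in>UNIV. if i < d then {x i - s..x i + s} else {0::real})"
    unfolding PiE_UNIV_domain Pi_def by blast
  moreover have "compactin (product_topology (\<lambda>i. euclideanreal) UNIV)
      (\<Pi>\<^sub>E i\<in>UNIV. if i < d then {x i - s..x i + s} else {0::real})"
    unfolding compactin_PiE by simp
  ultimately have "compactin (product_topology (\<lambda>i. euclideanreal) UNIV) ?K" by (simp only:)
  then show ?thesis unfolding Euclidean_space_def compactin_subtopology by blast
qed

text \<open>A tangent vector at \<open>p\<close>, as a derivation of the global functions. It is
  kept apart from vector fields because tangent vectors also arise by pushing forward along a map,
  where no field on the target is given.\<close>

definition pt_deriv :: "'a manifold \<Rightarrow> 'a \<Rightarrow> (('a \<Rightarrow> real) \<Rightarrow> real) \<Rightarrow> bool" where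
  "pt_deriv M p D \<longleftrightarrow>
     (\<forall>f\<in>smooth_functions M. \<forall>h\<in>smooth_functions M. \<forall>a b. D (\<lambda>x. a * f x + b * h x) = a * D f + b * D h) \<and>
     (\<forall>f\<in>smooth_functions M. \<forall>h\<in>smooth_functions M. D (\<lambda>x. f x * h x) = f p * D h + h p * D f)"

lemma pt_deriv_linear:
  "pt_deriv M p D \<Longrightarrow> f \<in> smooth_functions M \<Longrightarrow> h \<in> smooth_functions M \<Longrightarrow> D (\<lambda>x. a * f x + b * h x) = a * D f + b * D h"
  by (simp add: pt_deriv_def)

lemma pt_deriv_mult:
  "pt_deriv M p D \<Longrightarrow> f \<in> smooth_functions M \<Longrightarrow> h \<in> smooth_functions M \<Longrightarrow> D (\<lambda>x. f x * h x) = f p * D h + h p * D f"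
  by (simp add: pt_deriv_def)

lemma vector_fields_pt_deriv: "X \<in> vector_fields M \<Longrightarrow> pt_deriv M p (\<lambda>f. X f p)"
  by (simp add: vector_fields_def pt_deriv_def)

context
  fixes M :: "'a manifold"
  assumes M: "smooth_manifold M"
begin

text \<open>The bump lives on a compact set inside a chart. The Hausdorff property makes that set
  closed in the whole manifold, so extension by zero is smooth. By the last property, multiplication
  by the bump makes a function that is smooth only on \<open>W\<close> global.\<close>

lemma bump_function:
  assumes W: "openin (mtop M) W" and p: "p \<in> W"
  obtains \<beta> where "\<beta> \<in> smooth_functions M" "\<beta> p = 1" "\<And>q. q \<notin> W \<Longrightarrow> \<beta> q = 0"
    "\<And>u. sm_fun M W u \<Longrightarrow> (\<lambda>q. \<beta> q * u q) \<in> smooth_functions M"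
proof -
  let ?n = "mdim M"
  have "p \<in> points M" using W p openin_subset by blast
  then obtain U c where Uc: "(U, c) \<in> atlas M" "p \<in> U" using chart_exists[OF M] by blast
  define x0 where "x0 = c p"
  have x0: "\<forall>i\<ge>?n. x0 i = 0" using chart_supp[OF M Uc] by (simp add: x0_def)
  obtain r where r: "r > 0" "cbx ?n x0 r \<subseteq> c ` (U \<inter> W)"
    by (rule openin_Euclidean_cbx[OF chart_image_open[OF M Uc(1) W], of x0]) (use Uc p x0_def in auto)
  have "r / 2 > 0" using r by simp
  from cbx_bump[OF this x0] obtain b where
    b: "\<forall>k. Ck_on k ?n (topspace (Euclidean_space ?n)) b" "b x0 = 1"
      "\<And>y i. i < ?n \<Longrightarrow> r / 2 \<le> \<bar>y i - x0 i\<bar> \<Longrightarrow> b y = 0" by blast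
  define KE where "KE = {y. (\<forall>i\<ge>?n. y i = 0) \<and> (\<forall>i<?n. \<bar>y i - x0 i\<bar> \<le> r / 2)}"
  have KE: "KE \<subseteq> c ` (U \<inter> W)"
  proof
    fix y assume "y \<in> KE"
    then have "y \<in> cbx ?n x0 r" using r(1) by (fastforce simp: KE_def cbx_def)
    then show "y \<in> c ` (U \<inter> W)" using r(2) by blast
  qed
  obtain g where g: "homeomorphic_maps (subtopology (mtop M) U) (subtopology (Euclidean_space ?n) (c ` U)) c g"
    using chart_homeo(1)[OF M Uc(1)] homeomorphic_map_maps by blast
  have topU: "topspace (subtopology (mtop M) U) = U" using chart_sub[OF M Uc(1)] by (simp add: inf.absorb2)
  have gc: "g (c q) = q" if "q \<in> U" for q using g that unfolding homeomorphic_maps_def topU by blast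
  define K where "K = g ` KE"
  have KW: "K \<subseteq> U \<inter> W" using KE gc unfolding K_def by force
  have "compactin (subtopology (Euclidean_space ?n) (c ` U)) KE"
    using compactin_closed_cbx[OF x0, of "r / 2"] KE unfolding KE_def compactin_subtopology by blast
  moreover have "continuous_map (subtopology (Euclidean_space ?n) (c ` U)) (subtopology (mtop M) U) g"
    using g unfolding homeomorphic_maps_def by blast
  ultimately have "compactin (subtopology (mtop M) U) K"
    unfolding K_def by (rule image_compactin)
  then have "compactin (mtop M) K" by (simp only: compactin_subtopology)
  have "Hausdorff_space (mtop M)" using M unfolding smooth_manifold_def by (elim conjE)
  then have Kcl: "closedin (mtop M) K"
    using \<open>compactin (mtop M) K\<close> by (rule compactin_imp_closedin)
  then have oK: "openin (mtop M) (points M - K)" by blast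
  define \<beta> where "\<beta> = (\<lambda>q. if q \<in> U then b (c q) else 0)"
  have \<beta>K: "\<beta> q = 0" if "q \<notin> K" for q
  proof (rule ccontr)
    assume "\<beta> q \<noteq> 0"
    then have q: "q \<in> U" "b (c q) \<noteq> 0" by (auto simp: \<beta>_def split: if_splits)
    then have "c q \<in> KE"
      using b(3)[of _ "c q"] chart_supp[OF M Uc(1) q(1)] unfolding KE_def by (force simp: not_less)
    then show False using gc[OF q(1)] that unfolding K_def by force
  qed
  have \<beta>U: "sm_fun M U \<beta>"
  proof (rule sm_fun_chartI[OF M Uc(1) chart_homeo(2)[OF M Uc(1)] subset_refl])
    have "smooth_on ?n (c ` U) b"
      by (rule smooth_on_subset[of _ "topspace (Euclidean_space ?n)"])
        (use b(1) openin_subset[OF chart_homeo(3)[OF M Uc(1)]] in \<open>auto simp: smooth_on_def\<close>)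
    then show "smooth_on ?n (c ` U) (\<lambda>x. \<beta> (inv_into U c x))"
      by (rule smooth_on_cong[OF chart_homeo(3)[OF M Uc(1)]]) (use chart_inv[OF M Uc(1)] in \<open>auto simp: \<beta>_def\<close>)
  qed
  have ext: "(\<lambda>q. \<beta> q * u q) \<in> smooth_functions M" if u: "sm_fun M W u" for u
  proof -
    have oUW: "openin (mtop M) (U \<inter> W)" using chart_homeo(2)[OF M Uc(1)] W by blast
    have 1: "sm_fun M (U \<inter> W) (\<lambda>q. \<beta> q * u q)"
      by (rule sm_fun_mult[OF M oUW sm_fun_subset[OF M \<beta>U] sm_fun_subset[OF M u]]) auto
    have 2: "sm_fun M (points M - K) (\<lambda>q. \<beta> q * u q)"
      by (rule sm_fun_cong[OF M oK sm_fun_const[OF M oK, of 0]]) (simp add: \<beta>K)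
    have "sm_fun M (points M) (\<lambda>q. \<beta> q * u q)"
    proof (rule sm_fun_local[OF M openin_topspace])
      fix q assume "q \<in> points M"
      then show "\<exists>W'. openin (mtop M) W' \<and> q \<in> W' \<and> sm_fun M W' (\<lambda>q. \<beta> q * u q)"
        using 1 2 oUW oK KW by (cases "q \<in> K") blast+
    qed
    moreover have "\<beta> q * u q = 0" if "q \<notin> points M" for q
      using \<beta>K[of q] that KW chart_sub[OF M Uc(1)] by auto
    ultimately show ?thesis unfolding mem_smooth_functions[OF M] by blast
  qed
  have "(\<lambda>q. \<beta> q * 1) \<in> smooth_functions M" by (rule ext[OF sm_fun_const[OF M W]])
  then have "\<beta> \<in> smooth_functions M" by simp
  moreover have "\<beta> p = 1" using Uc b(2) by (simp add: \<beta>_def x0_def)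
  moreover have "\<beta> q = 0" if "q \<notin> W" for q using \<beta>K[of q] KW that by blast
  ultimately show ?thesis using ext that by blast
qed

lemma pt_deriv_zero: "pt_deriv M p D \<Longrightarrow> D (\<lambda>x. 0) = 0"
  using pt_deriv_linear[of M p D "\<lambda>x. 0" "\<lambda>x. 0" 0 0] smooth_functions_zero[OF M] by simp

lemma pt_deriv_add:
  "pt_deriv M p D \<Longrightarrow> f \<in> smooth_functions M \<Longrightarrow> h \<in> smooth_functions M \<Longrightarrow> D (\<lambda>x. f x + h x) = D f + D h"
  using pt_deriv_linear[of M p D f h 1 1] by simp

lemma pt_deriv_scale:
  "pt_deriv M p D \<Longrightarrow> f \<in> smooth_functions M \<Longrightarrow> D (\<lambda>x. a * f x) = a * D f"
  using pt_deriv_linear[of M p D f f a 0] by simp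

lemma pt_deriv_sum:
  assumes "pt_deriv M p D" "\<And>j. j \<in> J \<Longrightarrow> f j \<in> smooth_functions M"
  shows "D (\<lambda>x. \<Sum>j\<in>J. f j x) = (\<Sum>j\<in>J. D (f j))"
  using assms(2)
proof (induction J rule: infinite_finite_induct)
  case (insert j J)
  have "D (\<lambda>x. f j x + (\<Sum>j\<in>J. f j x)) = D (f j) + D (\<lambda>x. \<Sum>j\<in>J. f j x)"
    by (rule pt_deriv_add[OF assms(1)]) (use insert.prems in \<open>auto intro: smooth_functions_sum[OF M]\<close>)
  then show ?case using insert by simp
qed (simp_all add: pt_deriv_zero[OF assms(1)])

text \<open>The function that is 1 on the manifold equals its own square, so Leibniz gives D e = 2 D
  e.\<close>

lemma pt_deriv_one:
  assumes "pt_deriv M p D" "p \<in> points M"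
  shows "D (\<lambda>x. if x \<in> points M then a else 0) = 0"
proof -
  let ?e = "\<lambda>x. if x \<in> points M then 1 else (0::real)"
  have "D (\<lambda>x. ?e x * ?e x) = ?e p * D ?e + ?e p * D ?e"
    by (rule pt_deriv_mult[OF assms(1)]) (rule smooth_functions_const[OF M])+
  moreover have "(\<lambda>x. ?e x * ?e x) = ?e" by auto
  ultimately have "D ?e = 0" using assms(2) by simp
  moreover have "D (\<lambda>x. a * ?e x) = a * D ?e"
    by (rule pt_deriv_scale[OF assms(1) smooth_functions_const[OF M]])
  moreover have "(\<lambda>x. a * ?e x) = (\<lambda>x. if x \<in> points M then a else 0)" by auto
  ultimately show ?thesis by simp
qed

lemma smooth_functions_chart:
  assumes "(U, c) \<in> atlas M" "f \<in> smooth_functions M"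
  shows "smooth_on (mdim M) (c ` U) (\<lambda>x. f (inv_into U c x))"
proof -
  have "sm_fun M U f" by (rule smooth_functions_sm_fun[OF M assms(2) chart_sub[OF M assms(1)]])
  from sm_funD[OF this assms(1)] show ?thesis by simp
qed

text \<open>Hadamard's lemma expands \<open>f\<close> only inside a cube of the chart. After
  multiplication by the square of a bump the expansion is an identity between global functions, and
  Leibniz applies to it without any prior knowledge that \<open>D\<close> is local. The functions
  \<xi> are the coordinates made global.\<close>

lemma pt_deriv_coordinates:
  assumes Uc: "(U, c) \<in> atlas M" and p: "p \<in> U"
  obtains \<xi> where "\<And>i. i < mdim M \<Longrightarrow> \<xi> i \<in> smooth_functions M"
    "\<And>D f. pt_deriv M p D \<Longrightarrow> f \<in> smooth_functions M \<Longrightarrow>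
       D f = (\<Sum>i<mdim M. D (\<xi> i) * partial i (\<lambda>x. f (inv_into U c x)) (c p))"
    "\<And>i j. i < mdim M \<Longrightarrow> j < mdim M \<Longrightarrow>
       partial i (\<lambda>x. \<xi> j (inv_into U c x)) (c p) = (if i = j then 1 else 0)"
proof -
  let ?n = "mdim M"
  define x0 where "x0 = c p"
  have x0: "\<forall>i\<ge>?n. x0 i = 0" using chart_supp[OF M Uc p] by (simp add: x0_def)
  obtain r where r: "r > 0" "cbx ?n x0 r \<subseteq> c ` U"
    by (rule openin_Euclidean_cbx[OF chart_homeo(3)[OF M Uc], of x0]) (use p x0_def in auto)
  define W where "W = {q \<in> U. c q \<in> cbx ?n x0 r}"
  have W: "openin (mtop M) W" unfolding W_def by (rule chart_preimage_open[OF M Uc openin_cbx])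
  have pW: "p \<in> W" using p cbx_centre[OF r(1) x0] by (simp add: W_def x0_def)
  have WU: "W \<subseteq> U" by (auto simp: W_def)
  obtain \<beta> where \<beta>: "\<beta> \<in> smooth_functions M" "\<beta> p = 1" "\<And>q. q \<notin> W \<Longrightarrow> \<beta> q = 0"
    "\<And>u. sm_fun M W u \<Longrightarrow> (\<lambda>q. \<beta> q * u q) \<in> smooth_functions M"
    by (rule bump_function[OF W pW]) blast
  define \<xi> where "\<xi> = (\<lambda>i q. \<beta> q * (c q i + - x0 i))"
  have \<xi>: "\<xi> i \<in> smooth_functions M" if "i < ?n" for i
    unfolding \<xi>_def
    by (rule \<beta>(4), rule sm_fun_add[OF M W sm_fun_subset[OF M sm_fun_coord[OF M Uc that] WU] sm_fun_const[OF M W]])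
  have expand: "D f = (\<Sum>i<?n. D (\<xi> i) * partial i (\<lambda>x. f (inv_into U c x)) (c p))"
    if D: "pt_deriv M p D" and f: "f \<in> smooth_functions M" for D f
  proof -
    let ?f = "\<lambda>x. f (inv_into U c x)"
    have "smooth_on ?n (cbx ?n x0 r) ?f"
      by (rule smooth_on_subset[OF smooth_functions_chart[OF Uc f] r(2)])
    from hadamard[OF this r(1) x0] obtain g where
      g: "\<And>i. i < ?n \<Longrightarrow> smooth_on ?n (cbx ?n x0 r) (g i)"
        "\<And>x. x \<in> cbx ?n x0 r \<Longrightarrow> ?f x = ?f x0 + (\<Sum>i<?n. (x i - x0 i) * g i x)"
        "\<And>i. i < ?n \<Longrightarrow> g i x0 = partial i ?f x0" by blast
    have gW: "sm_fun M W (\<lambda>q. g i (c q))" if "i < ?n" for i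
    proof (rule sm_fun_chartI[OF M Uc W WU])
      have 1: "openin (Euclidean_space ?n) (c ` W)"
        using chart_image_open[OF M Uc W] WU by (simp add: inf.absorb2)
      have "smooth_on ?n (c ` W) (g i)"
        by (rule smooth_on_subset[OF g(1)[OF that]]) (auto simp: W_def)
      then show "smooth_on ?n (c ` W) (\<lambda>x. g i (c (inv_into U c x)))"
        by (rule smooth_on_cong[OF 1]) (use chart_inv[OF M Uc] WU in auto)
    qed
    define \<gamma> where "\<gamma> = (\<lambda>i q. \<beta> q * g i (c q))"
    have \<gamma>: "\<gamma> i \<in> smooth_functions M" if "i < ?n" for i
      unfolding \<gamma>_def by (rule \<beta>(4)[OF gW[OF that]])
    have \<beta>\<beta>: "(\<lambda>q. \<beta> q * \<beta> q) \<in> smooth_functions M" by (rule smooth_functions_mult[OF M \<beta>(1,1)])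
    have \<xi>\<gamma>: "(\<lambda>q. \<xi> i q * \<gamma> i q) \<in> smooth_functions M" if "i < ?n" for i
      by (rule smooth_functions_mult[OF M \<xi>[OF that] \<gamma>[OF that]])
    \<comment> \<open>Two factors \<beta> are needed: one extends the coordinate difference in
      \<open>\<xi> i\<close>, the other the Hadamard quotient in \<open>\<gamma> i\<close>. When
      \<open>D\<close> is applied, the derivative of \<beta>^2 cancels, and the derivatives of
      \<open>\<gamma> i\<close> drop out because \<open>\<xi> i\<close> vanishes at
      \<open>p\<close>.\<close>
    have *: "(\<lambda>q. (\<beta> q * \<beta> q) * f q) = (\<lambda>q. f p * (\<beta> q * \<beta> q) + 1 * (\<Sum>i<?n. \<xi> i q * \<gamma> i q))"
    proof
      fix q
      show "(\<beta> q * \<beta> q) * f q = f p * (\<beta> q * \<beta> q) + 1 * (\<Sum>i<?n. \<xi> i q * \<gamma> i q)"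
      proof (cases "q \<in> W")
        case True
        then have q: "q \<in> U" "c q \<in> cbx ?n x0 r" by (auto simp: W_def)
        have "f q = f p + (\<Sum>i<?n. (c q i - x0 i) * g i (c q))"
          using g(2)[OF q(2)] chart_inv[OF M Uc] q p by (simp add: x0_def)
        then show ?thesis
          by (simp add: \<xi>_def \<gamma>_def sum_distrib_left algebra_simps)
      next
        case False
        then show ?thesis using \<beta>(3) by (simp add: \<xi>_def)
      qed
    qed
    have "D (\<lambda>q. (\<beta> q * \<beta> q) * f q) = (\<beta> p * \<beta> p) * D f + f p * D (\<lambda>q. \<beta> q * \<beta> q)"
      by (rule pt_deriv_mult[OF D \<beta>\<beta> f])
    moreover have "D (\<lambda>q. f p * (\<beta> q * \<beta> q) + 1 * (\<Sum>i<?n. \<xi> i q * \<gamma> i q)) =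
        f p * D (\<lambda>q. \<beta> q * \<beta> q) + 1 * D (\<lambda>q. \<Sum>i<?n. \<xi> i q * \<gamma> i q)"
      by (rule pt_deriv_linear[OF D \<beta>\<beta>], rule smooth_functions_sum[OF M]) (use \<xi>\<gamma> in blast)
    moreover have "D (\<lambda>q. \<Sum>i<?n. \<xi> i q * \<gamma> i q) = (\<Sum>i<?n. D (\<lambda>q. \<xi> i q * \<gamma> i q))"
      by (rule pt_deriv_sum[OF D]) (use \<xi>\<gamma> in blast)
    moreover have "D (\<lambda>q. \<xi> i q * \<gamma> i q) = D (\<xi> i) * partial i ?f (c p)" if "i < ?n" for i
    proof -
      have "D (\<lambda>q. \<xi> i q * \<gamma> i q) = \<xi> i p * D (\<gamma> i) + \<gamma> i p * D (\<xi> i)"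
        by (rule pt_deriv_mult[OF D \<xi>[OF that] \<gamma>[OF that]])
      moreover have "\<xi> i p = 0" by (simp add: \<xi>_def x0_def)
      moreover have "\<gamma> i p = partial i ?f x0" using g(3)[OF that] \<beta>(2) by (simp add: \<gamma>_def x0_def)
      ultimately show ?thesis by (simp add: x0_def)
    qed
    ultimately show ?thesis using \<beta>(2) unfolding * by simp
  qed
  have delta: "partial i (\<lambda>x. \<xi> j (inv_into U c x)) (c p) = (if i = j then 1 else 0)" if i: "i < ?n" and j: "j < ?n" for i j
  proof -
    let ?h = "\<lambda>x. \<beta> (inv_into U c x)"
    have xU: "x0 \<in> c ` U" using p by (simp add: x0_def)
    have h: "((\<lambda>t. ?h (x0(i := t))) has_real_derivative partial i ?h x0) (at (x0 i))"
      by (rule smooth_on_DERIV[OF smooth_functions_chart[OF Uc \<beta>(1)] i xU])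
    have l: "((\<lambda>t. (x0(i := t)) j + - x0 j) has_real_derivative (if i = j then 1 else 0)) (at (x0 i))"
      by (cases "i = j") (auto intro!: derivative_eq_intros)
    have "((\<lambda>t. ?h (x0(i := t)) * ((x0(i := t)) j + - x0 j)) has_real_derivative
        partial i ?h x0 * ((x0(i := x0 i)) j + - x0 j) + (if i = j then 1 else 0) * ?h (x0(i := x0 i))) (at (x0 i))"
      by (rule DERIV_mult[OF h l])
    then have "partial i (\<lambda>x. ?h x * (x j + - x0 j)) x0 =
        partial i ?h x0 * ((x0(i := x0 i)) j + - x0 j) + (if i = j then 1 else 0) * ?h (x0(i := x0 i))"
      by (rule partialI)
    also have "\<dots> = (if i = j then 1 else 0)"
      using \<beta>(2) chart_inv[OF M Uc p] by (simp add: x0_def)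
    finally have "partial i (\<lambda>x. ?h x * (x j + - x0 j)) x0 = (if i = j then 1 else 0)" .
    moreover have "partial i (\<lambda>x. ?h x * (x j + - x0 j)) x0 = partial i (\<lambda>x. \<xi> j (inv_into U c x)) x0"
    proof (rule partial_cong(1)[OF chart_homeo(3)[OF M Uc] xU i])
      fix y assume "y \<in> c ` U"
      then show "?h y * (y j + - x0 j) = \<xi> j (inv_into U c y)"
        using chart_inv[OF M Uc] by (auto simp: \<xi>_def)
    qed
    ultimately show ?thesis by (simp add: x0_def)
  qed
  show ?thesis using that[of \<xi>] \<xi> expand delta by blast
qed

text \<open>The converse of the expansion: every coefficient vector is realised. This supplies the
  tangent vectors at the identity of a Lie group that are extended to left-invariant fields.\<close>

lemma coordinate_pt_deriv:
  assumes Uc: "(U, c) \<in> atlas M" and p: "p \<in> U"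
  shows "pt_deriv M p (\<lambda>f. \<Sum>i<mdim M. v i * partial i (\<lambda>x. f (inv_into U c x)) (c p))"
proof -
  let ?x = "c p" and ?g = "\<lambda>f x. f (inv_into U c x)"
  have D: "((\<lambda>t. ?g f (?x(i := t))) has_real_derivative partial i (?g f) ?x) (at (?x i))"
    if "f \<in> smooth_functions M" "i < mdim M" for f i
    by (rule smooth_on_DERIV[OF smooth_functions_chart[OF Uc that(1)] that(2)]) (use p in auto)
  have inv: "inv_into U c ?x = p" by (rule chart_inv[OF M Uc p])
  have lin: "partial i (?g (\<lambda>x. a * f x + b * h x)) ?x = a * partial i (?g f) ?x + b * partial i (?g h) ?x"
    if "f \<in> smooth_functions M" "h \<in> smooth_functions M" "i < mdim M" for f h a b i
    by (rule partialI) (rule DERIV_add[OF DERIV_cmult[OF D[OF that(1,3)]] DERIV_cmult[OF D[OF that(2,3)]]])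
  have mult: "partial i (?g (\<lambda>x. f x * h x)) ?x = f p * partial i (?g h) ?x + h p * partial i (?g f) ?x"
    if "f \<in> smooth_functions M" "h \<in> smooth_functions M" "i < mdim M" for f h i
  proof -
    have "partial i (?g (\<lambda>x. f x * h x)) ?x = partial i (?g f) ?x * ?g h (?x(i := ?x i)) + partial i (?g h) ?x * ?g f (?x(i := ?x i))"
      by (rule partialI) (rule DERIV_mult[OF D[OF that(1,3)] D[OF that(2,3)]])
    then show ?thesis by (simp only: fun_upd_triv inv) simp
  qed
  show ?thesis unfolding pt_deriv_def
  proof (intro conjI ballI allI)
    fix f h a b assume fh: "f \<in> smooth_functions M" "h \<in> smooth_functions M"
    show "(\<Sum>i<mdim M. v i * partial i (?g (\<lambda>x. a * f x + b * h x)) ?x) =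
       a * (\<Sum>i<mdim M. v i * partial i (?g f) ?x) + b * (\<Sum>i<mdim M. v i * partial i (?g h) ?x)"
      by (simp add: lin[OF fh] sum_distrib_left sum.distrib[symmetric] algebra_simps)
    show "(\<Sum>i<mdim M. v i * partial i (?g (\<lambda>x. f x * h x)) ?x) =
       f p * (\<Sum>i<mdim M. v i * partial i (?g h) ?x) + h p * (\<Sum>i<mdim M. v i * partial i (?g f) ?x)"
      by (simp add: mult[OF fh] sum_distrib_left sum.distrib[symmetric] algebra_simps)
  qed
qed

end

section \<open>Products\<close>

lemma second_countable_prod_topology:
  assumes "second_countable X" "second_countable Y"
  shows "second_countable (prod_topology X Y)"
proof -
  obtain A where A: "countable A" "\<And>V. V \<in> A \<Longrightarrow> openin X V"
    "\<And>U x. openin X U \<Longrightarrow> x \<in> U \<Longrightarrow> \<exists>V\<in>A. x \<in> V \<and> V \<subseteq> U"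
    using assms(1) unfolding second_countable_def by metis
  obtain B where B: "countable B" "\<And>V. V \<in> B \<Longrightarrow> openin Y V"
    "\<And>U x. openin Y U \<Longrightarrow> x \<in> U \<Longrightarrow> \<exists>V\<in>B. x \<in> V \<and> V \<subseteq> U"
    using assms(2) unfolding second_countable_def by metis
  show ?thesis
    unfolding second_countable_def
  proof (intro exI conjI ballI allI impI)
    show "countable ((\<lambda>(V, W). V \<times> W) ` (A \<times> B))" using A(1) B(1) by simp
    show "openin (prod_topology X Y) V" if "V \<in> (\<lambda>(V, W). V \<times> W) ` (A \<times> B)" for V
      using that A(2) B(2) by (auto simp: openin_prod_Times_iff)
    fix U z assume U: "openin (prod_topology X Y) U \<and> z \<in> U"
    obtain x y where z: "z = (x, y)" by (cases z)
    obtain S T where ST: "openin X S" "openin Y T" "x \<in> S" "y \<in> T" "S \<times> T \<subseteq> U"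
      using U unfolding z openin_prod_topology_alt by blast
    obtain V where V: "V \<in> A" "x \<in> V" "V \<subseteq> S" using A(3)[OF ST(1,3)] by blast
    obtain W where W: "W \<in> B" "y \<in> W" "W \<subseteq> T" using B(3)[OF ST(2,4)] by blast
    have "V \<times> W \<in> (\<lambda>(V, W). V \<times> W) ` (A \<times> B)" using V W by blast
    moreover have "z \<in> V \<times> W" "V \<times> W \<subseteq> U" using V W ST(5) z by auto
    ultimately show "\<exists>V\<in>(\<lambda>(V, W). V \<times> W) ` (A \<times> B). z \<in> V \<and> V \<subseteq> U" by blast
  qed
qed

lemma continuous_map_Euclidean_coord:
  assumes "continuous_map X (Euclidean_space d) f"
  shows "continuous_map X euclideanreal (\<lambda>x. f x i)"
  using assms unfolding Euclidean_space_def continuous_map_in_subtopology continuous_map_componentwise_UNIV by blast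

lemma continuous_map_EuclideanI:
  assumes "\<And>i. i < d \<Longrightarrow> continuous_map X euclideanreal (\<lambda>x. f x i)"
    "\<And>x i. x \<in> topspace X \<Longrightarrow> i \<ge> d \<Longrightarrow> f x i = 0"
  shows "continuous_map X (Euclidean_space d) f"
proof -
  have "continuous_map X (Euclidean_space d) (\<lambda>x i. if i < d then f x i else 0)"
    unfolding continuous_map_componentwise_Euclidean_space using assms(1) by blast
  then show ?thesis by (rule continuous_map_eq) (use assms(2) in \<open>force simp: fun_eq_iff\<close>)
qed

section \<open>Splitting R^(n+m) and charts of a product\<close>

definition pr1 :: "nat \<Rightarrow> (nat \<Rightarrow> real) \<Rightarrow> nat \<Rightarrow> real" where
  "pr1 n z = (\<lambda>i. if i < n then z i else 0)"

definition pr2 :: "nat \<Rightarrow> nat \<Rightarrow> (nat \<Rightarrow> real) \<Rightarrow> nat \<Rightarrow> real" where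
  "pr2 n m z = (\<lambda>i. if i < m then z (n + i) else 0)"

definition cat :: "nat \<Rightarrow> (nat \<Rightarrow> real) \<Rightarrow> (nat \<Rightarrow> real) \<Rightarrow> nat \<Rightarrow> real" where
  "cat n x y = (\<lambda>i. if i < n then x i else y (i - n))"

lemma pr1_cat: "(\<forall>i\<ge>n. x i = 0) \<Longrightarrow> pr1 n (cat n x y) = x"
  by (auto simp: pr1_def cat_def fun_eq_iff not_less)

lemma pr2_cat: "(\<forall>i\<ge>m. y i = 0) \<Longrightarrow> pr2 n m (cat n x y) = y"
  by (auto simp: pr2_def cat_def fun_eq_iff not_less)

lemma cat_pr: "(\<forall>i\<ge>n + m. z i = 0) \<Longrightarrow> cat n (pr1 n z) (pr2 n m z) = z"
  by (auto simp: pr1_def pr2_def cat_def fun_eq_iff not_less)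

lemma cat_supp: "(\<forall>i\<ge>m. y i = 0) \<Longrightarrow> i \<ge> n + m \<Longrightarrow> cat n x y i = 0"
  by (auto simp: cat_def)

lemma cat_upd: "(cat n x y)(n + j := t) = cat n x (y(j := t))"
  by (auto simp: cat_def fun_eq_iff)

lemma smooth_on_pr1:
  assumes "openin (Euclidean_space (n + m)) V" "openin (Euclidean_space n) S"
    "\<And>z. z \<in> V \<Longrightarrow> pr1 n z \<in> S" "smooth_on n S f"
  shows "smooth_on (n + m) V (\<lambda>z. f (pr1 n z))"
proof (rule smooth_on_compose[where G = "pr1 n" and f = f, OF assms])
  show "smooth_on (n + m) V (\<lambda>z. pr1 n z j)" if "j < n" for j
    using smooth_on_coord[OF assms(1), of j] that by (simp add: pr1_def)
qed

lemma smooth_on_pr2: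
  assumes "openin (Euclidean_space (n + m)) V" "openin (Euclidean_space m) S"
    "\<And>z. z \<in> V \<Longrightarrow> pr2 n m z \<in> S" "smooth_on m S f"
  shows "smooth_on (n + m) V (\<lambda>z. f (pr2 n m z))"
proof (rule smooth_on_compose[where G = "pr2 n m" and f = f, OF assms])
  show "smooth_on (n + m) V (\<lambda>z. pr2 n m z j)" if "j < m" for j
    using smooth_on_coord[OF assms(1), of "n + j"] that by (simp add: pr2_def)
qed

lemma prod_atlas:
  "atlas (prod_manifold M M') =
    {(U \<times> U', \<lambda>z. cat (mdim M) (c (fst z)) (c' (snd z))) | U c U' c'. (U, c) \<in> atlas M \<and> (U', c') \<in> atlas M'}"
  unfolding prod_manifold_def cat_def by (simp add: case_prod_unfold)

lemma mdim_prod [simp]: "mdim (prod_manifold M M') = mdim M + mdim M'"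
  and mtop_prod [simp]: "mtop (prod_manifold M M') = prod_topology (mtop M) (mtop M')"
  by (simp_all add: prod_manifold_def)

context
  fixes M :: "'a manifold" and M' :: "'b manifold"
  assumes M: "smooth_manifold M" and M': "smooth_manifold M'"
begin

context
  fixes U c U' c'
  assumes Uc: "(U, c) \<in> atlas M" and Uc': "(U', c') \<in> atlas M'"
begin

lemma prod_chart: "(U \<times> U', \<lambda>z. cat (mdim M) (c (fst z)) (c' (snd z))) \<in> atlas (prod_manifold M M')"
  unfolding prod_atlas using Uc Uc' by blast

lemma chart_supps: "x \<in> U \<Longrightarrow> \<forall>i\<ge>mdim M. c x i = 0" "y \<in> U' \<Longrightarrow> \<forall>i\<ge>mdim M'. c' y i = 0"
  using chart_supp[OF M Uc] chart_supp[OF M' Uc'] by blast+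

lemma prod_chart_image:
  "(\<lambda>z. cat (mdim M) (c (fst z)) (c' (snd z))) ` (U \<times> U') =
    {z \<in> topspace (Euclidean_space (mdim M + mdim M')). pr1 (mdim M) z \<in> c ` U \<and> pr2 (mdim M) (mdim M') z \<in> c' ` U'}"
  (is "?L = ?R")
proof (intro equalityI subsetI)
  fix z assume "z \<in> ?L"
  then obtain x y where xy: "x \<in> U" "y \<in> U'" "z = cat (mdim M) (c x) (c' y)" by auto
  then show "z \<in> ?R"
    using pr1_cat[OF chart_supps(1)[OF xy(1)], of "c' y"] pr2_cat[OF chart_supps(2)[OF xy(2)], of "mdim M" "c x"]
      cat_supp[OF chart_supps(2)[OF xy(2)]] by (simp add: topspace_Euclidean_space)
next
  fix z assume "z \<in> ?R"
  then obtain x y where "x \<in> U" "y \<in> U'" "pr1 (mdim M) z = c x" "pr2 (mdim M) (mdim M') z = c' y"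
    "\<forall>i\<ge>mdim M + mdim M'. z i = 0" by (auto simp: topspace_Euclidean_space)
  then show "z \<in> ?L"
    using cat_pr[of "mdim M" "mdim M'" z] by (intro image_eqI[of _ _ "(x, y)"]) auto
qed

lemma prod_chart_inj: "inj_on (\<lambda>z. cat (mdim M) (c (fst z)) (c' (snd z))) (U \<times> U')"
proof (rule inj_onI)
  fix z w assume z: "z \<in> U \<times> U'" and w: "w \<in> U \<times> U'"
    and eq: "cat (mdim M) (c (fst z)) (c' (snd z)) = cat (mdim M) (c (fst w)) (c' (snd w))"
  have zs: "fst z \<in> U" "snd z \<in> U'" "fst w \<in> U" "snd w \<in> U'" using z w by auto
  have "c (fst z) = c (fst w)"
    using pr1_cat[OF chart_supps(1)[OF zs(1)], of "c' (snd z)"] pr1_cat[OF chart_supps(1)[OF zs(3)], of "c' (snd w)"] eq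
    by simp
  moreover have "c' (snd z) = c' (snd w)"
    using pr2_cat[OF chart_supps(2)[OF zs(2)], of "mdim M" "c (fst z)"]
      pr2_cat[OF chart_supps(2)[OF zs(4)], of "mdim M" "c (fst w)"] eq by simp
  ultimately have "fst z = fst w" "snd z = snd w"
    using inj_onD[OF chart_inj[OF M Uc]] inj_onD[OF chart_inj[OF M' Uc']] zs by blast+
  then show "z = w" by (rule prod_eqI)
qed

lemma prod_chart_inv:
  assumes "z \<in> (\<lambda>z. cat (mdim M) (c (fst z)) (c' (snd z))) ` (U \<times> U')"
  shows "inv_into (U \<times> U') (\<lambda>z. cat (mdim M) (c (fst z)) (c' (snd z))) z =
    (inv_into U c (pr1 (mdim M) z), inv_into U' c' (pr2 (mdim M) (mdim M') z))"
proof -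
  obtain x y where xy: "x \<in> U" "y \<in> U'" "z = cat (mdim M) (c x) (c' y)" using assms by auto
  have "inv_into (U \<times> U') (\<lambda>z. cat (mdim M) (c (fst z)) (c' (snd z))) z = (x, y)"
    using inv_into_f_f[OF prod_chart_inj, of "(x, y)"] xy by simp
  moreover have "pr1 (mdim M) z = c x" "pr2 (mdim M) (mdim M') z = c' y"
    unfolding xy(3) by (rule pr1_cat[OF chart_supps(1)[OF xy(1)]], rule pr2_cat[OF chart_supps(2)[OF xy(2)]])
  ultimately show ?thesis using chart_inv[OF M Uc xy(1)] chart_inv[OF M' Uc' xy(2)] by simp
qed

lemma continuous_map_pr:
  "continuous_map (Euclidean_space (mdim M + mdim M')) (Euclidean_space (mdim M)) (pr1 (mdim M))"
  "continuous_map (Euclidean_space (mdim M + mdim M')) (Euclidean_space (mdim M')) (pr2 (mdim M) (mdim M'))"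
proof -
  have id: "continuous_map (Euclidean_space (mdim M + mdim M')) (Euclidean_space (mdim M + mdim M')) (\<lambda>z. z)" by simp
  show "continuous_map (Euclidean_space (mdim M + mdim M')) (Euclidean_space (mdim M)) (pr1 (mdim M))"
  proof (rule continuous_map_EuclideanI)
    show "continuous_map (Euclidean_space (mdim M + mdim M')) euclideanreal (\<lambda>z. pr1 (mdim M) z i)"
      if "i < mdim M" for i
      using continuous_map_Euclidean_coord[OF id, of i] that by (simp add: pr1_def)
  qed (simp add: pr1_def)
  show "continuous_map (Euclidean_space (mdim M + mdim M')) (Euclidean_space (mdim M')) (pr2 (mdim M) (mdim M'))"
  proof (rule continuous_map_EuclideanI)
    show "continuous_map (Euclidean_space (mdim M + mdim M')) euclideanreal (\<lambda>z. pr2 (mdim M) (mdim M') z i)"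
      if "i < mdim M'" for i
      using continuous_map_Euclidean_coord[OF id, of "mdim M + i"] that by (simp add: pr2_def)
  qed (simp add: pr2_def)
qed

lemma prod_chart_image_open:
  "openin (Euclidean_space (mdim M + mdim M')) ((\<lambda>z. cat (mdim M) (c (fst z)) (c' (snd z))) ` (U \<times> U'))"
proof -
  let ?E = "Euclidean_space (mdim M + mdim M')"
  have "openin ?E {z \<in> topspace ?E. pr1 (mdim M) z \<in> c ` U}"
    by (rule openin_continuous_map_preimage[OF continuous_map_pr(1) chart_homeo(3)[OF M Uc]])
  moreover have "openin ?E {z \<in> topspace ?E. pr2 (mdim M) (mdim M') z \<in> c' ` U'}"
    by (rule openin_continuous_map_preimage[OF continuous_map_pr(2) chart_homeo(3)[OF M' Uc']])
  ultimately have "openin ?E ({z \<in> topspace ?E. pr1 (mdim M) z \<in> c ` U} \<inter>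
      {z \<in> topspace ?E. pr2 (mdim M) (mdim M') z \<in> c' ` U'})" by (rule openin_Int)
  moreover have "{z \<in> topspace ?E. pr1 (mdim M) z \<in> c ` U} \<inter>
      {z \<in> topspace ?E. pr2 (mdim M) (mdim M') z \<in> c' ` U'} =
      (\<lambda>z. cat (mdim M) (c (fst z)) (c' (snd z))) ` (U \<times> U')"
    unfolding prod_chart_image by blast
  ultimately show ?thesis by (simp only:)
qed

lemma prod_chart_homeo:
  "homeomorphic_map (subtopology (prod_topology (mtop M) (mtop M')) (U \<times> U'))
     (subtopology (Euclidean_space (mdim M + mdim M')) ((\<lambda>z. cat (mdim M) (c (fst z)) (c' (snd z))) ` (U \<times> U')))
     (\<lambda>z. cat (mdim M) (c (fst z)) (c' (snd z)))"
proof -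
  let ?cc = "\<lambda>z. cat (mdim M) (c (fst z)) (c' (snd z))"
  let ?E = "Euclidean_space (mdim M + mdim M')"
  let ?X = "prod_topology (subtopology (mtop M) U) (subtopology (mtop M') U')"
  have X: "subtopology (prod_topology (mtop M) (mtop M')) (U \<times> U') = ?X"
    by (simp add: subtopology_Times)
  have tU: "topspace (subtopology (mtop M) U) = U" "topspace (subtopology (mtop M') U') = U'"
    using chart_sub[OF M Uc] chart_sub[OF M' Uc'] by (simp_all add: inf.absorb2)
  have tX: "topspace ?X = U \<times> U'" by (simp only: topspace_prod_topology tU)
  have tE: "topspace (subtopology ?E (?cc ` (U \<times> U'))) = ?cc ` (U \<times> U')"
    using openin_subset[OF prod_chart_image_open] by (simp add: inf.absorb2)
  have cc: "continuous_map (subtopology (mtop M) U) (Euclidean_space (mdim M)) c"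
    using homeomorphic_imp_continuous_map[OF chart_homeo(1)[OF M Uc]] by (simp only: continuous_map_in_subtopology)
  have cc': "continuous_map (subtopology (mtop M') U') (Euclidean_space (mdim M')) c'"
    using homeomorphic_imp_continuous_map[OF chart_homeo(1)[OF M' Uc']] by (simp only: continuous_map_in_subtopology)
  have 1: "continuous_map ?X (Euclidean_space (mdim M)) (\<lambda>z. c (fst z))"
    using continuous_map_compose[OF continuous_map_fst cc] unfolding o_def .
  have 2: "continuous_map ?X (Euclidean_space (mdim M')) (\<lambda>z. c' (snd z))"
    using continuous_map_compose[OF continuous_map_snd cc'] unfolding o_def .
  have c1: "continuous_map ?X ?E ?cc"
  proof (rule continuous_map_EuclideanI)
    fix i assume "i < mdim M + mdim M'"
    show "continuous_map ?X euclideanreal (\<lambda>z. ?cc z i)"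
      using continuous_map_Euclidean_coord[OF 1, of i] continuous_map_Euclidean_coord[OF 2, of "i - mdim M"]
      by (cases "i < mdim M") (simp_all add: cat_def)
  next
    fix z i assume "z \<in> topspace ?X" "mdim M + mdim M' \<le> i"
    then show "?cc z i = 0" unfolding tX using cat_supp[OF chart_supps(2)] by auto
  qed
  obtain g where g: "homeomorphic_maps (subtopology (mtop M) U) (subtopology (Euclidean_space (mdim M)) (c ` U)) c g"
    using chart_homeo(1)[OF M Uc] homeomorphic_map_maps by blast
  obtain g' where g': "homeomorphic_maps (subtopology (mtop M') U') (subtopology (Euclidean_space (mdim M')) (c' ` U')) c' g'"
    using chart_homeo(1)[OF M' Uc'] homeomorphic_map_maps by blast
  let ?g = "\<lambda>z. (g (pr1 (mdim M) z), g' (pr2 (mdim M) (mdim M') z))"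
  let ?Y = "subtopology ?E (?cc ` (U \<times> U'))"
  have p1: "continuous_map ?Y (subtopology (Euclidean_space (mdim M)) (c ` U)) (pr1 (mdim M))"
    unfolding continuous_map_in_subtopology tE
    by (intro conjI continuous_map_from_subtopology continuous_map_pr(1)) (simp add: prod_chart_image)
  have p2: "continuous_map ?Y (subtopology (Euclidean_space (mdim M')) (c' ` U')) (pr2 (mdim M) (mdim M'))"
    unfolding continuous_map_in_subtopology tE
    by (intro conjI continuous_map_from_subtopology continuous_map_pr(2)) (simp add: prod_chart_image)
  have q1: "continuous_map ?Y (subtopology (mtop M) U) (\<lambda>z. g (pr1 (mdim M) z))"
    using continuous_map_compose[OF p1, of _ g] g unfolding homeomorphic_maps_def o_def by blast
  have q2: "continuous_map ?Y (subtopology (mtop M') U') (\<lambda>z. g' (pr2 (mdim M) (mdim M') z))"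
    using continuous_map_compose[OF p2, of _ g'] g' unfolding homeomorphic_maps_def o_def by blast
  have gc: "g (c x) = x" if "x \<in> U" for x using g that unfolding homeomorphic_maps_def tU by blast
  have gc': "g' (c' x) = x" if "x \<in> U'" for x using g' that unfolding homeomorphic_maps_def tU by blast
  have inv: "?g (?cc z) = z" if "z \<in> U \<times> U'" for z
  proof -
    have z: "fst z \<in> U" "snd z \<in> U'" using that by auto
    show ?thesis
      unfolding pr1_cat[OF chart_supps(1)[OF z(1)]] pr2_cat[OF chart_supps(2)[OF z(2)]] gc[OF z(1)] gc'[OF z(2)] by simp
  qed
  have "homeomorphic_maps ?X ?Y ?cc ?g"
    unfolding homeomorphic_maps_def tX tE
  proof (intro conjI ballI)
    show "continuous_map ?X ?Y ?cc"
      unfolding continuous_map_in_subtopology tX using c1 by blast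
    show "continuous_map ?Y ?X ?g" by (rule continuous_map_pairedI[OF q1 q2])
    show "?g (?cc z) = z" if "z \<in> U \<times> U'" for z by (rule inv[OF that])
    show "?cc (?g z) = z" if z: "z \<in> ?cc ` (U \<times> U')" for z
    proof -
      obtain w where w: "w \<in> U \<times> U'" "z = ?cc w" using z by blast
      show ?thesis unfolding w(2) inv[OF w(1)] by (rule refl)
    qed
  qed
  then show ?thesis unfolding X homeomorphic_map_maps by blast
qed

end

lemma prod_atlasE:
  assumes "(W, d) \<in> atlas (prod_manifold M M')"
  obtains U c U' c' where "(U, c) \<in> atlas M" "(U', c') \<in> atlas M'" "W = U \<times> U'"
    "d = (\<lambda>z. cat (mdim M) (c (fst z)) (c' (snd z)))"
  using assms unfolding prod_atlas by blast

lemma smooth_on_prod_chart1: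
  assumes Uc: "(U, c) \<in> atlas M" and Uc': "(U', c') \<in> atlas M'"
    and V: "V \<subseteq> (\<lambda>z. cat (mdim M) (c (fst z)) (c' (snd z))) ` (U \<times> U')" "openin (Euclidean_space (mdim M + mdim M')) V"
    and S: "openin (mtop M) S" "sm_fun M S f"
    and VS: "\<And>z. z \<in> U \<times> U' \<Longrightarrow> cat (mdim M) (c (fst z)) (c' (snd z)) \<in> V \<Longrightarrow> fst z \<in> S"
  shows "smooth_on (mdim M + mdim M') V (\<lambda>x. f (fst (inv_into (U \<times> U') (\<lambda>z. cat (mdim M) (c (fst z)) (c' (snd z))) x)))"
proof -
  have "smooth_on (mdim M + mdim M') V (\<lambda>z. f (inv_into U c (pr1 (mdim M) z)))"
  proof (rule smooth_on_pr1[OF V(2) chart_image_open[OF M Uc S(1)] _ sm_funD[OF S(2) Uc]])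
    fix z assume "z \<in> V"
    then obtain x y where xy: "x \<in> U" "y \<in> U'" "z = cat (mdim M) (c x) (c' y)" using V(1) by auto
    have "pr1 (mdim M) z = c x" unfolding xy(3) by (rule pr1_cat[OF chart_supps(1)[OF Uc Uc' xy(1)]])
    moreover have "x \<in> S" using VS[of "(x, y)"] xy \<open>z \<in> V\<close> by simp
    ultimately show "pr1 (mdim M) z \<in> c ` (U \<inter> S)" using xy(1) by blast
  qed
  then show ?thesis
    by (rule smooth_on_cong[OF V(2)]) (subst prod_chart_inv[OF Uc Uc' subsetD[OF V(1)]], assumption, simp)
qed

lemma smooth_on_prod_chart2:
  assumes Uc: "(U, c) \<in> atlas M" and Uc': "(U', c') \<in> atlas M'"
    and V: "V \<subseteq> (\<lambda>z. cat (mdim M) (c (fst z)) (c' (snd z))) ` (U \<times> U')" "openin (Euclidean_space (mdim M + mdim M')) V"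
    and S: "openin (mtop M') S" "sm_fun M' S f"
    and VS: "\<And>z. z \<in> U \<times> U' \<Longrightarrow> cat (mdim M) (c (fst z)) (c' (snd z)) \<in> V \<Longrightarrow> snd z \<in> S"
  shows "smooth_on (mdim M + mdim M') V (\<lambda>x. f (snd (inv_into (U \<times> U') (\<lambda>z. cat (mdim M) (c (fst z)) (c' (snd z))) x)))"
proof -
  have "smooth_on (mdim M + mdim M') V (\<lambda>z. f (inv_into U' c' (pr2 (mdim M) (mdim M') z)))"
  proof (rule smooth_on_pr2[OF V(2) chart_image_open[OF M' Uc' S(1)] _ sm_funD[OF S(2) Uc']])
    fix z assume "z \<in> V"
    then obtain x y where xy: "x \<in> U" "y \<in> U'" "z = cat (mdim M) (c x) (c' y)" using V(1) by auto
    have "pr2 (mdim M) (mdim M') z = c' y" unfolding xy(3) by (rule pr2_cat[OF chart_supps(2)[OF Uc Uc' xy(2)]])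
    moreover have "y \<in> S" using VS[of "(x, y)"] xy \<open>z \<in> V\<close> by simp
    ultimately show "pr2 (mdim M) (mdim M') z \<in> c' ` (U' \<inter> S)" using xy(2) by blast
  qed
  then show ?thesis
    by (rule smooth_on_cong[OF V(2)]) (subst prod_chart_inv[OF Uc Uc' subsetD[OF V(1)]], assumption, simp)
qed

lemma prod_image_Int_open:
  assumes Uc: "(U, c) \<in> atlas M" and Uc': "(U', c') \<in> atlas M'" and W: "openin (prod_topology (mtop M) (mtop M')) W"
  shows "openin (Euclidean_space (mdim M + mdim M')) ((\<lambda>z. cat (mdim M) (c (fst z)) (c' (snd z))) ` ((U \<times> U') \<inter> W))"
proof -
  have "openin (subtopology (prod_topology (mtop M) (mtop M')) (U \<times> U')) ((U \<times> U') \<inter> W)"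
    using W by (simp add: openin_subtopology_Int2)
  from homeomorphic_imp_open_map[OF prod_chart_homeo[OF Uc Uc'], unfolded open_map_def, rule_format, OF this]
  show ?thesis using openin_open_subtopology[OF prod_chart_image_open[OF Uc Uc']] by blast
qed

lemma smooth_manifold_prod: "smooth_manifold (prod_manifold M M')"
  unfolding smooth_manifold_def
proof (intro conjI)
  show "Hausdorff_space (mtop (prod_manifold M M'))"
    using M M' unfolding smooth_manifold_def mtop_prod Hausdorff_space_prod_topology by blast
  show "second_countable (mtop (prod_manifold M M'))"
    using M M' unfolding smooth_manifold_def mtop_prod by (intro second_countable_prod_topology) blast+
  show "(\<Union>(U, c)\<in>atlas (prod_manifold M M'). U) = points (prod_manifold M M')"
  proof (intro equalityI subsetI)
    fix z assume "z \<in> (\<Union>(U, c)\<in>atlas (prod_manifold M M'). U)"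
    then obtain W d where "(W, d) \<in> atlas (prod_manifold M M')" "z \<in> W" by blast
    then show "z \<in> points (prod_manifold M M')"
      using chart_sub[OF M] chart_sub[OF M'] by (elim prod_atlasE) fastforce
  next
    fix z assume "z \<in> points (prod_manifold M M')"
    then have "fst z \<in> points M" "snd z \<in> points M'" by auto
    then obtain U c U' c' where "(U, c) \<in> atlas M" "fst z \<in> U" "(U', c') \<in> atlas M'" "snd z \<in> U'"
      using chart_exists[OF M] chart_exists[OF M'] by blast
    then show "z \<in> (\<Union>(U, c)\<in>atlas (prod_manifold M M'). U)"
      using prod_chart[of U c U' c'] by (intro UN_I[of "(U \<times> U', _)"]) (auto simp: mem_Times_iff)
  qed
  show "\<forall>(U, c)\<in>atlas (prod_manifold M M').
      openin (mtop (prod_manifold M M')) U \<and> openin (Euclidean_space (mdim (prod_manifold M M'))) (c ` U) \<and>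
      homeomorphic_map (subtopology (mtop (prod_manifold M M')) U)
        (subtopology (Euclidean_space (mdim (prod_manifold M M'))) (c ` U)) c"
  proof (intro ballI, clarify, elim prod_atlasE, intro conjI)
    fix W d U c U' c'
    assume *: "(U, c) \<in> atlas M" "(U', c') \<in> atlas M'" "W = U \<times> U'" "d = (\<lambda>z. cat (mdim M) (c (fst z)) (c' (snd z)))"
    show "openin (mtop (prod_manifold M M')) W"
      unfolding *(3) mtop_prod openin_prod_Times_iff using chart_homeo(2)[OF M *(1)] chart_homeo(2)[OF M' *(2)] by blast
    show "openin (Euclidean_space (mdim (prod_manifold M M'))) (d ` W)"
      unfolding *(3,4) mdim_prod by (rule prod_chart_image_open[OF *(1,2)])
    show "homeomorphic_map (subtopology (mtop (prod_manifold M M')) W)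
        (subtopology (Euclidean_space (mdim (prod_manifold M M'))) (d ` W)) d"
      unfolding *(3,4) mdim_prod mtop_prod by (rule prod_chart_homeo[OF *(1,2)])
  qed
  have "smooth_on (mdim (prod_manifold M M')) (d ` (W \<inter> W')) (\<lambda>x. d' (inv_into W d x) i)"
    if Wd: "(W, d) \<in> atlas (prod_manifold M M')" and Wd': "(W', d') \<in> atlas (prod_manifold M M')"
      and i: "i < mdim (prod_manifold M M')" for W d W' d' i
  proof -
    from Wd obtain U c U' c' where A: "(U, c) \<in> atlas M" "(U', c') \<in> atlas M'" "W = U \<times> U'"
      "d = (\<lambda>z. cat (mdim M) (c (fst z)) (c' (snd z)))" by (rule prod_atlasE)
    from Wd' obtain V b V' b' where B: "(V, b) \<in> atlas M" "(V', b') \<in> atlas M'" "W' = V \<times> V'"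
      "d' = (\<lambda>z. cat (mdim M) (b (fst z)) (b' (snd z)))" by (rule prod_atlasE)
    have oV: "openin (mtop M) V" "openin (mtop M') V'"
      using chart_homeo(2)[OF M B(1)] chart_homeo(2)[OF M' B(2)] by auto
    have oW': "openin (prod_topology (mtop M) (mtop M')) (V \<times> V')"
      unfolding openin_prod_Times_iff using oV by blast
    have mem: "z \<in> V \<times> V'" if "z \<in> U \<times> U'" "d z \<in> d ` (W \<inter> W')" for z
      using that inj_onD[OF prod_chart_inj[OF A(1,2)]] unfolding A(3,4) B(3) by blast
    have op: "openin (Euclidean_space (mdim M + mdim M')) (d ` (W \<inter> W'))"
      unfolding A(3,4) B(3) by (rule prod_image_Int_open[OF A(1,2) oW'])
    have sub: "d ` (W \<inter> W') \<subseteq> (\<lambda>z. cat (mdim M) (c (fst z)) (c' (snd z))) ` (U \<times> U')"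
      unfolding A(3,4) by blast
    show ?thesis
    proof (cases "i < mdim M")
      case True
      have "smooth_on (mdim M + mdim M') (d ` (W \<inter> W'))
          (\<lambda>x. b (fst (inv_into (U \<times> U') (\<lambda>z. cat (mdim M) (c (fst z)) (c' (snd z))) x)) i)"
        by (rule smooth_on_prod_chart1[where f = "\<lambda>q. b q i", OF A(1,2) sub op oV(1) sm_fun_coord[OF M B(1) True]])
          (use mem A(4) in force)
      then show ?thesis using True unfolding mdim_prod A(3,4) B(4) by (simp add: cat_def)
    next
      case False
      then have i': "i - mdim M < mdim M'" using i by simp
      have "smooth_on (mdim M + mdim M') (d ` (W \<inter> W'))
          (\<lambda>x. b' (snd (inv_into (U \<times> U') (\<lambda>z. cat (mdim M) (c (fst z)) (c' (snd z))) x)) (i - mdim M))"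
        by (rule smooth_on_prod_chart2[where f = "\<lambda>q. b' q (i - mdim M)", OF A(1,2) sub op oV(2) sm_fun_coord[OF M' B(2) i']])
          (use mem A(4) in force)
      then show ?thesis using False unfolding mdim_prod A(3,4) B(4) by (simp add: cat_def)
    qed
  qed
  then show "\<forall>(U, c)\<in>atlas (prod_manifold M M'). \<forall>(U', c')\<in>atlas (prod_manifold M M').
      \<forall>i<mdim (prod_manifold M M').
      smooth_on (mdim (prod_manifold M M')) (c ` (U \<inter> U')) (\<lambda>x. c' (inv_into U c x) i)" by blast
qed

section \<open>Smooth maps into and out of a product\<close>

lemma sm_fun_fst:
  assumes S: "openin (mtop M) S" "sm_fun M S f" and W: "openin (prod_topology (mtop M) (mtop M')) W" "fst ` W \<subseteq> S"
  shows "sm_fun (prod_manifold M M') W (\<lambda>z. f (fst z))"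
proof (rule sm_funI, unfold mdim_prod, elim prod_atlasE)
  fix U d V c V' c'
  assume A: "(V, c) \<in> atlas M" "(V', c') \<in> atlas M'" "U = V \<times> V'" "d = (\<lambda>z. cat (mdim M) (c (fst z)) (c' (snd z)))"
  have "fst z \<in> S" if "z \<in> V \<times> V'" "d z \<in> d ` (V \<times> V' \<inter> W)" for z
    using that inj_onD[OF prod_chart_inj[OF A(1,2)]] W(2) unfolding A(3,4) by blast
  then show "smooth_on (mdim M + mdim M') (d ` (U \<inter> W)) (\<lambda>x. f (fst (inv_into U d x)))"
    unfolding A(3,4)
    by (intro smooth_on_prod_chart1[OF A(1,2) _ prod_image_Int_open[OF A(1,2) W(1)] S]) blast+
qed

lemma sm_fun_snd:
  assumes S: "openin (mtop M') S" "sm_fun M' S f" and W: "openin (prod_topology (mtop M) (mtop M')) W" "snd ` W \<subseteq> S"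
  shows "sm_fun (prod_manifold M M') W (\<lambda>z. f (snd z))"
proof (rule sm_funI, unfold mdim_prod, elim prod_atlasE)
  fix U d V c V' c'
  assume A: "(V, c) \<in> atlas M" "(V', c') \<in> atlas M'" "U = V \<times> V'" "d = (\<lambda>z. cat (mdim M) (c (fst z)) (c' (snd z)))"
  have "snd z \<in> S" if "z \<in> V \<times> V'" "d z \<in> d ` (V \<times> V' \<inter> W)" for z
    using that inj_onD[OF prod_chart_inj[OF A(1,2)]] W(2) unfolding A(3,4) by blast
  then show "smooth_on (mdim M + mdim M') (d ` (U \<inter> W)) (\<lambda>x. f (snd (inv_into U d x)))"
    unfolding A(3,4)
    by (intro smooth_on_prod_chart2[OF A(1,2) _ prod_image_Int_open[OF A(1,2) W(1)] S]) blast+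
qed

lemma smooth_map_fst: "smooth_map (prod_manifold M M') M fst"
proof (rule smooth_mapI[OF smooth_manifold_prod])
  show c: "continuous_map (mtop (prod_manifold M M')) (mtop M) fst" by (simp add: continuous_map_fst)
  fix U c i assume Uc: "(U, c) \<in> atlas M" "i < mdim M"
  show "sm_fun (prod_manifold M M') {x \<in> points (prod_manifold M M'). fst x \<in> U} (\<lambda>x. c (fst x) i)"
    by (rule sm_fun_fst[where f = "\<lambda>q. c q i", OF chart_homeo(2)[OF M Uc(1)] sm_fun_coord[OF M Uc]])
      (use openin_continuous_map_preimage[OF c chart_homeo(2)[OF M Uc(1)]] in auto)
qed

lemma smooth_map_snd: "smooth_map (prod_manifold M M') M' snd"
proof (rule smooth_mapI[OF smooth_manifold_prod])
  show c: "continuous_map (mtop (prod_manifold M M')) (mtop M') snd" by (simp add: continuous_map_snd)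
  fix U c i assume Uc: "(U, c) \<in> atlas M'" "i < mdim M'"
  show "sm_fun (prod_manifold M M') {x \<in> points (prod_manifold M M'). snd x \<in> U} (\<lambda>x. c (snd x) i)"
    by (rule sm_fun_snd[where f = "\<lambda>q. c q i", OF chart_homeo(2)[OF M' Uc(1)] sm_fun_coord[OF M' Uc]])
      (use openin_continuous_map_preimage[OF c chart_homeo(2)[OF M' Uc(1)]] in auto)
qed

lemma smooth_map_pair:
  assumes Q: "smooth_manifold Q" and F: "smooth_map Q M F" and G: "smooth_map Q M' G"
  shows "smooth_map Q (prod_manifold M M') (\<lambda>q. (F q, G q))"
proof (rule smooth_mapI[OF Q])
  show c: "continuous_map (mtop Q) (mtop (prod_manifold M M')) (\<lambda>q. (F q, G q))"
    unfolding mtop_prod by (rule continuous_map_pairedI[OF smooth_map_continuous[OF F] smooth_map_continuous[OF G]])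
  fix W d i assume Wd: "(W, d) \<in> atlas (prod_manifold M M')" and i: "i < mdim (prod_manifold M M')"
  from Wd obtain U c U' c' where A: "(U, c) \<in> atlas M" "(U', c') \<in> atlas M'" "W = U \<times> U'"
    "d = (\<lambda>z. cat (mdim M) (c (fst z)) (c' (snd z)))" by (rule prod_atlasE)
  show "sm_fun Q {x \<in> points Q. (F x, G x) \<in> W} (\<lambda>x. d (F x, G x) i)"
  proof (cases "i < mdim M")
    case True
    have "sm_fun Q {x \<in> points Q. (F x, G x) \<in> W} (\<lambda>x. c (F x) i)"
      by (rule sm_fun_subset[OF Q smooth_mapD[OF Q F A(1) True]]) (auto simp: A(3))
    then show ?thesis using True unfolding A(4) by (simp add: cat_def)
  next
    case False
    then have i': "i - mdim M < mdim M'" using i by simp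
    have "sm_fun Q {x \<in> points Q. (F x, G x) \<in> W} (\<lambda>x. c' (G x) (i - mdim M))"
      by (rule sm_fun_subset[OF Q smooth_mapD[OF Q G A(2) i']]) (auto simp: A(3))
    then show ?thesis using False unfolding A(4) by (simp add: cat_def)
  qed
qed

lemma smooth_functions_slice:
  assumes f: "f \<in> smooth_functions (prod_manifold M M')"
  shows "(\<lambda>y. f (a, y)) \<in> smooth_functions M'"
proof (cases "a \<in> points M")
  case True
  have "smooth_map M' (prod_manifold M M') (\<lambda>y. (a, y))"
    by (rule smooth_map_pair[OF M' smooth_map_const[OF M' True] smooth_map_id[OF M']])
  from pull_fun_smooth[OF M' smooth_manifold_prod this f]
  have "pull_fun M' (\<lambda>y. (a, y)) f \<in> smooth_functions M'" .
  moreover have "pull_fun M' (\<lambda>y. (a, y)) f = (\<lambda>y. f (a, y))"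
    using smooth_functions_0[OF smooth_manifold_prod f] by (auto simp: pull_fun_def fun_eq_iff)
  ultimately show ?thesis by simp
next
  case False
  then have "(\<lambda>y. f (a, y)) = (\<lambda>y. 0)"
    using smooth_functions_0[OF smooth_manifold_prod f] by auto
  then show ?thesis using smooth_functions_zero[OF M'] by simp
qed

text \<open>Differentiation at a fixed point of one factor depends smoothly on the other factor: in
  a product chart it is a combination of the partial derivatives in the last coordinates, restricted
  to a slice. This is what makes left translates of a tangent vector into a smooth field.\<close>

lemma smooth_functions_partial_deriv:
  assumes e: "e \<in> points M'" and D: "pt_deriv M' e D" and f: "f \<in> smooth_functions (prod_manifold M M')"
  shows "(\<lambda>a. D (\<lambda>y. f (a, y))) \<in> smooth_functions M"
proof -
  let ?n = "mdim M" and ?m = "mdim M'"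
  obtain U' c' where Uc': "(U', c') \<in> atlas M'" "e \<in> U'" using chart_exists[OF M' e] by blast
  obtain \<xi> where \<xi>: "\<And>D f. pt_deriv M' e D \<Longrightarrow> f \<in> smooth_functions M' \<Longrightarrow>
       D f = (\<Sum>j<?m. D (\<xi> j) * partial j (\<lambda>x. f (inv_into U' c' x)) (c' e))"
    by (rule pt_deriv_coordinates[OF M' Uc']) blast
  define y0 where "y0 = c' e"
  have y0: "y0 \<in> c' ` U'" using Uc' by (simp add: y0_def)
  have "sm_fun M (points M) (\<lambda>a. D (\<lambda>y. f (a, y)))"
  proof (rule sm_fun_local[OF M openin_topspace])
    fix a assume "a \<in> points M"
    then obtain U c where Uc: "(U, c) \<in> atlas M" "a \<in> U" using chart_exists[OF M] by blast
    let ?cc = "\<lambda>z. cat ?n (c (fst z)) (c' (snd z))"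
    let ?F = "\<lambda>x. f (inv_into (U \<times> U') ?cc x)"
    have F: "smooth_on (?n + ?m) (?cc ` (U \<times> U')) ?F"
      using smooth_functions_chart[OF smooth_manifold_prod prod_chart[OF Uc(1) Uc'(1)] f] by simp
    have cU: "openin (Euclidean_space ?n) (c ` U)" by (rule chart_homeo(3)[OF M Uc(1)])
    have cat_mem: "cat ?n x y \<in> ?cc ` (U \<times> U')" if xy: "x \<in> c ` U" "y \<in> c' ` U'" for x y
    proof -
      obtain p q where "p \<in> U" "q \<in> U'" "x = c p" "y = c' q" using xy by blast
      then show ?thesis by (intro image_eqI[of _ _ "(p, q)"]) auto
    qed
    have Fcat: "?F (cat ?n x y) = f (inv_into U c x, inv_into U' c' y)" if "x \<in> c ` U" "y \<in> c' ` U'" for x y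
    proof -
      have "\<forall>i\<ge>?n. x i = 0" "\<forall>i\<ge>?m. y i = 0"
        using that chart_supps[OF Uc(1) Uc'(1)] by auto
      then have "pr1 ?n (cat ?n x y) = x" "pr2 ?n ?m (cat ?n x y) = y" by (simp_all add: pr1_cat pr2_cat)
      then show ?thesis using prod_chart_inv[OF Uc(1) Uc'(1) cat_mem[OF that]] by simp
    qed
    have "sm_fun M U (\<lambda>a. D (\<lambda>y. f (a, y)))"
    proof (rule sm_fun_chartI[OF M Uc(1) chart_homeo(2)[OF M Uc(1)] subset_refl])
      have "smooth_on ?n (c ` U) (\<lambda>x. \<Sum>j<?m. D (\<xi> j) * partial (?n + j) ?F (cat ?n x y0))"
      proof (rule smooth_on_sum[OF cU], rule smooth_on_mult[OF cU smooth_on_const[OF cU]])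
        fix j assume "j \<in> {..<?m}"
        then have j: "?n + j < ?n + ?m" by simp
        show "smooth_on ?n (c ` U) (\<lambda>x. partial (?n + j) ?F (cat ?n x y0))"
        proof (rule smooth_on_compose[where G = "\<lambda>x. cat ?n x y0" and f = "partial (?n + j) ?F",
              OF cU prod_chart_image_open[OF Uc(1) Uc'(1)] cat_mem[OF _ y0] smooth_on_partial[OF F j]])
          fix l
          show "smooth_on ?n (c ` U) (\<lambda>x. cat ?n x y0 l)"
            using smooth_on_coord[OF cU, of l] smooth_on_const[OF cU, of "y0 (l - ?n)"]
            by (cases "l < ?n") (simp_all add: cat_def)
        qed
      qed
      then show "smooth_on ?n (c ` U) (\<lambda>x. D (\<lambda>y. f (inv_into U c x, y)))"
      proof (rule smooth_on_cong[OF cU])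
        fix x assume x: "x \<in> c ` U"
        have "partial (?n + j) ?F (cat ?n x y0) = partial j (\<lambda>y. f (inv_into U c x, inv_into U' c' y)) y0"
          if j: "j < ?m" for j
        proof -
          have "partial (?n + j) ?F (cat ?n x y0) = partial j (\<lambda>y. ?F (cat ?n x y)) y0"
            unfolding partial_def cat_upd by (simp add: cat_def)
          also have "\<dots> = partial j (\<lambda>y. f (inv_into U c x, inv_into U' c' y)) y0"
            by (rule partial_cong(1)[OF chart_homeo(3)[OF M' Uc'(1)] y0 j Fcat[OF x]])
          finally show ?thesis .
        qed
        then show "(\<Sum>j<?m. D (\<xi> j) * partial (?n + j) ?F (cat ?n x y0)) = D (\<lambda>y. f (inv_into U c x, y))"
          using \<xi>[OF D smooth_functions_slice[OF f], of "inv_into U c x"] by (simp add: y0_def)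
      qed
    qed
    then show "\<exists>W'. openin (mtop M) W' \<and> a \<in> W' \<and> sm_fun M W' (\<lambda>a. D (\<lambda>y. f (a, y)))"
      using chart_homeo(2)[OF M Uc(1)] Uc(2) by blast
  qed
  moreover have "D (\<lambda>y. f (a, y)) = 0" if "a \<notin> points M" for a
  proof -
    have "(\<lambda>y. f (a, y)) = (\<lambda>y. 0)" using smooth_functions_0[OF smooth_manifold_prod f] that by auto
    then show ?thesis using pt_deriv_zero[OF M' D] by simp
  qed
  ultimately show ?thesis unfolding mem_smooth_functions[OF M] by blast
qed

end

section \<open>The quotient of a Lie group by a discrete subgroup\<close>

lemma topspace_quotient_topology [simp]: "topspace (quotient_topology X q) = q ` topspace X"
proof
  show "topspace (quotient_topology X q) \<subseteq> q ` topspace X"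
    using openin_topspace[of "quotient_topology X q"] unfolding openin_quotient_topology by blast
  have "{x \<in> topspace X. q x \<in> q ` topspace X} = topspace X" by blast
  then have "openin (quotient_topology X q) (q ` topspace X)"
    unfolding openin_quotient_topology by simp
  then show "q ` topspace X \<subseteq> topspace (quotient_topology X q)" by (rule openin_subset)
qed

text \<open>Used for the nilmanifold and, with the trivial subgroup, for the structure group of the
  bundle, where the results on left-invariant fields are wanted.\<close>

locale lie_quotient =
  fixes N :: "'a smooth_group" and \<Gamma> :: "'a set"
  assumes lie: "lie_group N" and sub: "subgroup \<Gamma> N"
    and discrete: "subtopology (mtop (gman N)) \<Gamma> = discrete_topology \<Gamma>"
begin

abbreviation "T \<equiv> mtop (gman N)"
abbreviation "\<pi> \<equiv> (\<lambda>x. \<Gamma> #>\<^bsub>N\<^esub> x)"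
abbreviation "Q \<equiv> coset_manifold N \<Gamma>"

lemma grp: "group N" and mfd: "smooth_manifold (gman N)" and pts: "points (gman N) = carrier N"
  and smooth_mult: "smooth_map (prod_manifold (gman N) (gman N)) (gman N) (\<lambda>(x, y). x \<otimes>\<^bsub>N\<^esub> y)"
  and smooth_inv: "smooth_map (gman N) (gman N) (\<lambda>x. inv\<^bsub>N\<^esub> x)"
  using lie unfolding lie_group_def by auto

interpretation group N by (rule grp)

lemma \<Gamma>_carrier: "\<gamma> \<in> \<Gamma> \<Longrightarrow> \<gamma> \<in> carrier N" using subgroup.subset[OF sub] by blast

lemma smooth_left: "a \<in> carrier N \<Longrightarrow> smooth_map (gman N) (gman N) (\<lambda>x. a \<otimes>\<^bsub>N\<^esub> x)"
proof -
  assume "a \<in> carrier N"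
  then have a: "a \<in> points (gman N)" using pts by simp
  have "smooth_map (gman N) (gman N) (\<lambda>x. (\<lambda>(x, y). x \<otimes>\<^bsub>N\<^esub> y) (a, x))"
    by (rule smooth_map_compose[OF mfd smooth_manifold_prod[OF mfd mfd] mfd
          smooth_map_pair[OF mfd mfd mfd smooth_map_const[OF mfd a] smooth_map_id[OF mfd]] smooth_mult])
  then show ?thesis by simp
qed

lemma open_left: "a \<in> carrier N \<Longrightarrow> openin T W \<Longrightarrow> openin T {x \<in> carrier N. a \<otimes>\<^bsub>N\<^esub> x \<in> W}"
  using smooth_map_preimage_open[OF smooth_left] pts by simp

lemma continuous_quot: "continuous_map (prod_topology T T) T (\<lambda>z. fst z \<otimes>\<^bsub>N\<^esub> inv\<^bsub>N\<^esub> (snd z))"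
proof -
  have 1: "continuous_map (prod_topology T T) T (\<lambda>(x, y). x \<otimes>\<^bsub>N\<^esub> y)"
    using smooth_map_continuous[OF smooth_mult] by simp
  have 2: "continuous_map (prod_topology T T) T (\<lambda>z. inv\<^bsub>N\<^esub> (snd z))"
    using continuous_map_compose[OF continuous_map_snd smooth_map_continuous[OF smooth_inv]] unfolding o_def .
  show ?thesis
    using continuous_map_compose[OF continuous_map_pairedI[OF continuous_map_fst 2] 1]
    unfolding o_def by (simp add: case_prod_unfold)
qed

lemma quot_nbhd:
  assumes "openin T W" "x \<in> carrier N" "y \<in> carrier N" "x \<otimes>\<^bsub>N\<^esub> inv\<^bsub>N\<^esub> y \<in> W"
  obtains A B where "openin T A" "openin T B" "x \<in> A" "y \<in> B"
    "\<And>a b. a \<in> A \<Longrightarrow> b \<in> B \<Longrightarrow> a \<otimes>\<^bsub>N\<^esub> inv\<^bsub>N\<^esub> b \<in> W"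
proof -
  let ?P = "{z \<in> topspace (prod_topology T T). fst z \<otimes>\<^bsub>N\<^esub> inv\<^bsub>N\<^esub> (snd z) \<in> W}"
  have 1: "openin (prod_topology T T) ?P"
    by (rule openin_continuous_map_preimage[OF continuous_quot assms(1)])
  have 2: "(x, y) \<in> ?P" using assms pts by simp
  from openin_prod_topology_alt[THEN iffD1, rule_format, OF 1 2]
  obtain A B where AB: "openin T A" "openin T B" "x \<in> A" "y \<in> B" "A \<times> B \<subseteq> ?P" by (elim exE conjE)
  show ?thesis
  proof (rule that[OF AB(1-4)])
    fix a b assume "a \<in> A" "b \<in> B"
    then have "(a, b) \<in> ?P" using AB(5) by blast
    then show "a \<otimes>\<^bsub>N\<^esub> inv\<^bsub>N\<^esub> b \<in> W" by simp
  qed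
qed

text \<open>The map (x, y) \<mapsto> x y^-1 is continuous and sends the pair of identities to the
  isolated point 1 of \<open>\<Gamma>\<close>, so two nearby elements in the same coset
  coincide.\<close>

lemma discrete_nbhd:
  obtains V where "openin T V" "\<one>\<^bsub>N\<^esub> \<in> V" "\<And>x y. x \<in> V \<Longrightarrow> y \<in> V \<Longrightarrow> x \<otimes>\<^bsub>N\<^esub> inv\<^bsub>N\<^esub> y \<in> \<Gamma> \<Longrightarrow> x = y"
proof -
  have "openin (subtopology T \<Gamma>) {\<one>\<^bsub>N\<^esub>}"
    unfolding discrete using subgroup.one_closed[OF sub] by simp
  then obtain W where W: "openin T W" "{\<one>\<^bsub>N\<^esub>} = W \<inter> \<Gamma>" unfolding openin_subtopology by blast
  have "\<one>\<^bsub>N\<^esub> \<otimes>\<^bsub>N\<^esub> inv\<^bsub>N\<^esub> \<one>\<^bsub>N\<^esub> \<in> W" using W(2) by auto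
  then obtain A B where AB: "openin T A" "openin T B" "\<one>\<^bsub>N\<^esub> \<in> A" "\<one>\<^bsub>N\<^esub> \<in> B"
    "\<And>a b. a \<in> A \<Longrightarrow> b \<in> B \<Longrightarrow> a \<otimes>\<^bsub>N\<^esub> inv\<^bsub>N\<^esub> b \<in> W"
    using quot_nbhd[OF W(1) one_closed one_closed] by blast
  have "x = y" if "x \<in> A \<inter> B" "y \<in> A \<inter> B" "x \<otimes>\<^bsub>N\<^esub> inv\<^bsub>N\<^esub> y \<in> \<Gamma>" for x y
  proof -
    have "x \<in> carrier N" "y \<in> carrier N" using that AB(1) openin_subset pts by fastforce+
    moreover have "x \<otimes>\<^bsub>N\<^esub> inv\<^bsub>N\<^esub> y = \<one>\<^bsub>N\<^esub>" using AB(5)[of x y] that W(2) by blast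
    ultimately show ?thesis by (metis inv_closed inv_equality inv_inv)
  qed
  then show ?thesis using that[of "A \<inter> B"] AB by blast
qed

lemma \<pi>_eq_iff:
  assumes "x \<in> carrier N" "y \<in> carrier N"
  shows "\<pi> x = \<pi> y \<longleftrightarrow> x \<otimes>\<^bsub>N\<^esub> inv\<^bsub>N\<^esub> y \<in> \<Gamma>"
proof
  assume "\<pi> x = \<pi> y"
  then have "x \<in> \<pi> y" using rcos_self[OF assms(1) sub] by simp
  then obtain h where "h \<in> \<Gamma>" "x = h \<otimes>\<^bsub>N\<^esub> y" unfolding r_coset_def by blast
  then show "x \<otimes>\<^bsub>N\<^esub> inv\<^bsub>N\<^esub> y \<in> \<Gamma>" using \<Gamma>_carrier assms by (simp add: m_assoc)
next
  assume h: "x \<otimes>\<^bsub>N\<^esub> inv\<^bsub>N\<^esub> y \<in> \<Gamma>"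
  have "x = (x \<otimes>\<^bsub>N\<^esub> inv\<^bsub>N\<^esub> y) \<otimes>\<^bsub>N\<^esub> y" using assms by (simp add: m_assoc)
  then have "x \<in> \<pi> y" using h unfolding r_coset_def by blast
  from repr_independence[OF this assms(2) sub] show "\<pi> x = \<pi> y" by simp
qed

lemma \<pi>_translate: "\<gamma> \<in> \<Gamma> \<Longrightarrow> x \<in> carrier N \<Longrightarrow> \<pi> (\<gamma> \<otimes>\<^bsub>N\<^esub> x) = \<pi> x"
  using \<Gamma>_carrier \<pi>_eq_iff[of "\<gamma> \<otimes>\<^bsub>N\<^esub> x" x] by (simp add: m_assoc)

lemma \<pi>_eqE:
  assumes "\<pi> x = \<pi> y" "x \<in> carrier N" "y \<in> carrier N"
  obtains \<gamma> where "\<gamma> \<in> \<Gamma>" "x = \<gamma> \<otimes>\<^bsub>N\<^esub> y"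
proof
  show "x \<otimes>\<^bsub>N\<^esub> inv\<^bsub>N\<^esub> y \<in> \<Gamma>" using \<pi>_eq_iff assms by blast
  show "x = x \<otimes>\<^bsub>N\<^esub> inv\<^bsub>N\<^esub> y \<otimes>\<^bsub>N\<^esub> y" using assms by (simp add: m_assoc)
qed

lemma open_right:
  assumes "openin T W" "p \<in> carrier N" shows "openin T {x \<in> carrier N. x \<otimes>\<^bsub>N\<^esub> inv\<^bsub>N\<^esub> p \<in> W}"
proof (subst openin_subopen, intro ballI)
  fix x assume x: "x \<in> {x \<in> carrier N. x \<otimes>\<^bsub>N\<^esub> inv\<^bsub>N\<^esub> p \<in> W}"
  then obtain A B where AB: "openin T A" "openin T B" "x \<in> A" "p \<in> B"
    "\<And>a b. a \<in> A \<Longrightarrow> b \<in> B \<Longrightarrow> a \<otimes>\<^bsub>N\<^esub> inv\<^bsub>N\<^esub> b \<in> W"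
    using quot_nbhd[OF assms(1) _ assms(2)] by blast
  then have "A \<subseteq> {x \<in> carrier N. x \<otimes>\<^bsub>N\<^esub> inv\<^bsub>N\<^esub> p \<in> W}"
    using openin_subset[OF AB(1)] pts by blast
  then show "\<exists>T'. openin T T' \<and> x \<in> T' \<and> T' \<subseteq> {x \<in> carrier N. x \<otimes>\<^bsub>N\<^esub> inv\<^bsub>N\<^esub> p \<in> W}"
    using AB by blast
qed

lemma right_cancel_quot:
  assumes "x \<in> carrier N" "y \<in> carrier N" "p \<in> carrier N"
  shows "(x \<otimes>\<^bsub>N\<^esub> inv\<^bsub>N\<^esub> p) \<otimes>\<^bsub>N\<^esub> inv\<^bsub>N\<^esub> (y \<otimes>\<^bsub>N\<^esub> inv\<^bsub>N\<^esub> p) = x \<otimes>\<^bsub>N\<^esub> inv\<^bsub>N\<^esub> y"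
proof -
  have "inv\<^bsub>N\<^esub> p \<otimes>\<^bsub>N\<^esub> (p \<otimes>\<^bsub>N\<^esub> inv\<^bsub>N\<^esub> y) = inv\<^bsub>N\<^esub> y"
    using assms by (simp add: m_assoc[symmetric])
  then show ?thesis using assms by (simp add: inv_mult_group m_assoc)
qed

text \<open>Right translation does not change the quotients x y^-1, so the neighbourhood of the
  identity from \<open>discrete_nbhd\<close> can be carried to \<open>p\<close>.\<close>

lemma inj_nbhd:
  assumes "p \<in> carrier N"
  obtains V where "openin T V" "p \<in> V" "inj_on \<pi> V"
proof -
  obtain V where V: "openin T V" "\<one>\<^bsub>N\<^esub> \<in> V" "\<And>x y. x \<in> V \<Longrightarrow> y \<in> V \<Longrightarrow> x \<otimes>\<^bsub>N\<^esub> inv\<^bsub>N\<^esub> y \<in> \<Gamma> \<Longrightarrow> x = y"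
    by (rule discrete_nbhd) blast
  let ?V = "{x \<in> carrier N. x \<otimes>\<^bsub>N\<^esub> inv\<^bsub>N\<^esub> p \<in> V}"
  have "inj_on \<pi> ?V"
  proof (rule inj_onI)
    fix x y assume xy: "x \<in> ?V" "y \<in> ?V" "\<pi> x = \<pi> y"
    then have "x \<otimes>\<^bsub>N\<^esub> inv\<^bsub>N\<^esub> y \<in> \<Gamma>" using \<pi>_eq_iff by blast
    then have "x \<otimes>\<^bsub>N\<^esub> inv\<^bsub>N\<^esub> p = y \<otimes>\<^bsub>N\<^esub> inv\<^bsub>N\<^esub> p"
      using V(3) xy right_cancel_quot[of x y p] assms by simp
    then show "x = y" using xy assms right_cancel[of "inv\<^bsub>N\<^esub> p" x y] by simp
  qed
  moreover have "p \<in> ?V" using assms V(2) by simp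
  ultimately show ?thesis using that open_right[OF V(1) assms] by blast
qed

text \<open>A right translate of the neighbourhood from \<open>discrete_nbhd\<close> meets
  \<open>\<Gamma>\<close> in at most one point. Deleting this point, which differs from
  \<open>z\<close>, leaves a neighbourhood of \<open>z\<close>. Closedness is what makes the
  quotient Hausdorff.\<close>

lemma closed_\<Gamma>: "openin T (carrier N - \<Gamma>)"
proof (subst openin_subopen, intro ballI)
  fix z assume z: "z \<in> carrier N - \<Gamma>"
  then have zc: "z \<in> carrier N" by blast
  obtain V where V: "openin T V" "\<one>\<^bsub>N\<^esub> \<in> V" "\<And>x y. x \<in> V \<Longrightarrow> y \<in> V \<Longrightarrow> x \<otimes>\<^bsub>N\<^esub> inv\<^bsub>N\<^esub> y \<in> \<Gamma> \<Longrightarrow> x = y"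
    by (rule discrete_nbhd) blast
  let ?V = "{x \<in> carrier N. x \<otimes>\<^bsub>N\<^esub> inv\<^bsub>N\<^esub> z \<in> V}"
  have op: "openin T ?V" by (rule open_right[OF V(1) zc])
  have zV: "z \<in> ?V" using zc V(2) by simp
  have uniq: "x = y" if "x \<in> ?V \<inter> \<Gamma>" "y \<in> ?V \<inter> \<Gamma>" for x y
  proof -
    have c: "x \<in> carrier N" "y \<in> carrier N" using that by auto
    have "x \<otimes>\<^bsub>N\<^esub> inv\<^bsub>N\<^esub> y \<in> \<Gamma>"
      using that subgroup.m_closed[OF sub] subgroup.m_inv_closed[OF sub] by blast
    then have "x \<otimes>\<^bsub>N\<^esub> inv\<^bsub>N\<^esub> z = y \<otimes>\<^bsub>N\<^esub> inv\<^bsub>N\<^esub> z"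
      using V(3) that right_cancel_quot[OF c zc] by simp
    then show ?thesis using c zc right_cancel[of "inv\<^bsub>N\<^esub> z" x y] by simp
  qed
  have H: "Hausdorff_space T" using mfd unfolding smooth_manifold_def by (elim conjE)
  have "\<exists>\<gamma>\<in>carrier N. ?V \<inter> \<Gamma> \<subseteq> {\<gamma>} \<and> \<gamma> \<noteq> z"
  proof (cases "?V \<inter> \<Gamma> = {}")
    case True
    show ?thesis
    proof (rule bexI[of _ "\<one>\<^bsub>N\<^esub>"])
      show "?V \<inter> \<Gamma> \<subseteq> {\<one>\<^bsub>N\<^esub>} \<and> \<one>\<^bsub>N\<^esub> \<noteq> z"
        using True z subgroup.one_closed[OF sub] by blast
    qed simp
  next
    case False
    then obtain \<gamma> where "\<gamma> \<in> ?V \<inter> \<Gamma>" by blast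
    then show ?thesis using uniq z by (intro bexI[of _ \<gamma>]) blast+
  qed
  then obtain \<gamma> where g: "\<gamma> \<in> carrier N" "?V \<inter> \<Gamma> \<subseteq> {\<gamma>}" "\<gamma> \<noteq> z" by blast
  have "closedin T {\<gamma>}" using H g(1) pts closedin_Hausdorff_singleton by metis
  then have "openin T (?V - {\<gamma>})" using op by (rule openin_diff[rotated])
  moreover have "z \<in> ?V - {\<gamma>}" using zV g by blast
  moreover have "?V - {\<gamma>} \<subseteq> carrier N - \<Gamma>" using g by blast
  ultimately show "\<exists>T'. openin T T' \<and> z \<in> T' \<and> T' \<subseteq> carrier N - \<Gamma>" by blast
qed

section \<open>The smooth structure of the coset space\<close>

lemma mtop_Q: "mtop Q = quotient_topology T \<pi>" and mdim_Q: "mdim Q = mdim (gman N)"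
  by (simp_all add: coset_manifold_def)

lemma points_Q: "points Q = \<pi> ` carrier N"
  unfolding mtop_Q by (simp add: pts)

lemma atlas_Q: "atlas Q = {(\<pi> ` V, \<lambda>y. c (inv_into V \<pi> y)) | U c V.
         (U, c) \<in> atlas (gman N) \<and> openin T V \<and> V \<subseteq> U \<and> inj_on \<pi> V}"
  by (simp add: coset_manifold_def)

lemma continuous_\<pi>: "continuous_map T (mtop Q) \<pi>"
  unfolding continuous_map_def mtop_Q openin_quotient_topology by auto

lemma open_\<pi>: "openin T W \<Longrightarrow> openin (mtop Q) (\<pi> ` W)"
proof -
  assume W: "openin T W"
  have Wc: "W \<subseteq> carrier N" using openin_subset[OF W] pts by simp
  have "{x \<in> carrier N. \<pi> x \<in> \<pi> ` W} = (\<Union>\<gamma>\<in>\<Gamma>. {x \<in> carrier N. \<gamma> \<otimes>\<^bsub>N\<^esub> x \<in> W})"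
  proof (intro equalityI subsetI)
    fix x assume "x \<in> {x \<in> carrier N. \<pi> x \<in> \<pi> ` W}"
    then obtain w where w: "x \<in> carrier N" "w \<in> W" "\<pi> w = \<pi> x" by auto
    then obtain \<gamma> where "\<gamma> \<in> \<Gamma>" "w = \<gamma> \<otimes>\<^bsub>N\<^esub> x" using \<pi>_eqE Wc by blast
    then show "x \<in> (\<Union>\<gamma>\<in>\<Gamma>. {x \<in> carrier N. \<gamma> \<otimes>\<^bsub>N\<^esub> x \<in> W})" using w by blast
  next
    fix x assume "x \<in> (\<Union>\<gamma>\<in>\<Gamma>. {x \<in> carrier N. \<gamma> \<otimes>\<^bsub>N\<^esub> x \<in> W})"
    then obtain \<gamma> where g: "\<gamma> \<in> \<Gamma>" "x \<in> carrier N" "\<gamma> \<otimes>\<^bsub>N\<^esub> x \<in> W" by blast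
    then show "x \<in> {x \<in> carrier N. \<pi> x \<in> \<pi> ` W}" using \<pi>_translate[OF g(1,2)] by (metis (mono_tags, lifting) image_eqI mem_Collect_eq)
  qed
  moreover have "openin T (\<Union>\<gamma>\<in>\<Gamma>. {x \<in> carrier N. \<gamma> \<otimes>\<^bsub>N\<^esub> x \<in> W})"
    using open_left[OF \<Gamma>_carrier W] by blast
  ultimately have "openin T {x \<in> topspace T. \<pi> x \<in> \<pi> ` W}" unfolding pts by (simp only:)
  then show ?thesis unfolding mtop_Q openin_quotient_topology using Wc pts by blast
qed

text \<open>Near a given point, projecting and then lifting into \<open>V\<close> is left
  translation by a single element of \<open>\<Gamma>\<close>. Hence the transition maps of the coset
  charts are smooth, and so is the projection.\<close>

lemma sm_fun_local_section:
  assumes Uc: "(U, c) \<in> atlas (gman N)" and V: "openin T V" "V \<subseteq> U" "inj_on \<pi> V" and i: "i < mdim (gman N)"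
  shows "sm_fun (gman N) {x \<in> carrier N. \<pi> x \<in> \<pi> ` V} (\<lambda>x. c (inv_into V \<pi> (\<pi> x)) i)"
proof (rule sm_fun_local[OF mfd])
  have Vc: "V \<subseteq> carrier N" using openin_subset[OF V(1)] pts by simp
  show "openin T {x \<in> carrier N. \<pi> x \<in> \<pi> ` V}"
    using openin_continuous_map_preimage[OF continuous_\<pi> open_\<pi>[OF V(1)]] pts by simp
  fix x assume "x \<in> {x \<in> carrier N. \<pi> x \<in> \<pi> ` V}"
  then obtain w where w: "x \<in> carrier N" "w \<in> V" "\<pi> w = \<pi> x" by auto
  then obtain \<gamma> where g: "\<gamma> \<in> \<Gamma>" "w = \<gamma> \<otimes>\<^bsub>N\<^esub> x" using \<pi>_eqE Vc by blast
  let ?W = "{x \<in> carrier N. \<gamma> \<otimes>\<^bsub>N\<^esub> x \<in> V}"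
  have oW: "openin T ?W" by (rule open_left[OF \<Gamma>_carrier[OF g(1)] V(1)])
  have "sm_fun (gman N) ?W (\<lambda>x. c (\<gamma> \<otimes>\<^bsub>N\<^esub> x) i)"
    by (rule sm_fun_subset[OF mfd smooth_mapD[OF mfd smooth_left[OF \<Gamma>_carrier[OF g(1)]] Uc i]])
      (use V(2) pts in auto)
  then have "sm_fun (gman N) ?W (\<lambda>x. c (inv_into V \<pi> (\<pi> x)) i)"
  proof (rule sm_fun_cong[OF mfd oW])
    fix y assume y: "y \<in> ?W"
    have "\<pi> y = \<pi> (\<gamma> \<otimes>\<^bsub>N\<^esub> y)" using \<pi>_translate[OF g(1)] y by simp
    then have "inv_into V \<pi> (\<pi> y) = \<gamma> \<otimes>\<^bsub>N\<^esub> y" using inv_into_f_f[OF V(3)] y by simp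
    then show "c (\<gamma> \<otimes>\<^bsub>N\<^esub> y) i = c (inv_into V \<pi> (\<pi> y)) i" by simp
  qed
  then show "\<exists>W'. openin T W' \<and> x \<in> W' \<and> sm_fun (gman N) W' (\<lambda>x. c (inv_into V \<pi> (\<pi> x)) i)"
    using oW w g by blast
qed

context
  fixes U c V
  assumes Uc: "(U, c) \<in> atlas (gman N)" and V: "openin T V" "V \<subseteq> U" "inj_on \<pi> V"
begin

lemma V_carrier: "V \<subseteq> carrier N" using openin_subset[OF V(1)] pts by simp

lemma coset_chart: "(\<pi> ` V, \<lambda>y. c (inv_into V \<pi> y)) \<in> atlas Q"
  unfolding atlas_Q using Uc V by blast

lemma coset_chart_image: "(\<lambda>y. c (inv_into V \<pi> y)) ` (\<pi> ` V \<inter> W) = c ` (V \<inter> {x. \<pi> x \<in> W})"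
proof -
  have "\<pi> ` V \<inter> W = \<pi> ` (V \<inter> {x. \<pi> x \<in> W})" by blast
  then have "(\<lambda>y. c (inv_into V \<pi> y)) ` (\<pi> ` V \<inter> W) = (\<lambda>x. c (inv_into V \<pi> (\<pi> x))) ` (V \<inter> {x. \<pi> x \<in> W})"
    by (simp only: image_image)
  also have "\<dots> = c ` (V \<inter> {x. \<pi> x \<in> W})"
    by (rule image_cong[OF refl], subst inv_into_f_f[OF V(3)]) auto
  finally show ?thesis .
qed

lemma coset_chart_inv:
  assumes "x \<in> c ` V"
  shows "inv_into (\<pi> ` V) (\<lambda>y. c (inv_into V \<pi> y)) x = \<pi> (inv_into U c x)"
proof -
  obtain v where v: "v \<in> V" "x = c v" using assms by blast
  have "inj_on (\<lambda>y. c (inv_into V \<pi> y)) (\<pi> ` V)"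
  proof (rule inj_onI)
    fix y z assume yz: "y \<in> \<pi> ` V" "z \<in> \<pi> ` V" "c (inv_into V \<pi> y) = c (inv_into V \<pi> z)"
    have "inv_into V \<pi> y = inv_into V \<pi> z"
      by (rule inj_onD[OF chart_inj[OF mfd Uc] yz(3) subsetD[OF V(2) inv_into_into[OF yz(1)]]
            subsetD[OF V(2) inv_into_into[OF yz(2)]]])
    then show "y = z" by (rule inv_into_injective[OF _ yz(1,2)])
  qed
  moreover have "c (inv_into V \<pi> (\<pi> v)) = x" using inv_into_f_f[OF V(3) v(1)] v(2) by simp
  ultimately have "inv_into (\<pi> ` V) (\<lambda>y. c (inv_into V \<pi> y)) x = \<pi> v"
    using v(1) by (intro inv_into_f_eq) auto
  then show ?thesis using chart_inv[OF mfd Uc subsetD[OF V(2) v(1)]] v(2) by simp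
qed

lemma coset_chart_homeo:
  "homeomorphic_map (subtopology (mtop Q) (\<pi> ` V)) (subtopology (Euclidean_space (mdim (gman N))) (c ` V))
     (\<lambda>y. c (inv_into V \<pi> y))"
proof -
  let ?E = "Euclidean_space (mdim (gman N))"
  have tV: "topspace (subtopology T V) = V" using V_carrier pts by (simp add: inf.absorb2)
  have tQ: "topspace (subtopology (mtop Q) (\<pi> ` V)) = \<pi> ` V"
    using openin_subset[OF open_\<pi>[OF V(1)]] by (simp add: inf.absorb2)
  have h: "homeomorphic_map (subtopology T V) (subtopology (mtop Q) (\<pi> ` V)) \<pi>"
  proof (rule bijective_open_imp_homeomorphic_map)
    show "continuous_map (subtopology T V) (subtopology (mtop Q) (\<pi> ` V)) \<pi>"
      unfolding continuous_map_in_subtopology tV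
      using continuous_map_from_subtopology[OF continuous_\<pi>] by blast
    show "open_map (subtopology T V) (subtopology (mtop Q) (\<pi> ` V)) \<pi>"
      unfolding open_map_def
    proof (intro allI impI)
      fix W assume "openin (subtopology T V) W"
      then have "openin T W" "W \<subseteq> V" using openin_open_subtopology[OF V(1)] by auto
      then show "openin (subtopology (mtop Q) (\<pi> ` V)) (\<pi> ` W)"
        using openin_open_subtopology[OF open_\<pi>[OF V(1)]] open_\<pi> by blast
    qed
  qed (use tV tQ V(3) in auto)
  then obtain g where g: "homeomorphic_maps (subtopology T V) (subtopology (mtop Q) (\<pi> ` V)) \<pi> g"
    unfolding homeomorphic_map_maps by blast
  then have hg: "homeomorphic_map (subtopology (mtop Q) (\<pi> ` V)) (subtopology T V) g"
    unfolding homeomorphic_maps_map by blast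
  have gp: "g y = inv_into V \<pi> y" if y: "y \<in> \<pi> ` V" for y
  proof -
    obtain v where "v \<in> V" "y = \<pi> v" using y by blast
    then show ?thesis using g inv_into_f_f[OF V(3)] unfolding homeomorphic_maps_def tV by simp
  qed
  have "homeomorphic_map (subtopology (subtopology T U) V) (subtopology (subtopology ?E (c ` U)) (c ` V)) c"
  proof (rule homeomorphic_map_subtopologies[OF chart_homeo(1)[OF mfd Uc]])
    have "topspace (subtopology ?E (c ` U)) = c ` U"
      using openin_subset[OF chart_homeo(3)[OF mfd Uc]] by (simp add: inf.absorb2)
    moreover have "topspace (subtopology T U) = U" using chart_sub[OF mfd Uc] by (simp add: inf.absorb2)
    ultimately show "c ` (topspace (subtopology T U) \<inter> V) = topspace (subtopology ?E (c ` U)) \<inter> c ` V"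
      using V(2) by blast
  qed
  moreover have "subtopology (subtopology T U) V = subtopology T V"
    "subtopology (subtopology ?E (c ` U)) (c ` V) = subtopology ?E (c ` V)"
    using V(2) by (simp_all add: subtopology_subtopology inf.absorb2 image_mono)
  ultimately have hc: "homeomorphic_map (subtopology T V) (subtopology ?E (c ` V)) c" by simp
  from homeomorphic_map_compose[OF hg hc]
  have "homeomorphic_map (subtopology (mtop Q) (\<pi> ` V)) (subtopology ?E (c ` V)) (c \<circ> g)" .
  then show ?thesis by (rule homeomorphic_map_eq) (use gp tQ in auto)
qed

end

lemma atlas_QE:
  assumes "(W, d) \<in> atlas Q"
  obtains U c V where "(U, c) \<in> atlas (gman N)" "openin T V" "V \<subseteq> U" "inj_on \<pi> V"
    "W = \<pi> ` V" "d = (\<lambda>y. c (inv_into V \<pi> y))"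
  using assms unfolding atlas_Q by blast

lemma coset_chart_exists:
  assumes "x \<in> carrier N"
  obtains U c V where "(U, c) \<in> atlas (gman N)" "openin T V" "V \<subseteq> U" "inj_on \<pi> V" "x \<in> V"
proof -
  obtain U c where Uc: "(U, c) \<in> atlas (gman N)" "x \<in> U" using chart_exists[OF mfd] assms pts by blast
  obtain V where V: "openin T V" "x \<in> V" "inj_on \<pi> V" by (rule inj_nbhd[OF assms])
  show ?thesis
    using that[OF Uc(1), of "U \<inter> V"] Uc V chart_homeo(2)[OF mfd Uc(1)] inj_on_subset[OF V(3)] by blast
qed

lemma smooth_manifold_Q: "smooth_manifold Q"
  unfolding smooth_manifold_def
proof (intro conjI)
  show "Hausdorff_space (mtop Q)"
    unfolding Hausdorff_space_def
  proof (intro allI impI)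
    fix y z assume yz: "y \<in> points Q \<and> z \<in> points Q \<and> y \<noteq> z"
    then obtain a b where ab: "a \<in> carrier N" "b \<in> carrier N" "y = \<pi> a" "z = \<pi> b" unfolding points_Q by blast
    \<comment> \<open>Distinct cosets mean that a b^-1 avoids \<open>\<Gamma>\<close>; the
      complement of \<open>\<Gamma>\<close> being open, this persists for points near
      \<open>a\<close> and \<open>b\<close>.\<close>
    then have "a \<otimes>\<^bsub>N\<^esub> inv\<^bsub>N\<^esub> b \<in> carrier N - \<Gamma>" using yz \<pi>_eq_iff by simp
    from quot_nbhd[OF closed_\<Gamma> ab(1,2) this] obtain A B where AB: "openin T A" "openin T B" "a \<in> A" "b \<in> B"
      "\<And>a b. a \<in> A \<Longrightarrow> b \<in> B \<Longrightarrow> a \<otimes>\<^bsub>N\<^esub> inv\<^bsub>N\<^esub> b \<in> carrier N - \<Gamma>" by blast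
    have Ac: "A \<subseteq> carrier N" "B \<subseteq> carrier N" using openin_subset AB(1,2) pts by auto
    have "\<pi> x \<noteq> \<pi> w" if "x \<in> A" "w \<in> B" for x w
      using AB(5)[OF that] \<pi>_eq_iff[of x w] that Ac by blast
    then have "disjnt (\<pi> ` A) (\<pi> ` B)" unfolding disjnt_iff by blast
    then show "\<exists>U V. openin (mtop Q) U \<and> openin (mtop Q) V \<and> y \<in> U \<and> z \<in> V \<and> disjnt U V"
      using open_\<pi>[OF AB(1)] open_\<pi>[OF AB(2)] AB(3,4) ab(3,4) by blast
  qed
  show "second_countable (mtop Q)"
  proof (rule second_countable_open_map_image[OF continuous_\<pi>])
    show "open_map T (mtop Q) \<pi>" unfolding open_map_def using open_\<pi> by blast
    show "\<pi> ` points (gman N) = points Q" unfolding points_Q pts ..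
    show "second_countable T" using mfd unfolding smooth_manifold_def by (elim conjE)
  qed
  show "(\<Union>(U, c)\<in>atlas Q. U) = points Q"
  proof (intro equalityI subsetI)
    fix y assume "y \<in> (\<Union>(U, c)\<in>atlas Q. U)"
    then obtain W d where "(W, d) \<in> atlas Q" "y \<in> W" by blast
    then show "y \<in> points Q"
    proof (elim atlas_QE)
      fix U c V assume V: "openin T V" "W = \<pi> ` V"
      show "y \<in> points Q" using subsetD[OF openin_subset[OF open_\<pi>[OF V(1)]]] \<open>y \<in> W\<close> V(2) by blast
    qed
  next
    fix y assume "y \<in> points Q"
    then obtain x where x: "x \<in> carrier N" "y = \<pi> x" unfolding points_Q by blast
    obtain U c V where A: "(U, c) \<in> atlas (gman N)" "openin T V" "V \<subseteq> U" "inj_on \<pi> V" "x \<in> V"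
      by (rule coset_chart_exists[OF x(1)])
    then show "y \<in> (\<Union>(U, c)\<in>atlas Q. U)"
      using coset_chart[OF A(1-4)] x(2) by blast
  qed
  show "\<forall>(U, c)\<in>atlas Q. openin (mtop Q) U \<and> openin (Euclidean_space (mdim Q)) (c ` U) \<and>
      homeomorphic_map (subtopology (mtop Q) U) (subtopology (Euclidean_space (mdim Q)) (c ` U)) c"
  proof (intro ballI, clarify, elim atlas_QE, intro conjI)
    fix W d U c V
    assume A: "(U, c) \<in> atlas (gman N)" "openin T V" "V \<subseteq> U" "inj_on \<pi> V" and W: "W = \<pi> ` V" and d: "d = (\<lambda>y. c (inv_into V \<pi> y))"
    have dW: "d ` W = c ` V" using coset_chart_image[OF A, of UNIV] unfolding W d by simp
    show "openin (mtop Q) W" unfolding W by (rule open_\<pi>[OF A(2)])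
    show "openin (Euclidean_space (mdim Q)) (d ` W)"
      unfolding dW mdim_Q using chart_image_open[OF mfd A(1,2)] A(3) by (simp add: inf.absorb2)
    show "homeomorphic_map (subtopology (mtop Q) W) (subtopology (Euclidean_space (mdim Q)) (d ` W)) d"
      unfolding dW mdim_Q unfolding W d by (rule coset_chart_homeo[OF A])
  qed
  have "smooth_on (mdim Q) (d ` (W \<inter> W')) (\<lambda>x. d' (inv_into W d x) i)"
    if Wd: "(W, d) \<in> atlas Q" and Wd': "(W', d') \<in> atlas Q" and i: "i < mdim Q" for W d W' d' i
  proof -
    from Wd obtain U c V where A: "(U, c) \<in> atlas (gman N)" "openin T V" "V \<subseteq> U" "inj_on \<pi> V"
      and W: "W = \<pi> ` V" and d: "d = (\<lambda>y. c (inv_into V \<pi> y))" by (rule atlas_QE)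
    from Wd' obtain U' c' V' where A': "(U', c') \<in> atlas (gman N)" "openin T V'" "V' \<subseteq> U'" "inj_on \<pi> V'"
      and W': "W' = \<pi> ` V'" and d': "d' = (\<lambda>y. c' (inv_into V' \<pi> y))" by (rule atlas_QE)
    have i': "i < mdim (gman N)" using i mdim_Q by simp
    let ?S = "{x \<in> carrier N. \<pi> x \<in> \<pi> ` V'}"
    have im: "d ` (W \<inter> W') = c ` (V \<inter> {x. \<pi> x \<in> W'})" unfolding W d by (rule coset_chart_image[OF A])
    have oS: "openin T ?S"
      using openin_continuous_map_preimage[OF continuous_\<pi> open_\<pi>[OF A'(2)]] pts by simp
    have VS: "V \<inter> {x. \<pi> x \<in> W'} = U \<inter> (V \<inter> ?S)"
      using V_carrier[OF A] A(3) unfolding W' by blast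
    have "openin T (V \<inter> ?S)" using A(2) oS by blast
    then have op: "openin (Euclidean_space (mdim (gman N))) (c ` (V \<inter> {x. \<pi> x \<in> W'}))"
      unfolding VS by (rule chart_image_open[OF mfd A(1)])
    have "smooth_on (mdim (gman N)) (c ` (U \<inter> ?S)) (\<lambda>x. c' (inv_into V' \<pi> (\<pi> (inv_into U c x))) i)"
      by (rule sm_funD[where f = "\<lambda>x. c' (inv_into V' \<pi> (\<pi> x)) i", OF sm_fun_local_section[OF A' i'] A(1)])
    then have "smooth_on (mdim (gman N)) (c ` (V \<inter> {x. \<pi> x \<in> W'})) (\<lambda>x. c' (inv_into V' \<pi> (\<pi> (inv_into U c x))) i)"
      by (rule smooth_on_subset) (use VS in blast)
    then have "smooth_on (mdim (gman N)) (c ` (V \<inter> {x. \<pi> x \<in> W'})) (\<lambda>x. d' (inv_into W d x) i)"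
    proof (rule smooth_on_cong[OF op])
      fix x assume "x \<in> c ` (V \<inter> {x. \<pi> x \<in> W'})"
      then have "x \<in> c ` V" by blast
      then show "c' (inv_into V' \<pi> (\<pi> (inv_into U c x))) i = d' (inv_into W d x) i"
        unfolding W d d' using coset_chart_inv[OF A] by simp
    qed
    then show ?thesis unfolding im mdim_Q .
  qed
  then show "\<forall>(U, c)\<in>atlas Q. \<forall>(U', c')\<in>atlas Q. \<forall>i<mdim Q.
      smooth_on (mdim Q) (c ` (U \<inter> U')) (\<lambda>x. c' (inv_into U c x) i)" by blast
qed

lemma smooth_\<pi>: "smooth_map (gman N) Q \<pi>"
proof (rule smooth_mapI[OF mfd continuous_\<pi>])
  fix W d i assume Wd: "(W, d) \<in> atlas Q" and i: "i < mdim Q"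
  from Wd obtain U c V where A: "(U, c) \<in> atlas (gman N)" "openin T V" "V \<subseteq> U" "inj_on \<pi> V"
    and W: "W = \<pi> ` V" and d: "d = (\<lambda>y. c (inv_into V \<pi> y))" by (rule atlas_QE)
  show "sm_fun (gman N) {x \<in> points (gman N). \<pi> x \<in> W} (\<lambda>x. d (\<pi> x) i)"
    unfolding W d pts by (rule sm_fun_local_section[OF A]) (use i mdim_Q in simp)
qed

text \<open>In a coset chart a function on the quotient has the same coordinate expression as its
  pullback in the underlying chart of \<open>N\<close>, so smoothness can be tested
  upstairs.\<close>

lemma smooth_functions_QI:
  assumes f: "(\<lambda>x. if x \<in> carrier N then f (\<pi> x) else 0) \<in> smooth_functions (gman N)"
    and 0: "\<And>y. y \<notin> points Q \<Longrightarrow> f y = 0"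
  shows "f \<in> smooth_functions Q"
proof -
  have "smooth_on (mdim Q) (d ` (W \<inter> points Q)) (\<lambda>x. f (inv_into W d x))" if Wd: "(W, d) \<in> atlas Q" for W d
  proof -
    from Wd obtain U c V where A: "(U, c) \<in> atlas (gman N)" "openin T V" "V \<subseteq> U" "inj_on \<pi> V"
      and W: "W = \<pi> ` V" and d: "d = (\<lambda>y. c (inv_into V \<pi> y))" by (rule atlas_QE)
    have "W \<inter> points Q = W \<inter> UNIV" using chart_sub[OF smooth_manifold_Q Wd] by blast
    then have im: "d ` (W \<inter> points Q) = c ` V" using coset_chart_image[OF A, of UNIV] unfolding W d by simp
    have op: "openin (Euclidean_space (mdim (gman N))) (c ` V)"
      using chart_image_open[OF mfd A(1,2)] A(3) by (simp add: inf.absorb2)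
    have "smooth_on (mdim (gman N)) (c ` V) (\<lambda>x. (\<lambda>x. if x \<in> carrier N then f (\<pi> x) else 0) (inv_into U c x))"
      by (rule smooth_on_subset[OF smooth_functions_chart[OF mfd A(1) f]]) (use A(3) in blast)
    then have "smooth_on (mdim (gman N)) (c ` V) (\<lambda>x. f (inv_into W d x))"
    proof (rule smooth_on_cong[OF op])
      fix x assume x: "x \<in> c ` V"
      then obtain v where v: "v \<in> V" "x = c v" by blast
      have "inv_into U c x = v" unfolding v(2) by (rule chart_inv[OF mfd A(1) subsetD[OF A(3) v(1)]])
      then have "inv_into U c x \<in> carrier N" using V_carrier[OF A] v(1) by blast
      then show "(\<lambda>x. if x \<in> carrier N then f (\<pi> x) else 0) (inv_into U c x) = f (inv_into W d x)"
        unfolding W d using coset_chart_inv[OF A x] by simp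
    qed
    then show ?thesis unfolding im mdim_Q .
  qed
  then have "sm_fun Q (points Q) f" by (rule sm_funI)
  then show ?thesis unfolding mem_smooth_functions[OF smooth_manifold_Q] using 0 by blast
qed

end

section \<open>Left-invariant frames\<close>

text \<open>Elimination of one unknown \<open>k\<close> through the last equation. The dimension
  counts and matrix inversions below are all reduced to this statement, applied to one vector more
  than there are equations.\<close>

lemma homogeneous_system:
  fixes A :: "'i \<Rightarrow> nat \<Rightarrow> real"
  assumes "finite I" "n < card I"
  shows "\<exists>c. (\<exists>i\<in>I. c i \<noteq> 0) \<and> (\<forall>j<n. (\<Sum>i\<in>I. c i * A i j) = 0)"
  using assms
proof (induction n arbitrary: I A)
  case 0
  then obtain i where "i \<in> I" by fastforce
  then show ?case by (intro exI[of _ "\<lambda>_. 1"]) auto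
next
  case (Suc n)
  show ?case
  proof (cases "\<forall>i\<in>I. A i n = 0")
    case True
    from Suc.IH[OF Suc.prems(1), of A] Suc.prems(2) obtain c where
      c: "\<exists>i\<in>I. c i \<noteq> 0" "\<forall>j<n. (\<Sum>i\<in>I. c i * A i j) = 0" by auto
    then show ?thesis using True by (intro exI[of _ c]) (auto simp: less_Suc_eq)
  next
    case False
    then obtain k where k: "k \<in> I" "A k n \<noteq> 0" by blast
    define B where "B = (\<lambda>i j. A i j - A i n / A k n * A k j)"
    have "finite (I - {k})" "n < card (I - {k})" using Suc.prems k by auto
    from Suc.IH[OF this, of B] obtain c where
      c: "\<exists>i\<in>I - {k}. c i \<noteq> 0" "\<forall>j<n. (\<Sum>i\<in>I - {k}. c i * B i j) = 0" by blast
    define s where "s = - (\<Sum>i\<in>I - {k}. c i * (A i n / A k n))"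
    define c' where "c' = c(k := s)"
    have split: "(\<Sum>i\<in>I. c' i * A i j) = (\<Sum>i\<in>I - {k}. c i * A i j) + s * A k j" for j
    proof -
      have "(\<Sum>i\<in>I. c' i * A i j) = c' k * A k j + (\<Sum>i\<in>I - {k}. c' i * A i j)"
        by (rule sum.remove[OF Suc.prems(1) k(1)])
      also have "(\<Sum>i\<in>I - {k}. c' i * A i j) = (\<Sum>i\<in>I - {k}. c i * A i j)"
        by (rule sum.cong) (auto simp: c'_def)
      finally show ?thesis by (simp add: c'_def)
    qed
    have B: "(\<Sum>i\<in>I - {k}. c i * B i j) = (\<Sum>i\<in>I - {k}. c i * A i j) + s * A k j" for j
      by (simp add: B_def s_def right_diff_distrib sum_subtractf sum_distrib_right mult.assoc)
    have "(\<Sum>i\<in>I. c' i * A i j) = 0" if "j < Suc n" for j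
    proof (cases "j = n")
      case True
      then show ?thesis unfolding split using k(2) by (simp add: s_def sum_distrib_right)
    next
      case False
      then show ?thesis unfolding split B[symmetric] using c(2) that by simp
    qed
    moreover have "\<exists>i\<in>I. c' i \<noteq> 0" using c(1) by (auto simp: c'_def)
    ultimately show ?thesis by blast
  qed
qed

lemma vector_fieldsI:
  assumes "\<And>f. f \<notin> smooth_functions M \<Longrightarrow> X f = (\<lambda>p. 0)"
    "\<And>f. f \<in> smooth_functions M \<Longrightarrow> X f \<in> smooth_functions M"
    "\<And>f h a b p. f \<in> smooth_functions M \<Longrightarrow> h \<in> smooth_functions M \<Longrightarrow>
       X (\<lambda>p. a * f p + b * h p) p = a * X f p + b * X h p"
    "\<And>f h p. f \<in> smooth_functions M \<Longrightarrow> h \<in> smooth_functions M \<Longrightarrow>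
       X (\<lambda>p. f p * h p) p = f p * X h p + h p * X f p"
  shows "X \<in> vector_fields M"
  unfolding vector_fields_def using assms by (auto simp: fun_eq_iff)

lemma vector_fieldsD:
  assumes "X \<in> vector_fields M"
  shows "f \<notin> smooth_functions M \<Longrightarrow> X f p = 0"
    "f \<in> smooth_functions M \<Longrightarrow> X f \<in> smooth_functions M"
  using assms unfolding vector_fields_def by auto

text \<open>Only pointwise independence is asked for; since the number of fields is the dimension,
  spanning follows by counting.\<close>

definition framing :: "'a manifold \<Rightarrow> 'a vfield list \<Rightarrow> bool" where
  "framing M Es \<longleftrightarrow> set Es \<subseteq> vector_fields M \<and> length Es = mdim M \<and>
     (\<forall>p\<in>points M. \<forall>a. (\<forall>f\<in>smooth_functions M. (\<Sum>i<mdim M. a i * (Es ! i) f p) = 0) \<longrightarrow> (\<forall>i<mdim M. a i = 0))"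

context lie_quotient
begin

interpretation group N by (rule grp)

abbreviation "G \<equiv> gman N"

lemma lie_algebra_vf: "X \<in> lie_algebra N \<Longrightarrow> X \<in> vector_fields G"
  by (simp add: lie_algebra_def)

lemma left_inv:
  assumes "X \<in> lie_algebra N" "f \<in> smooth_functions G" "a \<in> carrier N" "x \<in> carrier N"
  shows "X (pull_fun G (\<lambda>x. a \<otimes>\<^bsub>N\<^esub> x) f) x = X f (a \<otimes>\<^bsub>N\<^esub> x)"
proof -
  have "X (pull_fun G (\<lambda>x. a \<otimes>\<^bsub>N\<^esub> x) f) = pull_fun G (\<lambda>x. a \<otimes>\<^bsub>N\<^esub> x) (X f)"
    using assms(1-3) unfolding lie_algebra_def by blast
  then show ?thesis using assms(4) pts by (simp add: pull_fun_def)
qed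

lemma zero_lie_algebra: "(\<lambda>f p. 0) \<in> lie_algebra N"
proof -
  have "(\<lambda>f p. 0) \<in> vector_fields G"
    by (rule vector_fieldsI) (use smooth_functions_zero[OF mfd] in auto)
  then show ?thesis unfolding lie_algebra_def by (auto simp: pull_fun_def)
qed

text \<open>A linear relation at one point spreads to every point by left translation, and a
  relation between the fields themselves contradicts the uniqueness of coordinates of the zero
  field.\<close>

lemma lie_basis_independent_at:
  assumes B: "is_basis (lie_algebra N) Es" and x: "x \<in> carrier N"
    and a: "\<And>f. f \<in> smooth_functions G \<Longrightarrow> (\<Sum>i<length Es. a i * (Es ! i) f x) = 0"
  shows "\<forall>i<length Es. a i = 0"
proof -
  define a' where "a' = (\<lambda>i. if i < length Es then a i else 0)"
  have Es: "Es ! i \<in> lie_algebra N" if "i < length Es" for i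
    using B that unfolding is_basis_def by (meson nth_mem subsetD)
  have zero: "(\<Sum>i<length Es. a i * (Es ! i) f y) = 0" for f y
  proof (cases "f \<in> smooth_functions G \<and> y \<in> carrier N")
    case True
    let ?b = "y \<otimes>\<^bsub>N\<^esub> inv\<^bsub>N\<^esub> x"
    have b: "?b \<in> carrier N" "?b \<otimes>\<^bsub>N\<^esub> x = y" using True x by (simp_all add: m_assoc)
    have p: "pull_fun G (\<lambda>x. ?b \<otimes>\<^bsub>N\<^esub> x) f \<in> smooth_functions G"
      by (rule pull_fun_smooth[OF mfd mfd smooth_left[OF b(1)]]) (use True in simp)
    have "(Es ! i) f y = (Es ! i) (pull_fun G (\<lambda>x. ?b \<otimes>\<^bsub>N\<^esub> x) f) x" if "i < length Es" for i
      using left_inv[OF Es[OF that] _ b(1) x] True b(2) by simp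
    then show ?thesis using a[OF p] by simp
  next
    case False
    have "(Es ! i) f y = 0" if "i < length Es" for i
    proof (cases "f \<in> smooth_functions G")
      case True
      then show ?thesis
        using False smooth_functions_0[OF mfd vector_fieldsD(2)[OF lie_algebra_vf[OF Es[OF that]] True]] pts by simp
    next
      case False
      then show ?thesis using vector_fieldsD(1)[OF lie_algebra_vf[OF Es[OF that]]] by simp
    qed
    then show ?thesis by simp
  qed
  have 1: "(\<lambda>f p. 0) = lincomb a' Es"
    unfolding lincomb_def a'_def using zero by (simp add: fun_eq_iff)
  have 2: "(\<lambda>f p. 0) = lincomb (\<lambda>i. 0) Es" unfolding lincomb_def by simp
  have "\<exists>!c. (\<forall>i\<ge>length Es. c i = 0) \<and> (\<lambda>f p. 0) = lincomb c Es"
    using B zero_lie_algebra unfolding is_basis_def by blast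
  then have "a' = (\<lambda>i. 0)" using 1 2 by (metis (mono_tags, lifting) a'_def not_le)
  then show ?thesis unfolding a'_def by (metis (full_types))
qed

text \<open>The field is X f (a) = D (y \<mapsto> f (a y)). Its smoothness in \<open>a\<close> is
  differentiation of f composed with the multiplication along the second factor of the
  product.\<close>

lemma left_invariant_extension:
  assumes D: "pt_deriv G \<one>\<^bsub>N\<^esub> D"
  obtains X where "X \<in> lie_algebra N" "\<And>f. f \<in> smooth_functions G \<Longrightarrow> X f \<one>\<^bsub>N\<^esub> = D f"
proof -
  \<comment> \<open>\<open>pull_fun\<close> on the product is used so that \<open>F f a\<close>
    vanishes off the group and counts as a smooth function for every \<open>a\<close>.\<close>
  define F where "F = (\<lambda>f a y. pull_fun (prod_manifold G G) (\<lambda>(x, y). x \<otimes>\<^bsub>N\<^esub> y) f (a, y))"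
  have F: "F f a y = (if a \<in> carrier N \<and> y \<in> carrier N then f (a \<otimes>\<^bsub>N\<^esub> y) else 0)" for f a y
    unfolding F_def pull_fun_def using pts by simp
  have pull: "pull_fun (prod_manifold G G) (\<lambda>(x, y). x \<otimes>\<^bsub>N\<^esub> y) f \<in> smooth_functions (prod_manifold G G)"
    if "f \<in> smooth_functions G" for f
    by (rule pull_fun_smooth[OF smooth_manifold_prod[OF mfd mfd] mfd smooth_mult that])
  have Fs: "F f a \<in> smooth_functions G" if "f \<in> smooth_functions G" for f a
    using smooth_functions_slice[OF mfd mfd pull[OF that], of a] unfolding F_def by simp
  define X where "X = (\<lambda>f a. if f \<in> smooth_functions G then D (F f a) else 0)"
  have e: "\<one>\<^bsub>N\<^esub> \<in> points G" using pts by simp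
  have Xs: "X f \<in> smooth_functions G" if "f \<in> smooth_functions G" for f
    using smooth_functions_partial_deriv[OF mfd mfd e D pull[OF that]] that unfolding X_def F_def by simp
  have Xvf: "X \<in> vector_fields G"
  proof (rule vector_fieldsI)
    show "X f = (\<lambda>p. 0)" if "f \<notin> smooth_functions G" for f using that by (simp add: X_def)
    show "X f \<in> smooth_functions G" if "f \<in> smooth_functions G" for f by (rule Xs[OF that])
    fix f h a b p assume f: "f \<in> smooth_functions G" and h: "h \<in> smooth_functions G"
    have s: "(\<lambda>p. a * f p + b * h p) \<in> smooth_functions G"
      by (rule smooth_functions_add[OF mfd smooth_functions_scale[OF mfd f] smooth_functions_scale[OF mfd h]])
    have "F (\<lambda>p. a * f p + b * h p) p = (\<lambda>y. a * F f p y + b * F h p y)" by (auto simp: F fun_eq_iff)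
    then show "X (\<lambda>p. a * f p + b * h p) p = a * X f p + b * X h p"
      using f h s pt_deriv_linear[OF D Fs[OF f] Fs[OF h]] by (simp add: X_def)
    have s: "(\<lambda>p. f p * h p) \<in> smooth_functions G" by (rule smooth_functions_mult[OF mfd f h])
    have "F (\<lambda>p. f p * h p) p = (\<lambda>y. F f p y * F h p y)" by (auto simp: F fun_eq_iff)
    then have X: "X (\<lambda>p. f p * h p) p = F f p \<one>\<^bsub>N\<^esub> * D (F h p) + F h p \<one>\<^bsub>N\<^esub> * D (F f p)"
      using s pt_deriv_mult[OF D Fs[OF f] Fs[OF h]] by (simp add: X_def)
    show "X (\<lambda>p. f p * h p) p = f p * X h p + h p * X f p"
    proof (cases "p \<in> carrier N")
      case True
      then have "F f p \<one>\<^bsub>N\<^esub> = f p" "F h p \<one>\<^bsub>N\<^esub> = h p" by (simp_all add: F)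
      then show ?thesis using X f h by (simp add: X_def)
    next
      case False
      then have "f p = 0" "h p = 0" "F f p \<one>\<^bsub>N\<^esub> = 0" "F h p \<one>\<^bsub>N\<^esub> = 0"
        using smooth_functions_0[OF mfd f] smooth_functions_0[OF mfd h] pts by (simp_all add: F)
      then show ?thesis using X by simp
    qed
  qed
  have "X \<in> lie_algebra N"
    unfolding lie_algebra_def
  proof (intro CollectI conjI ballI Xvf)
    fix b f assume b: "b \<in> carrier N" and f: "f \<in> smooth_functions G"
    let ?L = "\<lambda>x. b \<otimes>\<^bsub>N\<^esub> x"
    have p: "pull_fun G ?L f \<in> smooth_functions G"
      by (rule pull_fun_smooth[OF mfd mfd smooth_left[OF b] f])
    show "X (pull_fun G ?L f) = pull_fun G ?L (X f)"
    proof
      fix a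
      show "X (pull_fun G ?L f) a = pull_fun G ?L (X f) a"
      proof (cases "a \<in> carrier N")
        case True
        have "F (pull_fun G ?L f) a = F f (b \<otimes>\<^bsub>N\<^esub> a)"
          using True b pts by (auto simp: F fun_eq_iff pull_fun_def m_assoc)
        then show ?thesis using True b pts f p by (simp add: X_def pull_fun_def)
      next
        case False
        then show ?thesis using smooth_functions_0[OF mfd Xs[OF p]] pts by (simp add: pull_fun_def)
      qed
    qed
  qed
  moreover have "X f \<one>\<^bsub>N\<^esub> = D f" if f: "f \<in> smooth_functions G" for f
  proof -
    have "F f \<one>\<^bsub>N\<^esub> = f" using smooth_functions_0[OF mfd f] pts by (auto simp: F fun_eq_iff)
    then show ?thesis using f by (simp add: X_def)
  qed
  ultimately show ?thesis using that by blast
qed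

text \<open>With more fields than dimensions, their values at the identity would be dependent. With
  fewer, the left-invariant extensions of the coordinate vectors at the identity would be dependent,
  although they take the values of a Kronecker delta on the functions \<xi>.\<close>

lemma lie_basis_length:
  assumes B: "is_basis (lie_algebra N) Es"
  shows "length Es = mdim G"
proof -
  let ?n = "mdim G" and ?m = "length Es"
  have e: "\<one>\<^bsub>N\<^esub> \<in> carrier N" by simp
  obtain U c where Uc: "(U, c) \<in> atlas G" "\<one>\<^bsub>N\<^esub> \<in> U" using chart_exists[OF mfd] pts e by metis
  obtain \<xi> where \<xi>: "\<And>i. i < ?n \<Longrightarrow> \<xi> i \<in> smooth_functions G"
    "\<And>D f. pt_deriv G \<one>\<^bsub>N\<^esub> D \<Longrightarrow> f \<in> smooth_functions G \<Longrightarrow>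
       D f = (\<Sum>i<?n. D (\<xi> i) * partial i (\<lambda>x. f (inv_into U c x)) (c \<one>\<^bsub>N\<^esub>))"
    "\<And>i j. i < ?n \<Longrightarrow> j < ?n \<Longrightarrow>
       partial i (\<lambda>x. \<xi> j (inv_into U c x)) (c \<one>\<^bsub>N\<^esub>) = (if i = j then 1 else 0)"
    by (rule pt_deriv_coordinates[OF mfd Uc]) blast
  have Es: "Es ! i \<in> vector_fields G" if "i < ?m" for i
    using B that lie_algebra_vf unfolding is_basis_def by (meson nth_mem subsetD)
  have "\<not> ?n < ?m"
  proof
    assume "?n < ?m"
    then obtain a where a: "\<exists>i\<in>{..<?m}. a i \<noteq> 0" "\<forall>j<?n. (\<Sum>i\<in>{..<?m}. a i * (Es ! i) (\<xi> j) \<one>\<^bsub>N\<^esub>) = 0"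
      using homogeneous_system[of "{..<?m}" ?n "\<lambda>i j. (Es ! i) (\<xi> j) \<one>\<^bsub>N\<^esub>"] by auto
    have "(\<Sum>i<?m. a i * (Es ! i) f \<one>\<^bsub>N\<^esub>) = 0" if f: "f \<in> smooth_functions G" for f
    proof -
      let ?p = "\<lambda>j. partial j (\<lambda>x. f (inv_into U c x)) (c \<one>\<^bsub>N\<^esub>)"
      have "(\<Sum>i<?m. a i * (Es ! i) f \<one>\<^bsub>N\<^esub>) = (\<Sum>i<?m. \<Sum>j<?n. a i * (Es ! i) (\<xi> j) \<one>\<^bsub>N\<^esub> * ?p j)"
        by (rule sum.cong[OF refl])
          (simp add: \<xi>(2)[OF vector_fields_pt_deriv[OF Es] f] sum_distrib_left mult.assoc)
      also have "\<dots> = (\<Sum>j<?n. (\<Sum>i<?m. a i * (Es ! i) (\<xi> j) \<one>\<^bsub>N\<^esub>) * ?p j)"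
        by (subst sum.swap) (simp add: sum_distrib_right)
      also have "\<dots> = 0" using a(2) by simp
      finally show ?thesis .
    qed
    then have "\<forall>i<?m. a i = 0" by (rule lie_basis_independent_at[OF B e])
    then show False using a(1) by blast
  qed
  moreover have "\<not> ?m < ?n"
  proof
    assume mn: "?m < ?n"
    have "\<exists>X c'. X \<in> lie_algebra N \<and> (\<forall>j<?n. X (\<xi> j) \<one>\<^bsub>N\<^esub> = (if j = i then 1 else 0)) \<and> X = lincomb c' Es"
      if i: "i < ?n" for i
    proof -
      let ?D = "\<lambda>f. \<Sum>k<?n. (if k = i then 1 else 0) * partial k (\<lambda>x. f (inv_into U c x)) (c \<one>\<^bsub>N\<^esub>)"
      obtain X where X: "X \<in> lie_algebra N" "\<And>f. f \<in> smooth_functions G \<Longrightarrow> X f \<one>\<^bsub>N\<^esub> = ?D f"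
        by (rule left_invariant_extension[OF coordinate_pt_deriv[OF mfd Uc, of "\<lambda>k. if k = i then 1 else 0"]]) blast
      have "X (\<xi> j) \<one>\<^bsub>N\<^esub> = (if j = i then 1 else 0)" if "j < ?n" for j
      proof -
        have "X (\<xi> j) \<one>\<^bsub>N\<^esub> = (\<Sum>k<?n. if k = i then (if k = j then 1 else 0) else 0)"
          unfolding X(2)[OF \<xi>(1)[OF that]]
          by (rule sum.cong[OF refl]) (use \<xi>(3)[OF _ that] in auto)
        also have "\<dots> = (if i = j then 1 else 0)" using i by (simp add: sum.delta)
        finally show ?thesis by auto
      qed
      moreover obtain c' where "X = lincomb c' Es" using B X(1) unfolding is_basis_def by blast
      ultimately show ?thesis using X(1) by blast
    qed
    then obtain X C where X: "\<And>i. i < ?n \<Longrightarrow> X i \<in> lie_algebra N"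
      "\<And>i j. i < ?n \<Longrightarrow> j < ?n \<Longrightarrow> X i (\<xi> j) \<one>\<^bsub>N\<^esub> = (if j = i then 1 else 0)"
      "\<And>i. i < ?n \<Longrightarrow> X i = lincomb (C i) Es" by metis
    obtain a where a: "\<exists>i\<in>{..<?n}. a i \<noteq> 0" "\<forall>j<?m. (\<Sum>i\<in>{..<?n}. a i * C i j) = 0"
      using homogeneous_system[of "{..<?n}" ?m C] mn by auto
    obtain l where l: "l < ?n" "a l \<noteq> 0" using a(1) by blast
    have "(\<Sum>i<?n. a i * X i (\<xi> l) \<one>\<^bsub>N\<^esub>) = (\<Sum>i<?n. \<Sum>j<?m. a i * C i j * (Es ! j) (\<xi> l) \<one>\<^bsub>N\<^esub>)"
      by (rule sum.cong[OF refl]) (simp add: X(3) lincomb_def sum_distrib_left mult.assoc)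
    also have "\<dots> = (\<Sum>j<?m. (\<Sum>i<?n. a i * C i j) * (Es ! j) (\<xi> l) \<one>\<^bsub>N\<^esub>)"
      by (subst sum.swap) (simp add: sum_distrib_right)
    also have "\<dots> = 0" using a(2) by simp
    finally have "(\<Sum>i<?n. a i * X i (\<xi> l) \<one>\<^bsub>N\<^esub>) = 0" .
    moreover have "(\<Sum>i<?n. a i * X i (\<xi> l) \<one>\<^bsub>N\<^esub>) = (\<Sum>i<?n. if i = l then a i else 0)"
      by (rule sum.cong[OF refl]) (use X(2) l(1) in auto)
    ultimately show False using l by (simp add: sum.delta)
  qed
  ultimately show ?thesis by simp
qed

text \<open>The value at a coset is computed at an arbitrary representative. Since the cosets are
  \<Gamma>x, two representatives differ by a left translation, under which the fields in question
  are invariant.\<close>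

definition descend :: "'a vfield \<Rightarrow> 'a set vfield" where
  "descend X = (\<lambda>f q. if f \<in> smooth_functions Q \<and> q \<in> points Q
     then X (pull_fun G \<pi> f) (SOME x. x \<in> carrier N \<and> \<pi> x = q) else 0)"

lemma pull_\<pi>: "f \<in> smooth_functions Q \<Longrightarrow> pull_fun G \<pi> f \<in> smooth_functions G"
  by (rule pull_fun_smooth[OF mfd smooth_manifold_Q smooth_\<pi>])

lemma descend_\<pi>:
  assumes X: "X \<in> lie_algebra N" and f: "f \<in> smooth_functions Q" and x: "x \<in> carrier N"
  shows "descend X f (\<pi> x) = X (pull_fun G \<pi> f) x"
proof -
  define y where "y = (SOME y. y \<in> carrier N \<and> \<pi> y = \<pi> x)"
  have y: "y \<in> carrier N \<and> \<pi> y = \<pi> x" unfolding y_def by (rule someI[of _ x]) (use x in simp)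
  then obtain \<gamma> where g: "\<gamma> \<in> \<Gamma>" "y = \<gamma> \<otimes>\<^bsub>N\<^esub> x" using \<pi>_eqE x by blast
  have "pull_fun G (\<lambda>x. \<gamma> \<otimes>\<^bsub>N\<^esub> x) (pull_fun G \<pi> f) = pull_fun G \<pi> f"
    using \<pi>_translate[OF g(1)] \<Gamma>_carrier[OF g(1)] pts by (auto simp: pull_fun_def fun_eq_iff)
  then have "X (pull_fun G \<pi> f) y = X (pull_fun G \<pi> f) x"
    using left_inv[OF X pull_\<pi>[OF f] \<Gamma>_carrier[OF g(1)] x] g(2) by simp
  moreover have "\<pi> x \<in> points Q" using x points_Q by blast
  ultimately show ?thesis using f unfolding descend_def y_def by simp
qed

lemma pull_\<pi>_descend:
  assumes X: "X \<in> lie_algebra N" and f: "f \<in> smooth_functions Q"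
  shows "pull_fun G \<pi> (descend X f) = X (pull_fun G \<pi> f)"
proof
  fix x
  show "pull_fun G \<pi> (descend X f) x = X (pull_fun G \<pi> f) x"
  proof (cases "x \<in> carrier N")
    case True
    then show ?thesis using descend_\<pi>[OF X f True] pts by (simp add: pull_fun_def)
  next
    case False
    then show ?thesis
      using smooth_functions_0[OF mfd vector_fieldsD(2)[OF lie_algebra_vf[OF X] pull_\<pi>[OF f]]] pts
      by (simp add: pull_fun_def)
  qed
qed

lemma descend_vf:
  assumes X: "X \<in> lie_algebra N" shows "descend X \<in> vector_fields Q"
proof (rule vector_fieldsI)
  show "descend X f = (\<lambda>p. 0)" if "f \<notin> smooth_functions Q" for f using that by (simp add: descend_def)
  show "descend X f \<in> smooth_functions Q" if f: "f \<in> smooth_functions Q" for f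
  proof (rule smooth_functions_QI)
    have "(\<lambda>x. if x \<in> carrier N then descend X f (\<pi> x) else 0) = pull_fun G \<pi> (descend X f)"
      using pts by (auto simp: pull_fun_def)
    then show "(\<lambda>x. if x \<in> carrier N then descend X f (\<pi> x) else 0) \<in> smooth_functions G"
      unfolding pull_\<pi>_descend[OF X f] using vector_fieldsD(2)[OF lie_algebra_vf[OF X] pull_\<pi>[OF f]] by simp
  qed (simp add: descend_def)
  fix f h a b q assume f: "f \<in> smooth_functions Q" and h: "h \<in> smooth_functions Q"
  have s: "(\<lambda>p. a * f p + b * h p) \<in> smooth_functions Q"
    by (rule smooth_functions_add[OF smooth_manifold_Q smooth_functions_scale[OF smooth_manifold_Q f]
          smooth_functions_scale[OF smooth_manifold_Q h]])
  have t: "(\<lambda>p. f p * h p) \<in> smooth_functions Q" by (rule smooth_functions_mult[OF smooth_manifold_Q f h])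
  have "descend X (\<lambda>p. a * f p + b * h p) q = a * descend X f q + b * descend X h q \<and>
      descend X (\<lambda>p. f p * h p) q = f q * descend X h q + h q * descend X f q"
  proof (cases "q \<in> points Q")
    case True
    then obtain x where x: "x \<in> carrier N" "q = \<pi> x" unfolding points_Q by blast
    have 1: "pull_fun G \<pi> (\<lambda>p. a * f p + b * h p) = (\<lambda>y. a * pull_fun G \<pi> f y + b * pull_fun G \<pi> h y)"
      and 2: "pull_fun G \<pi> (\<lambda>p. f p * h p) = (\<lambda>y. pull_fun G \<pi> f y * pull_fun G \<pi> h y)"
      by (auto simp: pull_fun_def fun_eq_iff)
    have D: "pt_deriv G x (\<lambda>f. X f x)" by (rule vector_fields_pt_deriv[OF lie_algebra_vf[OF X]])
    have fx: "pull_fun G \<pi> f x = f q" "pull_fun G \<pi> h x = h q" using x pts by (simp_all add: pull_fun_def)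
    have "X (\<lambda>y. a * pull_fun G \<pi> f y + b * pull_fun G \<pi> h y) x = a * X (pull_fun G \<pi> f) x + b * X (pull_fun G \<pi> h) x"
      using pt_deriv_linear[OF D pull_\<pi>[OF f] pull_\<pi>[OF h]] by simp
    moreover have "X (\<lambda>y. pull_fun G \<pi> f y * pull_fun G \<pi> h y) x = f q * X (pull_fun G \<pi> h) x + h q * X (pull_fun G \<pi> f) x"
      using pt_deriv_mult[OF D pull_\<pi>[OF f] pull_\<pi>[OF h]] fx by simp
    ultimately show ?thesis unfolding x(2)
      using descend_\<pi>[OF X f x(1)] descend_\<pi>[OF X h x(1)] descend_\<pi>[OF X s x(1)] descend_\<pi>[OF X t x(1)] 1 2 x(2)
      by simp
  next
    case False
    then show ?thesis by (simp add: descend_def)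
  qed
  then show "descend X (\<lambda>p. a * f p + b * h p) q = a * descend X f q + b * descend X h q"
    "descend X (\<lambda>p. f p * h p) q = f q * descend X h q + h q * descend X f q" by auto
qed

lemma descend_bracket:
  assumes X: "X \<in> lie_algebra N" and Y: "Y \<in> lie_algebra N" and f: "f \<in> smooth_functions Q" and x: "x \<in> carrier N"
  shows "bracket (descend X) (descend Y) f (\<pi> x) = bracket X Y (pull_fun G \<pi> f) x"
  unfolding bracket_def
  using descend_\<pi>[OF X vector_fieldsD(2)[OF descend_vf[OF Y] f] x] descend_\<pi>[OF Y vector_fieldsD(2)[OF descend_vf[OF X] f] x]
    pull_\<pi>_descend[OF X f] pull_\<pi>_descend[OF Y f] by simp

text \<open>The projection is a local diffeomorphism: coordinates \<zeta> of the quotient pull back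
  to functions with the same first derivatives at \<open>x\<close> as the coordinates \<xi> of the
  group. Functions from the quotient therefore detect every tangent vector at
  \<open>x\<close>.\<close>

lemma descend_independent:
  assumes B: "is_basis (lie_algebra N) Es" and x: "x \<in> carrier N"
    and a: "\<And>f. f \<in> smooth_functions Q \<Longrightarrow> (\<Sum>i<length Es. a i * descend (Es ! i) f (\<pi> x)) = 0"
  shows "\<forall>i<length Es. a i = 0"
proof (rule lie_basis_independent_at[OF B x])
  fix h assume h: "h \<in> smooth_functions G"
  let ?n = "mdim G"
  have Es: "Es ! i \<in> lie_algebra N" if "i < length Es" for i
    using B that unfolding is_basis_def by (meson nth_mem subsetD)
  obtain U c V where A: "(U, c) \<in> atlas G" "openin T V" "V \<subseteq> U" "inj_on \<pi> V" and xV: "x \<in> V"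
    by (rule coset_chart_exists[OF x])
  have xU: "x \<in> U" using A(3) xV by blast
  let ?d = "\<lambda>y. c (inv_into V \<pi> y)"
  have d: "?d (\<pi> x) = c x" using inv_into_f_f[OF A(4) xV] by simp
  obtain \<xi> where \<xi>: "\<And>i. i < ?n \<Longrightarrow> \<xi> i \<in> smooth_functions G"
    "\<And>D f. pt_deriv G x D \<Longrightarrow> f \<in> smooth_functions G \<Longrightarrow>
       D f = (\<Sum>i<?n. D (\<xi> i) * partial i (\<lambda>y. f (inv_into U c y)) (c x))"
    by (rule pt_deriv_coordinates[OF mfd A(1) xU]) blast
  have \<pi>V: "\<pi> x \<in> \<pi> ` V" using xV by blast
  obtain \<zeta> where \<zeta>: "\<And>i. i < ?n \<Longrightarrow> \<zeta> i \<in> smooth_functions Q"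
    "\<And>i j. i < ?n \<Longrightarrow> j < ?n \<Longrightarrow>
       partial i (\<lambda>y. \<zeta> j (inv_into (\<pi> ` V) ?d y)) (c x) = (if i = j then 1 else 0)"
    by (rule pt_deriv_coordinates[OF smooth_manifold_Q coset_chart[OF A] \<pi>V, unfolded mdim_Q d]) blast
  have opV: "openin (Euclidean_space ?n) (c ` V)"
    using chart_image_open[OF mfd A(1,2)] A(3) by (simp add: inf.absorb2)
  have part: "partial i (\<lambda>y. pull_fun G \<pi> (\<zeta> j) (inv_into U c y)) (c x) = (if i = j then 1 else 0)"
    if ij: "i < ?n" "j < ?n" for i j
  proof -
    have "partial i (\<lambda>y. pull_fun G \<pi> (\<zeta> j) (inv_into U c y)) (c x) =
        partial i (\<lambda>y. \<zeta> j (inv_into (\<pi> ` V) ?d y)) (c x)"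
    proof (rule partial_cong(1)[OF opV imageI[OF xV] ij(1)])
      fix y assume y: "y \<in> c ` V"
      then obtain v where v: "v \<in> V" "y = c v" by blast
      have "inv_into U c y = v" unfolding v(2) by (rule chart_inv[OF mfd A(1) subsetD[OF A(3) v(1)]])
      moreover have "v \<in> carrier N" using V_carrier[OF A] v(1) by blast
      ultimately show "pull_fun G \<pi> (\<zeta> j) (inv_into U c y) = \<zeta> j (inv_into (\<pi> ` V) ?d y)"
        unfolding coset_chart_inv[OF A y] using pts by (simp add: pull_fun_def)
    qed
    then show ?thesis using \<zeta>(2)[OF ij] by simp
  qed
  have E\<zeta>: "descend (Es ! k) (\<zeta> j) (\<pi> x) = (Es ! k) (\<xi> j) x" if k: "k < length Es" and j: "j < ?n" for k j
  proof -
    have "descend (Es ! k) (\<zeta> j) (\<pi> x) = (Es ! k) (pull_fun G \<pi> (\<zeta> j)) x"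
      by (rule descend_\<pi>[OF Es[OF k] \<zeta>(1)[OF j] x])
    also have "\<dots> = (\<Sum>i<?n. (Es ! k) (\<xi> i) x * partial i (\<lambda>y. pull_fun G \<pi> (\<zeta> j) (inv_into U c y)) (c x))"
      by (rule \<xi>(2)[OF vector_fields_pt_deriv[OF lie_algebra_vf[OF Es[OF k]]] pull_\<pi>[OF \<zeta>(1)[OF j]]])
    also have "\<dots> = (\<Sum>i<?n. if i = j then (Es ! k) (\<xi> i) x else 0)"
      by (rule sum.cong[OF refl]) (use part j in auto)
    also have "\<dots> = (Es ! k) (\<xi> j) x" using j by (simp add: sum.delta)
    finally show ?thesis .
  qed
  let ?p = "\<lambda>j. partial j (\<lambda>y. h (inv_into U c y)) (c x)"
  have "(\<Sum>k<length Es. a k * (Es ! k) h x) = (\<Sum>k<length Es. \<Sum>j<?n. a k * descend (Es ! k) (\<zeta> j) (\<pi> x) * ?p j)"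
  proof (rule sum.cong[OF refl])
    fix k assume "k \<in> {..<length Es}"
    then have k: "k < length Es" by simp
    show "a k * (Es ! k) h x = (\<Sum>j<?n. a k * descend (Es ! k) (\<zeta> j) (\<pi> x) * ?p j)"
      unfolding \<xi>(2)[OF vector_fields_pt_deriv[OF lie_algebra_vf[OF Es[OF k]]] h]
      by (simp add: E\<zeta>[OF k] sum_distrib_left mult.assoc)
  qed
  also have "\<dots> = (\<Sum>j<?n. (\<Sum>k<length Es. a k * descend (Es ! k) (\<zeta> j) (\<pi> x)) * ?p j)"
    by (subst sum.swap) (simp add: sum_distrib_right)
  also have "\<dots> = 0" using a[OF \<zeta>(1)] by simp
  finally show "(\<Sum>k<length Es. a k * (Es ! k) h x) = 0" .
qed

lemma framing_Q:
  assumes "lie_algebra_iso N D"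
  obtains Es where "framing Q Es" "length Es = length D"
    "\<And>i j f p. i < length D \<Longrightarrow> j < length D \<Longrightarrow> f \<in> smooth_functions Q \<Longrightarrow> p \<in> points Q \<Longrightarrow>
       bracket (Es ! i) (Es ! j) f p = (\<Sum>k<length D. - diff_coeff D k i j * (Es ! k) f p)"
proof -
  obtain Es where E: "length Es = length D" "is_basis (lie_algebra N) Es"
    "\<And>i j. i < length D \<Longrightarrow> j < length D \<Longrightarrow>
        bracket (Es ! i) (Es ! j) = lincomb (\<lambda>k. - diff_coeff D k i j) Es"
    using assms unfolding lie_algebra_iso_def by blast
  have n: "length Es = mdim Q" using lie_basis_length[OF E(2)] mdim_Q by simp
  have Es: "Es ! i \<in> lie_algebra N" if "i < length Es" for i
    using E(2) that unfolding is_basis_def by (meson nth_mem subsetD)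
  let ?Es = "map descend Es"
  have "framing Q ?Es"
    unfolding framing_def
  proof (intro conjI ballI allI impI)
    show "set ?Es \<subseteq> vector_fields Q"
    proof
      fix X assume "X \<in> set ?Es"
      then obtain i where "i < length Es" "X = descend (Es ! i)" by (auto simp: in_set_conv_nth)
      then show "X \<in> vector_fields Q" using descend_vf[OF Es] by simp
    qed
    show "length ?Es = mdim Q" using n by simp
    fix p a i assume p: "p \<in> points Q" and i: "i < mdim Q"
      and a: "\<forall>f\<in>smooth_functions Q. (\<Sum>i<mdim Q. a i * (?Es ! i) f p) = 0"
    obtain x where x: "x \<in> carrier N" "p = \<pi> x" using p points_Q by blast
    have "\<forall>i<length Es. a i = 0"
    proof (rule descend_independent[OF E(2) x(1)])
      fix f assume "f \<in> smooth_functions Q"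
      then have "(\<Sum>i<mdim Q. a i * (?Es ! i) f p) = 0" using a by blast
      then show "(\<Sum>i<length Es. a i * descend (Es ! i) f (\<pi> x)) = 0"
        unfolding n[symmetric] x(2) by simp
    qed
    then show "a i = 0" using i n by simp
  qed
  moreover have "bracket (?Es ! i) (?Es ! j) f p = (\<Sum>k<length D. - diff_coeff D k i j * (?Es ! k) f p)"
    if i: "i < length D" and j: "j < length D" and f: "f \<in> smooth_functions Q" and p: "p \<in> points Q" for i j f p
  proof -
    obtain x where x: "x \<in> carrier N" "p = \<pi> x" using p points_Q by blast
    have i': "i < length Es" and j': "j < length Es" using i j E(1) by auto
    have "bracket (?Es ! i) (?Es ! j) f p = bracket (Es ! i) (Es ! j) (pull_fun G \<pi> f) x"
      unfolding x(2) nth_map[OF i'] nth_map[OF j'] by (rule descend_bracket[OF Es[OF i'] Es[OF j'] f x(1)])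
    also have "\<dots> = (\<Sum>k<length Es. - diff_coeff D k i j * (Es ! k) (pull_fun G \<pi> f) x)"
      unfolding E(3)[OF i j] lincomb_def ..
    also have "\<dots> = (\<Sum>k<length Es. - diff_coeff D k i j * (?Es ! k) f p)"
    proof (rule sum.cong[OF refl])
      fix k assume "k \<in> {..<length Es}"
      then have k: "k < length Es" by simp
      show "- diff_coeff D k i j * (Es ! k) (pull_fun G \<pi> f) x = - diff_coeff D k i j * (?Es ! k) f p"
        unfolding x(2) nth_map[OF k] descend_\<pi>[OF Es[OF k] f x(1)] ..
    qed
    finally show ?thesis unfolding E(1) .
  qed
  ultimately show ?thesis using that[of ?Es] E(1) by simp
qed

end

section \<open>Alternating multilinear forms on lists of vectors\<close>

subsection \<open>Recursive forms of the shuffle sums\<close>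

text \<open>Recursion on the list of arguments replaces the sums over index sets in the definitions of the wedge
  product (\<open>wd\<close>), the Hodge star (\<open>es\<close>) and the two parts of the exterior derivative (\<open>sgs\<close> and
  \<open>prs\<close>).\<close>

fun sgs :: "('x \<Rightarrow> 'x list \<Rightarrow> real) \<Rightarrow> 'x list \<Rightarrow> real" where
  "sgs C [] = 0"
| "sgs C (x # xs) = C x xs - sgs (\<lambda>y r. C y (x # r)) xs"

fun prs :: "('x \<Rightarrow> 'x \<Rightarrow> 'x list \<Rightarrow> real) \<Rightarrow> 'x list \<Rightarrow> real" where
  "prs B [] = 0"
| "prs B (x # xs) = - sgs (B x) xs + prs (\<lambda>y z r. B y z (x # r)) xs"

fun wd :: "nat \<Rightarrow> ('x list \<Rightarrow> real) \<Rightarrow> ('x list \<Rightarrow> real) \<Rightarrow> 'x list \<Rightarrow> real" where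
  "wd 0 \<alpha> \<beta> vs = \<alpha> [] * \<beta> vs"
| "wd (Suc k) \<alpha> \<beta> [] = 0"
| "wd (Suc k) \<alpha> \<beta> (v # vs) = wd k (\<lambda>r. \<alpha> (v # r)) \<beta> vs + (-1) ^ Suc k * wd (Suc k) \<alpha> (\<lambda>r. \<beta> (v # r)) vs"

fun es :: "nat \<Rightarrow> ('x list \<Rightarrow> real) \<Rightarrow> ('x list \<Rightarrow> real) \<Rightarrow> 'x list \<Rightarrow> real" where
  "es 0 \<beta> \<gamma> Es = \<beta> [] * \<gamma> []"
| "es (Suc k) \<beta> \<gamma> [] = 0"
| "es (Suc k) \<beta> \<gamma> (e # Es) = es k (\<lambda>r. \<beta> (e # r)) (\<lambda>r. \<gamma> (e # r)) Es + es (Suc k) \<beta> \<gamma> Es"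

lemma finite_subsets_card: "finite {S. S \<subseteq> {..<n::nat} \<and> card S = k}"
  by (rule finite_subset[of _ "Pow {..<n}"]) auto

lemma subset_sum_0: "(\<Sum>S | S \<subseteq> {..<n::nat} \<and> card S = 0. F S) = F {}"
proof -
  have "{S. S \<subseteq> {..<n} \<and> card S = 0} = {{}}" using finite_subset by fastforce
  then show ?thesis by simp
qed

lemma subset_sum_Suc:
  fixes F :: "nat set \<Rightarrow> real"
  shows "(\<Sum>S | S \<subseteq> {..<Suc n} \<and> card S = Suc k. F S) =
    (\<Sum>S | S \<subseteq> {..<n} \<and> card S = k. F (insert 0 (Suc ` S))) + (\<Sum>S | S \<subseteq> {..<n} \<and> card S = Suc k. F (Suc ` S))"
proof -
  let ?A = "\<lambda>k. {S. S \<subseteq> {..<n} \<and> card S = k}"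
  have eq: "{S. S \<subseteq> {..<Suc n} \<and> card S = Suc k} = (\<lambda>S. insert 0 (Suc ` S)) ` ?A k \<union> (`) Suc ` ?A (Suc k)"
  proof (intro equalityI subsetI)
    fix S assume S: "S \<in> {S. S \<subseteq> {..<Suc n} \<and> card S = Suc k}"
    define S' where "S' = {j. Suc j \<in> S}"
    have S'n: "S' \<subseteq> {..<n}" using S by (auto simp: S'_def)
    then have fin: "finite S'" by (rule finite_subset) simp
    show "S \<in> (\<lambda>S. insert 0 (Suc ` S)) ` ?A k \<union> (`) Suc ` ?A (Suc k)"
    proof (cases "0 \<in> S")
      case True
      have "S = insert 0 (Suc ` S')" using True by (auto simp: S'_def image_iff) (metis not0_implies_Suc)
      moreover from this have "card S = Suc (card S')" using fin by (simp add: card_image)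
      ultimately show ?thesis using S S'n by auto
    next
      case False
      have "S = Suc ` S'" using False by (auto simp: S'_def image_iff) (metis not0_implies_Suc)
      moreover from this have "card S = card S'" by (simp add: card_image)
      ultimately show ?thesis using S S'n by auto
    qed
  next
    fix S assume "S \<in> (\<lambda>S. insert 0 (Suc ` S)) ` ?A k \<union> (`) Suc ` ?A (Suc k)"
    then consider S' where "S = insert 0 (Suc ` S')" "S' \<subseteq> {..<n}" "card S' = k"
      | S' where "S = Suc ` S'" "S' \<subseteq> {..<n}" "card S' = Suc k" by auto
    then show "S \<in> {S. S \<subseteq> {..<Suc n} \<and> card S = Suc k}"
    proof cases
      case 1
      then have "finite S'" using finite_subset by blast
      then show ?thesis using 1 by (auto simp: card_image)
    next
      case 2
      then show ?thesis by (auto simp: card_image)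
    qed
  qed
  have "(\<Sum>S | S \<subseteq> {..<Suc n} \<and> card S = Suc k. F S) =
      sum F ((\<lambda>S. insert 0 (Suc ` S)) ` ?A k) + sum F ((`) Suc ` ?A (Suc k))"
    unfolding eq by (rule sum.union_disjoint) (auto simp: finite_subsets_card)
  also have "sum F ((\<lambda>S. insert 0 (Suc ` S)) ` ?A k) = (\<Sum>S\<in>?A k. F (insert 0 (Suc ` S)))"
  proof (rule sum.reindex[unfolded o_def], rule inj_onI)
    fix S S' :: "nat set" assume "insert 0 (Suc ` S) = insert 0 (Suc ` S')"
    then have "Suc ` S = Suc ` S'" by (metis Diff_insert_absorb Zero_not_Suc imageE)
    then show "S = S'" by (simp add: inj_image_eq_iff)
  qed
  also have "sum F ((`) Suc ` ?A (Suc k)) = (\<Sum>S\<in>?A (Suc k). F (Suc ` S))"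
    by (rule sum.reindex[unfolded o_def]) (auto simp: inj_on_def inj_image_eq_iff)
  finally show ?thesis .
qed

lemma nths_Cons_Suc: "nths (x # xs) (Suc ` S) = nths xs S" "nths (x # xs) (insert 0 (Suc ` S)) = x # nths xs S"
  by (simp_all add: nths_Cons image_iff)

text \<open>Induction on the arguments, according to whether the first one goes to \<alpha>. If it
  goes to \<beta>, each of the \<open>k\<close> positions in \<open>S\<close> has one more
  inversion, which accounts for the sign (-1)^k in \<open>wd\<close>.\<close>

lemma wd_subsets:
  "(\<Sum>S | S \<subseteq> {..<length xs} \<and> card S = k.
     (-1) ^ card {(i, j). i \<in> S \<and> j \<in> {..<length xs} - S \<and> j < i} *
     \<alpha> (nths xs S) * \<beta> (nths xs ({..<length xs} - S))) = wd k \<alpha> \<beta> xs"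
proof (induction xs arbitrary: k \<alpha> \<beta>)
  case Nil
  show ?case
  proof (cases k)
    case 0
    then show ?thesis using subset_sum_0[where n = 0 and F = "\<lambda>_. 1::nat"] by simp
  next
    case (Suc k)
    have "{S. S \<subseteq> {..<length ([]::'a list)} \<and> card S = Suc k} = {}" by auto
    then show ?thesis unfolding Suc by (simp only: sum.empty wd.simps)
  qed
next
  case (Cons x xs)
  let ?n = "length xs"
  have full: "nths (x # xs) {..<Suc ?n} = x # xs" by simp
  show ?case
  proof (cases k)
    case 0
    show ?thesis unfolding 0 length_Cons subset_sum_0 using full by simp
  next
    case (Suc k')
    have c1: "{..<Suc ?n} - insert 0 (Suc ` S) = Suc ` ({..<?n} - S)" for S
      by (auto simp: image_iff) (metis lessE lessThan_iff not0_implies_Suc Suc_less_eq DiffI)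
    have c2: "{..<Suc ?n} - Suc ` S = insert 0 (Suc ` ({..<?n} - S))" for S
      by (auto simp: image_iff) (metis lessThan_iff not0_implies_Suc Suc_less_eq DiffI)
    have i1: "card {(i, j). i \<in> insert 0 (Suc ` S) \<and> j \<in> {..<Suc ?n} - insert 0 (Suc ` S) \<and> j < i} =
        card {(i, j). i \<in> S \<and> j \<in> {..<?n} - S \<and> j < i}" for S
    proof -
      have "{(i, j). i \<in> insert 0 (Suc ` S) \<and> j \<in> {..<Suc ?n} - insert 0 (Suc ` S) \<and> j < i} =
          map_prod Suc Suc ` {(i, j). i \<in> S \<and> j \<in> {..<?n} - S \<and> j < i}"
        unfolding c1 by (auto simp: image_iff)
      then show ?thesis by (simp add: card_image prod.inj_map inj_on_subset[OF _ subset_UNIV])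
    qed
    have i2: "card {(i, j). i \<in> Suc ` S \<and> j \<in> {..<Suc ?n} - Suc ` S \<and> j < i} =
        card {(i, j). i \<in> S \<and> j \<in> {..<?n} - S \<and> j < i} + card S" if S: "S \<subseteq> {..<?n}" for S
    proof -
      have fin: "finite S" using S finite_subset by blast
      have eq: "{(i, j). i \<in> Suc ` S \<and> j \<in> {..<Suc ?n} - Suc ` S \<and> j < i} =
          map_prod Suc Suc ` {(i, j). i \<in> S \<and> j \<in> {..<?n} - S \<and> j < i} \<union> (\<lambda>i. (Suc i, 0)) ` S"
        unfolding c2 by (auto simp: image_iff)
      have "finite {(i, j). i \<in> S \<and> j \<in> {..<?n} - S \<and> j < i}"
        by (rule finite_subset[of _ "S \<times> {..<?n}"]) (use fin in auto)
      then have "card {(i, j). i \<in> Suc ` S \<and> j \<in> {..<Suc ?n} - Suc ` S \<and> j < i} =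
          card (map_prod Suc Suc ` {(i, j). i \<in> S \<and> j \<in> {..<?n} - S \<and> j < i}) + card ((\<lambda>i. (Suc i, 0::nat)) ` S)"
        unfolding eq using fin by (intro card_Un_disjoint) auto
      also have "card ((\<lambda>i. (Suc i, 0::nat)) ` S) = card S" by (rule card_image) (auto simp: inj_on_def)
      finally show ?thesis by (simp add: card_image prod.inj_map inj_on_subset[OF _ subset_UNIV])
    qed
    let ?F = "\<lambda>n xs \<alpha> \<beta> S. (-1) ^ card {(i, j). i \<in> S \<and> j \<in> {..<n} - S \<and> j < i} *
        \<alpha> (nths xs S) * \<beta> (nths xs ({..<n} - S)) :: real"
    have "(\<Sum>S | S \<subseteq> {..<Suc ?n} \<and> card S = Suc k'. ?F (Suc ?n) (x # xs) \<alpha> \<beta> S) =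
        (\<Sum>S | S \<subseteq> {..<?n} \<and> card S = k'. ?F (Suc ?n) (x # xs) \<alpha> \<beta> (insert 0 (Suc ` S))) +
        (\<Sum>S | S \<subseteq> {..<?n} \<and> card S = Suc k'. ?F (Suc ?n) (x # xs) \<alpha> \<beta> (Suc ` S))"
      by (rule subset_sum_Suc)
    also have "(\<Sum>S | S \<subseteq> {..<?n} \<and> card S = k'. ?F (Suc ?n) (x # xs) \<alpha> \<beta> (insert 0 (Suc ` S))) =
        (\<Sum>S | S \<subseteq> {..<?n} \<and> card S = k'. ?F ?n xs (\<lambda>r. \<alpha> (x # r)) \<beta> S)"
      unfolding i1 unfolding c1 nths_Cons_Suc ..
    also have "\<dots> = wd k' (\<lambda>r. \<alpha> (x # r)) \<beta> xs" by (rule Cons.IH)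
    also have "(\<Sum>S | S \<subseteq> {..<?n} \<and> card S = Suc k'. ?F (Suc ?n) (x # xs) \<alpha> \<beta> (Suc ` S)) =
        (\<Sum>S | S \<subseteq> {..<?n} \<and> card S = Suc k'. (-1) ^ Suc k' * ?F ?n xs \<alpha> (\<lambda>r. \<beta> (x # r)) S)"
    proof (rule sum.cong[OF refl])
      fix S assume "S \<in> {S. S \<subseteq> {..<?n} \<and> card S = Suc k'}"
      then have S: "S \<subseteq> {..<?n}" "card S = Suc k'" by auto
      show "?F (Suc ?n) (x # xs) \<alpha> \<beta> (Suc ` S) = (-1) ^ Suc k' * ?F ?n xs \<alpha> (\<lambda>r. \<beta> (x # r)) S"
        unfolding i2[OF S(1)] unfolding c2 nths_Cons_Suc S(2) by (simp add: power_add)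
    qed
    also have "\<dots> = (-1) ^ Suc k' * wd (Suc k') \<alpha> (\<lambda>r. \<beta> (x # r)) xs"
      unfolding sum_distrib_left[symmetric]
        Cons.IH[where k = "Suc k'" and \<alpha> = \<alpha> and \<beta> = "\<lambda>r. \<beta> (x # r)", symmetric] ..
    finally show ?thesis unfolding Suc by simp
  qed
qed

lemma wedge_wd: "wedge k \<alpha> \<beta> Xs p = wd k (\<lambda>r. \<alpha> r p) (\<lambda>r. \<beta> r p) Xs"
  unfolding wedge_def by (rule wd_subsets)

lemma es_subsets:
  "(\<Sum>S | S \<subseteq> {..<length xs} \<and> card S = k. \<beta> (nths xs S) * \<gamma> (nths xs S)) = es k \<beta> \<gamma> xs"
proof (induction xs arbitrary: k \<beta> \<gamma>)
  case Nil
  show ?case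
  proof (cases k)
    case 0
    then show ?thesis using subset_sum_0[where n = 0 and F = "\<lambda>_. 1::nat"] by simp
  next
    case (Suc k)
    have "{S. S \<subseteq> {..<length ([]::'a list)} \<and> card S = Suc k} = {}" by auto
    then show ?thesis unfolding Suc by (simp only: sum.empty es.simps)
  qed
next
  case (Cons x xs)
  show ?case
  proof (cases k)
    case 0
    show ?thesis unfolding 0 length_Cons subset_sum_0 by simp
  next
    case (Suc k')
    show ?thesis
      using subset_sum_Suc[where F = "\<lambda>S. \<beta> (nths (x # xs) S) * \<gamma> (nths (x # xs) S)" and n = "length xs" and k = k']
      unfolding Suc length_Cons nths_Cons_Suc Cons.IH es.simps
      using Cons.IH[where k = k' and \<beta> = "\<lambda>r. \<beta> (x # r)" and \<gamma> = "\<lambda>r. \<gamma> (x # r)"] by simp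
  qed
qed

lemma sgs_sum: "sgs C xs = (\<Sum>i<length xs. (-1) ^ i * C (xs ! i) (nths xs (- {i})))"
proof (induction xs arbitrary: C)
  case (Cons x xs)
  have 0: "nths (x # xs) (- {0}) = xs"
  proof -
    have "{j. Suc j \<in> - {0::nat}} = UNIV" by auto
    then show ?thesis by (simp add: nths_Cons nths_all)
  qed
  have S: "nths (x # xs) (- {Suc i}) = x # nths xs (- {i})" for i
  proof -
    have "{j. Suc j \<in> - {Suc i}} = - {i}" by auto
    then show ?thesis by (simp add: nths_Cons)
  qed
  show ?case
    by (simp add: Cons.IH sum.lessThan_Suc_shift 0 S sum_negf[symmetric] del: sum.lessThan_Suc)
qed simp

lemma prs_sum: "prs B xs = (\<Sum>j<length xs. \<Sum>i<j. (-1) ^ (i + j) * B (xs ! i) (xs ! j) (nths xs (- {i, j})))"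
proof (induction xs arbitrary: B)
  case (Cons x xs)
  have 0: "nths (x # xs) (- {0, Suc j}) = nths xs (- {j})" for j
  proof -
    have "{l. Suc l \<in> - {0, Suc j}} = - {j}" by auto
    then show ?thesis by (simp add: nths_Cons)
  qed
  have S: "nths (x # xs) (- {Suc i, Suc j}) = x # nths xs (- {i, j})" for i j
  proof -
    have "{l. Suc l \<in> - {Suc i, Suc j}} = - {i, j}" by auto
    then show ?thesis by (simp add: nths_Cons)
  qed
  show ?case
    by (simp add: Cons.IH sum.lessThan_Suc_shift 0 S sgs_sum sum_subtractf sum_negf del: sum.lessThan_Suc)
qed simp

lemma ext_deriv_sgs: "ext_deriv \<omega> Xs p =
    sgs (\<lambda>X r. X (\<omega> r) p) Xs + prs (\<lambda>X Y r. \<omega> (bracket X Y # r) p) Xs"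
  unfolding ext_deriv_def sgs_sum prs_sum ..

lemma hodge_es:
  assumes "p \<in> points M" "length (SOME Es. orthonormal_at M g p Es) = mdim M"
  shows "hodge M g vol k \<beta> Xs p = es k (\<lambda>r. \<beta> r p) (\<lambda>r. vol (r @ Xs) p) (SOME Es. orthonormal_at M g p Es)"
  unfolding hodge_def Let_def using assms es_subsets[where xs = "SOME Es. orthonormal_at M g p Es" and k = k and \<beta> = "\<lambda>r. \<beta> r p" and \<gamma> = "\<lambda>r. vol (r @ Xs) p"]
  by simp

section \<open>Congruence, naturality and linearity of the recursive sums\<close>

lemma sgs_cong: "(\<And>y r. Suc (length r) = length xs \<Longrightarrow> y \<in> set xs \<Longrightarrow> set r \<subseteq> set xs \<Longrightarrow> C y r = C' y r) \<Longrightarrow> sgs C xs = sgs C' xs"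
proof (induction xs arbitrary: C C')
  case (Cons x xs)
  have "C x xs = C' x xs" by (rule Cons.prems) auto
  moreover have "sgs (\<lambda>y r. C y (x # r)) xs = sgs (\<lambda>y r. C' y (x # r)) xs"
    by (rule Cons.IH, rule Cons.prems) auto
  ultimately show ?case by simp
qed simp

lemma prs_cong: "(\<And>y z r. Suc (Suc (length r)) = length xs \<Longrightarrow> y \<in> set xs \<Longrightarrow> z \<in> set xs \<Longrightarrow> set r \<subseteq> set xs \<Longrightarrow>
    B y z r = B' y z r) \<Longrightarrow> prs B xs = prs B' xs"
proof (induction xs arbitrary: B B')
  case (Cons x xs)
  have "sgs (B x) xs = sgs (B' x) xs" by (rule sgs_cong, rule Cons.prems) auto
  moreover have "prs (\<lambda>y z r. B y z (x # r)) xs = prs (\<lambda>y z r. B' y z (x # r)) xs"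
    by (rule Cons.IH, rule Cons.prems) auto
  ultimately show ?case by simp
qed simp

lemma sgs_add: "sgs (\<lambda>y r. C y r + C' y r) xs = sgs C xs + sgs C' xs"
  by (induction xs arbitrary: C C') auto

lemma sgs_diff: "sgs (\<lambda>y r. C y r - C' y r) xs = sgs C xs - sgs C' xs"
  by (induction xs arbitrary: C C') auto

lemma sgs_uminus: "sgs (\<lambda>y r. - C y r) xs = - sgs C xs"
  by (induction xs arbitrary: C) auto

lemma prs_add: "prs (\<lambda>x y r. B x y r + B' x y r) xs = prs B xs + prs B' xs"
  by (induction xs arbitrary: B B') (auto simp: sgs_add)

text \<open>This cancellation is \<open>d \<circ> d = 0\<close> in disguise: it makes the derivatives of the coefficients drop
  out of the exterior derivative of a form with constant coefficients.\<close>

lemma sgs_sgs_prs: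
  "sgs (\<lambda>X r. sgs (B X) r) xs + prs (\<lambda>X Y r. B X Y r - B Y X r) xs = 0"
proof (induction xs arbitrary: B)
  case (Cons x xs)
  have "sgs (\<lambda>X r. sgs (B X) (x # r)) xs = sgs (\<lambda>X r. B X x r) xs - sgs (\<lambda>X r. sgs (\<lambda>y r. B X y (x # r)) r) xs"
    by (simp add: sgs_diff)
  moreover have "sgs (\<lambda>X r. B x X r - B X x r) xs = sgs (B x) xs - sgs (\<lambda>X r. B X x r) xs"
    by (simp add: sgs_diff)
  ultimately show ?case using Cons.IH[of "\<lambda>X Y r. B X Y (x # r)"] by simp
qed simp

lemma sgs_map: "sgs C (map h xs) = sgs (\<lambda>y r. C (h y) (map h r)) xs"
  by (induction xs arbitrary: C) auto

lemma prs_map: "prs B (map h xs) = prs (\<lambda>y z r. B (h y) (h z) (map h r)) xs"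
  by (induction xs arbitrary: B) (auto simp: sgs_map)

lemma wd_map: "wd k \<alpha> \<beta> (map h xs) = wd k (\<lambda>r. \<alpha> (map h r)) (\<lambda>r. \<beta> (map h r)) xs"
proof (induction xs arbitrary: k \<alpha> \<beta>)
  case Nil then show ?case by (cases k) auto
next
  case (Cons x xs) then show ?case by (cases k) auto
qed

lemma es_map: "es k \<beta> \<gamma> (map h xs) = es k (\<lambda>r. \<beta> (map h r)) (\<lambda>r. \<gamma> (map h r)) xs"
proof (induction xs arbitrary: k \<beta> \<gamma>)
  case Nil then show ?case by (cases k) auto
next
  case (Cons x xs) then show ?case by (cases k) auto
qed

lemma wd_cong:
  "(\<And>r. length r = k \<Longrightarrow> set r \<subseteq> set xs \<Longrightarrow> \<alpha> r = \<alpha>' r) \<Longrightarrow>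
   (\<And>r. length r + k = length xs \<Longrightarrow> set r \<subseteq> set xs \<Longrightarrow> \<beta> r = \<beta>' r) \<Longrightarrow> wd k \<alpha> \<beta> xs = wd k \<alpha>' \<beta>' xs"
proof (induction xs arbitrary: k \<alpha> \<beta> \<alpha>' \<beta>')
  case Nil then show ?case by (cases k) auto
next
  case (Cons x xs)
  show ?case
  proof (cases k)
    case 0
    then show ?thesis using Cons.prems(1)[of "[]"] Cons.prems(2)[of "x # xs"] by simp
  next
    case (Suc k')
    have "wd k' (\<lambda>r. \<alpha> (x # r)) \<beta> xs = wd k' (\<lambda>r. \<alpha>' (x # r)) \<beta>' xs"
      by (rule Cons.IH; (rule Cons.prems(1) | rule Cons.prems(2))) (auto simp: Suc)
    moreover have "wd (Suc k') \<alpha> (\<lambda>r. \<beta> (x # r)) xs = wd (Suc k') \<alpha>' (\<lambda>r. \<beta>' (x # r)) xs"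
      by (rule Cons.IH; (rule Cons.prems(1) | rule Cons.prems(2))) (auto simp: Suc)
    ultimately show ?thesis by (simp add: Suc)
  qed
qed

lemma es_cong:
  "(\<And>r. length r = k \<Longrightarrow> set r \<subseteq> set xs \<Longrightarrow> \<beta> r = \<beta>' r) \<Longrightarrow> (\<And>r. length r = k \<Longrightarrow> set r \<subseteq> set xs \<Longrightarrow> \<gamma> r = \<gamma>' r) \<Longrightarrow>
   es k \<beta> \<gamma> xs = es k \<beta>' \<gamma>' xs"
proof (induction xs arbitrary: k \<beta> \<gamma> \<beta>' \<gamma>')
  case Nil then show ?case by (cases k) auto
next
  case (Cons x xs)
  show ?case
  proof (cases k)
    case 0
    then show ?thesis using Cons.prems(1)[of "[]"] Cons.prems(2)[of "[]"] by simp
  next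
    case (Suc k')
    have "es k' (\<lambda>r. \<beta> (x # r)) (\<lambda>r. \<gamma> (x # r)) xs = es k' (\<lambda>r. \<beta>' (x # r)) (\<lambda>r. \<gamma>' (x # r)) xs"
      by (rule Cons.IH; (rule Cons.prems(1) | rule Cons.prems(2))) (auto simp: Suc)
    moreover have "es (Suc k') \<beta> \<gamma> xs = es (Suc k') \<beta>' \<gamma>' xs"
      by (rule Cons.IH; (rule Cons.prems(1) | rule Cons.prems(2))) (auto simp: Suc)
    ultimately show ?thesis by (simp add: Suc)
  qed
qed

lemma wd_lin1:
  "(\<And>r. length r = k \<Longrightarrow> \<alpha> r = (\<Sum>i\<in>I. c i * A i r)) \<Longrightarrow> wd k \<alpha> \<beta> vs = (\<Sum>i\<in>I. c i * wd k (A i) \<beta> vs)"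
proof (induction vs arbitrary: k \<alpha> \<beta> A)
  case Nil then show ?case by (cases k) (auto simp: sum_distrib_right mult.assoc)
next
  case (Cons v vs)
  show ?case
  proof (cases k)
    case 0
    then show ?thesis using Cons.prems[of "[]"] by (simp add: sum_distrib_right mult.assoc)
  next
    case (Suc k')
    have "wd k' (\<lambda>r. \<alpha> (v # r)) \<beta> vs = (\<Sum>i\<in>I. c i * wd k' (\<lambda>r. A i (v # r)) \<beta> vs)"
      by (rule Cons.IH, rule Cons.prems) (simp add: Suc)
    moreover have "wd (Suc k') \<alpha> (\<lambda>r. \<beta> (v # r)) vs = (\<Sum>i\<in>I. c i * wd (Suc k') (A i) (\<lambda>r. \<beta> (v # r)) vs)"
      by (rule Cons.IH, rule Cons.prems) (simp add: Suc)
    ultimately show ?thesis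
      by (simp add: Suc right_diff_distrib sum_subtractf sum_distrib_left mult.left_commute sum_negf)
  qed
qed

lemma wd_lin2:
  "(\<And>r. k + length r = length vs \<Longrightarrow> \<beta> r = (\<Sum>i\<in>I. c i * B i r)) \<Longrightarrow> wd k \<alpha> \<beta> vs = (\<Sum>i\<in>I. c i * wd k \<alpha> (B i) vs)"
proof (induction vs arbitrary: k \<alpha> \<beta> B)
  case Nil then show ?case by (cases k) (auto simp: sum_distrib_left mult.left_commute)
next
  case (Cons v vs)
  show ?case
  proof (cases k)
    case 0
    then show ?thesis using Cons.prems[of "v # vs"] by (simp add: sum_distrib_left mult.left_commute)
  next
    case (Suc k')
    have "wd k' (\<lambda>r. \<alpha> (v # r)) \<beta> vs = (\<Sum>i\<in>I. c i * wd k' (\<lambda>r. \<alpha> (v # r)) (B i) vs)"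
      by (rule Cons.IH, rule Cons.prems) (simp add: Suc)
    moreover have "wd (Suc k') \<alpha> (\<lambda>r. \<beta> (v # r)) vs = (\<Sum>i\<in>I. c i * wd (Suc k') \<alpha> (\<lambda>r. B i (v # r)) vs)"
      by (rule Cons.IH, rule Cons.prems) (simp add: Suc)
    ultimately show ?thesis
      by (simp add: Suc right_diff_distrib sum_subtractf sum_distrib_left mult.left_commute sum_negf)
  qed
qed

lemma wd_1_sgs: "wd (Suc 0) \<alpha> \<beta> vs = sgs (\<lambda>x r. \<alpha> [x] * \<beta> r) vs"
  by (induction vs arbitrary: \<beta>) auto

text \<open>The minus sign reconciles two conventions: the leading pair of arguments has sign +1 in
  a wedge product but (-1)^(0+1) in the bracket part of the exterior derivative. In this way the
  bracket terms become wedge products with the differentials de^k.\<close>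

lemma wd_2_prs: "wd 2 \<alpha> \<beta> vs = prs (\<lambda>x y r. - \<alpha> [x, y] * \<beta> r) vs"
proof (induction vs arbitrary: \<beta>)
  case (Cons v vs)
  have "wd 2 \<alpha> \<beta> (v # vs) = wd (Suc 0) (\<lambda>r. \<alpha> (v # r)) \<beta> vs + wd 2 \<alpha> (\<lambda>r. \<beta> (v # r)) vs"
    unfolding numeral_2_eq_2 by simp
  also have "\<dots> = prs (\<lambda>x y r. - \<alpha> [x, y] * \<beta> r) (v # vs)"
    unfolding Cons.IH wd_1_sgs by (simp add: sgs_uminus)
  finally show ?case .
qed (simp add: numeral_2_eq_2)

subsection \<open>Alternating forms on seven-dimensional space\<close>

type_synonym rvec = "nat \<Rightarrow> real"

definition bs :: "nat \<Rightarrow> rvec" where "bs i = (\<lambda>j. if j = i then 1 else 0)"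

text \<open>Alternating \<open>k\<close>-linear forms on R^7. Linearity and alternation are demanded
  at the head of the list only, but for all contractions as well, hence in every position. Vectors
  enter through their first seven components, and only lists of length \<open>k\<close> are
  constrained.\<close>

fun kform :: "nat \<Rightarrow> (rvec list \<Rightarrow> real) \<Rightarrow> bool" where
  "kform 0 W = True"
| "kform (Suc k) W \<longleftrightarrow> (\<forall>v. kform k (\<lambda>vs. W (v # vs))) \<and>
     (\<forall>v vs. length vs = k \<longrightarrow> W (v # vs) = (\<Sum>i<7. v i * W (bs i # vs))) \<and>
     (\<forall>v vs. Suc (length vs) = k \<longrightarrow> W (v # v # vs) = 0)"

lemma kform_contract: "kform (Suc k) W \<Longrightarrow> kform k (\<lambda>vs. W (v # vs))"
  unfolding kform.simps(2) by blast

lemma kform_expand: "kform (Suc k) W \<Longrightarrow> length vs = k \<Longrightarrow> W (v # vs) = (\<Sum>i<7. v i * W (bs i # vs))"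
  unfolding kform.simps(2) by blast

lemma kform_alt_head: "kform (Suc k) W \<Longrightarrow> Suc (length vs) = k \<Longrightarrow> W (v # v # vs) = 0"
  unfolding kform.simps(2) by blast

declare kform.simps(2) [simp del]

lemma kform_cong: "(\<And>vs. length vs = k \<Longrightarrow> W vs = W' vs) \<Longrightarrow> kform k W = kform k W'"
proof (induction k arbitrary: W W')
  case (Suc k)
  have "kform k (\<lambda>vs. W (v # vs)) = kform k (\<lambda>vs. W' (v # vs))" for v
    by (rule Suc.IH) (simp add: Suc.prems)
  then show ?case by (simp add: kform.simps(2) Suc.prems cong: conj_cong)
qed simp

lemma kform_lincomb:
  "(\<And>i. i \<in> I \<Longrightarrow> kform k (A i)) \<Longrightarrow> kform k (\<lambda>vs. \<Sum>i\<in>I. c i * A i vs)"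
proof (induction k arbitrary: A)
  case (Suc k)
  have "kform k (\<lambda>vs. \<Sum>i\<in>I. c i * A i (v # vs))" for v
    by (rule Suc.IH) (rule kform_contract[OF Suc.prems])
  moreover have "(\<Sum>i\<in>I. c i * A i (v # vs)) = (\<Sum>j<7. v j * (\<Sum>i\<in>I. c i * A i (bs j # vs)))"
    if "length vs = k" for v vs
  proof -
    have "(\<Sum>i\<in>I. c i * A i (v # vs)) = (\<Sum>i\<in>I. \<Sum>j<7. v j * (c i * A i (bs j # vs)))"
      by (rule sum.cong[OF refl]) (simp add: kform_expand[OF Suc.prems that, of _ v] sum_distrib_left mult.left_commute)
    also have "\<dots> = (\<Sum>j<7. \<Sum>i\<in>I. v j * (c i * A i (bs j # vs)))" by (rule sum.swap)
    finally show ?thesis by (simp add: sum_distrib_left)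
  qed
  moreover have "(\<Sum>i\<in>I. c i * A i (v # v # vs)) = 0" if "Suc (length vs) = k" for v vs
    by (rule sum.neutral) (simp add: kform_alt_head[OF Suc.prems that])
  ultimately show ?case by (simp add: kform.simps(2))
qed simp

lemma kform_scale: "kform k W \<Longrightarrow> kform k (\<lambda>vs. a * W vs)"
  using kform_lincomb[where I = "{()}" and A = "\<lambda>_. W" and c = "\<lambda>_. a"] by simp

lemma kform_zero: "kform k (\<lambda>vs. 0)"
  using kform_lincomb[where I = "{}::unit set" and A = "\<lambda>_ _. 0"] by simp

lemma kform_add: "kform k V \<Longrightarrow> kform k W \<Longrightarrow> kform k (\<lambda>vs. V vs + W vs)"
proof -
  assume V: "kform k V" and W: "kform k W"
  have "kform k (\<lambda>vs. \<Sum>b\<in>(UNIV :: bool set). 1 * (if b then V else W) vs)"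
    by (rule kform_lincomb) (use V W in \<open>simp split: if_splits\<close>)
  then show ?thesis by (simp add: UNIV_bool add.commute)
qed

lemma kform_diff: "kform k V \<Longrightarrow> kform k W \<Longrightarrow> kform k (\<lambda>vs. V vs - W vs)"
  using kform_add[of k V "\<lambda>vs. (- 1) * W vs"] kform_scale[of k W "- 1"] by simp

lemma kform_sum_arg:
  assumes "kform (Suc k) W" "length vs = k"
  shows "W ((\<lambda>j. \<Sum>m\<in>I. x m * A m j) # vs) = (\<Sum>m\<in>I. x m * W (A m # vs))"
proof -
  have "W ((\<lambda>j. \<Sum>m\<in>I. x m * A m j) # vs) = (\<Sum>i<7. \<Sum>m\<in>I. x m * (A m i * W (bs i # vs)))"
    unfolding kform_expand[OF assms, of "\<lambda>j. \<Sum>m\<in>I. x m * A m j"] by (simp add: sum_distrib_right mult.assoc)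
  also have "\<dots> = (\<Sum>m\<in>I. \<Sum>i<7. x m * (A m i * W (bs i # vs)))" by (rule sum.swap)
  also have "\<dots> = (\<Sum>m\<in>I. x m * W (A m # vs))"
    by (rule sum.cong[OF refl]) (simp add: kform_expand[OF assms, of "A _"] sum_distrib_left)
  finally show ?thesis .
qed

lemma kform_lin2:
  assumes "kform (Suc k) W" "length vs = k"
  shows "W ((\<lambda>j. a * x j + b * y j) # vs) = a * W (x # vs) + b * W (y # vs)"
  using kform_sum_arg[OF assms, where I = "UNIV :: bool set" and x = "\<lambda>c. if c then a else b" and A = "\<lambda>c. if c then x else y"]
  by (simp add: UNIV_bool add.commute)

text \<open>Polarisation: expand the value on x + y repeated.\<close>

lemma kform_swap:
  assumes "kform (Suc k) W" "Suc (length vs) = k"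
  shows "W (x # y # vs) = - W (y # x # vs)"
proof -
  obtain k' where k: "k = Suc k'" "length vs = k'" using assms(2) by blast
  let ?z = "\<lambda>j. 1 * x j + 1 * y j"
  have K: "kform (Suc k') (\<lambda>vs. W (u # vs))" for u using kform_contract[OF assms(1)] unfolding k(1) .
  have "0 = W (?z # ?z # vs)" using kform_alt_head[OF assms, of ?z] by simp
  also have "\<dots> = 1 * W (x # ?z # vs) + 1 * W (y # ?z # vs)"
    by (rule kform_lin2[OF assms(1)]) (use k in simp)
  also have "W (x # ?z # vs) = 1 * W (x # x # vs) + 1 * W (x # y # vs)"
    by (rule kform_lin2[OF K k(2)])
  also have "W (y # ?z # vs) = 1 * W (y # x # vs) + 1 * W (y # y # vs)"
    by (rule kform_lin2[OF K k(2)])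
  finally show ?thesis using kform_alt_head[OF assms, of x] kform_alt_head[OF assms, of y] by simp
qed

lemma kform_move:
  "kform k W \<Longrightarrow> length us + Suc (length vs) = k \<Longrightarrow> W (us @ x # vs) = (-1) ^ length us * W (x # us @ vs)"
proof (induction us arbitrary: k W)
  case (Cons u us)
  obtain k' where k: "k = Suc k'" "length us + Suc (length vs) = k'" using Cons.prems(2) by simp
  have K: "kform (Suc k') W" using Cons.prems(1) k(1) by simp
  have "W (u # us @ x # vs) = (-1) ^ length us * W (u # x # us @ vs)"
    by (rule Cons.IH[OF kform_contract[OF K] k(2)])
  also have "W (u # x # us @ vs) = - W (x # u # us @ vs)"
    by (rule kform_swap[OF K]) (use k in simp)
  finally show ?case by simp
qed simp

lemma kform_upd:
  assumes "kform k W" "length vs = k" "i < k"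
  shows "W (vs[i := x]) = (-1) ^ i * W (x # take i vs @ drop (Suc i) vs)"
proof -
  have "vs[i := x] = take i vs @ x # drop (Suc i) vs" by (rule upd_conv_take_nth_drop) (use assms in simp)
  then show ?thesis using kform_move[OF assms(1), of "take i vs" "drop (Suc i) vs" x] assms(2,3) by simp
qed

lemma kform_upd_lin2:
  assumes "kform k W" "length vs = k" "i < k"
  shows "W (vs[i := (\<lambda>j. a * x j + b * y j)]) = a * W (vs[i := x]) + b * W (vs[i := y])"
proof -
  obtain k' where k: "k = Suc k'" using assms(3) by (cases k) auto
  have "length (take i vs @ drop (Suc i) vs) = k'" using assms k by simp
  then show ?thesis
    unfolding kform_upd[OF assms] using kform_lin2[of k' W "take i vs @ drop (Suc i) vs" a x b y] assms(1) k
    by (simp add: algebra_simps)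
qed

lemma kform_alt:
  assumes "kform k W" "length vs = k" "i < j" "j < k" "vs ! i = vs ! j"
  shows "W vs = 0"
proof -
  define A where "A = take i vs"
  define B where "B = take (j - Suc i) (drop (Suc i) vs)"
  define C where "C = drop (Suc j) vs"
  have 1: "vs = A @ vs ! i # drop (Suc i) vs" unfolding A_def by (rule id_take_nth_drop) (use assms in simp)
  have 2: "drop (Suc i) vs = B @ vs ! j # C"
    using id_take_nth_drop[of "j - Suc i" "drop (Suc i) vs"] assms(2-4) by (simp add: B_def C_def)
  obtain k' where k: "k = Suc k'" using assms(4) by (cases k) auto
  have K: "kform (Suc k') W" using assms(1) k by simp
  let ?x = "vs ! j"
  have vs: "vs = A @ ?x # B @ ?x # C" using 1 2 assms(5) by simp
  have len: "length A + length B + length C + 2 = k" using arg_cong[OF vs, of length] assms(2) by simp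
  have "W (A @ ?x # B @ ?x # C) = (-1) ^ length A * W (?x # A @ B @ ?x # C)"
    by (rule kform_move[OF assms(1)]) (use len in simp)
  then have "W vs = (-1) ^ length A * W (?x # (A @ B) @ ?x # C)"
    using vs by simp
  also have "W (?x # (A @ B) @ ?x # C) = (-1) ^ length (A @ B) * W (?x # ?x # (A @ B) @ C)"
    by (rule kform_move[OF kform_contract[OF K]]) (use len k in simp)
  also have "W (?x # ?x # (A @ B) @ C) = 0" by (rule kform_alt_head[OF K]) (use len k in simp)
  finally show ?thesis by simp
qed

lemma wd_zero1: "(\<And>r. length r = k \<Longrightarrow> \<alpha> r = 0) \<Longrightarrow> wd k \<alpha> \<beta> vs = 0"
  using wd_lin1[where k = k and \<alpha> = \<alpha> and I = "{}::unit set"] by simp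

lemma wd_zero2: "(\<And>r. k + length r = length vs \<Longrightarrow> \<beta> r = 0) \<Longrightarrow> wd k \<alpha> \<beta> vs = 0"
  using wd_lin2[where k = k and vs = vs and \<beta> = \<beta> and I = "{}::unit set"] by simp

lemma wd_short: "length vs < k \<Longrightarrow> wd k \<alpha> \<beta> vs = 0"
  by (rule wd_zero2) simp

text \<open>If both copies of \<open>v\<close> go to the same factor, that factor vanishes; the two
  ways of separating them cancel by sign.\<close>

lemma wd_alt_head:
  assumes "kform k \<alpha>" "kform l \<beta>" "Suc (Suc (length vs)) = k + l"
  shows "wd k \<alpha> \<beta> (v # v # vs) = 0"
proof (cases k)
  case 0
  then obtain l' where "l = Suc l'" using assms(3) by (cases l) auto
  then show ?thesis using kform_alt_head[of l' \<beta> vs v] assms 0 by simp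
next
  case (Suc k')
  have b0: "wd m A (\<lambda>r. \<beta> (v # v # r)) vs = 0" if mk: "m = k" for m A
  proof (rule wd_zero2)
    fix r :: "rvec list" assume r: "m + length r = length vs"
    then obtain l' where l: "l = Suc l'" "Suc (length r) = l'" using assms(3) mk by (cases l) auto
    then show "\<beta> (v # v # r) = 0" using kform_alt_head[of l' \<beta> r v] assms(2) by simp
  qed
  show ?thesis
  proof (cases k')
    case 0
    then show ?thesis using b0[of "Suc 0" \<alpha>] Suc by simp
  next
    case (Suc k'')
    have "wd k'' (\<lambda>r. \<alpha> (v # v # r)) \<beta> vs = 0"
      by (rule wd_zero1) (use kform_alt_head[of k' \<alpha> _ v] assms(1) Suc \<open>k = Suc k'\<close> in simp)
    then show ?thesis using b0[of k \<alpha>] Suc \<open>k = Suc k'\<close> by simp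
  qed
qed

lemma wd_expand_head:
  assumes "kform k \<alpha>" "kform l \<beta>" "Suc (length vs) = k + l"
  shows "wd k \<alpha> \<beta> (v # vs) = (\<Sum>i<7. v i * wd k \<alpha> \<beta> (bs i # vs))"
proof (cases k)
  case 0
  then obtain l' where "l = Suc l'" using assms(3) by (cases l) auto
  then show ?thesis using kform_expand[of l' \<beta> vs v] assms 0 by (simp add: sum_distrib_left mult.left_commute)
next
  case (Suc k')
  have 1: "wd k' (\<lambda>r. \<alpha> (v # r)) \<beta> vs = (\<Sum>i<7. v i * wd k' (\<lambda>r. \<alpha> (bs i # r)) \<beta> vs)"
    by (rule wd_lin1) (use kform_expand[of k' \<alpha> _ v] assms(1) Suc in simp)
  have 2: "wd k \<alpha> (\<lambda>r. \<beta> (v # r)) vs = (\<Sum>i<7. v i * wd k \<alpha> (\<lambda>r. \<beta> (bs i # r)) vs)"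
  proof (rule wd_lin2)
    fix r :: "rvec list" assume r: "k + length r = length vs"
    then obtain l' where "l = Suc l'" "length r = l'" using assms(3) by (cases l) auto
    then show "\<beta> (v # r) = (\<Sum>i<7. v i * \<beta> (bs i # r))" using kform_expand[of l' \<beta> r v] assms(2) by simp
  qed
  show ?thesis using 1 2
    by (simp add: Suc right_diff_distrib sum_subtractf sum_distrib_left mult.left_commute sum_negf)
qed

lemma kform_wd: "kform k \<alpha> \<Longrightarrow> kform l \<beta> \<Longrightarrow> k + l = m \<Longrightarrow> kform m (wd k \<alpha> \<beta>)"
proof (induction m arbitrary: k l \<alpha> \<beta>)
  case (Suc m)
  have "kform m (\<lambda>vs. wd k \<alpha> \<beta> (v # vs))" for v
  proof (cases k)
    case 0
    then have "kform m (\<lambda>r. \<beta> (v # r))" using Suc.prems kform_contract by auto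
    then show ?thesis using 0 kform_scale[of m "\<lambda>r. \<beta> (v # r)" "\<alpha> []"] by simp
  next
    case k: (Suc k')
    have 1: "kform m (wd k' (\<lambda>r. \<alpha> (v # r)) \<beta>)"
      by (rule Suc.IH[OF _ Suc.prems(2)]) (use Suc.prems k kform_contract in auto)
    have 2: "kform m (wd k \<alpha> (\<lambda>r. \<beta> (v # r)))"
    proof (cases l)
      case 0
      have "kform m (wd k \<alpha> (\<lambda>r. \<beta> (v # r))) = kform m (\<lambda>vs. 0)"
        by (rule kform_cong) (use Suc.prems(3) 0 in \<open>simp add: wd_short\<close>)
      then show ?thesis using kform_zero by simp
    next
      case (Suc l')
      show ?thesis by (rule Suc.IH[OF Suc.prems(1), of l']) (use Suc.prems Suc kform_contract in auto)
    qed
    show ?thesis using kform_add[OF 1 kform_scale[OF 2, of "(-1) ^ k"]] unfolding k by simp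
  qed
  then show ?case
    unfolding kform.simps(2) using wd_expand_head[OF Suc.prems(1,2)] wd_alt_head[OF Suc.prems(1,2)] Suc.prems(3) by auto
qed simp

section \<open>Forms are determined by increasing lists of basis vectors\<close>

fun subs :: "nat \<Rightarrow> 'x list \<Rightarrow> 'x list list" where
  "subs 0 L = [[]]"
| "subs (Suc k) [] = []"
| "subs (Suc k) (x # L) = map ((#) x) (subs k L) @ subs (Suc k) L"

text \<open>If the first vector of \<open>L\<close> occurs among the arguments, it is moved to the
  front and contracted away; a second occurrence makes the value vanish by alternation.\<close>

lemma kform_vanish_subs:
  "kform k W \<Longrightarrow> (\<forall>J\<in>set (subs k L). W J = 0) \<Longrightarrow> length vs = k \<Longrightarrow> set vs \<subseteq> set L \<Longrightarrow> W vs = 0"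
proof (induction L arbitrary: k W vs)
  case Nil then show ?case by (cases k) auto
next
  case (Cons x L)
  show ?case
  proof (cases k)
    case 0 then show ?thesis using Cons.prems by simp
  next
    case (Suc k')
    have W1: "\<forall>J\<in>set (subs k' L). W (x # J) = 0" and W2: "\<forall>J\<in>set (subs k L). W J = 0"
      using Cons.prems(2) unfolding Suc by auto
    have K: "kform (Suc k') W" using Cons.prems(1) Suc by simp
    show ?thesis
    proof (cases "x \<in> set vs")
      case False
      then show ?thesis using Cons.IH[OF Cons.prems(1) W2 Cons.prems(3)] Cons.prems(4) by auto
    next
      case True
      then obtain a b where ab: "vs = a @ x # b" by (meson split_list)
      have len: "length (a @ b) = k'" using Cons.prems(3) ab Suc by simp
      have "W vs = (-1) ^ length a * W (x # a @ b)"
        unfolding ab by (rule kform_move[OF Cons.prems(1)]) (use len Suc in simp)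
      moreover have "W (x # a @ b) = 0"
      proof (cases "x \<in> set (a @ b)")
        case True
        then obtain i where i: "i < k'" "(a @ b) ! i = x" unfolding in_set_conv_nth len by blast
        show ?thesis by (rule kform_alt[OF K, of _ 0 "Suc i"]) (use len i in auto)
      next
        case False
        then show ?thesis
          using Cons.IH[OF kform_contract[OF K] W1 len] Cons.prems(4) ab by auto
      qed
      ultimately show ?thesis by simp
    qed
  qed
qed

lemma kform_vanish_basis:
  "kform k W \<Longrightarrow> (\<And>vs. length vs = k \<Longrightarrow> set vs \<subseteq> bs ` {..<7} \<Longrightarrow> W vs = 0) \<Longrightarrow> length vs = k \<Longrightarrow> W vs = 0"
proof (induction k arbitrary: W vs)
  case (Suc k)
  obtain v r where vs: "vs = v # r" "length r = k" using Suc.prems(3) by (cases vs) auto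
  have "W (bs i # r) = 0" if i: "i < 7" for i
    by (rule Suc.IH[OF kform_contract[OF Suc.prems(1)] Suc.prems(2) vs(2)]) (use i in auto)
  then show ?case unfolding vs(1) kform_expand[OF Suc.prems(1) vs(2), of v] by simp
qed simp

lemma kform_zeroI:
  assumes "kform k W" "\<forall>J\<in>set (subs k (map bs [0..<7])). W J = 0" "length vs = k"
  shows "W vs = 0"
proof (rule kform_vanish_basis[OF assms(1) _ assms(3)])
  fix us :: "rvec list" assume "length us = k" "set us \<subseteq> bs ` {..<7}"
  then show "W us = 0" using kform_vanish_subs[OF assms(1,2)] by (simp add: atLeast0LessThan)
qed

lemma subs_map: "subs k (map h L) = map (map h) (subs k L)"
proof (induction L arbitrary: k)
  case Nil then show ?case by (cases k) auto
next
  case (Cons x L) then show ?case by (cases k) auto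
qed

text \<open>Reduces an identity of \<open>k\<close>-forms to the binomial number (7 choose k) of
  index lists, a finite check within reach of the simplifier.\<close>

lemma kform_eqI:
  assumes "kform k V" "kform k W" "\<forall>J\<in>set (subs k [0..<7]). V (map bs J) = W (map bs J)" "length vs = k"
  shows "V vs = W vs"
proof -
  have "(\<lambda>vs. V vs - W vs) vs = 0"
    by (rule kform_zeroI[OF kform_diff[OF assms(1,2)] _ assms(4)]) (use assms(3) in \<open>simp add: subs_map\<close>)
  then show ?thesis by simp
qed

subsection \<open>Independence of the orthonormal basis\<close>

text \<open>Summing over all lists of basis vectors instead of the increasing ones multiplies \<open>es k\<close> by
  \<open>k!\<close> (\<open>fs_es\<close>), and reduces the change of basis to one argument at a time.\<close>

fun fs :: "nat \<Rightarrow> (rvec list \<Rightarrow> real) \<Rightarrow> (rvec list \<Rightarrow> real) \<Rightarrow> rvec list \<Rightarrow> real" where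
  "fs 0 \<beta> \<gamma> Es = \<beta> [] * \<gamma> []"
| "fs (Suc k) \<beta> \<gamma> Es = (\<Sum>e\<leftarrow>Es. fs k (\<lambda>r. \<beta> (e # r)) (\<lambda>r. \<gamma> (e # r)) Es)"

lemma sum_list_sum_swap:
  "(\<Sum>e\<leftarrow>Es. \<Sum>i\<in>I. F e i) = (\<Sum>i\<in>I. \<Sum>e\<leftarrow>Es. (F e i :: real))"
  by (induction Es) (auto simp: sum.distrib)

lemma fs_lin1:
  "(\<And>r. length r = k \<Longrightarrow> \<beta> r = (\<Sum>i\<in>I. c i * B i r)) \<Longrightarrow> fs k \<beta> \<gamma> Es = (\<Sum>i\<in>I. c i * fs k (B i) \<gamma> Es)"
proof (induction k arbitrary: \<beta> \<gamma> B)
  case 0 then show ?case by (simp add: sum_distrib_right mult.assoc)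
next
  case (Suc k)
  have "fs k (\<lambda>r. \<beta> (e # r)) (\<lambda>r. \<gamma> (e # r)) Es = (\<Sum>i\<in>I. c i * fs k (\<lambda>r. B i (e # r)) (\<lambda>r. \<gamma> (e # r)) Es)" for e
    by (rule Suc.IH, rule Suc.prems) simp
  then show ?case by (simp add: sum_list_sum_swap sum_list_const_mult)
qed

lemma fs_commute: "fs k \<beta> \<gamma> Es = fs k \<gamma> \<beta> Es"
  by (induction k arbitrary: \<beta> \<gamma>) (auto simp: mult.commute intro!: arg_cong[of _ _ sum_list])

lemma fs_cong: "(\<And>r. length r = k \<Longrightarrow> \<beta> r = \<beta>' r) \<Longrightarrow> fs k \<beta> \<gamma> Es = fs k \<beta>' \<gamma> Es"
  using fs_lin1[where k = k and \<beta> = \<beta> and I = "{()}" and c = "\<lambda>_. 1" and B = "\<lambda>_. \<beta>'"] by simp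

lemma fs_lin2:
  "(\<And>r. length r = k \<Longrightarrow> \<gamma> r = (\<Sum>i\<in>I. c i * B i r)) \<Longrightarrow> fs k \<beta> \<gamma> Es = (\<Sum>i\<in>I. c i * fs k \<beta> (B i) Es)"
  using fs_lin1[where k = k and \<beta> = \<gamma> and I = I and c = c and B = B and \<gamma> = \<beta> and Es = Es] by (simp add: fs_commute[of k \<beta>])

lemma fs_neg: "(\<And>r. length r = k \<Longrightarrow> \<beta> r = - \<beta>' r) \<Longrightarrow> fs k \<beta> \<gamma> Es = - fs k \<beta>' \<gamma> Es"
  using fs_lin1[where k = k and \<beta> = \<beta> and I = "{()}" and c = "\<lambda>_. -1" and B = "\<lambda>_. \<beta>'"] by simp

text \<open>Orthonormality is stated as the resolution of the identity, the sum of e e^T being the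
  unit matrix, since this is the form that trace arguments use.\<close>

definition orthobasis :: "rvec list \<Rightarrow> bool" where
  "orthobasis Es \<longleftrightarrow> (\<forall>i<7. \<forall>j<7. (\<Sum>e\<leftarrow>Es. e i * e j) = (if i = j then 1 else 0))"

lemma orthobasis_trace:
  assumes Es: "orthobasis Es" and B: "\<And>x y. B x y = (\<Sum>i<7. \<Sum>j<7. x i * (y j * B (bs i) (bs j)))"
  shows "(\<Sum>e\<leftarrow>Es. B e e) = (\<Sum>i<7. B (bs i) (bs i))"
proof -
  have "(\<Sum>e\<leftarrow>Es. B e e) = (\<Sum>e\<leftarrow>Es. \<Sum>i<7. \<Sum>j<7. (e i * e j) * B (bs i) (bs j))"
    by (subst B) (simp add: mult.assoc)
  also have "\<dots> = (\<Sum>i<7. \<Sum>j<7. (\<Sum>e\<leftarrow>Es. e i * e j) * B (bs i) (bs j))"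
    by (simp add: sum_list_sum_swap sum_list_mult_const)
  also have "\<dots> = (\<Sum>i<7. \<Sum>j<7. if i = j then B (bs i) (bs j) else 0)"
    by (intro sum.cong refl) (use Es in \<open>auto simp: orthobasis_def\<close>)
  also have "\<dots> = (\<Sum>i<7. B (bs i) (bs i))" by (intro sum.cong refl) (simp add: sum.delta')
  finally show ?thesis .
qed

text \<open>For fixed remaining arguments the sum over one slot is the trace of a bilinear form,
  which every resolution of the identity computes alike. Slots are exchanged one after
  another.\<close>

lemma fs_orthobasis:
  "orthobasis Es \<Longrightarrow> orthobasis Es' \<Longrightarrow> kform k \<beta> \<Longrightarrow> kform k \<gamma> \<Longrightarrow> fs k \<beta> \<gamma> Es = fs k \<beta> \<gamma> Es'"
proof (induction k arbitrary: \<beta> \<gamma>)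
  case (Suc k)
  define B where "B = (\<lambda>x y. fs k (\<lambda>r. \<beta> (x # r)) (\<lambda>r. \<gamma> (y # r)) Es')"
  have B: "B x y = (\<Sum>i<7. \<Sum>j<7. x i * (y j * B (bs i) (bs j)))" for x y
  proof -
    have "B x y = (\<Sum>i<7. x i * B (bs i) y)"
      unfolding B_def by (rule fs_lin1) (rule kform_expand[OF Suc.prems(3)])
    also have "\<dots> = (\<Sum>i<7. x i * (\<Sum>j<7. y j * B (bs i) (bs j)))"
    proof (intro sum.cong refl)
      fix i show "x i * B (bs i) y = x i * (\<Sum>j<7. y j * B (bs i) (bs j))"
        unfolding B_def by (subst fs_lin2[OF kform_expand[OF Suc.prems(4)]]) auto
    qed
    finally show ?thesis by (simp add: sum_distrib_left)
  qed
  have "fs (Suc k) \<beta> \<gamma> Es = (\<Sum>e\<leftarrow>Es. B e e)"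
    unfolding fs.simps B_def
    using Suc.IH[OF Suc.prems(1,2) kform_contract[OF Suc.prems(3)] kform_contract[OF Suc.prems(4)]] by simp
  also have "\<dots> = (\<Sum>e\<leftarrow>Es'. B e e)"
    using orthobasis_trace[OF Suc.prems(1) B] orthobasis_trace[OF Suc.prems(2) B] by simp
  finally show ?case unfolding fs.simps B_def .
qed simp

text \<open>By alternation the new vector \<open>e\<close> occupies at most one of the
  \<open>k\<close> slots. Moving it to the front changes the sign of both \<beta> and \<gamma>, so
  all \<open>k\<close> slots contribute equally.\<close>

lemma fs_Cons:
  "kform k \<beta> \<Longrightarrow> kform k \<gamma> \<Longrightarrow> fs k \<beta> \<gamma> (e # Es) = fs k \<beta> \<gamma> Es + k * fs (k - 1) (\<lambda>r. \<beta> (e # r)) (\<lambda>r. \<gamma> (e # r)) Es"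
proof (induction k arbitrary: \<beta> \<gamma>)
  case (Suc k)
  let ?\<beta> = "\<lambda>e r. \<beta> (e # r)" and ?\<gamma> = "\<lambda>e r. \<gamma> (e # r)"
  have IH: "fs k (?\<beta> f) (?\<gamma> f) (e # Es) = fs k (?\<beta> f) (?\<gamma> f) Es + k * fs (k - 1) (\<lambda>r. \<beta> (f # e # r)) (\<lambda>r. \<gamma> (f # e # r)) Es" for f
    by (rule Suc.IH[OF kform_contract[OF Suc.prems(1)] kform_contract[OF Suc.prems(2)]])
  have sw: "k * fs (k - 1) (\<lambda>r. \<beta> (f # e # r)) (\<lambda>r. \<gamma> (f # e # r)) Es = k * fs (k - 1) (\<lambda>r. \<beta> (e # f # r)) (\<lambda>r. \<gamma> (e # f # r)) Es" for f
  proof (cases k)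
    case (Suc k')
    have "fs k' (\<lambda>r. \<beta> (f # e # r)) (\<lambda>r. \<gamma> (f # e # r)) Es = - fs k' (\<lambda>r. \<beta> (e # f # r)) (\<lambda>r. \<gamma> (f # e # r)) Es"
      by (rule fs_neg) (rule kform_swap[OF Suc.prems(1)], simp add: Suc)
    also have "fs k' (\<lambda>r. \<beta> (e # f # r)) (\<lambda>r. \<gamma> (f # e # r)) Es = fs k' (\<lambda>r. \<gamma> (f # e # r)) (\<lambda>r. \<beta> (e # f # r)) Es"
      by (rule fs_commute)
    also have "\<dots> = - fs k' (\<lambda>r. \<gamma> (e # f # r)) (\<lambda>r. \<beta> (e # f # r)) Es"
      by (rule fs_neg) (rule kform_swap[OF Suc.prems(2)], simp add: Suc)
    also have "fs k' (\<lambda>r. \<gamma> (e # f # r)) (\<lambda>r. \<beta> (e # f # r)) Es = fs k' (\<lambda>r. \<beta> (e # f # r)) (\<lambda>r. \<gamma> (e # f # r)) Es"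
      by (rule fs_commute)
    finally show ?thesis by (simp add: Suc)
  qed simp
  have zero: "k * fs (k - 1) (\<lambda>r. \<beta> (e # e # r)) (\<lambda>r. \<gamma> (e # e # r)) Es = 0"
  proof (cases k)
    case (Suc k')
    have "fs k' (\<lambda>r. \<beta> (e # e # r)) (\<lambda>r. \<gamma> (e # e # r)) Es = fs k' (\<lambda>r. 0) (\<lambda>r. \<gamma> (e # e # r)) Es"
      by (rule fs_cong) (rule kform_alt_head[OF Suc.prems(1)], simp add: Suc)
    also have "\<dots> = 0" using fs_lin1[where k = k' and \<beta> = "\<lambda>r. 0" and I = "{}::unit set"] by simp
    finally show ?thesis by (simp add: Suc)
  qed simp
  have "(\<Sum>f\<leftarrow>Es. fs k (?\<beta> f) (?\<gamma> f) (e # Es)) =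
      (\<Sum>f\<leftarrow>Es. fs k (?\<beta> f) (?\<gamma> f) Es) + (\<Sum>f\<leftarrow>Es. k * fs (k - 1) (\<lambda>r. \<beta> (e # f # r)) (\<lambda>r. \<gamma> (e # f # r)) Es)"
    unfolding IH sw by (simp add: sum_list_addf)
  also have "(\<Sum>f\<leftarrow>Es. k * fs (k - 1) (\<lambda>r. \<beta> (e # f # r)) (\<lambda>r. \<gamma> (e # f # r)) Es) = k * fs k (?\<beta> e) (?\<gamma> e) Es"
    by (cases k) (simp_all add: sum_list_const_mult)
  finally have "fs (Suc k) \<beta> \<gamma> (e # Es) = fs k (?\<beta> e) (?\<gamma> e) Es + (fs (Suc k) \<beta> \<gamma> Es + k * fs k (?\<beta> e) (?\<gamma> e) Es)"
    using IH[of e] zero by simp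
  then show ?case by (simp add: algebra_simps)
qed simp

lemma fs_es: "kform k \<beta> \<Longrightarrow> kform k \<gamma> \<Longrightarrow> fs k \<beta> \<gamma> Es = fact k * es k \<beta> \<gamma> Es"
proof (induction Es arbitrary: k \<beta> \<gamma>)
  case Nil then show ?case by (cases k) auto
next
  case (Cons e Es)
  show ?case
  proof (cases k)
    case (Suc k')
    have "fs k' (\<lambda>r. \<beta> (e # r)) (\<lambda>r. \<gamma> (e # r)) Es = fact k' * es k' (\<lambda>r. \<beta> (e # r)) (\<lambda>r. \<gamma> (e # r)) Es"
      by (rule Cons.IH) (use Cons.prems Suc kform_contract in auto)
    then show ?thesis
      unfolding fs_Cons[OF Cons.prems] Cons.IH[OF Cons.prems] by (simp add: Suc algebra_simps del: fs.simps)
  qed simp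
qed

lemma es_orthobasis:
  assumes "orthobasis Es" "orthobasis Es'" "kform k \<beta>" "kform k \<gamma>"
  shows "es k \<beta> \<gamma> Es = es k \<beta> \<gamma> Es'"
  using fs_orthobasis[OF assms] unfolding fs_es[OF assms(3,4)] by simp

lemma es_short: "length Es < k \<Longrightarrow> es k \<beta> \<gamma> Es = 0"
proof (induction Es arbitrary: k \<beta> \<gamma>)
  case Nil then show ?case by (cases k) auto
next
  case (Cons e Es) then show ?case by (cases k) auto
qed

lemma es_full: "es (length Es) \<beta> \<gamma> Es = \<beta> Es * \<gamma> Es"
  by (induction Es arbitrary: \<beta> \<gamma>) (auto simp: es_short)

lemma orthobasis_standard: "orthobasis (map bs [0..<7])"
proof -
  have "(\<Sum>e\<leftarrow>map bs [0..<7]. e i * e j) = (if i = j then 1 else 0)" if "i < 7" "j < 7" for i j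
  proof -
    have "(\<Sum>e\<leftarrow>map bs [0..<7]. e i * e j) = (\<Sum>l\<leftarrow>[0..<7]. bs l i * bs l j)" by (simp add: o_def)
    also have "\<dots> = (\<Sum>l<7. if l = i then (if i = j then 1 else 0) else 0)"
      unfolding sum_set_upt_conv_sum_list_nat[symmetric] atLeast0LessThan set_upt
      by (intro sum.cong refl) (auto simp: bs_def)
    finally show ?thesis using that by (simp add: sum.delta)
  qed
  then show ?thesis unfolding orthobasis_def by blast
qed

text \<open>This is E E^T = 1 implying E^T E = 1. The seven vectors and \<open>bs i\<close> are
  eight vectors in R^7, hence related; pairing the relation with each \<open>Es ! b\<close>
  determines its coefficients and expands \<open>bs i\<close> in the basis.\<close>

lemma orthonormal_orthobasis:
  assumes len: "length Es = 7" and on: "\<And>a b. a < 7 \<Longrightarrow> b < 7 \<Longrightarrow> (\<Sum>i<7. (Es ! a) i * (Es ! b) i) = (if a = b then 1 else 0)"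
  shows "orthobasis Es"
  unfolding orthobasis_def
proof (intro allI impI)
  fix i j :: nat assume i: "i < 7" and j: "j < 7"
  define A where "A = (\<lambda>a l. if a < 7 then (Es ! a) l else bs i l)"
  obtain c where c: "\<exists>a\<in>{..<8}. c a \<noteq> 0" "\<forall>l<7. (\<Sum>a\<in>{..<8}. c a * A a l) = 0"
    using homogeneous_system[of "{..<8}" 7 A] by auto
  have split: "(\<Sum>a\<in>{..<8}. c a * A a l) = (\<Sum>a<7. c a * (Es ! a) l) + c 7 * bs i l" for l
  proof -
    have "{..<8} = insert 7 {..<7::nat}" by auto
    then show ?thesis by (simp add: A_def)
  qed
  have rel: "(\<Sum>a<7. c a * (Es ! a) l) + c 7 * bs i l = 0" if "l < 7" for l
    using c(2) that unfolding split by blast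
  have cb: "c b = - c 7 * (Es ! b) i" if b: "b < 7" for b
  proof -
    have "0 = (\<Sum>l<7. ((\<Sum>a<7. c a * (Es ! a) l) + c 7 * bs i l) * (Es ! b) l)" using rel by simp
    also have "\<dots> = (\<Sum>l<7. \<Sum>a<7. c a * ((Es ! a) l * (Es ! b) l)) + (\<Sum>l<7. c 7 * (bs i l * (Es ! b) l))"
      by (simp add: distrib_right sum.distrib sum_distrib_right mult.assoc)
    also have "(\<Sum>l<7. \<Sum>a<7. c a * ((Es ! a) l * (Es ! b) l)) = (\<Sum>a<7. c a * (\<Sum>l<7. (Es ! a) l * (Es ! b) l))"
      by (subst sum.swap) (simp add: sum_distrib_left)
    also have "\<dots> = (\<Sum>a<7. if a = b then c a else 0)" by (rule sum.cong[OF refl]) (use on b in auto)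
    also have "(\<Sum>l<7. c 7 * (bs i l * (Es ! b) l)) = (\<Sum>l<7. if l = i then c 7 * (Es ! b) l else 0)"
      by (rule sum.cong[OF refl]) (simp add: bs_def)
    finally show ?thesis using i b by (simp add: sum.delta)
  qed
  have "c 7 \<noteq> 0"
  proof
    assume "c 7 = 0"
    then have "c a = 0" if "a < 8" for a using cb[of a] that by (cases "a = 7") auto
    then show False using c(1) by auto
  qed
  moreover have "c 7 * bs i j = c 7 * (\<Sum>a<7. (Es ! a) i * (Es ! a) j)"
    using rel[OF j] cb by (simp add: sum_distrib_left mult.assoc sum_negf)
  ultimately have "(\<Sum>a<7. (Es ! a) i * (Es ! a) j) = bs i j" by simp
  moreover have "(\<Sum>e\<leftarrow>Es. e i * e j) = (\<Sum>a<7. (Es ! a) i * (Es ! a) j)"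
    by (simp add: sum_list_sum_nth len atLeast0LessThan)
  ultimately show "(\<Sum>e\<leftarrow>Es. e i * e j) = (if i = j then 1 else 0)" by (auto simp: bs_def)
qed

subsection \<open>Linear combinations of decomposable forms\<close>

fun dec :: "nat list \<Rightarrow> rvec list \<Rightarrow> real" where
  "dec [] vs = (if vs = [] then 1 else 0)"
| "dec (i # I) vs = wd (Suc 0) (\<lambda>r. hd r i) (dec I) vs"

text \<open>The term \<open>(s, I)\<close> stands for \<open>s e\<^sup>I\<close>; the indices start at 0.\<close>

definition frm :: "(real \<times> nat list) list \<Rightarrow> rvec list \<Rightarrow> real" where
  "frm L vs = (\<Sum>(s, I)\<leftarrow>L. s * dec I vs)"

definition frm_ok :: "nat \<Rightarrow> (real \<times> nat list) list \<Rightarrow> bool" where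
  "frm_ok k L \<longleftrightarrow> list_all (\<lambda>(s, I). length I = k \<and> list_all (\<lambda>i. i < 7) I) L"

lemma frm_Nil [simp]: "frm [] vs = 0"
  and frm_Cons [simp]: "frm ((s, I) # L) vs = s * dec I vs + frm L vs"
  by (simp_all add: frm_def)

lemma frm_append [simp]: "frm (L @ M) vs = frm L vs + frm M vs"
  by (simp add: frm_def)

lemma kform_coord: "i < 7 \<Longrightarrow> kform (Suc 0) (\<lambda>r. hd r i)"
proof -
  assume i: "i < 7"
  have "v i = (\<Sum>j<7. v j * bs j i)" for v :: rvec
  proof -
    have "(\<Sum>j<7. v j * bs j i) = (\<Sum>j<7. if j = i then v j else 0)"
      by (rule sum.cong) (auto simp: bs_def)
    then show ?thesis using i by (simp add: sum.delta)
  qed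
  then show ?thesis by (simp add: kform.simps(2))
qed

lemma kform_dec: "list_all (\<lambda>i. i < 7) I \<Longrightarrow> length I = k \<Longrightarrow> kform k (dec I)"
proof (induction I arbitrary: k)
  case (Cons i I)
  have "kform k (wd (Suc 0) (\<lambda>r. hd r i) (dec I))"
    by (rule kform_wd[OF kform_coord Cons.IH[OF _ refl]]) (use Cons.prems in auto)
  moreover have "dec (i # I) = wd (Suc 0) (\<lambda>r. hd r i) (dec I)" by (rule ext) simp
  ultimately show ?case by simp
qed simp

lemma kform_frm: "frm_ok k L \<Longrightarrow> kform k (frm L)"
proof (induction L)
  case Nil
  have "frm [] = (\<lambda>vs. 0)" by (rule ext) simp
  then show ?case using kform_zero by simp
next
  case (Cons x L)
  obtain s I where x: "x = (s, I)" by (cases x)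
  have "kform k (\<lambda>vs. s * dec I vs + frm L vs)"
    by (rule kform_add[OF kform_scale[OF kform_dec] Cons.IH]) (use Cons.prems x in \<open>auto simp: frm_ok_def\<close>)
  moreover have "frm (x # L) = (\<lambda>vs. s * dec I vs + frm L vs)" by (rule ext) (simp add: x)
  ultimately show ?case by simp
qed

lemma wd_scale_add1: "wd k (\<lambda>r. s * \<alpha> r + \<alpha>' r) \<beta> vs = s * wd k \<alpha> \<beta> vs + wd k \<alpha>' \<beta> vs"
  using wd_lin1[where k = k and \<alpha> = "\<lambda>r. s * \<alpha> r + \<alpha>' r" and I = "UNIV :: bool set"
      and c = "\<lambda>b. if b then s else 1" and A = "\<lambda>b. if b then \<alpha> else \<alpha>'" and \<beta> = \<beta> and vs = vs]
  by (simp add: UNIV_bool add.commute)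

lemma wd_scale_add2: "wd k \<alpha> (\<lambda>r. s * \<beta> r + \<beta>' r) vs = s * wd k \<alpha> \<beta> vs + wd k \<alpha> \<beta>' vs"
  using wd_lin2[where k = k and \<beta> = "\<lambda>r. s * \<beta> r + \<beta>' r" and I = "UNIV :: bool set"
      and c = "\<lambda>b. if b then s else 1" and B = "\<lambda>b. if b then \<beta> else \<beta>'" and \<alpha> = \<alpha> and vs = vs]
  by (simp add: UNIV_bool add.commute)

lemma wd_frm1: "wd k (frm L) \<beta> vs = (\<Sum>(s, I)\<leftarrow>L. s * wd k (dec I) \<beta> vs)"
proof (induction L)
  case Nil then show ?case by (simp add: wd_zero1)
next
  case (Cons x L)
  obtain s I where x: "x = (s, I)" by (cases x)
  have "frm (x # L) = (\<lambda>r. s * dec I r + frm L r)" by (rule ext) (simp add: x)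
  then show ?case using Cons.IH by (simp add: x wd_scale_add1)
qed

lemma wd_frm2: "wd k \<alpha> (frm L) vs = (\<Sum>(s, I)\<leftarrow>L. s * wd k \<alpha> (dec I) vs)"
proof (induction L)
  case Nil then show ?case by (simp add: wd_zero2)
next
  case (Cons x L)
  obtain s I where x: "x = (s, I)" by (cases x)
  have "frm (x # L) = (\<lambda>r. s * dec I r + frm L r)" by (rule ext) (simp add: x)
  then show ?case using Cons.IH by (simp add: x wd_scale_add2)
qed

text \<open>With the wedge product given by recursion, this is an induction on the arguments: the
  first one goes to one of the three factors, and the signs depend only on the degrees
  \<open>k\<close> and \<open>l\<close>.\<close>

lemma wd_assoc: "wd (k + l) (wd k \<alpha> \<beta>) \<gamma> vs = wd k \<alpha> (wd l \<beta> \<gamma>) vs"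
proof (induction vs arbitrary: k l \<alpha> \<beta> \<gamma>)
  case Nil
  show ?case by (cases k; cases l) auto
next
  case (Cons v vs)
  let ?\<alpha> = "\<lambda>r. \<alpha> (v # r)" and ?\<beta> = "\<lambda>r. \<beta> (v # r)" and ?\<gamma> = "\<lambda>r. \<gamma> (v # r)"
  show ?case
  proof (cases k)
    case 0
    have "wd l (\<lambda>r. \<alpha> [] * \<beta> r) \<gamma> ws = \<alpha> [] * wd l \<beta> \<gamma> ws" for ws
      using wd_scale_add1[of l "\<alpha> []" \<beta> "\<lambda>r. 0" \<gamma> ws] by (simp add: wd_zero1)
    moreover have "wd 0 \<alpha> \<beta> = (\<lambda>r. \<alpha> [] * \<beta> r)" by (rule ext) simp
    ultimately show ?thesis using 0 by simp
  next
    case (Suc k')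
    have c1: "(\<lambda>r. wd (Suc k') \<alpha> \<beta> (v # r)) = (\<lambda>r. (-1) ^ Suc k' * wd (Suc k') \<alpha> ?\<beta> r + wd k' ?\<alpha> \<beta> r)"
      by (rule ext) simp
    have L: "wd (Suc k' + l) (wd (Suc k') \<alpha> \<beta>) \<gamma> (v # vs) =
        (-1) ^ Suc k' * wd (k' + l) (wd (Suc k') \<alpha> ?\<beta>) \<gamma> vs + wd (k' + l) (wd k' ?\<alpha> \<beta>) \<gamma> vs
        + (-1) ^ Suc (k' + l) * wd (Suc k' + l) (wd (Suc k') \<alpha> \<beta>) ?\<gamma> vs"
    proof -
      have "wd (Suc (k' + l)) X \<gamma> (v # vs) = wd (k' + l) (\<lambda>r. X (v # r)) \<gamma> vs + (-1) ^ Suc (k' + l) * wd (Suc (k' + l)) X ?\<gamma> vs" for X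
        by simp
      from this[of "wd (Suc k') \<alpha> \<beta>"] show ?thesis unfolding c1 wd_scale_add1 add_Suc .
    qed
    show ?thesis
    proof (cases l)
      case 0
      have z: "wd (k' + l) (wd (Suc k') \<alpha> ?\<beta>) \<gamma> vs = 0"
        by (rule wd_zero1) (simp add: 0 wd_short)
      have b0: "wd l \<beta> \<delta> = (\<lambda>r. \<beta> [] * \<delta> r)" for \<delta> by (rule ext) (simp add: 0)
      have "wd (Suc k') \<alpha> (wd l \<beta> \<gamma>) (v # vs) = wd k' ?\<alpha> (wd l \<beta> \<gamma>) vs + (-1) ^ Suc k' * wd (Suc k') \<alpha> (wd l \<beta> ?\<gamma>) vs"
        unfolding b0 by simp
      then show ?thesis using L z Cons.IH[of k' l ?\<alpha> \<beta> \<gamma>] Cons.IH[of "Suc k'" l \<alpha> \<beta> ?\<gamma>] by (simp add: Suc 0)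
    next
      case l: (Suc l')
      have c2: "(\<lambda>r. wd l \<beta> \<gamma> (v # r)) = (\<lambda>r. (-1) ^ l * wd l \<beta> ?\<gamma> r + wd l' ?\<beta> \<gamma> r)"
        by (rule ext) (simp add: l)
      have "wd (Suc k') \<alpha> (wd l \<beta> \<gamma>) (v # vs) = wd k' ?\<alpha> (wd l \<beta> \<gamma>) vs
          + (-1) ^ Suc k' * ((-1) ^ l * wd (Suc k') \<alpha> (wd l \<beta> ?\<gamma>) vs + wd (Suc k') \<alpha> (wd l' ?\<beta> \<gamma>) vs)"
        unfolding wd.simps(3) c2 wd_scale_add2 ..
      moreover have "wd (k' + l) (wd (Suc k') \<alpha> ?\<beta>) \<gamma> vs = wd (Suc k') \<alpha> (wd l' ?\<beta> \<gamma>) vs"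
        using Cons.IH[of "Suc k'" l' \<alpha> ?\<beta> \<gamma>] by (simp add: l)
      ultimately show ?thesis
        using L Cons.IH[of k' l ?\<alpha> \<beta> \<gamma>] Cons.IH[of "Suc k'" l \<alpha> \<beta> ?\<gamma>] by (simp add: Suc power_add algebra_simps)
    qed
  qed
qed

lemma wd_dec: "wd (length I) (dec I) (dec J) vs = dec (I @ J) vs"
proof (induction I arbitrary: vs)
  case Nil then show ?case by simp
next
  case (Cons i I)
  have e: "dec (i # I) = wd (Suc 0) (\<lambda>r. hd r i) (dec I)" by (rule ext) simp
  have "wd (Suc 0 + length I) (wd (Suc 0) (\<lambda>r. hd r i) (dec I)) (dec J) vs =
      wd (Suc 0) (\<lambda>r. hd r i) (wd (length I) (dec I) (dec J)) vs" by (rule wd_assoc)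
  moreover have "wd (length I) (dec I) (dec J) = dec (I @ J)" by (rule ext) (rule Cons.IH)
  ultimately show ?case unfolding e by simp
qed

definition mulf :: "(real \<times> nat list) list \<Rightarrow> (real \<times> nat list) list \<Rightarrow> (real \<times> nat list) list" where
  "mulf L M = concat (map (\<lambda>(s, I). map (\<lambda>(t, J). (s * t, I @ J)) M) L)"

lemma wd_frm: "frm_ok k L \<Longrightarrow> wd k (frm L) (frm M) vs = frm (mulf L M) vs"
proof (induction L)
  case Nil then show ?case by (simp add: mulf_def wd_zero1)
next
  case (Cons x L)
  obtain s I where x: "x = (s, I)" by (cases x)
  have k: "length I = k" using Cons.prems by (simp add: x frm_ok_def)
  have "wd k (frm (x # L)) (frm M) vs = s * wd k (dec I) (frm M) vs + wd k (frm L) (frm M) vs"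
    unfolding wd_frm1 by (simp add: x)
  also have "wd k (dec I) (frm M) vs = (\<Sum>(t, J)\<leftarrow>M. t * dec (I @ J) vs)"
    unfolding wd_frm2 k[symmetric] wd_dec ..
  also have "s * (\<Sum>(t, J)\<leftarrow>M. t * dec (I @ J) vs) = frm (map (\<lambda>(t, J). (s * t, I @ J)) M) vs"
    by (induction M) (auto simp: frm_def algebra_simps)
  also have "wd k (frm L) (frm M) vs = frm (mulf L M) vs" using Cons by (simp add: frm_ok_def)
  finally show ?case by (simp add: x mulf_def)
qed

text \<open>Symbolic contraction of a decomposable form with a basis vector, by the antiderivation
  rule: every factor passed over contributes a minus sign.\<close>

fun ct :: "nat \<Rightarrow> nat list \<Rightarrow> (real \<times> nat list) list" where
  "ct i [] = []"
| "ct i (j # I) = (if j = i then [(1, I)] else []) @ map (\<lambda>(s, K). (- s, j # K)) (ct i I)"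

lemma frm_ct: "dec I (bs i # vs) = frm (ct i I) vs"
proof (induction I arbitrary: vs)
  case (Cons j I)
  have e: "(\<lambda>r. dec I (bs i # r)) = frm (ct i I)" by (rule ext) (rule Cons.IH)
  have m: "frm (map (\<lambda>(s, K). (- s, j # K)) L) vs = - (\<Sum>(s, K)\<leftarrow>L. s * wd (Suc 0) (\<lambda>r. hd r j) (dec K) vs)" for L
    by (induction L) auto
  have "dec (j # I) (bs i # vs) = bs i j * dec I vs - wd (Suc 0) (\<lambda>r. hd r j) (frm (ct i I)) vs"
    unfolding dec.simps wd.simps e by simp
  also have "\<dots> = frm (ct i (j # I)) vs" unfolding ct.simps frm_append m wd_frm2 by (simp add: bs_def)
  finally show ?case .
qed simp

definition ctf :: "nat \<Rightarrow> (real \<times> nat list) list \<Rightarrow> (real \<times> nat list) list" where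
  "ctf i L = concat (map (\<lambda>(s, I). map (\<lambda>(t, K). (s * t, K)) (ct i I)) L)"

lemma frm_ctf: "frm L (bs i # vs) = frm (ctf i L) vs"
proof (induction L)
  case (Cons x L)
  obtain s I where x: "x = (s, I)" by (cases x)
  have "s * frm M vs = frm (map (\<lambda>(t, K). (s * t, K)) M) vs" for M
    by (induction M) (auto simp: algebra_simps)
  then show ?case using Cons.IH by (simp add: x ctf_def frm_ct)
qed (simp add: ctf_def)

text \<open>One row of a Laplace expansion: the alternating sum over the positions of
  \<open>i\<close> in the index list. Iterated over \<open>I\<close> it gives \<open>sg\<close>, the
  determinant of Kronecker deltas that is the value of e^I on the basis vectors e_J.\<close>

fun pk :: "nat \<Rightarrow> (nat list \<Rightarrow> real) \<Rightarrow> nat list \<Rightarrow> real" where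
  "pk i F [] = 0"
| "pk i F (j # J) = (if j = i then F J else 0) - pk i (\<lambda>r. F (j # r)) J"

fun sg :: "nat list \<Rightarrow> nat list \<Rightarrow> real" where
  "sg [] J = (if J = [] then 1 else 0)"
| "sg (i # I) J = pk i (sg I) J"

lemma wd_pk: "wd (Suc 0) (\<lambda>r. hd r i) \<beta> (map bs J) = pk i (\<lambda>r. \<beta> (map bs r)) J"
  by (induction J arbitrary: \<beta>) (auto simp: bs_def)

lemma dec_sg: "dec I (map bs J) = sg I J"
proof (induction I arbitrary: J)
  case (Cons i I)
  have "(\<lambda>r. dec I (map bs r)) = sg I" by (rule ext) (rule Cons.IH)
  then show ?case by (simp add: wd_pk)
qed simp

lemma frm_sg: "frm L (map bs J) = (\<Sum>(s, I)\<leftarrow>L. s * sg I J)"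
  unfolding frm_def dec_sg ..

text \<open>A form of \<open>sg\<close> for distinct indices that the simplifier evaluates quickly.\<close>

fun ps :: "nat \<Rightarrow> nat list \<Rightarrow> real" where
  "ps i [] = 0"
| "ps i (j # J) = (if j = i then 1 else - ps i J)"

fun sgd :: "nat list \<Rightarrow> nat list \<Rightarrow> real" where
  "sgd [] J = (if J = [] then 1 else 0)"
| "sgd (i # I) J = (if i \<in> set J then ps i J * sgd I (remove1 i J) else 0)"

lemma pk_ps: "distinct J \<Longrightarrow> pk i F J = (if i \<in> set J then ps i J * F (remove1 i J) else 0)"
  by (induction J arbitrary: F) auto

lemma sg_sgd: "distinct J \<Longrightarrow> sg I J = sgd I J"
  by (induction I arbitrary: J) (auto simp: pk_ps)

lemma subs_distinct: "distinct L \<Longrightarrow> J \<in> set (subs k L) \<Longrightarrow> distinct J \<and> set J \<subseteq> set L"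
proof (induction L arbitrary: k J)
  case Nil then show ?case by (cases k) auto
next
  case (Cons x L) then show ?case by (cases k) fastforce+
qed

lemma dec_not_mem: "l \<notin> set I \<Longrightarrow> dec I (bs l # r) = 0"
proof (induction I arbitrary: r)
  case (Cons j I)
  have "(\<lambda>s. dec I (bs l # s)) = (\<lambda>s. 0)" by (rule ext) (use Cons in simp)
  then show ?case using Cons.prems by (simp add: bs_def wd_zero2)
qed simp

lemma dec_head:
  assumes "l \<notin> set L" "set r \<subseteq> bs ` set L"
  shows "dec (l # I) (bs l # r) = dec I r" "dec (l # I) r = 0"
proof -
  have 0: "wd (Suc 0) (\<lambda>r. hd r l) \<beta> r = 0" if "set r \<subseteq> bs ` set L" for \<beta> r
    using that
  proof (induction r arbitrary: \<beta>)
    case (Cons v r)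
    then show ?case using assms(1) by (auto simp: bs_def)
  qed simp
  show "dec (l # I) r = 0" using 0[OF assms(2)] by simp
  show "dec (l # I) (bs l # r) = dec I r" using 0[OF assms(2)] by (simp add: bs_def)
qed

text \<open>Among the increasing lists of basis vectors only the one indexed by \<open>I\<close>
  gives e^I a non-zero value, namely 1.\<close>

lemma es_dec:
  "sorted_wrt (<) L \<Longrightarrow> sorted_wrt (<) I \<Longrightarrow> set I \<subseteq> set L \<Longrightarrow> es (length I) (dec I) \<gamma> (map bs L) = \<gamma> (map bs I)"
proof (induction L arbitrary: I \<gamma>)
  case (Cons l L)
  have lL: "l \<notin> set L" using Cons.prems(1) by auto
  have sL: "sorted_wrt (<) L" using Cons.prems(1) by simp
  show ?case
  proof (cases I)
    case (Cons i I')
    show ?thesis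
    proof (cases "i = l")
      case True
      have sI: "sorted_wrt (<) I'" "set I' \<subseteq> set L"
        using Cons.prems(2,3) unfolding Cons True by auto
      have "es (length I') (\<lambda>r. dec I (bs l # r)) (\<lambda>r. \<gamma> (bs l # r)) (map bs L) =
          es (length I') (dec I') (\<lambda>r. \<gamma> (bs l # r)) (map bs L)"
        unfolding Cons True by (rule es_cong) (use dec_head(1)[OF lL] in auto)
      also have "\<dots> = \<gamma> (bs l # map bs I')" by (rule Cons.IH[OF sL sI])
      also have "es (Suc (length I')) (dec I) \<gamma> (map bs L) = es (Suc (length I')) (\<lambda>r. 0) \<gamma> (map bs L)"
        unfolding Cons True by (rule es_cong) (use dec_head(2)[OF lL] in auto)
      then have "es (Suc (length I')) (dec I) \<gamma> (map bs L) = 0"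
        by (simp add: es_subsets[symmetric])
      ultimately show ?thesis by (simp add: Cons True del: dec.simps)
    next
      case False
      have lI: "l \<notin> set I"
      proof
        assume "l \<in> set I"
        then have "i < l" using Cons.prems(2) False unfolding Cons by auto
        moreover have "i \<in> set L" using Cons.prems(3) False unfolding Cons by auto
        ultimately show False using Cons.prems(1) by auto
      qed
      have "es (length I') (\<lambda>r. dec I (bs l # r)) (\<lambda>r. \<gamma> (bs l # r)) (map bs L) = es (length I') (\<lambda>r. 0) (\<lambda>r. \<gamma> (bs l # r)) (map bs L)"
        by (rule es_cong) (use dec_not_mem[OF lI] in auto)
      then have "es (length I') (\<lambda>r. dec I (bs l # r)) (\<lambda>r. \<gamma> (bs l # r)) (map bs L) = 0"
        by (simp add: es_subsets[symmetric])
      moreover have "es (length I) (dec I) \<gamma> (map bs L) = \<gamma> (map bs I)"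
        by (rule Cons.IH[OF sL Cons.prems(2)]) (use Cons.prems(3) lI in auto)
      ultimately show ?thesis by (simp add: Cons del: dec.simps)
    qed
  qed simp
qed simp

lemma es_add1: "es k (\<lambda>r. s * \<beta> r + \<beta>' r) \<gamma> Es = s * es k \<beta> \<gamma> Es + es k \<beta>' \<gamma> Es"
  unfolding es_subsets[symmetric] by (simp add: sum.distrib sum_distrib_left algebra_simps)

lemma es_frm:
  "list_all (\<lambda>(s, I). length I = k \<and> sorted_wrt (<) I \<and> list_all (\<lambda>i. i < 7) I) L \<Longrightarrow>
    es k (frm L) \<gamma> (map bs [0..<7]) = (\<Sum>(s, I)\<leftarrow>L. s * \<gamma> (map bs I))"
proof (induction L)
  case Nil
  have "frm [] = (\<lambda>r. 0)" by (rule ext) simp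
  then show ?case by (simp add: es_subsets[symmetric])
next
  case (Cons x L)
  obtain s I where x: "x = (s, I)" by (cases x)
  have I: "length I = k" "sorted_wrt (<) I" "list_all (\<lambda>i. i < 7) I" using Cons.prems by (simp_all add: x)
  have "es (length I) (dec I) \<gamma> (map bs [0..<7]) = \<gamma> (map bs I)"
    by (rule es_dec[OF _ I(2)]) (use I(3) in \<open>auto simp: list_all_iff\<close>)
  moreover have "frm (x # L) = (\<lambda>vs. s * dec I vs + frm L vs)" by (rule ext) (simp add: x)
  ultimately show ?case using Cons I(1) by (simp add: x es_add1)
qed

subsection \<open>The model forms\<close>

text \<open>\<open>psi0\<close> and \<open>vol0\<close> are \<open>\<star>\<phi>\<close> and the volume form of the \<open>G\<^sub>2\<close>-structure \<open>phi0\<close>; \<open>dphi0\<close> is its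
  differential and \<open>T0\<close> its torsion when the differentials of the coframe are \<open>de0 a b c\<close>.\<close>

definition "phi0 = [(1, [4,5,6]), (1, [0,1,4]), (1, [2,3,4]), (1, [0,2,5]), (-1, [1,3,5]), (-1, [0,3,6]), (-1::real, [1,2,6::nat])]"
definition "psi0 = [(1, [0,1,2,3]), (1, [2,3,5,6]), (1, [0,1,5,6]), (1, [1,3,4,6]), (-1, [0,2,4,6]), (-1, [1,2,4,5]), (-1::real, [0,3,4,5::nat])]"
definition "vol0 = [(1::real, [0,1,2,3,4,5,6::nat])]"

definition de0 :: "real \<Rightarrow> real \<Rightarrow> real \<Rightarrow> nat \<Rightarrow> (real \<times> nat list) list" where
  "de0 a b c k = (if k = 4 then [(a, [0,1]), (-a, [2,3])] else if k = 5 then [(b, [0,2]), (b, [1,3])]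
     else if k = 6 then [(c, [0,3]), (-c, [1,2])] else [])"

definition dphi0 :: "real \<Rightarrow> real \<Rightarrow> real \<Rightarrow> (real \<times> nat list) list" where
  "dphi0 a b c = [(a, [0,1,5,6]), (-a, [2,3,5,6]), (-b, [0,2,4,6]), (-b, [1,3,4,6]), (c, [0,3,4,5]), (-c, [1,2,4,5])]"

definition T0 :: "real \<Rightarrow> real \<Rightarrow> real \<Rightarrow> (real \<times> nat list) list" where
  "T0 a b c = [(a, [0,1,4]), (-a, [2,3,4]), (b, [0,2,5]), (b, [1,3,5]), (c, [0,3,6]), (-c, [1,2,6])]"

text \<open>The exterior derivative of a form with constant coefficients in a coframe, where
  \<open>\<delta> k\<close> stands for de^k: replace each factor e^k by de^k, which is to contract
  with e_k and wedge with de^k from the left.\<close>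

definition dW :: "(nat \<Rightarrow> rvec list \<Rightarrow> real) \<Rightarrow> (rvec list \<Rightarrow> real) \<Rightarrow> rvec list \<Rightarrow> real" where
  "dW \<delta> W vs = (\<Sum>k<7. wd 2 (\<delta> k) (\<lambda>r. W (bs k # r)) vs)"

lemma sum_lessThan_7: "(\<Sum>k<7. f k) = f 0 + f 1 + f 2 + f 3 + f 4 + f 5 + (f (6::nat) :: real)"
  by (simp add: eval_nat_numeral)

lemma upt_0_7: "[0..<7] = [0,1,2,3,4,5,6::nat]"
  by (simp add: upt_rec)

lemma de0_ok: "frm_ok 2 (de0 a b c k)"
  by (simp add: de0_def frm_ok_def)

lemma dW_frm:
  "dW (\<lambda>k. frm (de0 a b c k)) (frm L) vs =
    frm (mulf (de0 a b c 4) (ctf 4 L) @ mulf (de0 a b c 5) (ctf 5 L) @ mulf (de0 a b c 6) (ctf 6 L)) vs"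
proof -
  have "wd 2 (frm (de0 a b c k)) (\<lambda>r. frm L (bs k # r)) vs = frm (mulf (de0 a b c k) (ctf k L)) vs" for k
    unfolding frm_ctf by (rule wd_frm[OF de0_ok])
  moreover have "mulf (de0 a b c k) M = []" if "k < 4" for k M
    using that by (simp add: de0_def mulf_def)
  ultimately show ?thesis unfolding dW_def sum_lessThan_7 by simp
qed

lemma frm_eqI:
  assumes "frm_ok k L" "frm_ok k M" "list_all (\<lambda>J. (\<Sum>(s, I)\<leftarrow>L. s * sgd I J) = (\<Sum>(s, I)\<leftarrow>M. s * sgd I J)) (subs k [0,1,2,3,4,5,6])"
    "length vs = k"
  shows "frm L vs = frm M vs"
proof (rule kform_eqI[OF kform_frm[OF assms(1)] kform_frm[OF assms(2)] _ assms(4)], intro ballI)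
  fix J assume J: "J \<in> set (subs k [0..<7])"
  then have "(\<Sum>(s, I)\<leftarrow>L. s * sgd I J) = (\<Sum>(s, I)\<leftarrow>M. s * sgd I J)"
    using assms(3) unfolding upt_0_7 list_all_iff by blast
  moreover have "distinct J" using subs_distinct[OF _ J] by simp
  ultimately show "frm L (map bs J) = frm M (map bs J)" by (simp add: frm_sg sg_sgd)
qed

lemmas frm_eval = frm_ok_def mulf_def ctf_def de0_def phi0_def psi0_def vol0_def dphi0_def T0_def numeral_eq_Suc

lemma frm_oks: "frm_ok 3 phi0" "frm_ok 4 psi0" "frm_ok 7 vol0" "frm_ok 4 (dphi0 a b c)" "frm_ok 3 (T0 a b c)"
  by (simp_all add: frm_ok_def phi0_def psi0_def vol0_def dphi0_def T0_def)

text \<open>The forms 12 + 34, 13 - 24 and 14 + 23 are self-dual and the de^k anti-self-dual in the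
  directions 1234, so their products vanish and only d(567) survives. The same cancellation is
  behind the vanishing of d\<psi>, d\<phi> \<and> \<phi>, \<phi> \<and> T and de^k \<and> \<psi>; in
  \<phi> \<and> T the remaining products of 567 repeat a factor e^k.\<close>

lemma dW_phi0: "length vs = 4 \<Longrightarrow> dW (\<lambda>k. frm (de0 a b c k)) (frm phi0) vs = frm (dphi0 a b c) vs"
  unfolding dW_frm by (rule frm_eqI[of 4]) (simp_all add: frm_eval)

lemma dW_psi0: "length vs = 5 \<Longrightarrow> dW (\<lambda>k. frm (de0 a b c k)) (frm psi0) vs = 0"
proof -
  assume "length vs = 5"
  then have "dW (\<lambda>k. frm (de0 a b c k)) (frm psi0) vs = frm [] vs"
    unfolding dW_frm by (intro frm_eqI[of 5]) (simp_all add: frm_eval)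
  then show ?thesis by simp
qed

lemma dphi0_phi0: "length vs = 7 \<Longrightarrow> wd 4 (frm (dphi0 a b c)) (frm phi0) vs = 0"
proof -
  assume "length vs = 7"
  then have "frm (mulf (dphi0 a b c) phi0) vs = frm [] vs"
    by (intro frm_eqI[of 7]) (simp_all add: frm_eval)
  then show ?thesis unfolding wd_frm[OF frm_oks(4)] by simp
qed

lemma phi0_T0: "length vs = 6 \<Longrightarrow> wd 3 (frm phi0) (frm (T0 a b c)) vs = 0"
proof -
  assume "length vs = 6"
  then have "frm (mulf phi0 (T0 a b c)) vs = frm [] vs"
    by (intro frm_eqI[of 6]) (simp_all add: frm_eval)
  then show ?thesis unfolding wd_frm[OF frm_oks(1)] by simp
qed

lemma de0_psi0: "length vs = 6 \<Longrightarrow> wd 2 (frm (de0 a b c k)) (frm psi0) vs = 0"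
proof -
  assume vs: "length vs = 6"
  have "frm (mulf (de0 a b c k) psi0) vs = frm [] vs"
  proof (cases "k \<in> {4, 5, 6}")
    case True
    then show ?thesis using vs by (elim insertE) (intro frm_eqI[of 6]; simp add: frm_eval)+
  qed (simp add: de0_def mulf_def)
  then show ?thesis unfolding wd_frm[OF de0_ok] by simp
qed

text \<open>T is the sum of the de^k \<and> e^k and the de^k have only the closed factors e^1, ...,
  e^4, so the derivative falls on the last factor.\<close>

lemma dW_T0: "length vs = 4 \<Longrightarrow> dW (\<lambda>k. frm (de0 a b c k)) (frm (T0 a b c)) vs =
  wd 2 (frm (de0 a b c 4)) (frm (de0 a b c 4)) vs + wd 2 (frm (de0 a b c 5)) (frm (de0 a b c 5)) vs
  + wd 2 (frm (de0 a b c 6)) (frm (de0 a b c 6)) vs"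
  unfolding dW_frm wd_frm[OF de0_ok] frm_append[symmetric]
  by (rule frm_eqI[of 4]) (simp_all add: frm_eval)

text \<open>In the standard basis the star of e^I is the contraction of the volume form with the
  vectors e_I, which is worked out symbolically.\<close>

lemma es_phi0: "es 3 (frm phi0) (\<lambda>r. frm vol0 (r @ xs)) (map bs [0..<7]) = frm psi0 xs"
proof -
  have "es 3 (frm phi0) (\<lambda>r. frm vol0 (r @ xs)) (map bs [0..<7]) = (\<Sum>(s, I)\<leftarrow>phi0. s * frm vol0 (map bs I @ xs))"
    by (rule es_frm) (simp add: phi0_def)
  also have "\<dots> = frm psi0 xs"
    by (simp add: phi0_def psi0_def vol0_def frm_ctf frm_ct ctf_def del: dec.simps)
  finally show ?thesis .
qed

lemma es_dphi0: "es 4 (frm (dphi0 a b c)) (\<lambda>r. frm vol0 (r @ xs)) (map bs [0..<7]) = - frm (T0 a b c) xs"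
proof -
  have "es 4 (frm (dphi0 a b c)) (\<lambda>r. frm vol0 (r @ xs)) (map bs [0..<7]) = (\<Sum>(s, I)\<leftarrow>dphi0 a b c. s * frm vol0 (map bs I @ xs))"
    by (rule es_frm) (simp add: dphi0_def)
  also have "\<dots> = - frm (T0 a b c) xs"
    by (simp add: dphi0_def T0_def vol0_def frm_ctf frm_ct ctf_def del: dec.simps)
  finally show ?thesis .
qed

lemma ct_ok: "list_all (\<lambda>(s, K). Suc (length K) = length I \<and> set K \<subseteq> set I) (ct i I)"
  by (induction I) (fastforce simp: list_all_iff)+

lemma ctf_ok: "frm_ok (Suc k) L \<Longrightarrow> frm_ok k (ctf i L)"
  using ct_ok unfolding frm_ok_def ctf_def list_all_iff by fastforce

lemma mulf_ok: "frm_ok k L \<Longrightarrow> frm_ok l M \<Longrightarrow> frm_ok (k + l) (mulf L M)"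
  unfolding frm_ok_def mulf_def list_all_iff by fastforce

text \<open>A 7-form on R^7 has a single coefficient, so the equation between metric and volume form
  comes down to one number for each of the 49 pairs of basis vectors.\<close>

lemma G2_metric_basis:
  assumes "i < 7" "j < 7" "length vs = 7"
  shows "wd 4 (wd 2 (\<lambda>r. frm phi0 (bs i # r)) (\<lambda>r. frm phi0 (bs j # r))) (frm phi0) vs =
    6 * (if i = j then 1 else 0) * frm vol0 vs"
proof -
  have ok: "frm_ok 2 (ctf i phi0)" "frm_ok 4 (mulf (ctf i phi0) (ctf j phi0))" "frm_ok 7 (mulf (mulf (ctf i phi0) (ctf j phi0)) phi0)"
    using ctf_ok[of 2 phi0] mulf_ok[of 2 "ctf i phi0" 2 "ctf j phi0"] mulf_ok[of 4 "mulf (ctf i phi0) (ctf j phi0)" 3 phi0] frm_oks(1)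
    by simp_all
  have e: "(\<lambda>r. frm phi0 (bs i # r)) = frm (ctf i phi0)" for i by (rule ext) (rule frm_ctf)
  have e2: "wd 2 (frm (ctf i phi0)) (frm (ctf j phi0)) = frm (mulf (ctf i phi0) (ctf j phi0))"
    by (rule ext) (rule wd_frm[OF ok(1)])
  \<comment> \<open>The value 6 for equal indices is the normalising factor in the definition of the
    metric; it shows that the coframe is orthonormal.\<close>
  have "(\<Sum>(s, I)\<leftarrow>mulf (mulf (ctf i phi0) (ctf j phi0)) phi0. s * sgd I [0,1,2,3,4,5,6]) = (if i = j then 6 else 0)"
  proof -
    have "i \<in> {0,1,2,3,4,5,6}" "j \<in> {0,1,2,3,4,5,6}" using assms(1,2) by auto
    then show ?thesis
      by (elim insertE emptyE) (simp_all add: phi0_def ctf_def mulf_def)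
  qed
  moreover have "sgd [0,1,2,3,4,5,6] [0,1,2,3,4,5,6] = 1" by simp
  moreover have "subs 7 [0,1,2,3,4,5,6::nat] = [[0,1,2,3,4,5,6]]" by (simp add: numeral_eq_Suc)
  ultimately have "frm (mulf (mulf (ctf i phi0) (ctf j phi0)) phi0) vs = frm [(6 * (if i = j then 1 else 0), [0,1,2,3,4,5,6])] vs"
    by (intro frm_eqI[OF ok(3) _ _ assms(3)]) (simp_all add: frm_ok_def del: sgd.simps)
  then show ?thesis unfolding e e2 wd_frm[OF ok(2)] by (simp add: vol0_def del: dec.simps)
qed

lemma G2_metric:
  assumes "length vs = 7"
  shows "wd 4 (wd 2 (\<lambda>r. frm phi0 (x # r)) (\<lambda>r. frm phi0 (y # r))) (frm phi0) vs =
    6 * (\<Sum>i<7. x i * y i) * frm vol0 vs"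
proof -
  let ?w = "\<lambda>x y. wd 4 (wd 2 (\<lambda>r. frm phi0 (x # r)) (\<lambda>r. frm phi0 (y # r))) (frm phi0) vs"
  have K: "kform (Suc 2) (frm phi0)" using kform_frm[OF frm_oks(1)] by simp
  have 1: "?w x y = (\<Sum>i<7. x i * ?w (bs i) y)" for x y
  proof (rule wd_lin1)
    fix r show "wd 2 (\<lambda>r. frm phi0 (x # r)) (\<lambda>r. frm phi0 (y # r)) r =
        (\<Sum>i<7. x i * wd 2 (\<lambda>r. frm phi0 (bs i # r)) (\<lambda>r. frm phi0 (y # r)) r)"
      by (rule wd_lin1) (rule kform_expand[OF K])
  qed
  have 2: "?w x y = (\<Sum>j<7. y j * ?w x (bs j))" for x y
  proof (rule wd_lin1)
    fix r :: "rvec list" assume r: "length r = 4"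
    show "wd 2 (\<lambda>r. frm phi0 (x # r)) (\<lambda>r. frm phi0 (y # r)) r =
        (\<Sum>j<7. y j * wd 2 (\<lambda>r. frm phi0 (x # r)) (\<lambda>r. frm phi0 (bs j # r)) r)"
      by (rule wd_lin2) (rule kform_expand[OF K], use r in simp)
  qed
  have "?w x y = (\<Sum>i<7. x i * (\<Sum>j<7. y j * ?w (bs i) (bs j)))"
    unfolding 1[of x y] 2[of "bs _" y] ..
  also have "\<dots> = (\<Sum>i<7. x i * (\<Sum>j<7. if i = j then y j * (6 * frm vol0 vs) else 0))"
    by (intro sum.cong refl arg_cong[of _ _ "(*) _"]) (use G2_metric_basis[OF _ _ assms] in auto)
  also have "\<dots> = (\<Sum>i<7. x i * (y i * (6 * frm vol0 vs)))"
    by (intro sum.cong refl) (simp add: sum.delta')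
  finally show ?thesis by (simp add: sum_distrib_right sum_distrib_left mult.assoc mult.left_commute)
qed

text \<open>The determinant of an orthogonal matrix is a sign: for a basis of seven vectors
  \<open>es 7\<close> has the single term vol(Es)^2, and \<open>es\<close> takes the same value on
  the standard basis.\<close>

lemma vol0_orthobasis:
  assumes "length Es = 7" "orthobasis Es"
  shows "\<bar>frm vol0 Es\<bar> = 1"
proof -
  have K: "kform 7 (frm vol0)" by (rule kform_frm[OF frm_oks(3)])
  have "frm vol0 Es * frm vol0 Es = es 7 (frm vol0) (frm vol0) Es"
    using es_full[of Es] assms(1) by simp
  also have "\<dots> = es 7 (frm vol0) (frm vol0) (map bs [0..<7])"
    by (rule es_orthobasis[OF assms(2) orthobasis_standard K K])
  also have "\<dots> = frm vol0 (map bs [0..<7]) * frm vol0 (map bs [0..<7])"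
    using es_full[of "map bs [0..<7]"] by simp
  also have "frm vol0 (map bs [0..<7]) = 1" unfolding frm_sg by (simp add: vol0_def upt_0_7)
  finally show ?thesis by (simp add: abs_square_eq_1[symmetric] power2_eq_square)
qed

section \<open>Invariant forms on a framed manifold\<close>

lemma sm_fun_nonzero_open:
  assumes M: "smooth_manifold M" and S: "openin (mtop M) S" and f: "sm_fun M S f"
  shows "openin (mtop M) {q \<in> S. f q \<noteq> 0}"
proof (subst openin_subopen, intro ballI)
  fix q assume q: "q \<in> {q \<in> S. f q \<noteq> 0}"
  then have "q \<in> points M" using openin_subset[OF S] by blast
  then obtain U c where Uc: "(U, c) \<in> atlas M" "q \<in> U" using chart_exists[OF M] by blast
  let ?V = "c ` (U \<inter> S)" and ?f = "\<lambda>x. f (inv_into U c x)"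
  have V: "openin (Euclidean_space (mdim M)) ?V" by (rule chart_image_open[OF M Uc(1) S])
  have "Ck_on 0 (mdim M) ?V ?f" using sm_funD[OF f Uc(1)] unfolding smooth_on_def by blast
  then have cont: "continuous_on ?V ?f" by simp
  have qV: "c q \<in> ?V" using q Uc by blast
  have inv: "inv_into U c (c x) = x" if "x \<in> U" for x by (rule chart_inv[OF M Uc(1) that])
  have e: "\<bar>f q\<bar> > 0" using q by simp
  obtain r where r: "r > 0" "cbx (mdim M) (c q) r \<subseteq> ?V"
    "\<And>y. y \<in> cbx (mdim M) (c q) r \<Longrightarrow> \<bar>?f y - ?f (c q)\<bar> < \<bar>f q\<bar>"
    by (rule continuous_on_cbxE[OF V cont qV e]) blast
  let ?W = "{x \<in> U. c x \<in> cbx (mdim M) (c q) r}"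
  have "openin (mtop M) ?W" by (rule chart_preimage_open[OF M Uc(1) openin_cbx])
  moreover have "q \<in> ?W" using Uc(2) cbx_centre[OF r(1)] openin_Euclidean_supp[OF V qV] by blast
  moreover have "?W \<subseteq> {q \<in> S. f q \<noteq> 0}"
  proof
    fix x assume x: "x \<in> ?W"
    then have "c x \<in> ?V" using r(2) by blast
    then obtain y where "y \<in> U" "y \<in> S" "c x = c y" by blast
    then have "x \<in> S" using x inv by (metis (mono_tags, lifting) mem_Collect_eq)
    moreover have "\<bar>f x - f q\<bar> < \<bar>f q\<bar>" using r(3)[of "c x"] x inv Uc(2) by simp
    ultimately show "x \<in> {q \<in> S. f q \<noteq> 0}" by auto
  qed
  ultimately show "\<exists>T. openin (mtop M) T \<and> q \<in> T \<and> T \<subseteq> {q \<in> S. f q \<noteq> 0}" by blast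
qed

lemma sm_fun_kform:
  assumes M: "smooth_manifold M" and S: "openin (mtop M) S"
  shows "kform k W \<Longrightarrow> length Vs = k \<Longrightarrow> (\<And>v j. v \<in> set Vs \<Longrightarrow> j < 7 \<Longrightarrow> sm_fun M S (\<lambda>u. v u j)) \<Longrightarrow>
    sm_fun M S (\<lambda>u. W (map (\<lambda>v. v u) Vs))"
proof (induction k arbitrary: W Vs)
  case 0
  then show ?case using sm_fun_const[OF M S] by simp
next
  case (Suc k)
  obtain v r where Vs: "Vs = v # r" "length r = k" using Suc.prems(2) by (cases Vs) auto
  have "sm_fun M S (\<lambda>u. \<Sum>i<7. v u i * W (bs i # map (\<lambda>v. v u) r))"
  proof (rule sm_fun_sum[OF M S], rule sm_fun_mult[OF M S])
    fix i assume "i \<in> {..<7::nat}"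
    then show "sm_fun M S (\<lambda>u. v u i)" using Suc.prems(3)[of v i] Vs(1) by simp
    show "sm_fun M S (\<lambda>u. W (bs i # map (\<lambda>v. v u) r))"
      by (rule Suc.IH[OF kform_contract[OF Suc.prems(1)] Vs(2)]) (use Suc.prems(3) Vs(1) in auto)
  qed
  moreover have "W (map (\<lambda>v. v u) Vs) = (\<Sum>i<7. v u i * W (bs i # map (\<lambda>v. v u) r))" for u
    unfolding Vs(1) list.map by (rule kform_expand[OF Suc.prems(1)]) (use Vs(2) in simp)
  ultimately show ?case by simp
qed

text \<open>Cramer's rule with the 7-form \<open>W\<close> in the role of the determinant: after
  replacing row \<open>k\<close> by a combination of the rows, all terms but the one with
  \<open>R ! k\<close> repeat a row. Components in a frame thus become quotients of determinants,
  which shows their smoothness.\<close>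

lemma kform_cramer:
  assumes W: "kform 7 W" and R: "length R = 7" and b: "b = (\<lambda>j. \<Sum>m<7. x m * (R ! m) j)" and k: "k < 7"
  shows "W (R[k := b]) = x k * W R"
proof -
  let ?r = "take k R @ drop (Suc k) R"
  have W6: "kform (Suc 6) W" using W by (simp add: numeral_eq_Suc)
  have len: "length ?r = 6" using R k by simp
  have "W (R[k := b]) = (-1) ^ k * W (b # ?r)" by (rule kform_upd[OF W R k])
  also have "W (b # ?r) = (\<Sum>m<7. x m * W (R ! m # ?r))" unfolding b by (rule kform_sum_arg[OF W6 len])
  also have "\<dots> = (\<Sum>m<7. if m = k then x k * W (R ! k # ?r) else 0)"
  proof (intro sum.cong refl)
    fix m assume "m \<in> {..<7::nat}"
    then have m: "m < 7" by simp
    have "W (R ! m # ?r) = 0" if mk: "m \<noteq> k"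
    proof -
      define l where "l = (if m < k then m else m - 1)"
      have "?r ! l = R ! m" "l < 6" using mk m k R by (auto simp: l_def nth_append min_def)
      then show ?thesis by (intro kform_alt[OF W, of _ 0 "Suc l"]) (use len in auto)
    qed
    then show "x m * W (R ! m # ?r) = (if m = k then x k * W (R ! k # ?r) else 0)" by auto
  qed
  also have "\<dots> = x k * W (R ! k # ?r)" using k by (simp add: sum.delta)
  finally have "W (R[k := b]) = x k * ((-1) ^ k * W (R ! k # ?r))" by simp
  also have "(-1) ^ k * W (R ! k # ?r) = W (R[k := R ! k])" by (rule kform_upd[OF W R k, symmetric])
  finally show ?thesis by simp
qed

lemma bracket_vector_field:
  assumes M: "smooth_manifold M" and X: "X \<in> vector_fields M" and Y: "Y \<in> vector_fields M"
  shows "bracket X Y \<in> vector_fields M"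
proof (rule vector_fieldsI)
  have Z: "X (\<lambda>p. 0) = (\<lambda>p. 0)" if "X \<in> vector_fields M" for X
    using pt_deriv_zero[OF M vector_fields_pt_deriv[OF that]] by (simp add: fun_eq_iff)
  have N: "X f = (\<lambda>p. 0)" if "X \<in> vector_fields M" "f \<notin> smooth_functions M" for X f
    using vector_fieldsD(1)[OF that] by (simp add: fun_eq_iff)
  have lin: "X (\<lambda>p. a * f p + b * h p) = (\<lambda>p. a * X f p + b * X h p)"
    if "X \<in> vector_fields M" "f \<in> smooth_functions M" "h \<in> smooth_functions M" for X f h a b
    using pt_deriv_linear[OF vector_fields_pt_deriv[OF that(1)] that(2,3)] by (simp add: fun_eq_iff)
  have mult: "X (\<lambda>p. f p * h p) = (\<lambda>p. f p * X h p + h p * X f p)"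
    if "X \<in> vector_fields M" "f \<in> smooth_functions M" "h \<in> smooth_functions M" for X f h
    using pt_deriv_mult[OF vector_fields_pt_deriv[OF that(1)] that(2,3)] by (simp add: fun_eq_iff)
  have add: "X (\<lambda>p. f p + h p) = (\<lambda>p. X f p + X h p)"
    if "X \<in> vector_fields M" "f \<in> smooth_functions M" "h \<in> smooth_functions M" for X f h
    using lin[OF that, of 1 1] by simp
  note sm = vector_fieldsD(2)
  show "bracket X Y f = (\<lambda>p. 0)" if "f \<notin> smooth_functions M" for f
    using that by (simp add: bracket_def N[OF X] N[OF Y] Z[OF X] Z[OF Y])
  show "bracket X Y f \<in> smooth_functions M" if f: "f \<in> smooth_functions M" for f
  proof -
    have "(\<lambda>p. X (Y f) p + (- 1) * Y (X f) p) \<in> smooth_functions M"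
      by (rule smooth_functions_add[OF M sm[OF X sm[OF Y f]] smooth_functions_scale[OF M sm[OF Y sm[OF X f]]]])
    then show ?thesis unfolding bracket_def by simp
  qed
  fix f h a b p assume f: "f \<in> smooth_functions M" and h: "h \<in> smooth_functions M"
  show "bracket X Y (\<lambda>p. a * f p + b * h p) p = a * bracket X Y f p + b * bracket X Y h p"
    unfolding bracket_def lin[OF X f h] lin[OF Y f h] lin[OF X sm[OF Y f] sm[OF Y h]] lin[OF Y sm[OF X f] sm[OF X h]]
    by (simp add: algebra_simps)
  have 1: "(\<lambda>p. f p * Y h p) \<in> smooth_functions M" "(\<lambda>p. h p * Y f p) \<in> smooth_functions M"
    "(\<lambda>p. f p * X h p) \<in> smooth_functions M" "(\<lambda>p. h p * X f p) \<in> smooth_functions M"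
    using smooth_functions_mult[OF M f sm[OF Y h]] smooth_functions_mult[OF M h sm[OF Y f]]
      smooth_functions_mult[OF M f sm[OF X h]] smooth_functions_mult[OF M h sm[OF X f]] by auto
  show "bracket X Y (\<lambda>p. f p * h p) p = f p * bracket X Y h p + h p * bracket X Y f p"
    unfolding bracket_def mult[OF X f h] mult[OF Y f h] add[OF X 1(1,2)] add[OF Y 1(3,4)]
      mult[OF X f sm[OF Y h]] mult[OF X h sm[OF Y f]] mult[OF Y f sm[OF X h]] mult[OF Y h sm[OF X f]]
    by (simp add: algebra_simps)
qed

lemma sgs_lin: "sgs (\<lambda>y r. \<Sum>i\<in>I. c i * C i y r) xs = (\<Sum>i\<in>I. c i * sgs (C i) xs)"
  by (induction xs arbitrary: C) (auto simp: right_diff_distrib sum_subtractf)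

lemma prs_lin: "prs (\<lambda>x y r. \<Sum>i\<in>I. c i * B i x y r) xs = (\<Sum>i\<in>I. c i * prs (B i) xs)"
  by (induction xs arbitrary: B) (auto simp: right_diff_distrib sum_subtractf sgs_lin)

text \<open>What remains of the nilmanifold: a global frame whose dual coframe has the differentials
  \<open>de0 a b c\<close>. The minus sign in \<open>struct\<close> is that of de^k(X, Y) = -
  e^k([X, Y]) for fields of the frame.\<close>

locale framed =
  fixes M :: "'a manifold" and Es :: "'a vfield list" and a b c :: real
  assumes mfd: "smooth_manifold M" and dim: "mdim M = 7" and frame: "framing M Es"
    and struct: "\<And>i j f p. i < 7 \<Longrightarrow> j < 7 \<Longrightarrow> f \<in> smooth_functions M \<Longrightarrow> p \<in> points M \<Longrightarrow>
      bracket (Es ! i) (Es ! j) f p = (\<Sum>k<7. - frm (de0 a b c k) [bs i, bs j] * (Es ! k) f p)"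
begin

abbreviation "\<delta> k \<equiv> frm (de0 a b c k)"

lemma Es_vf: "i < 7 \<Longrightarrow> Es ! i \<in> vector_fields M"
  using frame dim unfolding framing_def by (metis nth_mem subsetD)

lemma length_Es: "length Es = 7" using frame dim unfolding framing_def by simp

lemma Es_smooth: "i < 7 \<Longrightarrow> f \<in> smooth_functions M \<Longrightarrow> (Es ! i) f \<in> smooth_functions M"
  using vector_fieldsD(2)[OF Es_vf] by blast

lemma Es_indep:
  assumes "p \<in> points M" "\<And>f. f \<in> smooth_functions M \<Longrightarrow> (\<Sum>i<7. x i * (Es ! i) f p) = 0" "i < 7"
  shows "x i = 0"
  using frame assms unfolding framing_def dim by blast

text \<open>Functions whose differentials at \<open>p\<close> are the dual coframe. They are
  combinations of local coordinates, with coefficients from the inverse of the matrix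
  \<open>A\<close> of the frame in those coordinates; the rows of \<open>A\<close> are independent
  because the frame is.\<close>

lemma dual_functions:
  assumes p: "p \<in> points M"
  obtains F where "\<And>j. j < 7 \<Longrightarrow> F j \<in> smooth_functions M"
    "\<And>k j. k < 7 \<Longrightarrow> j < 7 \<Longrightarrow> (Es ! k) (F j) p = (if k = j then 1 else 0)"
    "\<And>D f. pt_deriv M p D \<Longrightarrow> f \<in> smooth_functions M \<Longrightarrow> D f = (\<Sum>k<7. D (F k) * (Es ! k) f p)"
proof -
  obtain U ch where Uc: "(U, ch) \<in> atlas M" "p \<in> U" using chart_exists[OF mfd p] by blast
  obtain \<xi> where \<xi>: "\<And>i. i < 7 \<Longrightarrow> \<xi> i \<in> smooth_functions M"
    "\<And>D f. pt_deriv M p D \<Longrightarrow> f \<in> smooth_functions M \<Longrightarrow>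
       D f = (\<Sum>i<7. D (\<xi> i) * partial i (\<lambda>x. f (inv_into U ch x)) (ch p))"
    by (rule pt_deriv_coordinates[OF mfd Uc, unfolded dim]) blast
  define pd where "pd = (\<lambda>i f. partial i (\<lambda>x. f (inv_into U ch x)) (ch p))"
  define A where "A = (\<lambda>k j. (Es ! k) (\<xi> j) p)"
  have Ef: "(Es ! k) f p = (\<Sum>j<7. A k j * pd j f)" if "k < 7" "f \<in> smooth_functions M" for k f
    unfolding A_def pd_def by (rule \<xi>(2)[OF vector_fields_pt_deriv[OF Es_vf[OF that(1)]] that(2)])
  have left: "x k = 0" if "\<And>j. j < 7 \<Longrightarrow> (\<Sum>k<7. x k * A k j) = 0" "k < 7" for x k
  proof (rule Es_indep[OF p _ that(2)])
    fix f assume f: "f \<in> smooth_functions M"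
    have "(\<Sum>i<7. x i * (Es ! i) f p) = (\<Sum>i<7. \<Sum>j<7. x i * A i j * pd j f)"
      by (rule sum.cong[OF refl]) (simp add: Ef[OF _ f] sum_distrib_left mult.assoc)
    also have "\<dots> = (\<Sum>j<7. (\<Sum>i<7. x i * A i j) * pd j f)"
      by (subst sum.swap) (simp add: sum_distrib_right)
    finally show "(\<Sum>i<7. x i * (Es ! i) f p) = 0" using that(1) by simp
  qed
  have "\<exists>x. \<forall>j<7. (\<Sum>k<7. x k * A k j) = (if j = l then 1 else 0)" if l: "l < 7" for l
  proof -
    \<comment> \<open>The eighth row is the unit vector \<open>l\<close>. Independence of the first
      seven forces its coefficient in the relation to be non-zero, and solving for it gives row
      \<open>l\<close> of the inverse.\<close>
    define B where "B = (\<lambda>k j. if k < 7 then A k j else if j = l then 1 else (0::real))"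
    obtain cc where cc: "\<exists>i\<in>{..<8}. cc i \<noteq> 0" "\<forall>j<7. (\<Sum>i\<in>{..<8}. cc i * B i j) = 0"
      using homogeneous_system[of "{..<8}" 7 B] by auto
    have split: "(\<Sum>i\<in>{..<8}. cc i * B i j) = (\<Sum>k<7. cc k * A k j) + cc 7 * (if j = l then 1 else 0)" for j
    proof -
      have "{..<8} = insert 7 {..<7::nat}" by auto
      then show ?thesis by (simp add: B_def)
    qed
    have c7: "cc 7 \<noteq> 0"
    proof
      assume 7: "cc 7 = 0"
      then have "cc k = 0" if "k < 7" for k
        by (rule_tac left[OF _ that]) (use cc(2) split in simp)
      then have "cc k = 0" if "k < 8" for k using that 7 by (cases "k = 7") auto
      then show False using cc(1) by auto
    qed
    have "(\<Sum>k<7. (- cc k / cc 7) * A k j) = (if j = l then 1 else 0)" if "j < 7" for j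
    proof -
      have "(\<Sum>k<7. cc k * A k j) = - cc 7 * (if j = l then 1 else 0)" using cc(2) that split[of j] by auto
      then have "- (\<Sum>k<7. cc k * A k j) / cc 7 = (if j = l then 1 else 0)" using c7 by (auto simp: field_simps)
      moreover have "(\<Sum>k<7. (- cc k / cc 7) * A k j) = - (\<Sum>k<7. cc k * A k j) / cc 7"
        by (simp add: sum_divide_distrib sum_negf)
      ultimately show ?thesis by simp
    qed
    then show ?thesis by (intro exI[of _ "\<lambda>k. - cc k / cc 7"]) blast
  qed
  then obtain X where X: "\<And>l j. l < 7 \<Longrightarrow> j < 7 \<Longrightarrow> (\<Sum>k<7. X l k * A k j) = (if j = l then 1 else 0)" by metis
  have AX: "(\<Sum>l<7. A k l * X l j) = (if k = j then 1 else 0)" if k: "k < 7" and j: "j < 7" for k j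
  proof -
    \<comment> \<open>From X A = 1 it follows that (A X - 1) A = 0, and the rows of \<open>A\<close>
      are independent; so the left inverse is also a right inverse.\<close>
    have "(\<Sum>l<7. A k l * X l m) - (if k = m then 1 else 0) = 0" if m: "m < 7" for m
    proof (rule left[OF _ m])
      fix n :: nat assume n: "n < 7"
      have "(\<Sum>m<7. (\<Sum>l<7. A k l * X l m) * A m n) = (\<Sum>l<7. A k l * (\<Sum>m<7. X l m * A m n))"
        by (simp add: sum_distrib_left sum_distrib_right mult.assoc) (rule sum.swap)
      also have "\<dots> = (\<Sum>l<7. if l = n then A k l else 0)"
        by (rule sum.cong[OF refl]) (use X n in auto)
      also have "\<dots> = A k n" using n by (simp add: sum.delta)
      finally have 1: "(\<Sum>m<7. (\<Sum>l<7. A k l * X l m) * A m n) = A k n" .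
      have "(\<Sum>m<7. (if k = m then 1 else 0) * A m n) = (\<Sum>m<7. if m = k then A m n else 0)"
        by (rule sum.cong) auto
      also have "\<dots> = A k n" using k by (simp add: sum.delta)
      finally show "(\<Sum>m<7. ((\<Sum>l<7. A k l * X l m) - (if k = m then 1 else 0)) * A m n) = 0"
        using 1 by (simp add: left_diff_distrib sum_subtractf)
    qed
    from this[OF j] show ?thesis by simp
  qed
  define F where "F = (\<lambda>j q. \<Sum>l<7. X l j * \<xi> l q)"
  have F: "F j \<in> smooth_functions M" for j
    unfolding F_def
    by (rule smooth_functions_sum[OF mfd], rule smooth_functions_scale[OF mfd], rule \<xi>(1)) simp
  have DF: "D (F j) = (\<Sum>l<7. X l j * D (\<xi> l))" if D: "pt_deriv M p D" for D j
  proof -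
    have "D (F j) = (\<Sum>l<7. D (\<lambda>q. X l j * \<xi> l q))"
      unfolding F_def by (rule pt_deriv_sum[OF mfd D], rule smooth_functions_scale[OF mfd], rule \<xi>(1)) simp
    also have "\<dots> = (\<Sum>l<7. X l j * D (\<xi> l))"
      by (rule sum.cong[OF refl], rule pt_deriv_scale[OF mfd D], rule \<xi>(1)) simp
    finally show ?thesis .
  qed
  show ?thesis
  proof (rule that[of F])
    show "F j \<in> smooth_functions M" for j by (rule F)
    show "(Es ! k) (F j) p = (if k = j then 1 else 0)" if k: "k < 7" and j: "j < 7" for k j
      using DF[OF vector_fields_pt_deriv[OF Es_vf[OF k]]] AX[OF k j] by (simp add: A_def mult.commute)
    fix D f assume D: "pt_deriv M p D" and f: "f \<in> smooth_functions M"
    have "(\<Sum>k<7. D (F k) * (Es ! k) f p) = (\<Sum>k<7. \<Sum>l<7. D (\<xi> l) * (X l k * (Es ! k) f p))"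
    proof (intro sum.cong refl)
      fix k show "D (F k) * (Es ! k) f p = (\<Sum>l<7. D (\<xi> l) * (X l k * (Es ! k) f p))"
        unfolding DF[OF D] sum_distrib_right by (rule sum.cong[OF refl]) simp
    qed
    also have "\<dots> = (\<Sum>l<7. D (\<xi> l) * (\<Sum>k<7. X l k * (Es ! k) f p))"
      by (subst sum.swap) (simp add: sum_distrib_left)
    also have "\<dots> = (\<Sum>l<7. D (\<xi> l) * pd l f)"
    proof (intro sum.cong refl)
      fix l assume "l \<in> {..<7::nat}"
      then have l: "l < 7" by simp
      have "(\<Sum>k<7. X l k * (Es ! k) f p) = (\<Sum>k<7. \<Sum>j<7. X l k * A k j * pd j f)"
        by (rule sum.cong[OF refl]) (simp add: Ef[OF _ f] sum_distrib_left mult.assoc)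
      also have "\<dots> = (\<Sum>j<7. (\<Sum>k<7. X l k * A k j) * pd j f)"
        by (subst sum.swap) (simp add: sum_distrib_right)
      also have "\<dots> = (\<Sum>j<7. if j = l then pd j f else 0)"
        by (rule sum.cong[OF refl]) (use X[OF l] in auto)
      finally show "D (\<xi> l) * (\<Sum>k<7. X l k * (Es ! k) f p) = D (\<xi> l) * pd l f"
        using l by (simp add: sum.delta)
    qed
    also have "\<dots> = D f" unfolding pd_def by (rule \<xi>(2)[OF D f, symmetric])
    finally show "D f = (\<Sum>k<7. D (F k) * (Es ! k) f p)" by simp
  qed
qed

section \<open>Components of tangent vectors in the frame\<close>

definition coef :: "'a \<Rightarrow> (('a \<Rightarrow> real) \<Rightarrow> real) \<Rightarrow> rvec" where
  "coef p D = (THE x. (\<forall>i\<ge>7. x i = 0) \<and> (\<forall>f\<in>smooth_functions M. D f = (\<Sum>i<7. x i * (Es ! i) f p)))"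

lemma coef_unique:
  assumes p: "p \<in> points M" and x: "\<And>i. i \<ge> 7 \<Longrightarrow> x i = 0"
    and D: "\<And>f. f \<in> smooth_functions M \<Longrightarrow> D f = (\<Sum>i<7. x i * (Es ! i) f p)"
  shows "coef p D = x"
  unfolding coef_def
proof (rule the_equality)
  show "(\<forall>i\<ge>7. x i = 0) \<and> (\<forall>f\<in>smooth_functions M. D f = (\<Sum>i<7. x i * (Es ! i) f p))" using x D by blast
  fix y assume y: "(\<forall>i\<ge>7. y i = 0) \<and> (\<forall>f\<in>smooth_functions M. D f = (\<Sum>i<7. y i * (Es ! i) f p))"
  show "y = x"
  proof
    fix i
    show "y i = x i"
    proof (cases "i < 7")
      case True
      have "(\<lambda>i. y i - x i) i = 0"
      proof (rule Es_indep[OF p _ True])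
        fix f assume f: "f \<in> smooth_functions M"
        have "(\<Sum>i<7. y i * (Es ! i) f p) = (\<Sum>i<7. x i * (Es ! i) f p)" using y D f by (metis)
        then show "(\<Sum>i<7. (y i - x i) * (Es ! i) f p) = 0" by (simp add: left_diff_distrib sum_subtractf)
      qed
      then show ?thesis by simp
    qed (use x y in simp)
  qed
qed

lemma coef_expand:
  assumes p: "p \<in> points M" and D: "pt_deriv M p D"
  shows "f \<in> smooth_functions M \<Longrightarrow> D f = (\<Sum>i<7. coef p D i * (Es ! i) f p)" "i \<ge> 7 \<Longrightarrow> coef p D i = 0"
proof -
  obtain F where F: "\<And>D f. pt_deriv M p D \<Longrightarrow> f \<in> smooth_functions M \<Longrightarrow> D f = (\<Sum>k<7. D (F k) * (Es ! k) f p)"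
    by (rule dual_functions[OF p]) blast
  have c: "coef p D = (\<lambda>k. if k < 7 then D (F k) else 0)"
    by (rule coef_unique[OF p]) (use F[OF D] in auto)
  show "f \<in> smooth_functions M \<Longrightarrow> D f = (\<Sum>i<7. coef p D i * (Es ! i) f p)" using F[OF D] by (simp add: c)
  show "i \<ge> 7 \<Longrightarrow> coef p D i = 0" by (simp add: c)
qed

end

text \<open>The coframe pulled back along \<open>pr\<close>. With the identity this is the coframe
  of M itself, with the bundle projection it is the horizontal coframe of the total space, so
  exterior derivatives on both are computed once.\<close>

locale framed_over = framed M Es a b c for M :: "'a manifold" and Es a b c +
  fixes P :: "'p manifold" and pr :: "'p \<Rightarrow> 'a"
  assumes Pm: "smooth_manifold P" and pr: "smooth_map P M pr"
begin

text \<open>The components of the push-forward of \<open>X\<close> at \<open>u\<close> along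
  \<open>pr\<close>, that is, the values of the pulled-back 1-forms e^k on \<open>X\<close>.\<close>

definition \<theta> :: "'p \<Rightarrow> 'p vfield \<Rightarrow> rvec" where
  "\<theta> u X = coef (pr u) (\<lambda>f. X (pull_fun P pr f) u)"

definition th :: "'p vfield \<Rightarrow> nat \<Rightarrow> 'p \<Rightarrow> real" where
  "th X k = (\<lambda>u. if u \<in> points P then \<theta> u X k else 0)"

lemma pr_points: "u \<in> points P \<Longrightarrow> pr u \<in> points M"
  by (rule smooth_map_points[OF pr])

lemma pull_smooth: "f \<in> smooth_functions M \<Longrightarrow> pull_fun P pr f \<in> smooth_functions P"
  by (rule pull_fun_smooth[OF Pm mfd pr])

lemma pull_pt_deriv:
  assumes "u \<in> points P" "pt_deriv P u D"
  shows "pt_deriv M (pr u) (\<lambda>f. D (pull_fun P pr f))"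
  unfolding pt_deriv_def
proof (intro conjI ballI allI)
  fix f h s t assume f: "f \<in> smooth_functions M" and h: "h \<in> smooth_functions M"
  have 1: "pull_fun P pr (\<lambda>x. s * f x + t * h x) = (\<lambda>x. s * pull_fun P pr f x + t * pull_fun P pr h x)"
    and 2: "pull_fun P pr (\<lambda>x. f x * h x) = (\<lambda>x. pull_fun P pr f x * pull_fun P pr h x)"
    by (auto simp: pull_fun_def fun_eq_iff)
  show "D (pull_fun P pr (\<lambda>x. s * f x + t * h x)) = s * D (pull_fun P pr f) + t * D (pull_fun P pr h)"
    unfolding 1 by (rule pt_deriv_linear[OF assms(2) pull_smooth[OF f] pull_smooth[OF h]])
  show "D (pull_fun P pr (\<lambda>x. f x * h x)) = f (pr u) * D (pull_fun P pr h) + h (pr u) * D (pull_fun P pr f)"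
    unfolding 2 pt_deriv_mult[OF assms(2) pull_smooth[OF f] pull_smooth[OF h]] using assms(1) by (simp add: pull_fun_def)
qed

lemma \<theta>_expand:
  assumes "u \<in> points P" "X \<in> vector_fields P" "f \<in> smooth_functions M"
  shows "X (pull_fun P pr f) u = (\<Sum>k<7. \<theta> u X k * (Es ! k) f (pr u))"
  unfolding \<theta>_def
  by (rule coef_expand(1)[OF pr_points[OF assms(1)] pull_pt_deriv[OF assms(1) vector_fields_pt_deriv[OF assms(2)]] assms(3)])

lemma \<theta>_supp:
  assumes "u \<in> points P" "X \<in> vector_fields P" "k \<ge> 7" shows "\<theta> u X k = 0"
  unfolding \<theta>_def
  by (rule coef_expand(2)[OF pr_points[OF assms(1)] pull_pt_deriv[OF assms(1) vector_fields_pt_deriv[OF assms(2)]] assms(3)])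

lemma \<theta>_unique:
  assumes "u \<in> points P" "\<And>i. i \<ge> 7 \<Longrightarrow> x i = 0"
    "\<And>f. f \<in> smooth_functions M \<Longrightarrow> X (pull_fun P pr f) u = (\<Sum>i<7. x i * (Es ! i) f (pr u))"
  shows "\<theta> u X = x"
  unfolding \<theta>_def by (rule coef_unique[OF pr_points[OF assms(1)] assms(2,3)])

text \<open>Near \<open>u0\<close> the components solve a linear system with smooth coefficients,
  obtained by applying \<open>X\<close> and the frame to functions dual to the frame at
  \<open>u0\<close>. Its matrix is the identity at \<open>u0\<close>, hence invertible nearby, and
  Cramer's rule writes the solution as a smooth quotient.\<close>

lemma th_smooth:
  assumes X: "X \<in> vector_fields P" shows "th X k \<in> smooth_functions P"
proof -
  have "sm_fun P (points P) (th X k)" if k: "k < 7"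
  proof (rule sm_fun_local[OF Pm openin_topspace])
    fix u0 assume u0: "u0 \<in> points P"
    obtain F where F: "\<And>j. j < 7 \<Longrightarrow> F j \<in> smooth_functions M"
      "\<And>k j. k < 7 \<Longrightarrow> j < 7 \<Longrightarrow> (Es ! k) (F j) (pr u0) = (if k = j then 1 else 0)"
      by (rule dual_functions[OF pr_points[OF u0]]) blast
    \<comment> \<open>Row \<open>k\<close> lists the derivatives of the seven functions
      \<open>F j\<close> along the frame field \<open>Es ! k\<close>; \<open>bb\<close> lists those
      along \<open>X\<close>, and \<open>frm vol0\<close> is the determinant.\<close>
    define R where "R = (\<lambda>u. map (\<lambda>k j. if j < 7 then pull_fun P pr ((Es ! k) (F j)) u else 0) [0..<7])"
    define bb where "bb = (\<lambda>u j. if j < 7 then X (pull_fun P pr (F j)) u else 0)"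
    have vol: "kform 7 (frm vol0)" by (rule kform_frm[OF frm_oks(3)])
    have Rs: "sm_fun P (points P) (\<lambda>u. if j < 7 then pull_fun P pr ((Es ! k) (F j)) u else 0)" if "j < 7" "k < 7" for j k
      using smooth_functions_sm_fun[OF Pm pull_smooth[OF Es_smooth[OF that(2) F(1)[OF that(1)]]] subset_refl] that by simp
    have bs': "sm_fun P (points P) (\<lambda>u. bb u j)" if "j < 7" for j
      using smooth_functions_sm_fun[OF Pm vector_fieldsD(2)[OF X pull_smooth[OF F(1)[OF that]]] subset_refl] that by (simp add: bb_def)
    have "sm_fun P (points P) (\<lambda>u. frm vol0 (map (\<lambda>v. v u) (map (\<lambda>k u j. if j < 7 then pull_fun P pr ((Es ! k) (F j)) u else 0) [0..<7])))"
      by (rule sm_fun_kform[OF Pm openin_topspace vol]) (use Rs in auto)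
    then have s1: "sm_fun P (points P) (\<lambda>u. frm vol0 (R u))" unfolding R_def by (simp add: o_def)
    have "sm_fun P (points P) (\<lambda>u. frm vol0 (map (\<lambda>v. v u) ((map (\<lambda>k u j. if j < 7 then pull_fun P pr ((Es ! k) (F j)) u else 0) [0..<7])[k := bb])))"
      by (rule sm_fun_kform[OF Pm openin_topspace vol]) (use Rs bs' in \<open>auto dest!: set_update_subset_insert[THEN subsetD]\<close>)
    then have s2: "sm_fun P (points P) (\<lambda>u. frm vol0 ((R u)[k := bb u]))" unfolding R_def by (simp add: o_def map_update)
    let ?W = "{u \<in> points P. frm vol0 (R u) \<noteq> 0}"
    have oW: "openin (mtop P) ?W" by (rule sm_fun_nonzero_open[OF Pm openin_topspace s1])
    have "R u0 = map bs [0..<7]"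
      unfolding R_def
    proof (rule map_cong[OF refl], rule ext)
      fix k j assume "k \<in> set [0..<7]"
      then have k: "k < 7" by simp
      have "pull_fun P pr ((Es ! k) (F j)) u0 = (if k = j then 1 else 0)" if "j < 7"
        using F(2)[OF k that] u0 by (simp add: pull_fun_def)
      then show "(if j < 7 then pull_fun P pr ((Es ! k) (F j)) u0 else 0) = bs k j"
        using k by (auto simp: bs_def)
    qed
    then have "\<bar>frm vol0 (R u0)\<bar> = 1" using vol0_orthobasis[OF _ orthobasis_standard] by simp
    then have u0W: "u0 \<in> ?W" using u0 by auto
    have key: "frm vol0 ((R u)[k := bb u]) * inverse (frm vol0 (R u)) = th X k u" if u: "u \<in> ?W" for u
    proof -
      have uP: "u \<in> points P" using u by simp
      have "bb u = (\<lambda>j. \<Sum>m<7. \<theta> u X m * (R u ! m) j)"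
      proof
        fix j
        show "bb u j = (\<Sum>m<7. \<theta> u X m * (R u ! m) j)"
        proof (cases "j < 7")
          case True
          have "bb u j = (\<Sum>m<7. \<theta> u X m * (Es ! m) (F j) (pr u))"
            using \<theta>_expand[OF uP X F(1)[OF True]] True by (simp add: bb_def)
          also have "\<dots> = (\<Sum>m<7. \<theta> u X m * (R u ! m) j)"
            by (rule sum.cong[OF refl]) (use True uP in \<open>simp add: R_def pull_fun_def\<close>)
          finally show ?thesis .
        qed (simp add: bb_def R_def)
      qed
      from kform_cramer[OF vol _ this k] have "frm vol0 ((R u)[k := bb u]) = \<theta> u X k * frm vol0 (R u)"
        by (simp add: R_def)
      then show ?thesis using u by (simp add: th_def)
    qed
    have "sm_fun P ?W (\<lambda>u. frm vol0 ((R u)[k := bb u]) * inverse (frm vol0 (R u)))"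
      by (rule sm_fun_mult[OF Pm oW sm_fun_subset[OF Pm s2] sm_fun_inverse[OF Pm oW sm_fun_subset[OF Pm s1]]]) auto
    then have "sm_fun P ?W (th X k)" by (rule sm_fun_cong[OF Pm oW]) (rule key)
    then show "\<exists>W'. openin (mtop P) W' \<and> u0 \<in> W' \<and> sm_fun P W' (th X k)" using oW u0W by blast
  qed
  moreover have "th X k = (\<lambda>u. 0)" if "k \<ge> 7" using \<theta>_supp[OF _ X that] by (auto simp: th_def)
  ultimately show ?thesis
    unfolding mem_smooth_functions[OF Pm] using sm_fun_const[OF Pm openin_topspace, of 0]
    by (cases "k < 7") (auto simp: th_def not_less)
qed

lemma \<theta>_lin:
  assumes u: "u \<in> points P" and X: "X \<in> vector_fields P" and Y: "Y \<in> vector_fields P"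
  shows "\<theta> u (\<lambda>f q. s q * X f q + t q * Y f q) = (\<lambda>k. s u * \<theta> u X k + t u * \<theta> u Y k)"
  by (rule \<theta>_unique[OF u])
    (simp_all add: \<theta>_supp[OF u X] \<theta>_supp[OF u Y] \<theta>_expand[OF u X] \<theta>_expand[OF u Y]
      sum_distrib_left sum.distrib distrib_right mult.assoc)

lemma pull_expand:
  assumes Y: "Y \<in> vector_fields P" and f: "f \<in> smooth_functions M"
  shows "Y (pull_fun P pr f) = (\<lambda>u. \<Sum>k<7. th Y k u * pull_fun P pr ((Es ! k) f) u)"
proof
  fix u
  show "Y (pull_fun P pr f) u = (\<Sum>k<7. th Y k u * pull_fun P pr ((Es ! k) f) u)"
  proof (cases "u \<in> points P")
    case True
    then show ?thesis using \<theta>_expand[OF True Y f] by (simp add: th_def pull_fun_def)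
  next
    case False
    then show ?thesis
      using smooth_functions_0[OF Pm vector_fieldsD(2)[OF Y pull_smooth[OF f]]] by (simp add: th_def)
  qed
qed

lemma vf_sum_mult:
  assumes X: "X \<in> vector_fields P" and "\<And>i. i \<in> I \<Longrightarrow> f i \<in> smooth_functions P" "\<And>i. i \<in> I \<Longrightarrow> h i \<in> smooth_functions P"
  shows "X (\<lambda>u. \<Sum>i\<in>I. f i u * h i u) u = (\<Sum>i\<in>I. f i u * X (h i) u + h i u * X (f i) u)"
proof -
  have "X (\<lambda>u. \<Sum>i\<in>I. f i u * h i u) u = (\<Sum>i\<in>I. X (\<lambda>u. f i u * h i u) u)"
    by (rule pt_deriv_sum[OF Pm vector_fields_pt_deriv[OF X]], rule smooth_functions_mult[OF Pm]) (use assms in auto)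
  also have "\<dots> = (\<Sum>i\<in>I. f i u * X (h i) u + h i u * X (f i) u)"
    by (rule sum.cong[OF refl], rule pt_deriv_mult[OF vector_fields_pt_deriv[OF X]]) (use assms in auto)
  finally show ?thesis .
qed

lemma kform_2: "kform (Suc (Suc 0)) (\<delta> k)"
  using kform_frm[OF de0_ok[of a b c k]] by (simp add: numeral_2_eq_2)

lemma \<delta>_expand: "\<delta> k [x, y] = (\<Sum>l<7. \<Sum>m<7. x l * (y m * \<delta> k [bs l, bs m]))"
proof -
  have "\<delta> k [x, y] = (\<Sum>l<7. x l * \<delta> k [bs l, y])" by (rule kform_expand[OF kform_2]) simp
  also have "\<dots> = (\<Sum>l<7. x l * (\<Sum>m<7. y m * \<delta> k [bs l, bs m]))"
  proof (intro sum.cong refl arg_cong[of _ _ "(*) _"])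
    fix l show "\<delta> k [bs l, y] = (\<Sum>m<7. y m * \<delta> k [bs l, bs m])"
      by (rule kform_expand[OF kform_contract[OF kform_2]]) simp
  qed
  finally show ?thesis by (simp add: sum_distrib_left)
qed

text \<open>The structure equation de^k(X, Y) = X e^k(Y) - Y e^k(X) - e^k([X, Y]) for arbitrary
  fields, solved for the components of the bracket. It is checked on functions pulled back from
  M.\<close>

lemma \<theta>_bracket:
  assumes u: "u \<in> points P" and X: "X \<in> vector_fields P" and Y: "Y \<in> vector_fields P"
  shows "\<theta> u (bracket X Y) = (\<lambda>k. X (th Y k) u - Y (th X k) u - (if k < 7 then \<delta> k [\<theta> u X, \<theta> u Y] else 0))"
proof (rule \<theta>_unique[OF u])
  fix i :: nat assume i: "i \<ge> 7"
  then have z: "th X i = (\<lambda>u. 0)" "th Y i = (\<lambda>u. 0)" using \<theta>_supp[OF _ X i] \<theta>_supp[OF _ Y i] by (auto simp: th_def)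
  show "X (th Y i) u - Y (th X i) u - (if i < 7 then \<delta> i [\<theta> u X, \<theta> u Y] else 0) = 0"
    unfolding z using i pt_deriv_zero[OF Pm vector_fields_pt_deriv[OF X]] pt_deriv_zero[OF Pm vector_fields_pt_deriv[OF Y]] by simp
next
  fix f assume f: "f \<in> smooth_functions M"
  let ?E = "\<lambda>k. (Es ! k) f (pr u)" and ?EE = "\<lambda>l k. (Es ! l) ((Es ! k) f) (pr u)"
  have XY: "X (Y (pull_fun P pr f)) u = (\<Sum>k<7. \<theta> u Y k * (\<Sum>l<7. \<theta> u X l * ?EE l k)) + (\<Sum>k<7. X (th Y k) u * ?E k)"
    if X: "X \<in> vector_fields P" and Y: "Y \<in> vector_fields P" for X Y
  proof -
    have "X (Y (pull_fun P pr f)) u = (\<Sum>k<7. th Y k u * X (pull_fun P pr ((Es ! k) f)) u + pull_fun P pr ((Es ! k) f) u * X (th Y k) u)"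
      unfolding pull_expand[OF Y f] by (rule vf_sum_mult[OF X th_smooth[OF Y]]) (use pull_smooth Es_smooth f in simp)
    also have "\<dots> = (\<Sum>k<7. \<theta> u Y k * (\<Sum>l<7. \<theta> u X l * ?EE l k) + X (th Y k) u * ?E k)"
      by (rule sum.cong[OF refl]) (use u \<theta>_expand[OF u X Es_smooth[OF _ f]] in \<open>simp add: th_def pull_fun_def\<close>)
    finally show ?thesis by (simp add: sum.distrib)
  qed
  let ?x = "\<theta> u X" and ?y = "\<theta> u Y"
  \<comment> \<open>The terms with two derivatives of \<open>f\<close> antisymmetrise to brackets of
    frame fields, which \<open>struct\<close> reduces to first order.\<close>
  have "(\<Sum>k<7. ?y k * (\<Sum>l<7. ?x l * ?EE l k)) - (\<Sum>k<7. ?x k * (\<Sum>l<7. ?y l * ?EE l k)) =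
      (\<Sum>l<7. \<Sum>m<7. ?x l * (?y m * (?EE l m - ?EE m l)))"
  proof -
    have "(\<Sum>k<7. ?y k * (\<Sum>l<7. ?x l * ?EE l k)) = (\<Sum>l<7. \<Sum>m<7. ?x l * (?y m * ?EE l m))"
      by (subst sum.swap) (simp add: sum_distrib_left mult.left_commute)
    moreover have "(\<Sum>k<7. ?x k * (\<Sum>l<7. ?y l * ?EE l k)) = (\<Sum>l<7. \<Sum>m<7. ?x l * (?y m * ?EE m l))"
      by (simp add: sum_distrib_left)
    ultimately show ?thesis by (simp add: right_diff_distrib sum_subtractf)
  qed
  also have "\<dots> = (\<Sum>l<7. \<Sum>m<7. \<Sum>k<7. - (?x l * (?y m * \<delta> k [bs l, bs m])) * ?E k)"
  proof (intro sum.cong refl)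
    fix l m assume "l \<in> {..<7::nat}" "m \<in> {..<7::nat}"
    then have lm: "l < 7" "m < 7" by auto
    have "?EE l m - ?EE m l = (\<Sum>k<7. - \<delta> k [bs l, bs m] * ?E k)"
      using struct[OF lm f pr_points[OF u]] unfolding bracket_def .
    then show "?x l * (?y m * (?EE l m - ?EE m l)) = (\<Sum>k<7. - (?x l * (?y m * \<delta> k [bs l, bs m])) * ?E k)"
      by (simp add: sum_distrib_left mult.assoc)
  qed
  also have "\<dots> = (\<Sum>l<7. \<Sum>k<7. \<Sum>m<7. - (?x l * (?y m * \<delta> k [bs l, bs m])) * ?E k)"
    by (rule sum.cong[OF refl], rule sum.swap)
  also have "\<dots> = (\<Sum>k<7. \<Sum>l<7. \<Sum>m<7. - (?x l * (?y m * \<delta> k [bs l, bs m])) * ?E k)"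
    by (rule sum.swap)
  also have "\<dots> = (\<Sum>k<7. - \<delta> k [?x, ?y] * ?E k)"
    unfolding \<delta>_expand[of _ ?x ?y] by (simp add: sum_distrib_right sum_negf)
  finally have S: "(\<Sum>k<7. ?y k * (\<Sum>l<7. ?x l * ?EE l k)) - (\<Sum>k<7. ?x k * (\<Sum>l<7. ?y l * ?EE l k)) =
      (\<Sum>k<7. - \<delta> k [?x, ?y] * ?E k)" .
  have "bracket X Y (pull_fun P pr f) u = (\<Sum>k<7. X (th Y k) u * ?E k) - (\<Sum>k<7. Y (th X k) u * ?E k) + (\<Sum>k<7. - \<delta> k [?x, ?y] * ?E k)"
    unfolding bracket_def XY[OF X Y] XY[OF Y X] S[symmetric] by simp
  also have "\<dots> = (\<Sum>k<7. (X (th Y k) u - Y (th X k) u - \<delta> k [?x, ?y]) * ?E k)"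
    by (simp add: sum_subtractf[symmetric] sum.distrib[symmetric] algebra_simps sum_negf[symmetric])
  finally show "bracket X Y (pull_fun P pr f) u =
      (\<Sum>k<7. (X (th Y k) u - Y (th X k) u - (if k < 7 then \<delta> k [?x, ?y] else 0)) * ?E k)" by simp
qed

section \<open>Forms with constant coefficients in the coframe and their differentials\<close>

definition cf :: "(rvec list \<Rightarrow> real) \<Rightarrow> 'p form" where
  "cf W = (\<lambda>Xs u. if u \<in> points P then W (map (\<theta> u) Xs) else 0)"

lemma cf_Cons:
  assumes "kform (Suc k) W" "length r = k"
  shows "cf W (Y # r) = (\<lambda>u. \<Sum>i<7. th Y i u * cf (\<lambda>vs. W (bs i # vs)) r u)"
proof
  fix u show "cf W (Y # r) u = (\<Sum>i<7. th Y i u * cf (\<lambda>vs. W (bs i # vs)) r u)"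
    using kform_expand[OF assms(1), of "map (\<theta> u) r" "\<theta> u Y"] assms(2) by (simp add: cf_def th_def)
qed

lemma cf_smooth:
  "kform k W \<Longrightarrow> length Xs = k \<Longrightarrow> set Xs \<subseteq> vector_fields P \<Longrightarrow> cf W Xs \<in> smooth_functions P"
proof (induction k arbitrary: W Xs)
  case 0
  then have "cf W Xs = (\<lambda>u. if u \<in> points P then W [] else 0)" by (simp only: cf_def length_0_conv list.map)
  then show ?case using smooth_functions_const[OF Pm] by simp
next
  case (Suc k)
  obtain Y r where Xs: "Xs = Y # r" "length r = k" using Suc.prems(2) by (cases Xs) auto
  show ?case
    unfolding Xs(1) cf_Cons[OF Suc.prems(1) Xs(2)]
  proof (rule smooth_functions_sum[OF Pm], rule smooth_functions_mult[OF Pm])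
    fix i show "th Y i \<in> smooth_functions P" by (rule th_smooth) (use Suc.prems(3) Xs(1) in simp)
    show "cf (\<lambda>vs. W (bs i # vs)) r \<in> smooth_functions P"
      by (rule Suc.IH[OF kform_contract[OF Suc.prems(1)] Xs(2)]) (use Suc.prems(3) Xs(1) in simp)
  qed
qed

text \<open>Since \<open>W\<close> is constant, the product rule differentiates the components of
  one argument at a time; bringing the differentiated argument to the front produces the alternating
  sum.\<close>

lemma cf_deriv:
  assumes u: "u \<in> points P" and X: "X \<in> vector_fields P"
  shows "kform k W \<Longrightarrow> length r = k \<Longrightarrow> set r \<subseteq> vector_fields P \<Longrightarrow>
    X (cf W r) u = sgs (\<lambda>Y r'. W ((\<lambda>k. X (th Y k) u) # map (\<theta> u) r')) r"
proof (induction k arbitrary: W r)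
  case 0
  then have "cf W r = (\<lambda>u. if u \<in> points P then W [] else 0)" by (simp only: cf_def length_0_conv list.map)
  then show ?case using pt_deriv_one[OF Pm vector_fields_pt_deriv[OF X] u] 0 by simp
next
  case (Suc k)
  obtain Y r' where r: "r = Y # r'" "length r' = k" using Suc.prems(2) by (cases r) auto
  have Y: "Y \<in> vector_fields P" and r': "set r' \<subseteq> vector_fields P" using Suc.prems(3) r(1) by auto
  let ?X = "\<lambda>Z k. X (th Z k) u"
  have "X (cf W r) u = (\<Sum>i<7. th Y i u * X (cf (\<lambda>vs. W (bs i # vs)) r') u + cf (\<lambda>vs. W (bs i # vs)) r' u * X (th Y i) u)"
    unfolding r(1) cf_Cons[OF Suc.prems(1) r(2)]
    by (rule vf_sum_mult[OF X th_smooth[OF Y] cf_smooth[OF kform_contract[OF Suc.prems(1)] r(2) r']])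
  also have "\<dots> = (\<Sum>i<7. \<theta> u Y i * sgs (\<lambda>Z s. W (bs i # ?X Z # map (\<theta> u) s)) r') + (\<Sum>i<7. ?X Y i * W (bs i # map (\<theta> u) r'))"
    unfolding Suc.IH[OF kform_contract[OF Suc.prems(1)] r(2) r'] using u by (simp add: th_def cf_def sum.distrib mult.commute)
  also have "(\<Sum>i<7. ?X Y i * W (bs i # map (\<theta> u) r')) = W (?X Y # map (\<theta> u) r')"
    by (rule kform_expand[OF Suc.prems(1), symmetric]) (use r(2) in simp)
  also have "(\<Sum>i<7. \<theta> u Y i * sgs (\<lambda>Z s. W (bs i # ?X Z # map (\<theta> u) s)) r') =
      sgs (\<lambda>Z s. \<Sum>i<7. \<theta> u Y i * W (bs i # ?X Z # map (\<theta> u) s)) r'"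
    by (rule sgs_lin[symmetric])
  \<comment> \<open>Exchanging the differentiated slot with the head gives exactly the minus sign in
    the recursion of \<open>sgs\<close>.\<close>
  also have "\<dots> = sgs (\<lambda>Z s. - W (?X Z # \<theta> u Y # map (\<theta> u) s)) r'"
  proof (rule sgs_cong)
    fix Z and s :: "'p vfield list" assume s: "Suc (length s) = length r'"
    have "(\<Sum>i<7. \<theta> u Y i * W (bs i # ?X Z # map (\<theta> u) s)) = W (\<theta> u Y # ?X Z # map (\<theta> u) s)"
      by (rule kform_expand[OF Suc.prems(1), symmetric]) (use s r(2) in simp)
    also have "\<dots> = - W (?X Z # \<theta> u Y # map (\<theta> u) s)"
      by (rule kform_swap[OF Suc.prems(1)]) (use s r(2) in simp)
    finally show "(\<Sum>i<7. \<theta> u Y i * W (bs i # ?X Z # map (\<theta> u) s)) = - W (?X Z # \<theta> u Y # map (\<theta> u) s)" .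
  qed
  finally show ?case unfolding r(1) by (simp add: sgs_uminus)
qed

text \<open>Forms obtained by a Hodge star agree with a \<open>cf\<close> on lists of vector fields
  of the right length, where their meaning lies, but not as functions on all lists.\<close>

definition rep :: "nat \<Rightarrow> 'p form \<Rightarrow> (rvec list \<Rightarrow> real) \<Rightarrow> bool" where
  "rep k \<omega> W \<longleftrightarrow> (\<forall>r. length r = k \<and> set r \<subseteq> vector_fields P \<longrightarrow> \<omega> r = cf W r)"

lemma rep_cf: "rep k (cf W) W" by (simp add: rep_def)

lemma repD: "rep k \<omega> W \<Longrightarrow> length r = k \<Longrightarrow> set r \<subseteq> vector_fields P \<Longrightarrow> u \<in> points P \<Longrightarrow> \<omega> r u = W (map (\<theta> u) r)"
  by (simp add: rep_def cf_def)

text \<open>Derivatives of components occur twice in the Koszul formula: through the product rule in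
  the first sum and through \<open>\<theta>_bracket\<close> in the second. They cancel by
  \<open>sgs_sgs_prs\<close>, and what is left are the terms with de^k, a sum of wedge
  products.\<close>

lemma ext_deriv_rep:
  assumes W: "kform k W" and \<omega>: "rep k \<omega> W" and Xs: "length Xs = Suc k" "set Xs \<subseteq> vector_fields P" and u: "u \<in> points P"
  shows "ext_deriv \<omega> Xs u = dW \<delta> W (map (\<theta> u) Xs)"
proof -
  \<comment> \<open>The value of \<open>W\<close> when the components of \<open>Y\<close>,
    differentiated along \<open>X\<close>, stand in the first slot.\<close>
  define B where "B = (\<lambda>X Y r. W ((\<lambda>k. X (th Y k) u) # map (\<theta> u) r))"
  have 1: "sgs (\<lambda>X r. X (\<omega> r) u) Xs = sgs (\<lambda>X r. sgs (B X) r) Xs"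
  proof (rule sgs_cong)
    fix X r assume r: "Suc (length r) = length Xs" "X \<in> set Xs" "set r \<subseteq> set Xs"
    have r': "length r = k" "set r \<subseteq> vector_fields P" using r Xs by auto
    have X: "X \<in> vector_fields P" using r Xs by blast
    have "\<omega> r = cf W r" using \<omega> r' unfolding rep_def by blast
    then show "X (\<omega> r) u = sgs (B X) r" unfolding B_def using cf_deriv[OF u X W r'] by simp
  qed
  have 2: "prs (\<lambda>X Y r. \<omega> (bracket X Y # r) u) Xs =
      prs (\<lambda>X Y r. (B X Y r - B Y X r) + (- W ((\<lambda>k. if k < 7 then \<delta> k [\<theta> u X, \<theta> u Y] else 0) # map (\<theta> u) r))) Xs"
  proof (rule prs_cong)
    fix X Y r assume r: "Suc (Suc (length r)) = length Xs" "X \<in> set Xs" "Y \<in> set Xs" "set r \<subseteq> set Xs"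
    have X: "X \<in> vector_fields P" and Y: "Y \<in> vector_fields P" using r Xs by auto
    obtain k' where k: "k = Suc k'" "length r = k'" using r(1) Xs(1) by auto
    have "length (bracket X Y # r) = k" "set (bracket X Y # r) \<subseteq> vector_fields P"
      using k r Xs(2) bracket_vector_field[OF Pm X Y] by auto
    then have "\<omega> (bracket X Y # r) u = W (\<theta> u (bracket X Y) # map (\<theta> u) r)" using repD[OF \<omega> _ _ u] by simp
    also have "\<theta> u (bracket X Y) = (\<lambda>k. 1 * (\<lambda>k. 1 * X (th Y k) u + (- 1) * Y (th X k) u) k + (- 1) * (if k < 7 then \<delta> k [\<theta> u X, \<theta> u Y] else 0))"
      unfolding \<theta>_bracket[OF u X Y] by (rule ext) simp
    also have "W (\<dots> # map (\<theta> u) r) = 1 * W ((\<lambda>k. 1 * X (th Y k) u + (- 1) * Y (th X k) u) # map (\<theta> u) r) +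
        (- 1) * W ((\<lambda>k. if k < 7 then \<delta> k [\<theta> u X, \<theta> u Y] else 0) # map (\<theta> u) r)"
      by (rule kform_lin2[of k']) (use W k in auto)
    also have "W ((\<lambda>k. 1 * X (th Y k) u + (- 1) * Y (th X k) u) # map (\<theta> u) r) = 1 * B X Y r + (- 1) * B Y X r"
      unfolding B_def by (rule kform_lin2[of k']) (use W k in auto)
    finally show "\<omega> (bracket X Y # r) u = (B X Y r - B Y X r) + (- W ((\<lambda>k. if k < 7 then \<delta> k [\<theta> u X, \<theta> u Y] else 0) # map (\<theta> u) r))"
      by simp
  qed
  have "prs (\<lambda>X Y r. - W ((\<lambda>k. if k < 7 then \<delta> k [\<theta> u X, \<theta> u Y] else 0) # map (\<theta> u) r)) Xs =
      prs (\<lambda>x y r. - W ((\<lambda>k. if k < 7 then \<delta> k [x, y] else 0) # r)) (map (\<theta> u) Xs)"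
    by (simp add: prs_map)
  also have "\<dots> = prs (\<lambda>x y r. \<Sum>k<7. 1 * (- \<delta> k [x, y] * W (bs k # r))) (map (\<theta> u) Xs)"
  proof (rule prs_cong)
    fix x y :: rvec and r :: "rvec list" assume r: "Suc (Suc (length r)) = length (map (\<theta> u) Xs)"
    obtain k' where k: "k = Suc k'" "length r = k'" using r Xs(1) by auto
    show "- W ((\<lambda>k. if k < 7 then \<delta> k [x, y] else 0) # r) = (\<Sum>k<7. 1 * (- \<delta> k [x, y] * W (bs k # r)))"
      using kform_expand[of k' W r "\<lambda>k. if k < 7 then \<delta> k [x, y] else 0"] W k by (simp add: sum_negf)
  qed
  also have "\<dots> = dW \<delta> W (map (\<theta> u) Xs)" unfolding prs_lin dW_def wd_2_prs by simp
  finally show ?thesis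
    unfolding ext_deriv_sgs 1 2 prs_add using sgs_sgs_prs[of B Xs] by simp
qed

end

lemma kform_append: "kform (k + l) W \<Longrightarrow> length us = l \<Longrightarrow> kform k (\<lambda>r. W (r @ us))"
proof (induction k arbitrary: W)
  case (Suc k)
  have K: "kform (Suc (k + l)) W" using Suc.prems(1) by simp
  have "kform k (\<lambda>r. W (v # r @ us))" for v by (rule Suc.IH[OF kform_contract[OF K] Suc.prems(2)])
  moreover have "W (v # r @ us) = (\<Sum>i<7. v i * W (bs i # r @ us))" if "length r = k" for v r
    by (rule kform_expand[OF K]) (use that Suc.prems(2) in simp)
  moreover have "W (v # v # r @ us) = 0" if "Suc (length r) = k" for v r
    by (rule kform_alt_head[OF K]) (use that Suc.prems(2) in simp)
  ultimately show ?case unfolding kform.simps(2) by simp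
qed simp

lemma es_zero: "es k (\<lambda>r. 0) \<gamma> xs = 0"
  by (simp add: es_subsets[symmetric])

lemma lincomb_vector_field:
  assumes M: "smooth_manifold M" and "\<And>i. i \<in> I \<Longrightarrow> E i \<in> vector_fields M"
  shows "(\<lambda>f q. \<Sum>i\<in>I. s i * E i f q) \<in> vector_fields M"
proof (rule vector_fieldsI)
  show "(\<lambda>q. \<Sum>i\<in>I. s i * E i f q) = (\<lambda>p. 0)" if "f \<notin> smooth_functions M" for f
    using vector_fieldsD(1)[OF assms(2) that] by simp
  show "(\<lambda>q. \<Sum>i\<in>I. s i * E i f q) \<in> smooth_functions M" if "f \<in> smooth_functions M" for f
    by (rule smooth_functions_sum[OF M], rule smooth_functions_scale[OF M], rule vector_fieldsD(2)[OF assms(2) that])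
  fix f h a b p assume f: "f \<in> smooth_functions M" and h: "h \<in> smooth_functions M"
  have "(\<Sum>i\<in>I. s i * E i (\<lambda>p. a * f p + b * h p) p) = (\<Sum>i\<in>I. a * (s i * E i f p) + b * (s i * E i h p))"
    by (rule sum.cong[OF refl])
      (simp add: pt_deriv_linear[OF vector_fields_pt_deriv[OF assms(2)] f h] algebra_simps)
  then show "(\<Sum>i\<in>I. s i * E i (\<lambda>p. a * f p + b * h p) p) = a * (\<Sum>i\<in>I. s i * E i f p) + b * (\<Sum>i\<in>I. s i * E i h p)"
    by (simp add: sum.distrib sum_distrib_left)
  have "(\<Sum>i\<in>I. s i * E i (\<lambda>p. f p * h p) p) = (\<Sum>i\<in>I. f p * (s i * E i h p) + h p * (s i * E i f p))"
    by (rule sum.cong[OF refl])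
      (simp add: pt_deriv_mult[OF vector_fields_pt_deriv[OF assms(2)] f h] algebra_simps)
  then show "(\<Sum>i\<in>I. s i * E i (\<lambda>p. f p * h p) p) = f p * (\<Sum>i\<in>I. s i * E i h p) + h p * (\<Sum>i\<in>I. s i * E i f p)"
    by (simp add: sum.distrib sum_distrib_left)
qed

context framed_over
begin

lemma is_form_cf:
  assumes W: "kform k W" shows "is_form P k (cf W)"
  unfolding is_form_def
proof (intro allI impI, elim conjE, intro conjI)
  fix Xs assume Xs: "length Xs = k" "set Xs \<subseteq> vector_fields P"
  show "cf W Xs \<in> smooth_functions P" by (rule cf_smooth[OF W Xs])
  show "\<forall>i<k. \<forall>X\<in>vector_fields P. \<forall>Y\<in>vector_fields P. \<forall>f\<in>smooth_functions P. \<forall>h\<in>smooth_functions P.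
      cf W (Xs[i := \<lambda>u p. f p * X u p + h p * Y u p]) = (\<lambda>p. f p * cf W (Xs[i := X]) p + h p * cf W (Xs[i := Y]) p)"
  proof (intro allI impI ballI ext)
    fix i X Y f h u assume i: "i < k" and X: "X \<in> vector_fields P" and Y: "Y \<in> vector_fields P"
    show "cf W (Xs[i := \<lambda>u p. f p * X u p + h p * Y u p]) u = f u * cf W (Xs[i := X]) u + h u * cf W (Xs[i := Y]) u"
    proof (cases "u \<in> points P")
      case True
      then show ?thesis
        using kform_upd_lin2[OF W _ i, of "map (\<theta> u) Xs" "f u" "\<theta> u X" "h u" "\<theta> u Y"] Xs(1) \<theta>_lin[OF True X Y, of f h]
        by (simp add: cf_def map_update)
    qed (simp add: cf_def)
  qed
  show "\<forall>i<k. \<forall>j<k. i \<noteq> j \<and> Xs ! i = Xs ! j \<longrightarrow> cf W Xs = (\<lambda>p. 0)"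
  proof (intro allI impI, elim conjE)
    fix i j assume ij: "i < k" "j < k" "i \<noteq> j" "Xs ! i = Xs ! j"
    have "W (map (\<theta> u) Xs) = 0" for u
      using kform_alt[OF W, of "map (\<theta> u) Xs" i j] kform_alt[OF W, of "map (\<theta> u) Xs" j i] ij Xs(1)
      by (cases "i < j") auto
    then show "cf W Xs = (\<lambda>p. 0)" unfolding cf_def by (simp only: if_cancel)
  qed
qed

end

context framed
begin

interpretation I: framed_over M Es a b c M "\<lambda>x. x"
  by unfold_locales (rule mfd, rule smooth_map_id[OF mfd])

lemma pull_id: "f \<in> smooth_functions M \<Longrightarrow> pull_fun M (\<lambda>x. x) f = f"
  using smooth_functions_0[OF mfd] by (auto simp: pull_fun_def)

section \<open>The G2-structure for which the frame is orthonormal\<close>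

definition "ph = I.cf (frm phi0)"
definition "vol = I.cf (frm vol0)"
definition "gm X Y = (\<lambda>p. if p \<in> points M then \<Sum>i<7. I.\<theta> p X i * I.\<theta> p Y i else 0)"

lemma \<theta>_Es: "p \<in> points M \<Longrightarrow> i < 7 \<Longrightarrow> I.\<theta> p (Es ! i) = bs i"
proof (rule I.\<theta>_unique)
  fix f assume i: "i < 7" and f: "f \<in> smooth_functions M"
  have "(\<Sum>k<7. bs i k * (Es ! k) f p) = (\<Sum>k<7. if k = i then (Es ! k) f p else 0)"
    by (rule sum.cong) (auto simp: bs_def)
  then show "(Es ! i) (pull_fun M (\<lambda>x. x) f) p = (\<Sum>k<7. bs i k * (Es ! k) f p)"
    using i by (simp add: pull_id[OF f] sum.delta)
qed (auto simp: bs_def)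

lemma riemannian: "riemannian_metric M gm"
  unfolding riemannian_metric_def
proof (intro conjI ballI impI)
  fix X Y assume X: "X \<in> vector_fields M" and Y: "Y \<in> vector_fields M"
  have "gm X Y = (\<lambda>p. \<Sum>i<7. I.th X i p * I.th Y i p)" by (auto simp: gm_def I.th_def)
  then show "gm X Y \<in> smooth_functions M"
    using smooth_functions_sum[OF mfd, of "{..<7}" "\<lambda>i p. I.th X i p * I.th Y i p"]
      smooth_functions_mult[OF mfd I.th_smooth[OF X] I.th_smooth[OF Y]] by simp
  have "(\<Sum>i<7. I.\<theta> p X i * I.\<theta> p Y i) = (\<Sum>i<7. I.\<theta> p Y i * I.\<theta> p X i)" for p by (simp add: mult.commute)
  then show "gm X Y = gm Y X" unfolding gm_def by (simp only:)
next
  fix X Y Z f h assume X: "X \<in> vector_fields M" and Y: "Y \<in> vector_fields M"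
  show "gm (\<lambda>u p. f p * X u p + h p * Y u p) Z = (\<lambda>p. f p * gm X Z p + h p * gm Y Z p)"
  proof
    fix p
    show "gm (\<lambda>u p. f p * X u p + h p * Y u p) Z p = f p * gm X Z p + h p * gm Y Z p"
      by (cases "p \<in> points M") (simp_all add: gm_def I.\<theta>_lin[OF _ X Y] sum_distrib_left sum.distrib algebra_simps)
  qed
next
  fix X p assume X: "X \<in> vector_fields M" and p: "p \<in> points M" and ex: "\<exists>f\<in>smooth_functions M. X f p \<noteq> 0"
  then obtain f where f: "f \<in> smooth_functions M" "X f p \<noteq> 0" by blast
  have "X f p = (\<Sum>k<7. I.\<theta> p X k * (Es ! k) f p)" using I.\<theta>_expand[OF p X f(1)] by (simp add: pull_id[OF f(1)])
  then obtain k where k: "k < 7" "I.\<theta> p X k \<noteq> 0" using f(2) by (metis (no_types, lifting) lessThan_iff mult_zero_left sum.neutral)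
  have "0 < I.\<theta> p X k * I.\<theta> p X k" using k(2) not_real_square_gt_zero by blast
  also have "\<dots> \<le> (\<Sum>i<7. I.\<theta> p X i * I.\<theta> p X i)" by (rule member_le_sum) (use k in auto)
  finally show "gm X X p > 0" using p by (simp add: gm_def)
qed

lemma orthonormal_orthobasis_\<theta>:
  assumes p: "p \<in> points M" and E: "orthonormal_at M gm p E"
  shows "length E = 7" "set E \<subseteq> vector_fields M" "orthobasis (map (I.\<theta> p) E)"
proof -
  show len: "length E = 7" and "set E \<subseteq> vector_fields M" using E dim unfolding orthonormal_at_def by auto
  show "orthobasis (map (I.\<theta> p) E)"
  proof (rule orthonormal_orthobasis)
    fix i j :: nat assume ij: "i < 7" "j < 7"
    then have "gm (E ! i) (E ! j) p = (if i = j then 1 else 0)" using E dim unfolding orthonormal_at_def by simp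
    then show "(\<Sum>l<7. (map (I.\<theta> p) E ! i) l * (map (I.\<theta> p) E ! j) l) = (if i = j then 1 else 0)"
      using ij len p by (simp add: gm_def)
  qed (simp add: len)
qed

lemma orthonormal_some:
  assumes p: "p \<in> points M" shows "orthonormal_at M gm p (SOME E. orthonormal_at M gm p E)"
proof (rule someI)
  \<comment> \<open>The frame itself is a witness, so the choice made in \<open>hodge\<close>
    succeeds at every point.\<close>
  show "orthonormal_at M gm p Es"
    unfolding orthonormal_at_def dim
  proof (intro conjI allI impI)
    show "length Es = 7" by (rule length_Es)
    show "set Es \<subseteq> vector_fields M" using frame unfolding framing_def by blast
    fix i j :: nat assume i: "i < 7" and j: "j < 7"
    have "(\<Sum>l<7. bs i l * bs j l) = (\<Sum>l<7. if l = i then (if i = j then 1 else 0) else 0)"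
      by (rule sum.cong) (auto simp: bs_def)
    then show "gm (Es ! i) (Es ! j) p = (if i = j then 1 else 0)"
      using i p by (simp add: gm_def \<theta>_Es[OF p i] \<theta>_Es[OF p j] sum.delta)
  qed
qed

lemma volume: "volume_form M gm vol"
  unfolding volume_form_def
proof (intro conjI ballI allI impI)
  show "is_form M (mdim M) vol" unfolding vol_def dim by (rule I.is_form_cf[OF kform_frm[OF frm_oks(3)]])
  fix p E assume p: "p \<in> points M" and E: "orthonormal_at M gm p E"
  show "\<bar>vol E p\<bar> = 1"
    using vol0_orthobasis[OF _ orthonormal_orthobasis_\<theta>(3)[OF p E]] orthonormal_orthobasis_\<theta>(1)[OF p E] p
    by (simp add: vol_def I.cf_def)
qed

lemma hodge_zero:
  assumes "\<And>r. p \<in> points M \<Longrightarrow> length r = k \<Longrightarrow> set r \<subseteq> vector_fields M \<Longrightarrow> \<beta> r p = 0"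
  shows "hodge M gm vol k \<beta> Xs p = 0"
proof (cases "p \<in> points M")
  case True
  let ?E = "SOME E. orthonormal_at M gm p E"
  note E = orthonormal_orthobasis_\<theta>[OF True orthonormal_some[OF True]]
  have "hodge M gm vol k \<beta> Xs p = es k (\<lambda>r. \<beta> r p) (\<lambda>r. vol (r @ Xs) p) ?E"
    by (rule hodge_es[OF True]) (simp add: E(1) dim)
  also have "\<dots> = es k (\<lambda>r. 0) (\<lambda>r. vol (r @ Xs) p) ?E"
    by (rule es_cong) (use assms True E(2) in blast)+
  finally show ?thesis by (simp add: es_zero)
qed (simp add: hodge_def)

text \<open>The orthonormal basis in \<open>hodge\<close> is chosen separately at each point, with
  no regularity. Independence of the basis allows the evaluation in the standard basis of R^7, that
  is, in the frame, and the result has constant coefficients.\<close>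

lemma hodge_rep:
  assumes B: "kform k B" and \<beta>: "\<And>r p. p \<in> points M \<Longrightarrow> length r = k \<Longrightarrow> set r \<subseteq> vector_fields M \<Longrightarrow> \<beta> r p = B (map (I.\<theta> p) r)"
    and k: "k + l = 7" and C: "\<And>xs. es k B (\<lambda>r. frm vol0 (r @ xs)) (map bs [0..<7]) = C xs"
  shows "I.rep l (hodge M gm vol k \<beta>) C"
  unfolding I.rep_def
proof (intro allI impI ext, elim conjE)
  fix Xs p assume Xs: "length Xs = l" "set Xs \<subseteq> vector_fields M"
  show "hodge M gm vol k \<beta> Xs p = I.cf C Xs p"
  proof (cases "p \<in> points M")
    case True
    let ?E = "SOME E. orthonormal_at M gm p E" and ?xs = "map (I.\<theta> p) Xs"
    note E = orthonormal_orthobasis_\<theta>[OF True orthonormal_some[OF True]]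
    have K: "kform k (\<lambda>r. frm vol0 (r @ ?xs))"
      by (rule kform_append[of k l]) (use kform_frm[OF frm_oks(3)] k Xs in auto)
    have "hodge M gm vol k \<beta> Xs p = es k (\<lambda>r. \<beta> r p) (\<lambda>r. vol (r @ Xs) p) ?E"
      by (rule hodge_es[OF True]) (simp add: E(1) dim)
    also have "\<dots> = es k (\<lambda>r. B (map (I.\<theta> p) r)) (\<lambda>r. frm vol0 (map (I.\<theta> p) r @ ?xs)) ?E"
    proof (rule es_cong)
      show "\<beta> r p = B (map (I.\<theta> p) r)" if "length r = k" "set r \<subseteq> set ?E" for r
        by (rule \<beta>[OF True that(1)]) (use that(2) E(2) in blast)
      show "vol (r @ Xs) p = frm vol0 (map (I.\<theta> p) r @ ?xs)" for r
        using True by (simp add: vol_def I.cf_def)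
    qed
    also have "\<dots> = es k B (\<lambda>r. frm vol0 (r @ ?xs)) (map (I.\<theta> p) ?E)" by (rule es_map[symmetric])
    also have "\<dots> = es k B (\<lambda>r. frm vol0 (r @ ?xs)) (map bs [0..<7])"
      by (rule es_orthobasis[OF E(3) orthobasis_standard B K])
    also have "\<dots> = C ?xs" by (rule C)
    finally show ?thesis using True by (simp add: I.cf_def)
  qed (simp add: hodge_def I.cf_def)
qed

lemma ph_at: "p \<in> points M \<Longrightarrow> ph r p = frm phi0 (map (I.\<theta> p) r)"
  by (simp add: ph_def I.cf_def)

lemma psi_rep: "I.rep 4 (G2_psi M ph gm vol) (frm psi0)"
  unfolding G2_psi_def
  by (rule hodge_rep[OF kform_frm[OF frm_oks(1)] _ _ es_phi0]) (auto simp: ph_at)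

lemma ext_deriv_ph:
  assumes "p \<in> points M" "length r = 4" "set r \<subseteq> vector_fields M"
  shows "ext_deriv ph r p = frm (dphi0 a b c) (map (I.\<theta> p) r)"
proof -
  have "ext_deriv ph r p = dW \<delta> (frm phi0) (map (I.\<theta> p) r)"
    unfolding ph_def by (rule I.ext_deriv_rep[OF kform_frm[OF frm_oks(1)] I.rep_cf]) (use assms in auto)
  then show ?thesis using dW_phi0[of "map (I.\<theta> p) r" a b c] assms(2) by simp
qed

lemma hodge_dph_rep: "I.rep 3 (hodge M gm vol 4 (ext_deriv ph)) (\<lambda>xs. - frm (T0 a b c) xs)"
  by (rule hodge_rep[OF kform_frm[OF frm_oks(4)] _ _ es_dphi0]) (auto simp: ext_deriv_ph)

lemma wedge_dph_ph:
  assumes "p \<in> points M" "length r = 7" "set r \<subseteq> vector_fields M"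
  shows "wedge 4 (ext_deriv ph) ph r p = 0"
proof -
  have "wedge 4 (ext_deriv ph) ph r p = wd 4 (\<lambda>s. frm (dphi0 a b c) (map (I.\<theta> p) s)) (\<lambda>s. frm phi0 (map (I.\<theta> p) s)) r"
    unfolding wedge_wd
  proof (rule wd_cong)
    show "ext_deriv ph s p = frm (dphi0 a b c) (map (I.\<theta> p) s)" if "length s = 4" "set s \<subseteq> set r" for s
      by (rule ext_deriv_ph[OF assms(1) that(1)]) (use that(2) assms(3) in blast)
  qed (rule ph_at[OF assms(1)])
  then show ?thesis using dphi0_phi0[of "map (I.\<theta> p) r" a b c] assms(2) by (simp add: wd_map)
qed

lemma hodge_7: "hodge M gm vol 7 (wedge 4 (ext_deriv ph) ph) [] p = 0"
  by (rule hodge_zero) (rule wedge_dph_ph)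

text \<open>Since \<star>d\<phi> = -T, this is \<phi> \<and> T = 0.\<close>

lemma tau1_zero: "tau1 M ph gm vol = (\<lambda>Xs p. 0)"
proof (intro ext)
  fix Xs p
  have "hodge M gm vol 6 (wedge 3 ph (hodge M gm vol 4 (ext_deriv ph))) Xs p = 0"
  proof (rule hodge_zero)
    fix r assume p: "p \<in> points M" and r: "length r = 6" "set r \<subseteq> vector_fields M"
    have "wedge 3 ph (hodge M gm vol 4 (ext_deriv ph)) r p =
        wd 3 (\<lambda>s. frm phi0 (map (I.\<theta> p) s)) (\<lambda>s. - frm (T0 a b c) (map (I.\<theta> p) s)) r"
      unfolding wedge_wd
    proof (rule wd_cong)
      show "hodge M gm vol 4 (ext_deriv ph) s p = - frm (T0 a b c) (map (I.\<theta> p) s)"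
        if s: "length s + 3 = length r" "set s \<subseteq> set r" for s
        by (rule I.repD[OF hodge_dph_rep _ _ p]) (use s r in auto)
    qed (rule ph_at[OF p])
    also have "\<dots> = wd 3 (frm phi0) (\<lambda>s. - frm (T0 a b c) s) (map (I.\<theta> p) r)" by (simp add: wd_map)
    also have "\<dots> = (\<Sum>i\<in>{()}. (- 1) * wd 3 (frm phi0) (frm (T0 a b c)) (map (I.\<theta> p) r))"
      by (rule wd_lin2) simp
    also have "\<dots> = 0" using phi0_T0[of "map (I.\<theta> p) r" a b c] r(1) by simp
    finally show "wedge 3 ph (hodge M gm vol 4 (ext_deriv ph)) r p = 0" .
  qed
  then show "tau1 M ph gm vol Xs p = 0" by (simp add: tau1_def)
qed

text \<open>The first and the last of the three terms vanish by \<open>hodge_7\<close> and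
  \<open>tau1_zero\<close>; what is left is -\<star>d\<phi>.\<close>

lemma torsion_rep: "I.rep 3 (G2_torsion M ph gm vol) (frm (T0 a b c))"
  unfolding I.rep_def
proof (intro allI impI ext, elim conjE)
  fix r p assume r: "length r = 3" "set r \<subseteq> vector_fields M"
  have "hodge M gm vol 4 (wedge 1 (\<lambda>Ys q. 4 * tau1 M ph gm vol Ys q) ph) r p = 0"
    by (rule hodge_zero) (simp add: tau1_zero wedge_def)
  moreover have "hodge M gm vol 4 (ext_deriv ph) r = I.cf (\<lambda>xs. - frm (T0 a b c) xs) r"
    using hodge_dph_rep r unfolding I.rep_def by blast
  ultimately show "G2_torsion M ph gm vol r p = I.cf (frm (T0 a b c)) r p"
    unfolding G2_torsion_def hodge_7 by (simp add: I.cf_def)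
qed

lemma G2: "G2_structure M ph gm vol"
  unfolding G2_structure_def
proof (intro conjI ballI)
  show "mdim M = 7" by (rule dim)
  show "is_form M 3 ph" unfolding ph_def by (rule I.is_form_cf[OF kform_frm[OF frm_oks(1)]])
  show "riemannian_metric M gm" by (rule riemannian)
  show "volume_form M gm vol" by (rule volume)
  fix X Y assume "X \<in> vector_fields M" "Y \<in> vector_fields M"
  show "form_eq M 7 (\<lambda>Xs p. 6 * gm X Y p * vol Xs p) (wedge 4 (wedge 2 (contract X ph) (contract Y ph)) ph)"
    unfolding form_eq_def
  proof (intro allI impI ballI, elim conjE)
    fix Xs :: "'a vfield list" and p assume Xs: "length Xs = 7" and p: "p \<in> points M"
    let ?t = "I.\<theta> p"
    have 1: "wedge 2 (contract X ph) (contract Y ph) r p =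
        wd 2 (\<lambda>r. frm phi0 (?t X # r)) (\<lambda>r. frm phi0 (?t Y # r)) (map ?t r)" for r
      unfolding wedge_wd contract_def by (simp add: wd_map ph_at[OF p])
    have "wedge 4 (wedge 2 (contract X ph) (contract Y ph)) ph Xs p =
        wd 4 (wd 2 (\<lambda>r. frm phi0 (?t X # r)) (\<lambda>r. frm phi0 (?t Y # r))) (frm phi0) (map ?t Xs)"
      unfolding wedge_wd[of 4] 1 by (simp add: wd_map ph_at[OF p])
    also have "\<dots> = 6 * (\<Sum>i<7. ?t X i * ?t Y i) * frm vol0 (map ?t Xs)"
      by (rule G2_metric) (simp add: Xs)
    finally show "6 * gm X Y p * vol Xs p = wedge 4 (wedge 2 (contract X ph) (contract Y ph)) ph Xs p"
      using p by (simp add: gm_def vol_def I.cf_def)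
  qed
qed

lemma ext_deriv_psi:
  assumes "p \<in> points M" "length r = 5" "set r \<subseteq> vector_fields M"
  shows "ext_deriv (G2_psi M ph gm vol) r p = 0"
proof -
  have "ext_deriv (G2_psi M ph gm vol) r p = dW \<delta> (frm psi0) (map (I.\<theta> p) r)"
    by (rule I.ext_deriv_rep[OF kform_frm[OF frm_oks(2)] psi_rep]) (use assms in auto)
  then show ?thesis using dW_psi0[of "map (I.\<theta> p) r" a b c] assms(2) by simp
qed

lemma purely: "purely_coclosed M ph gm vol"
  unfolding purely_coclosed_def form_eq_def tau0_def hodge_7 using ext_deriv_psi by simp

lemma heterotic_1: "form_eq M 5 (ext_deriv (G2_psi M ph gm vol))
    (wedge 1 (\<lambda>Xs p. 4 * tau1 M ph gm vol Xs p) (G2_psi M ph gm vol))"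
  unfolding form_eq_def tau1_zero using ext_deriv_psi by (simp add: wedge_def)

end

section \<open>Pullback of invariant forms\<close>

context framed_over
begin

interpretation I: framed_over M Es a b c M "\<lambda>x. x"
  by unfold_locales (rule mfd, rule smooth_map_id[OF mfd])

text \<open>The fields on M chosen inside \<open>pullback\<close> are prescribed only through their
  values at \<open>pr u\<close>. Any admissible choice has the components \<open>\<theta> u\<close>
  there, and a form with constant coefficients depends on nothing else.\<close>

lemma pullback_at:
  assumes u: "u \<in> points P" and Ys: "length Ys = k" "set Ys \<subseteq> vector_fields P"
    and \<omega>: "\<And>Zs. length Zs = k \<Longrightarrow> set Zs \<subseteq> vector_fields M \<Longrightarrow> \<omega> Zs (pr u) = W (map (I.\<theta> (pr u)) Zs)"
  shows "pullback P M pr \<omega> Ys u = W (map (\<theta> u) Ys)"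
proof -
  let ?Q = "\<lambda>Zs. length Zs = length Ys \<and> set Zs \<subseteq> vector_fields M \<and>
    (\<forall>i<length Ys. \<forall>f\<in>smooth_functions M. (Zs ! i) f (pr u) = (Ys ! i) (pull_fun P pr f) u)"
  \<comment> \<open>Admissible fields exist: combinations of the frame whose constant coefficients
    are the components at \<open>u\<close>.\<close>
  have "?Q (map (\<lambda>Y f q. \<Sum>k<7. \<theta> u Y k * (Es ! k) f q) Ys)"
  proof (intro conjI allI impI ballI)
    show "set (map (\<lambda>Y f q. \<Sum>k<7. \<theta> u Y k * (Es ! k) f q) Ys) \<subseteq> vector_fields M"
      using lincomb_vector_field[OF mfd, of "{..<7}" "\<lambda>k. Es ! k"] Es_vf by auto
    fix i f assume i: "i < length Ys" and f: "f \<in> smooth_functions M"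
    have "Ys ! i \<in> vector_fields P" using i Ys(2) by (meson nth_mem subsetD)
    then show "(map (\<lambda>Y f q. \<Sum>k<7. \<theta> u Y k * (Es ! k) f q) Ys ! i) f (pr u) = (Ys ! i) (pull_fun P pr f) u"
      using \<theta>_expand[OF u _ f] i by simp
  qed simp
  then have Q: "?Q (SOME Zs. ?Q Zs)" by (rule someI)
  define Zs where "Zs = (SOME Zs. ?Q Zs)"
  have Z: "length Zs = k" "set Zs \<subseteq> vector_fields M"
    "\<And>i f. i < k \<Longrightarrow> f \<in> smooth_functions M \<Longrightarrow> (Zs ! i) f (pr u) = (Ys ! i) (pull_fun P pr f) u"
    using Q Ys(1) unfolding Zs_def by auto
  have "map (I.\<theta> (pr u)) Zs = map (\<theta> u) Ys"
  proof (rule nth_equalityI)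
    fix i assume "i < length (map (I.\<theta> (pr u)) Zs)"
    then have i: "i < k" using Z(1) by simp
    have Y: "Ys ! i \<in> vector_fields P" using i Ys by (meson nth_mem subsetD)
    have "I.\<theta> (pr u) (Zs ! i) = \<theta> u (Ys ! i)"
    proof (rule I.\<theta>_unique[OF pr_points[OF u]])
      show "\<theta> u (Ys ! i) j = 0" if "j \<ge> 7" for j by (rule \<theta>_supp[OF u Y that])
      fix f assume f: "f \<in> smooth_functions M"
      show "(Zs ! i) (pull_fun M (\<lambda>x. x) f) (pr u) = (\<Sum>j<7. \<theta> u (Ys ! i) j * (Es ! j) f (pr u))"
        unfolding pull_id[OF f] Z(3)[OF i f] by (rule \<theta>_expand[OF u Y f])
    qed
    then show "map (I.\<theta> (pr u)) Zs ! i = map (\<theta> u) Ys ! i" using i Z(1) Ys(1) by simp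
  qed (simp add: Z(1) Ys(1))
  then have "\<omega> Zs (pr u) = W (map (\<theta> u) Ys)" using \<omega>[OF Z(1,2)] by simp
  then show ?thesis using u unfolding pullback_def Zs_def by simp
qed

lemma pullback_psi:
  assumes "u \<in> points P" "length Ys = 4" "set Ys \<subseteq> vector_fields P"
  shows "pullback P M pr (G2_psi M ph gm vol) Ys u = frm psi0 (map (\<theta> u) Ys)"
  by (rule pullback_at[OF assms]) (rule I.repD[OF psi_rep], simp_all add: pr_points assms(1))

lemma pullback_torsion:
  assumes "u \<in> points P" "length Ys = 4" "set Ys \<subseteq> vector_fields P"
  shows "pullback P M pr (ext_deriv (G2_torsion M ph gm vol)) Ys u = dW \<delta> (frm (T0 a b c)) (map (\<theta> u) Ys)"
  by (rule pullback_at[OF assms]) (rule I.ext_deriv_rep[OF kform_frm[OF frm_oks(5)] torsion_rep], simp_all add: pr_points assms(1))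

end

section \<open>The abelian group of translations\<close>

definition Rn :: "nat \<Rightarrow> (nat \<Rightarrow> real) manifold" where
  "Rn n = \<lparr>mdim = n, mtop = Euclidean_space n, atlas = {(topspace (Euclidean_space n), \<lambda>x. x)}\<rparr>"

definition Vn :: "nat \<Rightarrow> (nat \<Rightarrow> real) smooth_group" where
  "Vn n = \<lparr>carrier = topspace (Euclidean_space n), mult = (\<lambda>x y i. x i + y i), one = (\<lambda>i. 0), gman = Rn n\<rparr>"

lemma Rn_simps [simp]: "mdim (Rn n) = n" "mtop (Rn n) = Euclidean_space n"
    "atlas (Rn n) = {(topspace (Euclidean_space n), \<lambda>x. x)}"
  by (simp_all add: Rn_def)

lemma Vn_simps [simp]: "carrier (Vn n) = topspace (Euclidean_space n)" "gman (Vn n) = Rn n"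
    "x \<otimes>\<^bsub>Vn n\<^esub> y = (\<lambda>i. x i + y i)" "\<one>\<^bsub>Vn n\<^esub> = (\<lambda>i. 0)"
  by (simp_all add: Vn_def)

lemma Euclidean_mem: "x \<in> topspace (Euclidean_space n) \<longleftrightarrow> (\<forall>i\<ge>n. x i = 0)"
  by (simp add: topspace_Euclidean_space)

lemma second_countable_Euclidean_space: "second_countable (Euclidean_space n)"
proof -
  obtain B :: "rvec set set" where B: "countable B" "\<And>X. X \<in> B \<Longrightarrow> open X"
    "\<And>X x. open X \<Longrightarrow> x \<in> X \<Longrightarrow> \<exists>Y\<in>B. x \<in> Y \<and> Y \<subseteq> X"
    using ex_countable_basis topological_basis_open topological_basisE by metis
  have "second_countable (euclidean :: rvec topology)"
    unfolding second_countable_def using B by (intro exI[of _ B]) auto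
  then show ?thesis unfolding Euclidean_space_top_of_set by (rule second_countable_subtopology)
qed

lemma inv_into_id: "x \<in> S \<Longrightarrow> inv_into S (\<lambda>x. x) x = x"
  by (metis inj_on_id2 inv_into_f_f)

lemma smooth_on_inv_id:
  assumes W: "openin (Euclidean_space n) W" and f: "smooth_on n W f"
  shows "smooth_on n W (\<lambda>x. f (inv_into (topspace (Euclidean_space n)) (\<lambda>x. x) x))"
proof (rule smooth_on_cong[OF W f])
  fix y assume "y \<in> W"
  then have "y \<in> topspace (Euclidean_space n)" using openin_subset[OF W] by blast
  then show "f y = f (inv_into (topspace (Euclidean_space n)) (\<lambda>x. x) y)" by (simp only: inv_into_id)
qed

lemma smooth_manifold_Rn: "smooth_manifold (Rn n)"
  unfolding smooth_manifold_def
  using second_countable_Euclidean_space homeomorphic_map_id[unfolded id_def, THEN iffD2, OF refl] smooth_on_inv_id[OF openin_topspace smooth_on_coord[OF openin_topspace]]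
  by (auto simp: Hausdorff_Euclidean_space homeomorphic_map_id image_ident)

lemma sm_fun_RnI: "openin (Euclidean_space n) W \<Longrightarrow> smooth_on n W f \<Longrightarrow> sm_fun (Rn n) W f"
  by (rule sm_funI) (auto simp: image_ident Int_absorb1 openin_subset intro: smooth_on_inv_id)

lemma smooth_map_RnI:
  assumes M: "smooth_manifold M" and "\<And>i. i < n \<Longrightarrow> sm_fun M (points M) (\<lambda>x. F x i)"
    "\<And>i. i < n \<Longrightarrow> continuous_map (mtop M) euclideanreal (\<lambda>x. F x i)"
    and supp: "\<And>x i. x \<in> points M \<Longrightarrow> i \<ge> n \<Longrightarrow> F x i = 0"
  shows "smooth_map M (Rn n) F"
proof (rule smooth_mapI[OF M])
  show "continuous_map (mtop M) (mtop (Rn n)) F"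
    unfolding Rn_simps by (rule continuous_map_EuclideanI) (use assms in auto)
  show "sm_fun M {x \<in> points M. F x \<in> U} (\<lambda>x. c (F x) i)" if "(U, c) \<in> atlas (Rn n)" "i < mdim (Rn n)" for U c i
    using that assms(2)[of i] by (auto intro: sm_fun_subset[OF M])
qed

lemma comm_group_Vn: "comm_group (Vn n)"
proof (rule comm_groupI)
  fix x assume "x \<in> carrier (Vn n)"
  then have "(\<lambda>i. - x i) \<in> carrier (Vn n)" by (simp add: Euclidean_mem)
  then show "\<exists>y\<in>carrier (Vn n). y \<otimes>\<^bsub>Vn n\<^esub> x = \<one>\<^bsub>Vn n\<^esub>" by (rule rev_bexI) simp
qed (auto simp: Euclidean_mem add_ac)

lemma inv_Vn: "x \<in> carrier (Vn n) \<Longrightarrow> inv\<^bsub>Vn n\<^esub> x = (\<lambda>i. - x i)"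
  by (rule group.inv_equality[OF comm_group.axioms(2)[OF comm_group_Vn]]) (auto simp: Euclidean_mem)

lemma sm_fun_Rn_coord: "sm_fun (Rn n) (points (Rn n)) (\<lambda>x. x i)"
  by (rule sm_fun_RnI) (auto intro: smooth_on_coord)

lemma continuous_map_Rn_coord: "continuous_map (Euclidean_space n) euclideanreal (\<lambda>x. x i)"
  using continuous_map_Euclidean_coord[OF continuous_map_id] by (simp add: id_def)

lemma smooth_add: "smooth_map (prod_manifold (Rn n) (Rn n)) (Rn n) (\<lambda>z i. fst z i + snd z i)"
proof (rule smooth_map_RnI[OF smooth_manifold_prod[OF smooth_manifold_Rn smooth_manifold_Rn]])
  let ?R = "prod_manifold (Rn n) (Rn n)"
  have o: "openin (prod_topology (mtop (Rn n)) (mtop (Rn n))) (points ?R)"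
    unfolding mtop_prod by (rule openin_topspace)
  have 1: "fst ` points ?R \<subseteq> points (Rn n)" "snd ` points ?R \<subseteq> points (Rn n)" by auto
  show "sm_fun ?R (points ?R) (\<lambda>z. fst z i + snd z i)" for i
    by (rule sm_fun_add[OF smooth_manifold_prod[OF smooth_manifold_Rn smooth_manifold_Rn] openin_topspace
          sm_fun_fst[OF smooth_manifold_Rn smooth_manifold_Rn openin_topspace sm_fun_Rn_coord o 1(1)]
          sm_fun_snd[OF smooth_manifold_Rn smooth_manifold_Rn openin_topspace sm_fun_Rn_coord o 1(2)]])
  have "continuous_map (prod_topology (Euclidean_space n) (Euclidean_space n)) euclideanreal (\<lambda>z. fst z i)"
    "continuous_map (prod_topology (Euclidean_space n) (Euclidean_space n)) euclideanreal (\<lambda>z. snd z i)" for i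
    using continuous_map_compose[OF continuous_map_fst continuous_map_Rn_coord]
      continuous_map_compose[OF continuous_map_snd continuous_map_Rn_coord] by (simp_all add: o_def)
  then show "continuous_map (mtop ?R) euclideanreal (\<lambda>z. fst z i + snd z i)" for i
    by (simp add: continuous_map_add)
qed (auto simp: Euclidean_mem)

lemma lie_group_Vn: "lie_group (Vn n)"
  unfolding lie_group_def
proof (intro conjI)
  show "group (Vn n)" by (rule comm_group.axioms(2)[OF comm_group_Vn])
  show "smooth_manifold (gman (Vn n))" using smooth_manifold_Rn by simp
  show "points (gman (Vn n)) = carrier (Vn n)" by simp
  show "smooth_map (prod_manifold (gman (Vn n)) (gman (Vn n))) (gman (Vn n)) (\<lambda>(x, y). x \<otimes>\<^bsub>Vn n\<^esub> y)"
    using smooth_add by (simp add: case_prod_unfold)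
  have "smooth_map (Rn n) (Rn n) (\<lambda>x i. - x i)"
  proof (rule smooth_map_RnI[OF smooth_manifold_Rn])
    have "sm_fun (Rn n) (points (Rn n)) (\<lambda>x. (- 1) * x i)" for i
      by (rule sm_fun_mult[OF smooth_manifold_Rn openin_topspace sm_fun_const[OF smooth_manifold_Rn openin_topspace] sm_fun_Rn_coord])
    then show "sm_fun (Rn n) (points (Rn n)) (\<lambda>x. - x i)" for i by simp
    show "continuous_map (mtop (Rn n)) euclideanreal (\<lambda>x. - x i)" for i
      by (simp add: continuous_map_minus continuous_map_Rn_coord)
  qed (auto simp: Euclidean_mem)
  then have "smooth_map (Rn n) (Rn n) (\<lambda>x. inv\<^bsub>Vn n\<^esub> x)"
    by (rule smooth_map_cong[OF smooth_manifold_Rn smooth_manifold_Rn]) (simp add: inv_Vn)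
  then show "smooth_map (gman (Vn n)) (gman (Vn n)) (\<lambda>x. inv\<^bsub>Vn n\<^esub> x)" by simp
qed

text \<open>Dividing by the trivial subgroup makes the extension of tangent vectors to
  left-invariant fields available for R^n.\<close>

lemma lie_quotient_Vn: "lie_quotient (Vn n) {\<one>\<^bsub>Vn n\<^esub>}"
proof (rule lie_quotient.intro)
  show "lie_group (Vn n)" by (rule lie_group_Vn)
  show "subgroup {\<one>\<^bsub>Vn n\<^esub>} (Vn n)" by (rule group.triv_subgroup[OF comm_group.axioms(2)[OF comm_group_Vn]])
  show "subtopology (mtop (gman (Vn n))) {\<one>\<^bsub>Vn n\<^esub>} = discrete_topology {\<one>\<^bsub>Vn n\<^esub>}"
    by (simp add: subtopology_eq_discrete_topology_sing Euclidean_mem)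
qed

section \<open>Translation-invariant fields on R^n\<close>

definition tb :: "nat \<Rightarrow> nat \<Rightarrow> rvec \<Rightarrow> real" where
  "tb n b x = (if x \<in> topspace (Euclidean_space n) then x b else 0)"

lemma tb_smooth: "tb n b \<in> smooth_functions (Rn n)"
  unfolding mem_smooth_functions[OF smooth_manifold_Rn]
proof
  show "\<forall>x. x \<notin> points (Rn n) \<longrightarrow> tb n b x = 0" by (simp add: tb_def)
  show "sm_fun (Rn n) (points (Rn n)) (tb n b)"
    by (rule sm_fun_cong[OF smooth_manifold_Rn openin_topspace sm_fun_Rn_coord[of n b]]) (simp add: tb_def)
qed

lemma pt_deriv_Rn:
  assumes p: "p \<in> points (Rn n)" and D: "pt_deriv (Rn n) p D" and f: "f \<in> smooth_functions (Rn n)"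
  shows "D f = (\<Sum>b<n. D (tb n b) * partial b f p)"
proof -
  have at: "(points (Rn n), \<lambda>x. x) \<in> atlas (Rn n)" by simp
  have pc: "partial b (\<lambda>x. f (inv_into (points (Rn n)) (\<lambda>x. x) x)) p = partial b f p" if "b < n" for f b
    by (rule partial_cong(1)[OF openin_topspace[of "Euclidean_space n"]]) (use p that in \<open>simp_all add: inv_into_id\<close>)
  obtain \<xi> where \<xi>: "\<And>D f. pt_deriv (Rn n) p D \<Longrightarrow> f \<in> smooth_functions (Rn n) \<Longrightarrow>
       D f = (\<Sum>i<n. D (\<xi> i) * partial i (\<lambda>x. f (inv_into (points (Rn n)) (\<lambda>x. x) x)) p)"
    by (rule pt_deriv_coordinates[OF smooth_manifold_Rn at p, unfolded Rn_simps(1)]) blast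
  have ex: "D f = (\<Sum>i<n. D (\<xi> i) * partial i f p)" if "f \<in> smooth_functions (Rn n)" for f
    unfolding \<xi>[OF D that] by (rule sum.cong[OF refl]) (simp only: pc lessThan_iff)
  have pt: "partial i (tb n b) p = (if i = b then 1 else 0)" if "i < n" for i b
  proof -
    have "partial i (tb n b) p = partial i (\<lambda>x. x b) p"
      by (rule partial_cong(1)[OF openin_topspace[of "Euclidean_space n"]]) (use p that in \<open>simp_all add: tb_def\<close>)
    also have "\<dots> = (if i = b then 1 else 0)" by (simp add: partial_def)
    finally show ?thesis .
  qed
  have "D (tb n b) = D (\<xi> b)" if "b < n" for b
  proof -
    have "D (tb n b) = (\<Sum>i<n. if i = b then D (\<xi> i) else 0)"
      unfolding ex[OF tb_smooth] by (rule sum.cong) (simp_all add: pt)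
    then show ?thesis using that by simp
  qed
  then show ?thesis unfolding ex[OF f] by simp
qed

text \<open>A coordinate function changes under translation by a constant, which derivations
  annihilate; so an invariant field has constant components.\<close>

lemma lie_algebra_Vn:
  assumes X: "X \<in> lie_algebra (Vn n)"
  shows "X \<in> vector_fields (Rn n)"
    "p \<in> points (Rn n) \<Longrightarrow> X (tb n b) p = X (tb n b) (\<lambda>i. 0)"
    "\<exists>k. X (tb n b) = (\<lambda>p. if p \<in> points (Rn n) then k else 0)"
proof -
  interpret lie_quotient "Vn n" "{\<one>\<^bsub>Vn n\<^esub>}" by (rule lie_quotient_Vn)
  show V: "X \<in> vector_fields (Rn n)" using lie_algebra_vf[OF X] by simp
  show c: "X (tb n b) p = X (tb n b) (\<lambda>i. 0)" if p: "p \<in> points (Rn n)" for p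
  proof -
    let ?z = "\<lambda>i. 0 :: real"
    have z: "?z \<in> points (Rn n)" by (simp add: Euclidean_mem)
    have "X (tb n b) p = X (pull_fun (Rn n) (\<lambda>x i. p i + x i) (tb n b)) ?z"
      using left_inv[OF X, of "tb n b" p ?z] tb_smooth p z by simp
    also have "pull_fun (Rn n) (\<lambda>x i. p i + x i) (tb n b) = (\<lambda>x. tb n b x + (if x \<in> points (Rn n) then p b else 0))"
      using p by (auto simp: pull_fun_def tb_def Euclidean_mem fun_eq_iff)
    also have "X \<dots> ?z = X (tb n b) ?z"
      using pt_deriv_add[OF smooth_manifold_Rn vector_fields_pt_deriv[OF V] tb_smooth smooth_functions_const[OF smooth_manifold_Rn]]
        pt_deriv_one[OF smooth_manifold_Rn vector_fields_pt_deriv[OF V] z] by simp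
    finally show ?thesis .
  qed
  have "X (tb n b) p = (if p \<in> points (Rn n) then X (tb n b) (\<lambda>i. 0) else 0)" for p
    using c[of p] smooth_functions_0[OF smooth_manifold_Rn vector_fieldsD(2)[OF V tb_smooth], of p b] by simp
  then show "\<exists>k. X (tb n b) = (\<lambda>p. if p \<in> points (Rn n) then k else 0)" by blast
qed

lemma vector_field_Rn_eqI:
  assumes X: "X \<in> vector_fields (Rn n)" and Y: "Y \<in> vector_fields (Rn n)"
    and eq: "\<And>b p. b < n \<Longrightarrow> p \<in> points (Rn n) \<Longrightarrow> X (tb n b) p = Y (tb n b) p"
  shows "X = Y"
proof (intro ext)
  fix f p
  show "X f p = Y f p"
  proof (cases "f \<in> smooth_functions (Rn n)")
    case f: True
    show ?thesis
    proof (cases "p \<in> points (Rn n)")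
      case True
      then show ?thesis
        using pt_deriv_Rn[OF True vector_fields_pt_deriv[OF X] f] pt_deriv_Rn[OF True vector_fields_pt_deriv[OF Y] f] eq by simp
    next
      case False
      then show ?thesis
        using smooth_functions_0[OF smooth_manifold_Rn vector_fieldsD(2)[OF X f]]
          smooth_functions_0[OF smooth_manifold_Rn vector_fieldsD(2)[OF Y f]] by simp
    qed
  qed (simp add: vector_fieldsD(1)[OF X] vector_fieldsD(1)[OF Y])
qed

text \<open>A vector field on R^n is determined by its action on coordinate functions. Both fields
  send these to constants, and a second derivation gives 0.\<close>

lemma bracket_Vn:
  assumes X: "X \<in> lie_algebra (Vn n)" and Y: "Y \<in> lie_algebra (Vn n)"
  shows "bracket X Y = (\<lambda>f p. 0)"
proof -
  note VX = lie_algebra_Vn(1)[OF X] and VY = lie_algebra_Vn(1)[OF Y]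
  have B: "bracket X Y \<in> vector_fields (Rn n)" by (rule bracket_vector_field[OF smooth_manifold_Rn VX VY])
  have Z: "(\<lambda>f p. 0) \<in> vector_fields (Rn n)"
  proof (rule lie_algebra_Vn(1))
    show "(\<lambda>f p. 0) \<in> lie_algebra (Vn n)"
      using lie_quotient.zero_lie_algebra[where N = "Vn n" and \<Gamma> = "{\<one>\<^bsub>Vn n\<^esub>}"] lie_quotient_Vn[of n] by blast
  qed
  have "bracket X Y (tb n b) p = 0" if p: "p \<in> points (Rn n)" for b p
  proof -
    obtain k l where "X (tb n b) = (\<lambda>p. if p \<in> points (Rn n) then k else 0)"
      "Y (tb n b) = (\<lambda>p. if p \<in> points (Rn n) then l else 0)"
      using lie_algebra_Vn(3)[OF X, of b] lie_algebra_Vn(3)[OF Y, of b] by blast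
    then show ?thesis
      unfolding bracket_def
      by (simp only: pt_deriv_one[OF smooth_manifold_Rn vector_fields_pt_deriv[OF VX] p]
          pt_deriv_one[OF smooth_manifold_Rn vector_fields_pt_deriv[OF VY] p] diff_self)
  qed
  then show ?thesis by (intro vector_field_Rn_eqI[OF B Z])
qed

lemma lie_algebra_Vn_basis:
  obtains Bs where "length Bs = n" "is_basis (lie_algebra (Vn n)) Bs"
    "\<And>i b. i < n \<Longrightarrow> b < n \<Longrightarrow> (Bs ! i) (tb n b) (\<lambda>i. 0) = (if i = b then 1 else 0)"
    "\<And>X. X \<in> lie_algebra (Vn n) \<Longrightarrow> X = lincomb (\<lambda>b. X (tb n b) (\<lambda>i. 0)) Bs"
proof -
  interpret lie_quotient "Vn n" "{\<one>\<^bsub>Vn n\<^esub>}" by (rule lie_quotient_Vn)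
  let ?z = "\<lambda>i. 0 :: real"
  have z: "?z \<in> points (Rn n)" by (simp add: Euclidean_mem)
  have at: "(points (Rn n), \<lambda>x. x) \<in> atlas (Rn n)" by simp
  have "\<exists>X\<in>lie_algebra (Vn n). \<forall>b<n. X (tb n b) ?z = (if i = b then 1 else 0)" if i: "i < n" for i
  proof -
    \<comment> \<open>The derivative in the direction \<open>i\<close> at the origin, whose
      left-invariant extension is the \<open>i\<close>-th member of the basis.\<close>
    define D where "D f = (\<Sum>j<n. bs i j * partial j (\<lambda>x. f (inv_into (points (Rn n)) (\<lambda>x. x) x)) ?z)" for f :: "rvec \<Rightarrow> real"
    have D: "pt_deriv (gman (Vn n)) \<one>\<^bsub>Vn n\<^esub> D"
      using coordinate_pt_deriv[OF smooth_manifold_Rn at z, of "bs i"] unfolding D_def by simp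
    obtain X where X: "X \<in> lie_algebra (Vn n)" "\<And>f. f \<in> smooth_functions (Rn n) \<Longrightarrow> X f ?z = D f"
      using left_invariant_extension[OF D] unfolding Vn_simps by metis
    have "X (tb n b) ?z = (if i = b then 1 else 0)" for b
    proof -
      have "partial j (\<lambda>x. tb n b (inv_into (points (Rn n)) (\<lambda>x. x) x)) ?z = (if j = b then 1 else 0)" if "j < n" for j
      proof -
        have "partial j (\<lambda>x. tb n b (inv_into (points (Rn n)) (\<lambda>x. x) x)) ?z = partial j (\<lambda>x. x b) ?z"
          by (rule partial_cong(1)[OF openin_topspace[of "Euclidean_space n"]]) (use z that in \<open>simp_all add: tb_def inv_into_id\<close>)
        also have "\<dots> = (if j = b then 1 else 0)" by (simp add: partial_def)
        finally show ?thesis .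
      qed
      then have "D (tb n b) = (\<Sum>j<n. if j = i then (if i = b then 1 else 0) else 0)"
        unfolding D_def by (intro sum.cong) (auto simp: bs_def)
      then show ?thesis using X(2)[OF tb_smooth] i by simp
    qed
    then show ?thesis using X(1) by blast
  qed
  then obtain B where B: "\<And>i. i < n \<Longrightarrow> B i \<in> lie_algebra (Vn n)"
    "\<And>i b. i < n \<Longrightarrow> b < n \<Longrightarrow> B i (tb n b) ?z = (if i = b then 1 else 0)" by metis
  define Bs where "Bs = map B [0..<n]"
  have Bs: "length Bs = n" "\<And>i. i < n \<Longrightarrow> Bs ! i = B i" by (simp_all add: Bs_def)
  have lc: "lincomb k Bs (tb n b) p = k b" if "b < n" "p \<in> points (Rn n)" for k b p
  proof -
    have "lincomb k Bs (tb n b) p = (\<Sum>i<n. if i = b then k i else 0)"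
      unfolding lincomb_def Bs(1)
      by (rule sum.cong) (use that B lie_algebra_Vn(2)[OF B(1) that(2)] in \<open>simp_all add: Bs(2)\<close>)
    then show ?thesis using that by simp
  qed
  have lv: "lincomb k Bs \<in> vector_fields (Rn n)" for k
    unfolding lincomb_def Bs(1)
    by (rule lincomb_vector_field[OF smooth_manifold_Rn]) (use lie_algebra_Vn(1)[OF B(1)] in \<open>simp add: Bs(2)\<close>)
  have ex: "X = lincomb (\<lambda>b. X (tb n b) ?z) Bs" if X: "X \<in> lie_algebra (Vn n)" for X
    by (rule vector_field_Rn_eqI[OF lie_algebra_Vn(1)[OF X] lv]) (simp only: lc lie_algebra_Vn(2)[OF X])
  have "is_basis (lie_algebra (Vn n)) Bs"
    unfolding is_basis_def Bs(1)
  proof (intro conjI ballI)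
    show "set Bs \<subseteq> lie_algebra (Vn n)" using B(1) by (auto simp: Bs_def)
    fix X assume X: "X \<in> lie_algebra (Vn n)"
    show "\<exists>!k. (\<forall>i\<ge>n. k i = 0) \<and> X = lincomb k Bs"
    proof (rule ex1I)
      let ?k = "\<lambda>b. if b < n then X (tb n b) ?z else 0"
      have "lincomb ?k Bs = lincomb (\<lambda>b. X (tb n b) ?z) Bs"
        unfolding lincomb_def Bs(1) by (intro ext sum.cong) auto
      then show "(\<forall>i\<ge>n. ?k i = 0) \<and> X = lincomb ?k Bs" using ex[OF X] by simp
      fix k assume k: "(\<forall>i\<ge>n. k i = 0) \<and> X = lincomb k Bs"
      have "X (tb n b) ?z = k b" if "b < n" for b using lc[OF that z, of k] k by simp
      then show "k = ?k" using k by (auto simp: fun_eq_iff)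
    qed
  qed
  then show ?thesis using that[of Bs] Bs B(2) ex by simp
qed

lemma coords_zero:
  assumes "is_basis V Bs" "(\<lambda>f p. 0) \<in> V"
  shows "coords Bs (\<lambda>f p. 0) = (\<lambda>i. 0)"
  unfolding coords_def
proof (rule the1_equality)
  show "\<exists>!c. (\<forall>i\<ge>length Bs. c i = 0) \<and> (\<lambda>f p. 0) = lincomb c Bs" using assms unfolding is_basis_def by blast
qed (simp add: lincomb_def)

lemma Ad_Vn:
  assumes h: "h \<in> carrier (Vn n)" and X: "X \<in> lie_algebra (Vn n)"
  shows "Ad (Vn n) h X = X"
proof (rule ext)
  fix f
  have V: "X \<in> vector_fields (Rn n)" by (rule lie_algebra_Vn(1)[OF X])
  have id: "pull_fun (Rn n) (\<lambda>x. x) f = f" if "f \<in> smooth_functions (Rn n)" for f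
    using smooth_functions_0[OF smooth_manifold_Rn that] by (auto simp: pull_fun_def)
  show "Ad (Vn n) h X f = X f"
  proof (cases "f \<in> smooth_functions (Rn n)")
    case True
    then show ?thesis unfolding Ad_def inv_Vn[OF h] by (simp add: id vector_fieldsD(2)[OF V])
  next
    case False
    then show ?thesis using vector_fieldsD(1)[OF V False] by (simp add: Ad_def fun_eq_iff)
  qed
qed

section \<open>The bundle and its connection\<close>

lemma open_submanifold_points:
  assumes "smooth_manifold M" shows "open_submanifold M (points M) = M"
proof -
  have "{(U \<inter> points M, c) |U c. (U, c) \<in> atlas M} = atlas M"
    using chart_sub[OF assms] by (force simp: inf.absorb1)
  then show ?thesis unfolding open_submanifold_def by simp
qed

lemma diffeomorphism_id:
  assumes "smooth_manifold M" shows "diffeomorphism M M (\<lambda>x. x)"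
  unfolding diffeomorphism_def
proof (intro conjI)
  show "bij_betw (\<lambda>x. x) (points M) (points M)" by (simp add: bij_betw_def)
  show "smooth_map M M (\<lambda>x. x)" by (rule smooth_map_id[OF assms])
  show "smooth_map M M (inv_into (points M) (\<lambda>x. x))"
    by (rule smooth_map_cong[OF assms assms smooth_map_id[OF assms]]) (simp add: inv_into_id)
qed

text \<open>Equivariance of the connection involves \<open>pullback\<close> along translations of
  the fibre; the push-forward is the field that shows the choice made there to be possible.\<close>

lemma vector_field_push_forward:
  assumes M: "smooth_manifold M" and F: "smooth_map M M F" and F': "smooth_map M M F'"
    and inv: "\<And>w. w \<in> points M \<Longrightarrow> F (F' w) = w" and X: "X \<in> vector_fields M"
  shows "(\<lambda>f. if f \<in> smooth_functions M then pull_fun M F' (X (pull_fun M F f)) else (\<lambda>w. 0)) \<in> vector_fields M"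
    (is "?Y \<in> _")
proof (rule vector_fieldsI)
  note pF = pull_fun_smooth[OF M M F]
  show "?Y f = (\<lambda>p. 0)" if "f \<notin> smooth_functions M" for f using that by simp
  show "?Y f \<in> smooth_functions M" if f: "f \<in> smooth_functions M" for f
    using pull_fun_smooth[OF M M F' vector_fieldsD(2)[OF X pF[OF f]]] f by simp
  fix f h a b p assume f: "f \<in> smooth_functions M" and h: "h \<in> smooth_functions M"
  have s: "(\<lambda>p. a * f p + b * h p) \<in> smooth_functions M"
    by (rule smooth_functions_add[OF M smooth_functions_scale[OF M f] smooth_functions_scale[OF M h]])
  have t: "(\<lambda>p. f p * h p) \<in> smooth_functions M" by (rule smooth_functions_mult[OF M f h])
  have 1: "pull_fun M F (\<lambda>p. a * f p + b * h p) = (\<lambda>p. a * pull_fun M F f p + b * pull_fun M F h p)"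
    and 2: "pull_fun M F (\<lambda>p. f p * h p) = (\<lambda>p. pull_fun M F f p * pull_fun M F h p)"
    by (auto simp: pull_fun_def fun_eq_iff)
  have D: "pt_deriv M q (\<lambda>f. X f q)" for q by (rule vector_fields_pt_deriv[OF X])
  show "?Y (\<lambda>p. a * f p + b * h p) p = a * ?Y f p + b * ?Y h p"
    using f h s 1 pt_deriv_linear[OF D pF[OF f] pF[OF h]] by (simp add: pull_fun_def[of M F'])
  show "?Y (\<lambda>p. f p * h p) p = f p * ?Y h p + h p * ?Y f p"
  proof (cases "p \<in> points M")
    case True
    then have "F' p \<in> points M" by (rule smooth_map_points[OF F'])
    then have "pull_fun M F f (F' p) = f p" "pull_fun M F h (F' p) = h p"
      using inv[OF True] by (simp_all add: pull_fun_def)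
    then show ?thesis using f h t 2 True pt_deriv_mult[OF D pF[OF f] pF[OF h], of "F' p"] by (simp add: pull_fun_def[of M F'])
  next
    case False
    then show ?thesis using f h t smooth_functions_0[OF M] by (simp add: pull_fun_def[of M F'])
  qed
qed

lemma is_form_add:
  assumes M: "smooth_manifold M" and "is_form M k \<alpha>" "is_form M k \<beta>"
  shows "is_form M k (\<lambda>Xs p. \<alpha> Xs p + \<beta> Xs p)"
  unfolding is_form_def
proof (intro allI impI, elim conjE, intro conjI)
  fix Xs assume Xs: "length Xs = k" "set Xs \<subseteq> vector_fields M"
  note A = assms(2)[unfolded is_form_def, rule_format, OF conjI[OF Xs]]
    and B = assms(3)[unfolded is_form_def, rule_format, OF conjI[OF Xs]]
  show "(\<lambda>p. \<alpha> Xs p + \<beta> Xs p) \<in> smooth_functions M" using smooth_functions_add[OF M] A B by blast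
  show "\<forall>i<k. \<forall>X\<in>vector_fields M. \<forall>Y\<in>vector_fields M. \<forall>f\<in>smooth_functions M. \<forall>h\<in>smooth_functions M.
      (\<lambda>p. \<alpha> (Xs[i := \<lambda>u p. f p * X u p + h p * Y u p]) p + \<beta> (Xs[i := \<lambda>u p. f p * X u p + h p * Y u p]) p) =
      (\<lambda>p. f p * (\<alpha> (Xs[i := X]) p + \<beta> (Xs[i := X]) p) + h p * (\<alpha> (Xs[i := Y]) p + \<beta> (Xs[i := Y]) p))"
  proof (intro allI impI ballI)
    fix i X Y f h assume a: "i < k" "X \<in> vector_fields M" "Y \<in> vector_fields M" "f \<in> smooth_functions M" "h \<in> smooth_functions M"
    have "\<alpha> (Xs[i := \<lambda>u p. f p * X u p + h p * Y u p]) = (\<lambda>p. f p * \<alpha> (Xs[i := X]) p + h p * \<alpha> (Xs[i := Y]) p)"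
      "\<beta> (Xs[i := \<lambda>u p. f p * X u p + h p * Y u p]) = (\<lambda>p. f p * \<beta> (Xs[i := X]) p + h p * \<beta> (Xs[i := Y]) p)"
      using A B a by blast+
    then show "(\<lambda>p. \<alpha> (Xs[i := \<lambda>u p. f p * X u p + h p * Y u p]) p + \<beta> (Xs[i := \<lambda>u p. f p * X u p + h p * Y u p]) p) =
      (\<lambda>p. f p * (\<alpha> (Xs[i := X]) p + \<beta> (Xs[i := X]) p) + h p * (\<alpha> (Xs[i := Y]) p + \<beta> (Xs[i := Y]) p))"
      by (simp add: algebra_simps)
  qed
  show "\<forall>i<k. \<forall>j<k. i \<noteq> j \<and> Xs ! i = Xs ! j \<longrightarrow> (\<lambda>p. \<alpha> Xs p + \<beta> Xs p) = (\<lambda>p. 0)"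
    using A B by fastforce
qed

lemma is_form_differential:
  assumes M: "smooth_manifold M" and g: "g \<in> smooth_functions M"
  shows "is_form M 1 (\<lambda>Xs. hd Xs g)"
  unfolding is_form_def
proof (intro allI impI, elim conjE, intro conjI)
  fix Xs :: "'a vfield list" assume "length Xs = 1" "set Xs \<subseteq> vector_fields M"
  then obtain X where X: "Xs = [X]" "X \<in> vector_fields M" by (auto simp: length_Suc_conv)
  then show "hd Xs g \<in> smooth_functions M" using vector_fieldsD(2)[OF _ g] by simp
  show "\<forall>i<1. \<forall>X\<in>vector_fields M. \<forall>Y\<in>vector_fields M. \<forall>f\<in>smooth_functions M. \<forall>h\<in>smooth_functions M.
      hd (Xs[i := \<lambda>u p. f p * X u p + h p * Y u p]) g = (\<lambda>p. f p * hd (Xs[i := X]) g p + h p * hd (Xs[i := Y]) g p)"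
    by (simp add: X(1))
qed simp

lemma lie_algebra_lincomb:
  assumes M: "smooth_manifold (gman N)" and Bs: "set Bs \<subseteq> lie_algebra N"
  shows "lincomb s Bs \<in> lie_algebra N"
  unfolding lie_algebra_def
proof (intro CollectI conjI ballI)
  have B: "Bs ! i \<in> lie_algebra N" if "i < length Bs" for i using Bs that by (meson nth_mem subsetD)
  then show "lincomb s Bs \<in> vector_fields (gman N)"
    unfolding lincomb_def by (intro lincomb_vector_field[OF M]) (simp add: lie_algebra_def)
  fix x f assume x: "x \<in> carrier N" and f: "f \<in> smooth_functions (gman N)"
  let ?p = "pull_fun (gman N) (\<lambda>y. x \<otimes>\<^bsub>N\<^esub> y)"
  have "(Bs ! i) (?p f) = ?p ((Bs ! i) f)" if "i < length Bs" for i
    using B[OF that] x f unfolding lie_algebra_def by blast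
  then have "lincomb s Bs (?p f) q = (\<Sum>i<length Bs. s i * ?p ((Bs ! i) f) q)" for q unfolding lincomb_def by simp
  also have "\<dots> q = ?p (lincomb s Bs f) q" for q by (simp add: pull_fun_def lincomb_def)
  finally show "lincomb s Bs (?p f) = ?p (lincomb s Bs f)" by (rule ext)
qed

context framed
begin

abbreviation "G3 \<equiv> Vn 3"
abbreviation "R3 \<equiv> Rn 3"
abbreviation "PP \<equiv> prod_manifold M R3"

definition act :: "'a \<times> rvec \<Rightarrow> rvec \<Rightarrow> 'a \<times> rvec" where
  "act u h = (fst u, \<lambda>i. snd u i + h i)"

lemma PP: "smooth_manifold PP" by (rule smooth_manifold_prod[OF mfd smooth_manifold_Rn])

text \<open>\<open>B.\<theta>\<close> gives the seven components of a field on the total space that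
  come from the base; the fibre components are its values on the functions
  \<open>tt\<close>.\<close>

sublocale B: framed_over M Es a b c PP fst
  by unfold_locales (rule PP, rule smooth_map_fst[OF mfd smooth_manifold_Rn])

lemma smooth_act: "smooth_map (prod_manifold PP R3) PP (\<lambda>(u, h). act u h)"
proof -
  have PR: "smooth_manifold (prod_manifold PP R3)" by (rule smooth_manifold_prod[OF PP smooth_manifold_Rn])
  have RR: "smooth_manifold (prod_manifold R3 R3)" by (rule smooth_manifold_prod[OF smooth_manifold_Rn smooth_manifold_Rn])
  have f: "smooth_map (prod_manifold PP R3) PP fst" by (rule smooth_map_fst[OF PP smooth_manifold_Rn])
  have 1: "smooth_map (prod_manifold PP R3) M (\<lambda>z. fst (fst z))"
    by (rule smooth_map_compose[OF PR PP mfd f smooth_map_fst[OF mfd smooth_manifold_Rn]])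
  have 2: "smooth_map (prod_manifold PP R3) R3 (\<lambda>z. snd (fst z))"
    by (rule smooth_map_compose[OF PR PP smooth_manifold_Rn f smooth_map_snd[OF mfd smooth_manifold_Rn]])
  have 3: "smooth_map (prod_manifold PP R3) (prod_manifold R3 R3) (\<lambda>z. (snd (fst z), snd z))"
    by (rule smooth_map_pair[OF smooth_manifold_Rn smooth_manifold_Rn PR 2 smooth_map_snd[OF PP smooth_manifold_Rn]])
  have 4: "smooth_map (prod_manifold PP R3) R3 (\<lambda>z i. snd (fst z) i + snd z i)"
    using smooth_map_compose[OF PR RR smooth_manifold_Rn 3 smooth_add] by simp
  show ?thesis using smooth_map_pair[OF mfd smooth_manifold_Rn PR 1 4] by (simp add: case_prod_unfold act_def)
qed

lemma smooth_translate:
  assumes "h \<in> points R3" shows "smooth_map PP PP (\<lambda>u. act u h)"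
  using smooth_map_compose[OF PP smooth_manifold_prod[OF PP smooth_manifold_Rn] PP
      smooth_map_pair[OF PP smooth_manifold_Rn PP smooth_map_id[OF PP] smooth_map_const[OF PP assms]] smooth_act]
  by simp

lemma principal: "principal_bundle PP M G3 act fst"
  unfolding principal_bundle_def
proof (intro conjI ballI)
  show "smooth_manifold PP" "smooth_manifold M" "lie_group G3" "smooth_map PP M fst"
    by (rule PP mfd lie_group_Vn smooth_map_fst[OF mfd smooth_manifold_Rn])+
  show "smooth_map (prod_manifold PP (gman G3)) PP (\<lambda>(u, h). act u h)" using smooth_act by simp
  show "act u \<one>\<^bsub>G3\<^esub> = u" "act (act u h) k = act u (h \<otimes>\<^bsub>G3\<^esub> k)" "fst (act u h) = fst u" for u h k
    by (simp_all add: act_def add.assoc)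
  fix x assume x: "x \<in> points M"
  have "{u \<in> points PP. fst u \<in> points M} = points PP" by auto
  \<comment> \<open>One trivialisation over all of M is enough, and it is the identity.\<close>
  then have "diffeomorphism (open_submanifold PP {u \<in> points PP. fst u \<in> points M})
      (prod_manifold (open_submanifold M (points M)) (gman G3)) (\<lambda>u. u)"
    using open_submanifold_points[OF PP] open_submanifold_points[OF mfd] diffeomorphism_id[OF PP] by simp
  then show "\<exists>U \<Phi>. openin (mtop M) U \<and> x \<in> U \<and>
      diffeomorphism (open_submanifold PP {u \<in> points PP. fst u \<in> U}) (prod_manifold (open_submanifold M U) (gman G3)) \<Phi> \<and>
      (\<forall>u\<in>points PP. fst u \<in> U \<longrightarrow> fst (\<Phi> u) = fst u \<and> (\<forall>h\<in>carrier G3. snd (\<Phi> (act u h)) = snd (\<Phi> u) \<otimes>\<^bsub>G3\<^esub> h))"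
    using x by (intro exI[of _ "points M"] exI[of _ "\<lambda>u. u"]) (simp add: act_def)
qed

section \<open>The connection and its curvature\<close>

definition tt :: "nat \<Rightarrow> 'a \<times> rvec \<Rightarrow> real" where "tt i = pull_fun PP snd (tb 3 i)"

lemma tt_smooth: "tt i \<in> smooth_functions PP"
  unfolding tt_def by (rule pull_fun_smooth[OF PP smooth_manifold_Rn smooth_map_snd[OF mfd smooth_manifold_Rn] tb_smooth])

lemma tt_eq: "u \<in> points PP \<Longrightarrow> tt i u = snd u i"
  by (auto simp: tt_def pull_fun_def tb_def)

text \<open>\<open>dt\<^sub>i + e\<^sup>4\<^sup>+\<^sup>i\<close>: its curvature is \<open>de\<^sup>4\<^sup>+\<^sup>i\<close>.\<close>

definition conn :: "nat \<Rightarrow> ('a \<times> rvec) form" where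
  "conn i = (\<lambda>Xs u. hd Xs (tt i) u + B.cf (\<lambda>r. hd r (4 + i)) Xs u)"

lemma conn_at: "u \<in> points PP \<Longrightarrow> conn i [X] u = X (tt i) u + B.\<theta> u X (4 + i)"
  by (simp add: conn_def B.cf_def)

lemma conn_form: "i < 3 \<Longrightarrow> is_form PP 1 (conn i)"
  unfolding conn_def
  by (rule is_form_add[OF PP is_form_differential[OF PP tt_smooth] B.is_form_cf]) (simp add: kform_coord)

text \<open>Along an orbit a function pulled back from M is constant, so the forms e^k vanish on
  fundamental fields; the fibre coordinate restricts to a coordinate of R^3 plus a constant, so dt_i
  returns the component of \<open>X\<close>.\<close>

lemma conn_fundamental:
  assumes X: "X \<in> lie_algebra G3" and u: "u \<in> points PP"
  shows "conn i [fundamental_field PP G3 act X] u = X (tb 3 i) (\<lambda>i. 0)"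
proof -
  let ?F = "fundamental_field PP G3 act X" and ?z = "\<lambda>i. 0 :: real"
  note V = lie_algebra_Vn(1)[OF X]
  have z: "?z \<in> points R3" by (simp add: Euclidean_mem)
  have one: "X (\<lambda>p. if p \<in> points R3 then k else 0) ?z = 0" for k
    by (rule pt_deriv_one[OF smooth_manifold_Rn vector_fields_pt_deriv[OF V] z])
  have act: "act u h \<in> points PP" if "h \<in> points R3" for h
    using smooth_map_points[OF smooth_translate[OF that] u] .
  have F: "?F f u = X (pull_fun R3 (\<lambda>h. act u h) f) ?z" if "f \<in> smooth_functions PP" for f
    using that u by (simp add: fundamental_field_def)
  have "B.\<theta> u ?F = (\<lambda>k. 0)"
  proof (rule B.\<theta>_unique[OF u])
    fix f assume f: "f \<in> smooth_functions M"
    have "pull_fun R3 (\<lambda>h. act u h) (pull_fun PP fst f) = (\<lambda>h. if h \<in> points R3 then f (fst u) else 0)"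
    proof
      fix h show "pull_fun R3 (\<lambda>h. act u h) (pull_fun PP fst f) h = (if h \<in> points R3 then f (fst u) else 0)"
        using act[of h] unfolding pull_fun_def by (cases "h \<in> points R3") (simp_all add: act_def)
    qed
    then show "?F (pull_fun PP fst f) u = (\<Sum>k<7. 0 * (Es ! k) f (fst u))"
      unfolding F[OF B.pull_smooth[OF f]] by (simp only: one) simp
  qed simp
  moreover have "?F (tt i) u = X (tb 3 i) ?z"
  proof -
    have "pull_fun R3 (\<lambda>h. act u h) (tt i) = (\<lambda>h. tb 3 i h + (if h \<in> points R3 then snd u i else 0))"
    proof
      fix h show "pull_fun R3 (\<lambda>h. act u h) (tt i) h = tb 3 i h + (if h \<in> points R3 then snd u i else 0)"
        using tt_eq[OF act[of h], of i] unfolding pull_fun_def by (cases "h \<in> points R3") (simp_all add: act_def tb_def)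
    qed
    then show ?thesis
      unfolding F[OF tt_smooth]
      using pt_deriv_add[OF smooth_manifold_Rn vector_fields_pt_deriv[OF V] tb_smooth smooth_functions_const[OF smooth_manifold_Rn]] one
      by simp
  qed
  ultimately show ?thesis unfolding conn_at[OF u] by simp
qed

text \<open>A translation adds a constant to the fibre coordinate and preserves the projection, so
  dt_i and the pulled-back e^k are both invariant. The adjoint action of an abelian group being
  trivial, invariance is equivariance.\<close>

lemma conn_equivariant:
  assumes h: "h \<in> points R3" and X: "X \<in> vector_fields PP" and u: "u \<in> points PP"
  shows "pullback PP PP (\<lambda>v. act v h) (conn i) [X] u = conn i [X] u"
proof -
  let ?R = "\<lambda>v. act v h" and ?R' = "\<lambda>v. act v (\<lambda>i. - h i)"
  have h': "(\<lambda>i. - h i) \<in> points R3" using h by (simp add: Euclidean_mem)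
  note S = smooth_translate[OF h] and S' = smooth_translate[OF h']
  have RR: "?R (?R' w) = w" "?R' (?R w) = w" for w by (simp_all add: act_def)
  have Ru: "?R u \<in> points PP" by (rule smooth_map_points[OF S u])
  \<comment> \<open>\<open>Y0\<close> only shows that the choice in \<open>pullback\<close> has a
    candidate. The rest of the argument concerns the field \<open>Y\<close> actually chosen, of
    which only the values at the translate of \<open>u\<close> are known.\<close>
  define Y0 where "Y0 = (\<lambda>f. if f \<in> smooth_functions PP then pull_fun PP ?R' (X (pull_fun PP ?R f)) else (\<lambda>w. 0))"
  have Y0: "Y0 \<in> vector_fields PP" unfolding Y0_def by (rule vector_field_push_forward[OF PP S S' RR(1) X])
  let ?Q = "\<lambda>Ys. length Ys = length [X] \<and> set Ys \<subseteq> vector_fields PP \<and>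
    (\<forall>i<length [X]. \<forall>f\<in>smooth_functions PP. (Ys ! i) f (?R u) = ([X] ! i) (pull_fun PP ?R f) u)"
  have "?Q [Y0]" using Y0 Ru RR by (simp add: Y0_def pull_fun_def[of PP ?R'])
  then have Q: "?Q (SOME Ys. ?Q Ys)" by (rule someI)
  then obtain Y where Y: "(SOME Ys. ?Q Ys) = [Y]" by (auto simp: length_Suc_conv)
  have YV: "Y \<in> vector_fields PP" and Yf: "\<And>f. f \<in> smooth_functions PP \<Longrightarrow> Y f (?R u) = X (pull_fun PP ?R f) u"
    using Q unfolding Y by auto
  have Rw: "?R w \<in> points PP \<longleftrightarrow> w \<in> points PP" for w
    using smooth_map_points[OF S, of w] smooth_map_points[OF S', of "?R w"] RR by auto
  have "pull_fun PP ?R (tt i) = (\<lambda>w. tt i w + (if w \<in> points PP then h i else 0))"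
  proof
    fix w show "pull_fun PP ?R (tt i) w = tt i w + (if w \<in> points PP then h i else 0)"
      using tt_eq[of w i] tt_eq[of "?R w" i] Rw[of w] smooth_functions_0[OF PP tt_smooth, of w i]
      unfolding pull_fun_def by (cases "w \<in> points PP") (simp_all add: act_def)
  qed
  then have 1: "Y (tt i) (?R u) = X (tt i) u"
    unfolding Yf[OF tt_smooth]
    using pt_deriv_add[OF PP vector_fields_pt_deriv[OF X] tt_smooth smooth_functions_const[OF PP]]
      pt_deriv_one[OF PP vector_fields_pt_deriv[OF X] u] by simp
  have 2: "B.\<theta> (?R u) Y = B.\<theta> u X"
  proof (rule B.\<theta>_unique[OF Ru])
    show "B.\<theta> u X k = 0" if "k \<ge> 7" for k by (rule B.\<theta>_supp[OF u X that])
    fix f assume f: "f \<in> smooth_functions M"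
    have "pull_fun PP ?R (pull_fun PP fst f) = pull_fun PP fst f"
    proof
      fix w show "pull_fun PP ?R (pull_fun PP fst f) w = pull_fun PP fst f w"
        using Rw[of w] unfolding pull_fun_def by (cases "w \<in> points PP") (simp_all add: act_def)
    qed
    then have "Y (pull_fun PP fst f) (?R u) = X (pull_fun PP fst f) u" using Yf[OF B.pull_smooth[OF f]] by simp
    also have "\<dots> = (\<Sum>k<7. B.\<theta> u X k * (Es ! k) f (fst u))" by (rule B.\<theta>_expand[OF u X f])
    finally show "Y (pull_fun PP fst f) (?R u) = (\<Sum>k<7. B.\<theta> u X k * (Es ! k) f (fst (?R u)))" by (simp add: act_def)
  qed
  have "pullback PP PP ?R (conn i) [X] u = conn i [Y] (?R u)"
    unfolding pullback_def using u Y by simp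
  also have "\<dots> = conn i [X] u" unfolding conn_at[OF Ru] conn_at[OF u] 1 2 ..
  finally show ?thesis .
qed

text \<open>The contribution of dt_i cancels by the very definition of the bracket, so only the
  differential of the pulled-back e^(4+i) remains; list positions start at 0, whence positions 4, 5,
  6 for e^5, e^6, e^7.\<close>

lemma ext_deriv_conn:
  assumes i: "i < 3" and XY: "length Xs = 2" "set Xs \<subseteq> vector_fields PP" and u: "u \<in> points PP"
  shows "ext_deriv (conn i) Xs u = \<delta> (4 + i) (map (B.\<theta> u) Xs)"
proof -
  obtain X Y where Xs: "Xs = [X, Y]" using XY(1) by (auto simp: length_Suc_conv numeral_2_eq_2)
  have X: "X \<in> vector_fields PP" and Y: "Y \<in> vector_fields PP" using XY(2) Xs by auto
  let ?W = "\<lambda>r. hd r (4 + i) :: real"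
  have W: "kform 1 ?W" using kform_coord[of "4 + i"] i by simp
  have c: "conn i [Z] = (\<lambda>u. Z (tt i) u + B.cf ?W [Z] u)" for Z by (simp add: conn_def fun_eq_iff)
  have s: "B.cf ?W [Z] \<in> smooth_functions PP" if "Z \<in> vector_fields PP" for Z
    by (rule B.cf_smooth[OF W]) (use that in auto)
  have d: "X' (conn i [Z]) u = X' (Z (tt i)) u + X' (B.cf ?W [Z]) u"
    if "X' \<in> vector_fields PP" "Z \<in> vector_fields PP" for X' Z
    unfolding c by (rule pt_deriv_add[OF PP vector_fields_pt_deriv[OF that(1)] vector_fieldsD(2)[OF that(2) tt_smooth] s[OF that(2)]])
  have "ext_deriv (conn i) Xs u = ext_deriv (B.cf ?W) Xs u"
    unfolding ext_deriv_sgs Xs by (simp add: d[OF X Y] d[OF Y X]) (simp add: c bracket_def)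
  also have "\<dots> = dW \<delta> ?W (map (B.\<theta> u) Xs)"
    by (rule B.ext_deriv_rep[OF W B.rep_cf]) (use XY u in auto)
  \<comment> \<open>Contracting the coordinate form at position 4 + i with the basis vector at
    position k gives a Kronecker delta.\<close>
  also have "\<dots> = (\<Sum>k<7. if k = 4 + i then \<delta> k (map (B.\<theta> u) Xs) else 0)"
    unfolding dW_def
  proof (rule sum.cong[OF refl])
    fix k
    have "wd 2 (\<delta> k) (\<lambda>r. bs k (4 + i)) (map (B.\<theta> u) Xs) = \<delta> k (map (B.\<theta> u) Xs) * bs k (4 + i)"
      unfolding Xs by (simp add: numeral_2_eq_2)
    then show "wd 2 (\<delta> k) (\<lambda>r. hd (bs k # r) (4 + i)) (map (B.\<theta> u) Xs) = (if k = 4 + i then \<delta> k (map (B.\<theta> u) Xs) else 0)"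
      by (simp add: bs_def)
  qed
  also have "\<dots> = \<delta> (4 + i) (map (B.\<theta> u) Xs)" using i by (simp add: sum.delta)
  finally show ?thesis .
qed

theorem heterotic_solution:
  "\<exists>Bs A. connection PP G3 act Bs A \<and> heterotic_G2_system M ph gm vol PP G3 fst Bs A"
proof -
  let ?z = "\<lambda>i. 0 :: real" and ?L = "lie_algebra G3"
  obtain Bs where Bs: "length Bs = 3" "is_basis ?L Bs"
    "\<And>i b. i < 3 \<Longrightarrow> b < 3 \<Longrightarrow> (Bs ! i) (tb 3 b) ?z = (if i = b then 1 else 0)"
    "\<And>X. X \<in> ?L \<Longrightarrow> X = lincomb (\<lambda>b. X (tb 3 b) ?z) Bs"
    by (rule lie_algebra_Vn_basis[of 3], rule that; assumption)
  define A where "A = map conn [0..<3]"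
  have A: "length A = 3" "\<And>i. i < 3 \<Longrightarrow> A ! i = conn i" by (simp_all add: A_def)
  have lc: "lincomb f Bs = lincomb g Bs" if "\<And>i. i < 3 \<Longrightarrow> f i = g i" for f g
    unfolding lincomb_def Bs(1) by (intro ext sum.cong) (simp_all add: that)
  have BsL: "Bs ! i \<in> ?L" if "i < 3" for i using Bs(1,2) that unfolding is_basis_def by (metis nth_mem subsetD)
  have zero: "(\<lambda>f p. 0) \<in> ?L" by (rule lie_quotient.zero_lie_algebra[OF lie_quotient_Vn])
  have lcL: "lincomb f Bs \<in> ?L" for f
    by (rule lie_algebra_lincomb) (use smooth_manifold_Rn Bs(2) in \<open>auto simp: is_basis_def\<close>)
  have "connection PP G3 act Bs A"
    unfolding connection_def
  proof (intro conjI ballI)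
    show "is_basis ?L Bs" "length A = length Bs" using Bs A by simp_all
    show "is_form PP 1 \<alpha>" if "\<alpha> \<in> set A" for \<alpha> using that conn_form by (auto simp: A_def)
    show "lincomb (\<lambda>i. (A ! i) [fundamental_field PP G3 act X] u) Bs = X" if "X \<in> ?L" "u \<in> points PP" for X u
      by (subst (2) Bs(4)[OF that(1)], rule lc) (simp add: A(2) conn_fundamental[OF that])
    fix h X u assume h: "h \<in> carrier G3" and X: "X \<in> vector_fields PP" and u: "u \<in> points PP"
    have h': "inv\<^bsub>G3\<^esub> h \<in> carrier G3" using h comm_group.axioms(2)[OF comm_group_Vn] by (rule group.inv_closed[rotated])
    have "lincomb (\<lambda>i. pullback PP PP (\<lambda>v. act v h) (A ! i) [X] u) Bs = lincomb (\<lambda>i. (A ! i) [X] u) Bs"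
      by (rule lc) (use h in \<open>simp add: A(2) conn_equivariant[OF _ X u]\<close>)
    then show "lincomb (\<lambda>i. pullback PP PP (\<lambda>v. act v h) (A ! i) [X] u) Bs =
        Ad G3 (inv\<^bsub>G3\<^esub> h) (lincomb (\<lambda>i. (A ! i) [X] u) Bs)"
      unfolding Ad_Vn[OF h' lcL] .
  qed
  moreover
  have curv: "curvature Bs A i Xs u = \<delta> (4 + i) (map (B.\<theta> u) Xs)"
    if "i < 3" "length Xs = 2" "set Xs \<subseteq> vector_fields PP" "u \<in> points PP" for i Xs u
  proof -
    \<comment> \<open>The quadratic term of the curvature involves brackets in the Lie algebra of
      R^3, which are zero.\<close>
    have "coords Bs (bracket (Bs ! j) (Bs ! k)) i = 0" if "j < 3" "k < 3" for j k
      unfolding bracket_Vn[OF BsL[OF that(1)] BsL[OF that(2)]] coords_zero[OF Bs(2) zero] ..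
    then show ?thesis unfolding curvature_def Bs(1) using ext_deriv_conn[OF that] that(1) by (simp add: A(2))
  qed
  have wc: "wedge 2 (curvature Bs A i) \<beta> Xs u = wd 2 (\<delta> (4 + i)) W (map (B.\<theta> u) Xs)"
    if i: "i < 3" and u: "u \<in> points PP" and Xs: "set Xs \<subseteq> vector_fields PP"
      and \<beta>: "\<And>r. length r + 2 = length Xs \<Longrightarrow> set r \<subseteq> vector_fields PP \<Longrightarrow> \<beta> r u = W (map (B.\<theta> u) r)" for i \<beta> Xs u W
    unfolding wedge_wd wd_map
  proof (rule wd_cong)
    show "curvature Bs A i r u = \<delta> (4 + i) (map (B.\<theta> u) r)" if "length r = 2" "set r \<subseteq> set Xs" for r
      by (rule curv[OF i that(1) _ u]) (use that(2) Xs in blast)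
    show "\<beta> r u = W (map (B.\<theta> u) r)" if "length r + 2 = length Xs" "set r \<subseteq> set Xs" for r
      by (rule \<beta>[OF that(1)]) (use that(2) Xs in blast)
  qed
  have "heterotic_G2_system M ph gm vol PP G3 fst Bs A"
    unfolding heterotic_G2_system_def
  proof (intro conjI allI impI)
    show "form_eq M 5 (ext_deriv (G2_psi M ph gm vol)) (wedge 1 (\<lambda>Xs p. 4 * tau1 M ph gm vol Xs p) (G2_psi M ph gm vol))"
      by (rule heterotic_1)
    show "form_eq PP 6 (wedge 2 (curvature Bs A i) (pullback PP M fst (G2_psi M ph gm vol))) (\<lambda>Xs p. 0)" if "i < length Bs" for i
      unfolding form_eq_def
    proof (intro allI impI ballI, elim conjE)
      fix Xs u assume Xs: "length Xs = 6" "set Xs \<subseteq> vector_fields PP" and u: "u \<in> points PP"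
      have "wedge 2 (curvature Bs A i) (pullback PP M fst (G2_psi M ph gm vol)) Xs u =
          wd 2 (\<delta> (4 + i)) (frm psi0) (map (B.\<theta> u) Xs)"
        by (rule wc[OF _ u Xs(2)]) (use that Bs(1) Xs B.pullback_psi[OF u] in auto)
      also have "\<dots> = 0" by (rule de0_psi0) (simp add: Xs(1))
      finally show "wedge 2 (curvature Bs A i) (pullback PP M fst (G2_psi M ph gm vol)) Xs u = 0" .
    qed
    \<comment> \<open>The inner product for which \<open>Bs\<close> is orthonormal, so that the
      double sum over components collapses to the sum of the squares de^k \<and> de^k, which is
      dT.\<close>
    define \<kappa> where "\<kappa> = (\<lambda>(X :: rvec vfield) (Y :: rvec vfield). \<Sum>i<3. X (tb 3 i) ?z * Y (tb 3 i) ?z)"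
    have "invariant_form ?L \<kappa>"
      unfolding invariant_form_def
    proof (intro conjI ballI allI impI)
      fix X Y Z :: "rvec vfield" and s t :: real assume X: "X \<in> ?L"
      show "\<kappa> X Y = \<kappa> Y X" by (simp add: \<kappa>_def mult.commute)
      show "\<kappa> (\<lambda>f p. s * X f p + t * Y f p) Z = s * \<kappa> X Z + t * \<kappa> Y Z"
        by (simp add: \<kappa>_def sum_distrib_left sum.distrib algebra_simps)
      assume Y: "Y \<in> ?L" and Z: "Z \<in> ?L"
      show "\<kappa> (bracket Z X) Y + \<kappa> X (bracket Z Y) = 0"
        unfolding bracket_Vn[OF Z X] bracket_Vn[OF Z Y] by (simp add: \<kappa>_def)
    next
      fix X assume X: "X \<in> ?L" and "\<forall>Y\<in>?L. \<kappa> X Y = 0"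
      then have "(\<Sum>i<3. X (tb 3 i) ?z * X (tb 3 i) ?z) = 0" unfolding \<kappa>_def by blast
      then have "X (tb 3 i) ?z = 0" if "i < 3" for i
        using that by (subst (asm) sum_nonneg_eq_0_iff) auto
      then have "lincomb (\<lambda>i. X (tb 3 i) ?z) Bs = lincomb (\<lambda>i. 0) Bs" by (intro lc)
      then show "X = (\<lambda>f p. 0)" using Bs(4)[OF X] by (simp add: lincomb_def)
    qed
    moreover have "form_eq PP 4 (pullback PP M fst (ext_deriv (G2_torsion M ph gm vol)))
          (\<lambda>Xs p. \<Sum>i<length Bs. \<Sum>j<length Bs. \<kappa> (Bs ! i) (Bs ! j) * wedge 2 (curvature Bs A i) (curvature Bs A j) Xs p)"
      unfolding form_eq_def
    proof (intro allI impI ballI, elim conjE)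
      fix Xs u assume Xs: "length Xs = 4" "set Xs \<subseteq> vector_fields PP" and u: "u \<in> points PP"
      have k: "\<kappa> (Bs ! i) (Bs ! j) = (if j = i then 1 else 0)" if "i < 3" "j < 3" for i j
      proof -
        have "\<kappa> (Bs ! i) (Bs ! j) = (\<Sum>l<3. if l = i then (if j = i then 1 else 0) else 0)"
          unfolding \<kappa>_def by (rule sum.cong[OF refl]) (use Bs(3) that in auto)
        then show ?thesis using that by simp
      qed
      have w: "wedge 2 (curvature Bs A i) (curvature Bs A i) Xs u = wd 2 (\<delta> (4 + i)) (\<delta> (4 + i)) (map (B.\<theta> u) Xs)" if "i < 3" for i
        by (rule wc[OF that u Xs(2)], rule curv[OF that]) (use Xs(1) u in auto)
      have "(\<Sum>i<3. \<Sum>j<3. \<kappa> (Bs ! i) (Bs ! j) * wedge 2 (curvature Bs A i) (curvature Bs A j) Xs u) =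
          (\<Sum>i<3. \<Sum>j<3. if j = i then wedge 2 (curvature Bs A i) (curvature Bs A i) Xs u else 0)"
        by (intro sum.cong refl) (simp add: k)
      also have "\<dots> = (\<Sum>i<3. wd 2 (\<delta> (4 + i)) (\<delta> (4 + i)) (map (B.\<theta> u) Xs))"
        by (intro sum.cong refl) (simp add: w)
      also have "\<dots> = dW \<delta> (frm (T0 a b c)) (map (B.\<theta> u) Xs)"
        using dW_T0[of "map (B.\<theta> u) Xs" a b c] Xs(1) by (simp add: numeral_3_eq_3)
      finally show "pullback PP M fst (ext_deriv (G2_torsion M ph gm vol)) Xs u =
          (\<Sum>i<length Bs. \<Sum>j<length Bs. \<kappa> (Bs ! i) (Bs ! j) * wedge 2 (curvature Bs A i) (curvature Bs A j) Xs u)"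
        unfolding Bs(1) B.pullback_torsion[OF u Xs] by simp
    qed
    ultimately show "\<exists>\<kappa>. invariant_form ?L \<kappa> \<and> form_eq PP 4 (pullback PP M fst (ext_deriv (G2_torsion M ph gm vol)))
          (\<lambda>Xs p. \<Sum>i<length Bs. \<Sum>j<length Bs. \<kappa> (Bs ! i) (Bs ! j) * wedge 2 (curvature Bs A i) (curvature Bs A j) Xs p)"
      by blast
  qed
  ultimately show ?thesis by blast
qed

end

section \<open>The three nilmanifolds\<close>

lemma framing_scale:
  assumes F: "framing M Es" and s: "\<And>i. i < mdim M \<Longrightarrow> s i * s i = (1 :: real)" and M: "smooth_manifold M"
  shows "framing M (map (\<lambda>i f p. s i * (Es ! i) f p) [0..<mdim M])"
proof -
  have V: "Es ! i \<in> vector_fields M" if "i < mdim M" for i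
    using F that unfolding framing_def by (metis nth_mem subsetD)
  show ?thesis
    unfolding framing_def
  proof (intro conjI ballI allI impI)
    have "(\<lambda>f p. s i * (Es ! i) f p) \<in> vector_fields M" if "i < mdim M" for i
      using lincomb_vector_field[OF M, of "{i}" "\<lambda>i. Es ! i" s] V[OF that] by simp
    then show "set (map (\<lambda>i f p. s i * (Es ! i) f p) [0..<mdim M]) \<subseteq> vector_fields M" by auto
    show "length (map (\<lambda>i f p. s i * (Es ! i) f p) [0..<mdim M]) = mdim M" by simp
    fix p x i assume p: "p \<in> points M" and i: "i < mdim M"
      and z: "\<forall>f\<in>smooth_functions M. (\<Sum>i<mdim M. x i * (map (\<lambda>i f p. s i * (Es ! i) f p) [0..<mdim M] ! i) f p) = 0"
    have "(\<Sum>i<mdim M. (x i * s i) * (Es ! i) f p) = 0" if "f \<in> smooth_functions M" for f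
      using z[rule_format, OF that] by (simp add: mult.assoc)
    moreover have ind: "(\<forall>f\<in>smooth_functions M. (\<Sum>i<mdim M. y i * (Es ! i) f p) = 0) \<Longrightarrow> y i = 0" for y
      using F p i unfolding framing_def by blast
    ultimately have "x i * s i = 0" using ind[of "\<lambda>i. x i * s i"] by blast
    moreover have "s i \<noteq> 0" using s[OF i] by auto
    ultimately show "x i = 0" by simp
  qed
qed

text \<open>Rescaling the frame by signs s_i multiplies the coefficient of the k-th field in the
  bracket of the i-th and j-th by s_i s_j s_k, because s_k is its own inverse.\<close>

lemma (in lie_quotient) framed_Q:
  assumes iso: "lie_algebra_iso N D" and D: "length D = 7" and s: "\<And>i. i < 7 \<Longrightarrow> s i * s i = (1 :: real)"
    and tab: "\<And>i j k. i < 7 \<Longrightarrow> j < 7 \<Longrightarrow> k < 7 \<Longrightarrow> s i * s j * s k * diff_coeff D k i j = frm (de0 a b c k) [bs i, bs j]"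
  shows "\<exists>Es. framed Q Es a b c"
proof -
  obtain Es where E: "framing Q Es" "length Es = length D"
    "\<And>i j f p. i < length D \<Longrightarrow> j < length D \<Longrightarrow> f \<in> smooth_functions Q \<Longrightarrow> p \<in> points Q \<Longrightarrow>
       bracket (Es ! i) (Es ! j) f p = (\<Sum>k<length D. - diff_coeff D k i j * (Es ! k) f p)"
    by (rule framing_Q[OF iso], rule that; assumption)
  have dim: "mdim Q = 7" using E(1,2) D unfolding framing_def by simp
  have V: "Es ! i \<in> vector_fields Q" if "i < 7" for i
    using E(1) that dim unfolding framing_def by (metis nth_mem subsetD)
  let ?Es = "map (\<lambda>i f p. s i * (Es ! i) f p) [0..<7]"
  have "framed Q ?Es a b c"
  proof
    show "smooth_manifold Q" by (rule smooth_manifold_Q)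
    show "mdim Q = 7" by (rule dim)
    show "framing Q ?Es" using framing_scale[OF E(1) s smooth_manifold_Q] dim by simp
    fix i j :: nat and f p assume i: "i < 7" and j: "j < 7" and f: "f \<in> smooth_functions Q" and p: "p \<in> points Q"
    have sc: "(Es ! i) (\<lambda>p. t * (Es ! j) f p) p = t * (Es ! i) ((Es ! j) f) p" if "i < 7" "j < 7" for i j t
      by (rule pt_deriv_scale[OF smooth_manifold_Q vector_fields_pt_deriv[OF V[OF that(1)]] vector_fieldsD(2)[OF V[OF that(2)] f]])
    have "bracket (?Es ! i) (?Es ! j) f p = s i * s j * bracket (Es ! i) (Es ! j) f p"
      using i j by (simp add: bracket_def sc algebra_simps)
    also have "\<dots> = (\<Sum>k<7. s i * s j * (- diff_coeff D k i j * (Es ! k) f p))"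
      using E(3)[of i j f p] i j f p D by (simp add: sum_distrib_left)
    also have "\<dots> = (\<Sum>k<7. - frm (de0 a b c k) [bs i, bs j] * (?Es ! k) f p)"
    proof (rule sum.cong[OF refl])
      fix k assume "k \<in> {..<7::nat}"
      then have k: "k < 7" by simp
      have "- frm (de0 a b c k) [bs i, bs j] * (?Es ! k) f p = s i * s j * (s k * s k) * (- diff_coeff D k i j * (Es ! k) f p)"
        unfolding tab[OF i j k, symmetric] using k by simp
      then show "s i * s j * (- diff_coeff D k i j * (Es ! k) f p) = - frm (de0 a b c k) [bs i, bs j] * (?Es ! k) f p"
        unfolding s[OF k] by simp
    qed
    finally show "bracket (?Es ! i) (?Es ! j) f p = (\<Sum>k<7. - frm (de0 a b c k) [bs i, bs j] * (?Es ! k) f p)" .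
  qed
  then show ?thesis by blast
qed

lemma dec_2_bs: "dec [r, t] [bs i, bs j] = of_bool (i = r \<and> j = t) - of_bool (i = t \<and> j = r)"
  by (auto simp: bs_def)

lemma less_7_cases: "k < 7 \<Longrightarrow> k = 0 \<or> k = 1 \<or> k = 2 \<or> k = 3 \<or> k = 4 \<or> k = 5 \<or> k = (6::nat)"
  by arith

lemmas table_simps = diff_coeff_def abelian_plus_def h5_def h3C_def hH_def de0_def dec_2_bs numeral_2_eq_2

text \<open>Position 2 is e_3: changing its sign turns 34 into -34, so 12 + 34 becomes the
  anti-self-dual form 12 - 34, while all other basis vectors stay as they are.\<close>

lemma table_h5:
  assumes "k < 7"
  shows "(if i = 2 then - 1 else 1) * (if j = 2 then - 1 else 1) * (if k = 2 then - 1 else 1) *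
    diff_coeff (abelian_plus 2 h5) k i j = frm (de0 1 0 0 k) [bs i, bs j]"
  using less_7_cases[OF assms] by (elim disjE) (auto simp: table_simps simp del: dec.simps)

lemma table_h3C:
  assumes "k < 7" shows "diff_coeff (abelian_plus 1 h3C) k i j = frm (de0 1 1 0 k) [bs i, bs j]"
  using less_7_cases[OF assms] by (elim disjE) (auto simp: table_simps simp del: dec.simps)

lemma table_hH:
  assumes "k < 7" shows "diff_coeff hH k i j = frm (de0 1 1 1 k) [bs i, bs j]"
  using less_7_cases[OF assms] by (elim disjE) (auto simp: table_simps simp del: dec.simps)

theorem corollary3p6:
  fixes N :: "'a smooth_group" and \<Gamma> :: "'a set"
  assumes "nilpotent_lie_group N"
    and "cocompact_lattice N \<Gamma>"
    and "lie_algebra_iso N (abelian_plus 2 h5) \<or> lie_algebra_iso N (abelian_plus 1 h3C) \<or>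
         lie_algebra_iso N hH"
  shows "\<exists>\<phi> g vol.
    G2_structure (coset_manifold N \<Gamma>) \<phi> g vol \<and>
    purely_coclosed (coset_manifold N \<Gamma>) \<phi> g vol \<and>
    (\<exists>(G :: (nat \<Rightarrow> real) smooth_group) (P :: ('a set \<times> (nat \<Rightarrow> real)) manifold) act \<pi> Bs A.
       comm_group G \<and>
       principal_bundle P (coset_manifold N \<Gamma>) G act \<pi> \<and>
       connection P G act Bs A \<and>
       heterotic_G2_system (coset_manifold N \<Gamma>) \<phi> g vol P G \<pi> Bs A)"
proof -
  interpret lie_quotient N \<Gamma>
    using assms(1,2) unfolding nilpotent_lie_group_def cocompact_lattice_def by (intro lie_quotient.intro) auto
  have "\<exists>Es a b c. framed Q Es a b c"
    using assms(3)
  proof (elim disjE)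
    assume "lie_algebra_iso N (abelian_plus 2 h5)"
    then have "\<exists>Es. framed Q Es 1 0 0"
      by (rule framed_Q[where s = "\<lambda>i. if i = 2 then - 1 else 1"])
        (simp_all only: table_h5, simp_all add: abelian_plus_def h5_def)
    then show ?thesis by blast
  next
    assume "lie_algebra_iso N (abelian_plus 1 h3C)"
    then have "\<exists>Es. framed Q Es 1 1 0"
      by (rule framed_Q[where s = "\<lambda>i. 1"]) (simp_all only: table_h3C mult_1, simp_all add: abelian_plus_def h3C_def)
    then show ?thesis by blast
  next
    assume "lie_algebra_iso N hH"
    then have "\<exists>Es. framed Q Es 1 1 1"
      by (rule framed_Q[where s = "\<lambda>i. 1"]) (simp_all only: table_hH mult_1, simp_all add: hH_def)
    then show ?thesis by blast
  qed
  then obtain Es a b c where "framed Q Es a b c" by blast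
  then interpret F: framed Q Es a b c .
  show ?thesis
    using F.G2 F.purely F.principal F.heterotic_solution comm_group_Vn by blast
qed

end
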